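(* Let $d\ge2$, let $\Omega\subset\mathbb{R}^4$ be a bounded smooth domain, let $-\lambda_1(\Omega)<\lambda_1,\dots,\lambda_d<0$, let $\beta_{ii}>0$ for all $i$ and $\beta_{ij}=\beta_{ji}\in\mathbb{R}$ for all $i\ne j$. Let $\mathbf{a}$ be an $m$-decomposition of $d$, $1\le m\le d$, and assume that $\beta_{ij}\ge0$ for $(i,j)\in\mathcal{K}_1$. There exists $\delta>0$, depending (for the given $\Omega$ and $\mathbf{a}$) only on $\beta_{ij}\ge0$ for $(i,j)\in\mathcal{K}_1$ and on $\beta_{ii},\lambda_i$, $i=1,\dots,d$, such that $$c_\Gamma<\sum_{h\in\Gamma}l_h-\delta\qquad\text{for every nonempty }\Gamma\subseteq\{1,\dots,m\}.$$ In particular, $c<\sum_{h=1}^ml_h-\delta$.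
   Context: $\lambda_1(\Omega)$ is the first Dirichlet eigenvalue of $-\Delta$ on $\Omega$. An $m$-decomposition of $d$ is $\mathbf{a}=(a_0,\dots,a_m)\in\mathbb{N}^{m+1}$ with $0=a_0<a_1<\dots<a_m=d$; set $I_h:=\{i: a_{h-1}<i\le a_h\}$, $\mathcal{K}_1:=\{(i,j)\in I_h^2 \text{ for some } h,\ i\neq j\}$. For $\mathbf{u}_h=(u_i)_{i\in I_h}\in H^1_0(\Omega)^{|I_h|}$ put $\|\mathbf{u}_h\|_h^2:=\sum_{i\in I_h}\int_\Omega|\nabla u_i|^2+\lambda_iu_i^2$. For nonempty $\Gamma\subseteq\{1,\dots,m\}$ and $\mathbf{u}=(\mathbf{u}_h)_{h\in\Gamma}$, $$J_\Gamma(\mathbf{u}):=\frac12\sum_{k\in\Gamma}\|\mathbf{u}_k\|_k^2-\frac14\sum_{k,l\in\Gamma}\sum_{(i,j)\in I_k\times I_l}\int_\Omega\beta_{ij}u_i^2u_j^2,$$ $$\mathcal{N}_\Gamma:=\Big\{(\mathbf{u}_h)_{h\in\Gamma}:\ \mathbf{u}_h\ne\mathbf{0},\ \sum_{i\in I_h}\partial_iJ_\Gamma(\mathbf{u})u_i=0\ \text{ for every }h\in\Gamma\Big\},\qquad c_\Gamma:=\inf_{\mathcal{N}_\Gamma}J_\Gamma,\qquad c:=c_{\{1,\dots,m\}}.$$ For each $h$, $$l_h:=\inf\{E_h(\mathbf{v}):\mathbf{v}\in\mathcal{D}^{1,2}(\mathbb{R}^4)^{|I_h|},\ \mathbf{v}\ne\mathbf{0},\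 \langle\nabla E_h(\mathbf{v}),\mathbf{v}\rangle=0\},\quad E_h(\mathbf{v})=\int_{\mathbb{R}^4}\frac12\sum_{i\in I_h}|\nabla v_i|^2-\frac14\sum_{(i,j)\in I_h^2}\beta_{ij}v_j^2v_i^2.$$ *)

theory Defs
  imports "HOL-Analysis.Analysis"
begin

section \<open>Smooth functions, smooth domains, test functions\<close>

text \<open>Only used for open \<open>S\<close>, where \<open>at x within S\<close> and \<open>at x\<close> agree.\<close>

primrec Ck_on :: "nat \<Rightarrow> 'a::euclidean_space set \<Rightarrow> ('a \<Rightarrow> real) \<Rightarrow> bool" where
  "Ck_on 0 S f \<longleftrightarrow> continuous_on S f"
| "Ck_on (Suc k) S f \<longleftrightarrow>
     f differentiable_on S \<and> (\<forall>b\<in>Basis. Ck_on k S (\<lambda>x. frechet_derivative f (at x) b))"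

definition smooth_on :: "'a::euclidean_space set \<Rightarrow> ('a \<Rightarrow> real) \<Rightarrow> bool" where
  "smooth_on S f \<longleftrightarrow> (\<forall>k. Ck_on k S f)"

definition grad :: "('a::euclidean_space \<Rightarrow> real) \<Rightarrow> 'a \<Rightarrow> 'a" where
  "grad f x = (\<Sum>b\<in>Basis. frechet_derivative f (at x) b *\<^sub>R b)"

text \<open>The boundary is described by local defining functions: near each boundary point,
  \<open>\<Omega>\<close> is the sublevel set of a smooth function without critical points.\<close>

definition bounded_smooth_domain :: "'a::euclidean_space set \<Rightarrow> bool" where
  "bounded_smooth_domain \<Omega> \<longleftrightarrow>
     open \<Omega> \<and> connected \<Omega> \<and> \<Omega> \<noteq> {} \<and> bounded \<Omega> \<and>
     (\<forall>x\<in>frontier \<Omega>. \<exists>U \<psi>. open U \<and> x \<in> U \<and> smooth_on U \<psi> \<and>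
        (\<forall>y\<in>U. grad \<psi> y \<noteq> 0) \<and> \<Omega> \<inter> U = {y\<in>U. \<psi> y < 0})"

definition test_functions :: "'a::euclidean_space set \<Rightarrow> ('a \<Rightarrow> real) set" where
  "test_functions \<Omega> =
     {\<phi>. smooth_on UNIV \<phi> \<and> compact (closure {x. \<phi> x \<noteq> 0}) \<and> closure {x. \<phi> x \<noteq> 0} \<subseteq> \<Omega>}"


section \<open>Weak gradients and Sobolev spaces\<close>

text \<open>The elements of the function spaces below are representatives, not classes modulo
  almost-everywhere equality.  Functions on \<open>\<Omega>\<close> are represented by functions on the whole
  space whose values outside \<open>\<Omega>\<close> are irrelevant.\<close>

definition is_weak_grad ::
    "'a::euclidean_space set \<Rightarrow> ('a \<Rightarrow> real) \<Rightarrow> ('a \<Rightarrow> 'a) \<Rightarrow> bool" where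
  "is_weak_grad \<Omega> u g \<longleftrightarrow>
     (\<forall>K. compact K \<and> K \<subseteq> \<Omega> \<longrightarrow> set_integrable lebesgue K u \<and> set_integrable lebesgue K g) \<and>
     (\<forall>\<phi>\<in>test_functions \<Omega>.
        (LINT x:\<Omega>|lebesgue. u x *\<^sub>R grad \<phi> x) = - (LINT x:\<Omega>|lebesgue. \<phi> x *\<^sub>R g x))"

text \<open>Weak gradients are unique up to null sets, so the choice does not affect integrals.\<close>

definition weak_grad :: "'a::euclidean_space set \<Rightarrow> ('a \<Rightarrow> real) \<Rightarrow> 'a \<Rightarrow> 'a" where
  "weak_grad \<Omega> u = (SOME g. is_weak_grad \<Omega> u g)"

definition Lp :: "nat \<Rightarrow> 'a::euclidean_space set \<Rightarrow> ('a \<Rightarrow> 'b::euclidean_space) set" where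
  "Lp p \<Omega> = {u. set_borel_measurable lebesgue \<Omega> u \<and>
                set_integrable lebesgue \<Omega> (\<lambda>x. norm (u x) ^ p)}"

definition H1 :: "'a::euclidean_space set \<Rightarrow> ('a \<Rightarrow> real) set" where
  "H1 \<Omega> = {u \<in> Lp 2 \<Omega>. \<exists>g \<in> Lp 2 \<Omega>. is_weak_grad \<Omega> u g}"

definition H1_0 :: "'a::euclidean_space set \<Rightarrow> ('a \<Rightarrow> real) set" where
  "H1_0 \<Omega> = {u \<in> H1 \<Omega>. \<exists>\<phi> :: nat \<Rightarrow> 'a \<Rightarrow> real. range \<phi> \<subseteq> test_functions \<Omega> \<and>
     (\<lambda>n. LINT x:\<Omega>|lebesgue. (norm (weak_grad \<Omega> (\<lambda>y. \<phi> n y - u y) x))\<^sup>2 + (\<phi> n x - u x)\<^sup>2)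
       \<longlonglongrightarrow> 0}"

text \<open>The completion of the test functions on \<open>\<real>\<^sup>4\<close> for the norm
  \<open>\<parallel>\<nabla>u\<parallel>\<close> in \<open>L\<^sup>2\<close>, realised inside \<open>L\<^sup>4\<close> (4 is the critical Sobolev exponent in
  dimension 4).\<close>

definition D12 :: "(real^4 \<Rightarrow> real) set" where
  "D12 = {u \<in> Lp 4 UNIV. (\<exists>g \<in> Lp 2 UNIV. is_weak_grad UNIV u g) \<and>
     (\<exists>\<phi> :: nat \<Rightarrow> real^4 \<Rightarrow> real. range \<phi> \<subseteq> test_functions UNIV \<and>
        (\<lambda>n. LINT x|lebesgue. (norm (weak_grad UNIV (\<lambda>y. \<phi> n y - u y) x))\<^sup>2) \<longlonglongrightarrow> 0)}"

definition zero_on :: "'a::euclidean_space set \<Rightarrow> ('a \<Rightarrow> real) \<Rightarrow> bool" where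
  "zero_on \<Omega> u \<longleftrightarrow> (AE x in lebesgue. x \<in> \<Omega> \<longrightarrow> u x = 0)"

definition dirichlet_eigenvalue :: "'a::euclidean_space set \<Rightarrow> real \<Rightarrow> bool" where
  "dirichlet_eigenvalue \<Omega> \<mu> \<longleftrightarrow>
     (\<exists>u\<in>H1_0 \<Omega>. \<not> zero_on \<Omega> u \<and>
        (\<forall>v\<in>H1_0 \<Omega>. (LINT x:\<Omega>|lebesgue. weak_grad \<Omega> u x \<bullet> weak_grad \<Omega> v x)
                    = \<mu> * (LINT x:\<Omega>|lebesgue. u x * v x)))"

definition first_dirichlet_eigenvalue :: "'a::euclidean_space set \<Rightarrow> real" where
  "first_dirichlet_eigenvalue \<Omega> = (LEAST \<mu>. dirichlet_eigenvalue \<Omega> \<mu>)"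


section \<open>Decompositions, functionals and energy levels\<close>

definition decomposition :: "nat \<Rightarrow> nat \<Rightarrow> (nat \<Rightarrow> nat) \<Rightarrow> bool" where
  "decomposition m d a \<longleftrightarrow> a 0 = 0 \<and> (\<forall>h<m. a h < a (Suc h)) \<and> a m = d"

definition block :: "(nat \<Rightarrow> nat) \<Rightarrow> nat \<Rightarrow> nat set" where
  "block a h = {a (h - 1)<..a h}"

definition K1 :: "nat \<Rightarrow> (nat \<Rightarrow> nat) \<Rightarrow> (nat \<times> nat) set" where
  "K1 m a = {(i, j). i \<noteq> j \<and> (\<exists>h\<in>{1..m}. i \<in> block a h \<and> j \<in> block a h)}"

text \<open>A family \<open>(u\<^sub>i)\<close> is a function on all of \<open>nat\<close>; the functionals below
  read only the components belonging to the blocks under consideration.\<close>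

type_synonym family = "nat \<Rightarrow> real^4 \<Rightarrow> real"

definition directional_deriv :: "(family \<Rightarrow> real) \<Rightarrow> family \<Rightarrow> family \<Rightarrow> real" where
  "directional_deriv F u v = deriv (\<lambda>t. F (\<lambda>i x. u i x + t * v i x)) 0"

text \<open>\<open>\<partial>\<^sub>iF(u)\<phi>\<close>\<close>

definition partial_deriv :: "nat \<Rightarrow> (family \<Rightarrow> real) \<Rightarrow> family \<Rightarrow> (real^4 \<Rightarrow> real) \<Rightarrow> real" where
  "partial_deriv i F u \<phi> = directional_deriv F u (\<lambda>j. if j = i then \<phi> else (\<lambda>x. 0))"

definition block_norm_sq ::
    "(real^4) set \<Rightarrow> (nat \<Rightarrow> real) \<Rightarrow> (nat \<Rightarrow> nat) \<Rightarrow> nat \<Rightarrow> family \<Rightarrow> real" where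
  "block_norm_sq \<Omega> lam a h u =
     (\<Sum>i\<in>block a h. LINT x:\<Omega>|lebesgue. (norm (weak_grad \<Omega> (u i) x))\<^sup>2 + lam i * (u i x)\<^sup>2)"

definition J :: "(real^4) set \<Rightarrow> (nat \<Rightarrow> real) \<Rightarrow> (nat \<Rightarrow> nat \<Rightarrow> real) \<Rightarrow> (nat \<Rightarrow> nat) \<Rightarrow>
    nat set \<Rightarrow> family \<Rightarrow> real" where
  "J \<Omega> lam \<beta> a \<Gamma> u =
     1/2 * (\<Sum>k\<in>\<Gamma>. block_norm_sq \<Omega> lam a k u)
     - 1/4 * (\<Sum>k\<in>\<Gamma>. \<Sum>l\<in>\<Gamma>. \<Sum>(i, j)\<in>block a k \<times> block a l.
                LINT x:\<Omega>|lebesgue. \<beta> i j * (u i x)\<^sup>2 * (u j x)\<^sup>2)"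

definition Nehari :: "(real^4) set \<Rightarrow> (nat \<Rightarrow> real) \<Rightarrow> (nat \<Rightarrow> nat \<Rightarrow> real) \<Rightarrow> (nat \<Rightarrow> nat) \<Rightarrow>
    nat set \<Rightarrow> family set" where
  "Nehari \<Omega> lam \<beta> a \<Gamma> = {u. \<forall>h\<in>\<Gamma>.
     (\<forall>i\<in>block a h. u i \<in> H1_0 \<Omega>) \<and>
     \<not> (\<forall>i\<in>block a h. zero_on \<Omega> (u i)) \<and>
     (\<Sum>i\<in>block a h. partial_deriv i (J \<Omega> lam \<beta> a \<Gamma>) u (u i)) = 0}"

definition c_level :: "(real^4) set \<Rightarrow> (nat \<Rightarrow> real) \<Rightarrow> (nat \<Rightarrow> nat \<Rightarrow> real) \<Rightarrow> (nat \<Rightarrow> nat) \<Rightarrow>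
    nat set \<Rightarrow> real" where
  "c_level \<Omega> lam \<beta> a \<Gamma> = (INF u\<in>Nehari \<Omega> lam \<beta> a \<Gamma>. J \<Omega> lam \<beta> a \<Gamma> u)"

definition E_fun :: "(nat \<Rightarrow> nat \<Rightarrow> real) \<Rightarrow> (nat \<Rightarrow> nat) \<Rightarrow> nat \<Rightarrow> family \<Rightarrow> real" where
  "E_fun \<beta> a h v = (LINT x|lebesgue.
     1/2 * (\<Sum>i\<in>block a h. (norm (weak_grad UNIV (v i) x))\<^sup>2)
     - 1/4 * (\<Sum>(i, j)\<in>block a h \<times> block a h. \<beta> i j * (v j x)\<^sup>2 * (v i x)\<^sup>2))"

definition l_level :: "(nat \<Rightarrow> nat \<Rightarrow> real) \<Rightarrow> (nat \<Rightarrow> nat) \<Rightarrow> nat \<Rightarrow> real" where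
  "l_level \<beta> a h = Inf {E_fun \<beta> a h v |v.
     (\<forall>i\<in>block a h. v i \<in> D12) \<and>
     \<not> (\<forall>i\<in>block a h. zero_on UNIV (v i)) \<and>
     directional_deriv (E_fun \<beta> a h) v v = 0}"

end

(* Every function in D12 satisfies the sharp Sobolev inequality S * (int v^4)^(1/2) <= int |grad v|^2,
   so Cauchy-Schwarz bounds l_h from below by S^2 / (4 F_h), where F_h is the maximum over the simplex of
   the quadratic form with the nonnegative coefficients beta_ij of the block h.  The sharp inequality is
   obtained by polarizing test functions to radial ones and then completing a square (Bliss).  By Rellich
   compactness the first eigenvalue is the minimum of the Rayleigh quotient, so J >= 0 on the Nehari set.

   For the upper bound, put into disjoint balls of Omega truncated bubbles W_h, one for each block.  In
   dimension four int W_h^2 is larger than the truncation error by a logarithm, so the negative lam_i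
   push the quotient strictly below S.  With weights almost maximizing the form, the rescaled W_h give a
   point of the Nehari set on which J splits into block energies, each smaller than l_h.  The interaction
   between different blocks vanishes, so only coefficients inside the blocks enter, and half of the
   smallest gap is the required constant. *)

theory Submission
  imports Defs "HOL-Library.Diagonal_Subsequence" "HOL-Complex_Analysis.Great_Picard"
begin

text \<open>The lower bound and the bubble have to meet at the same constant, so no step may lose a
  factor. Polarization destroys smoothness; the Dirichlet integral is therefore replaced by the
  integral of \<open>(v x - v y)^2\<close> over pairs of points at distance at most
  \<open>h\<close>. This makes sense for Lipschitz functions, obeys a two-point inequality, and
  controls the gradient sharply as \<open>h\<close> tends to 0, up to a second moment of the unit
  ball that cancels. The radial competitor is found as the maximizer of a Gaussian-weighted
  integral, which a polarization that changed it would raise. It is only Lipschitz, so its profile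
  is averaged over dilations before the one-dimensional argument applies. In \<open>D12\<close> the
  approximating functions converge only through their gradients; their \<open>L^4\<close> limit is
  identified because an \<open>L^4\<close> function with zero weak gradient vanishes. Finally,
  \<open>Inf\<close> and \<open>LEAST\<close> over the reals carry information only after
  nonemptiness, lower bounds or a least element are proved, which is why an explicit constrained
  point and an attained Rayleigh quotient appear.\<close>

abbreviation L2_sq :: "('a::euclidean_space \<Rightarrow> 'b::euclidean_space) \<Rightarrow> real" where
  "L2_sq f \<equiv> LINT x|lebesgue. (norm (f x))\<^sup>2"

abbreviation nn_sq :: "('a::euclidean_space \<Rightarrow> 'b::euclidean_space) \<Rightarrow> ennreal" where
  "nn_sq f \<equiv> \<integral>\<^sup>+x. ennreal ((norm (f x))\<^sup>2) \<partial>lborel"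

abbreviation nn_pow4 :: "'a measure \<Rightarrow> ('a \<Rightarrow> real) \<Rightarrow> ennreal" where
  "nn_pow4 M f \<equiv> \<integral>\<^sup>+x. ennreal ((f x) ^ 4) \<partial>M"

abbreviation zero_ext :: "'a set \<Rightarrow> ('a \<Rightarrow> 'b::real_vector) \<Rightarrow> 'a \<Rightarrow> 'b" where
  "zero_ext \<Omega> u \<equiv> \<lambda>x. indicator \<Omega> x *\<^sub>R u x"

abbreviation blocks :: "(nat \<Rightarrow> nat) \<Rightarrow> nat set \<Rightarrow> nat set" where
  "blocks a \<Gamma> \<equiv> \<Union>k\<in>\<Gamma>. block a k"

abbreviation weighted_energy ::
    "(nat \<Rightarrow> real) \<Rightarrow> (nat \<Rightarrow> nat) \<Rightarrow> nat \<Rightarrow> (real^4 \<Rightarrow> real) \<Rightarrow> (nat \<Rightarrow> real) \<Rightarrow> real" where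
  "weighted_energy lam a h W y \<equiv> \<Sum>i\<in>block a h. y i * (L2_sq (grad W) + lam i * (LINT x|lebesgue. (W x)\<^sup>2))"

abbreviation coupling :: "(nat \<Rightarrow> nat \<Rightarrow> real) \<Rightarrow> (nat \<Rightarrow> nat) \<Rightarrow> nat \<Rightarrow> (nat \<Rightarrow> real) \<Rightarrow> real" where
  "coupling \<beta> a h y \<equiv> \<Sum>(i, j)\<in>block a h \<times> block a h. \<beta> i j * (y i * y j)"

section \<open>Smooth functions and bumps\<close>

text \<open>\<open>frechet_derivative f (at x)\<close> depends only on the germ of \<open>f\<close>
  at \<open>x\<close>, and on an open set equality on \<open>S\<close> is equality of germs.\<close>

lemma Ck_on_cong:
  assumes "open S" "\<And>x. x \<in> S \<Longrightarrow> f x = g x"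
  shows "Ck_on k S f \<longleftrightarrow> Ck_on k S g"
  using assms(2)
proof (induction k arbitrary: f g)
  case 0
  then show ?case by (simp cong: continuous_on_cong)
next
  case (Suc k)
  have diff: "f differentiable (at x) \<longleftrightarrow> g differentiable (at x)" if "x \<in> S" for x unfolding differentiable_def
    using has_derivative_transform_within_open[OF _ \<open>open S\<close> that] Suc.prems by metis
  have "f differentiable_on S \<longleftrightarrow> g differentiable_on S" unfolding differentiable_on_def using diff by (simp add: at_within_open[OF _ \<open>open S\<close>])
  moreover have "Ck_on k S (\<lambda>x. frechet_derivative f (at x) b) = Ck_on k S (\<lambda>x. frechet_derivative g (at x) b)"
    if "f differentiable_on S" for b
  proof (rule Suc.IH)
    fix x assume x: "x \<in> S"
    then have "f differentiable (at x)" using that by (simp add: differentiable_on_def at_within_open[OF _ \<open>open S\<close>])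
    then show "frechet_derivative f (at x) b = frechet_derivative g (at x) b"
      using frechet_derivative_transform_within_open[OF _ \<open>open S\<close> x] Suc.prems by metis
  qed
  ultimately show ?case by auto
qed

text \<open>Trades the description operator \<open>frechet_derivative\<close> for any explicit
  derivative \<open>D\<close>, so that the closure rules below become inductions on the formulas of
  calculus.\<close>

lemma Ck_on_SucI:
  assumes "open S" "\<And>x. x \<in> S \<Longrightarrow> (f has_derivative D x) (at x)"
    and "\<And>b. b \<in> Basis \<Longrightarrow> Ck_on k S (\<lambda>x. D x b)"
  shows "Ck_on (Suc k) S f"
proof -
  have "frechet_derivative f (at x) = D x" if "x \<in> S" for x using frechet_derivative_at[OF assms(2)[OF that]] by simp
  then have "Ck_on k S (\<lambda>x. frechet_derivative f (at x) b)" if "b \<in> Basis" for b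
    using assms(3)[OF that] Ck_on_cong[OF assms(1), of "\<lambda>x. frechet_derivative f (at x) b" "\<lambda>x. D x b"] by simp
  moreover have "f differentiable_on S" using assms(1,2) unfolding differentiable_on_def differentiable_def by (metis at_within_open)
  ultimately show ?thesis by simp
qed

lemma Ck_on_SucD:
  assumes "open S" "Ck_on (Suc k) S f" "x \<in> S"
  shows "(f has_derivative frechet_derivative f (at x)) (at x)"
  using assms by (auto simp: differentiable_on_def at_within_open[OF _ assms(1)] frechet_derivative_works)

lemma Ck_on_mono: "Ck_on (Suc k) S f \<Longrightarrow> Ck_on k S f"
proof (induction k arbitrary: f)
  case 0
  then show ?case by (simp add: differentiable_imp_continuous_on)
qed auto

lemma Ck_on_const: "open S \<Longrightarrow> Ck_on k S (\<lambda>x. c)"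
proof (induction k arbitrary: c)
  case (Suc k)
  then show ?case by (intro Ck_on_SucI[where D="\<lambda>x h. 0"]) auto
qed simp

lemma Ck_on_inner: "open S \<Longrightarrow> Ck_on k S (\<lambda>x. x \<bullet> v)"
proof (cases k)
  case (Suc j)
  moreover assume "open S"
  ultimately show ?thesis by (simp only:, intro Ck_on_SucI[where D="\<lambda>x h. h \<bullet> v"]) (auto intro!: Ck_on_const derivative_eq_intros)
qed (auto intro: continuous_intros)

lemma Ck_on_add:
  assumes "open S" "Ck_on k S f" "Ck_on k S g"
  shows "Ck_on k S (\<lambda>x. f x + g x)"
  using assms(2,3)
proof (induction k arbitrary: f g)
  case 0
  then show ?case by (auto intro: continuous_intros)
next
  case (Suc k)
  show ?case by (rule Ck_on_SucI[where D="\<lambda>x h. frechet_derivative f (at x) h + frechet_derivative g (at x) h"])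
      (use Suc in \<open>auto intro!: has_derivative_add Ck_on_SucD[OF assms(1), of k] assms(1)\<close>)
qed

lemma Ck_on_mult:
  assumes "open S" "Ck_on k S f" "Ck_on k S g"
  shows "Ck_on k S (\<lambda>x. f x * g x)"
  using assms(2,3)
proof (induction k arbitrary: f g)
  case 0
  then show ?case by (auto intro: continuous_intros)
next
  case (Suc k)
  have "Ck_on k S f" "Ck_on k S g" using Suc.prems Ck_on_mono by blast+
  with Suc show ?case by (intro Ck_on_SucI[where D="\<lambda>x h. f x * frechet_derivative g (at x) h + frechet_derivative f (at x) h * g x"])
      (auto intro!: has_derivative_mult Ck_on_add Ck_on_SucD[OF assms(1), of k] assms(1))
qed

text \<open>The derivative of a scalar outer function is multiplication by its value at 1, so the
  chain rule stays a product and the induction closes under \<open>Ck_on_mult\<close>. All cutoffs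
  and bubbles are composites of this kind.\<close>

lemma Ck_on_compose:
  fixes g :: "real \<Rightarrow> real"
  assumes "open S" "open T" "Ck_on k T g" "Ck_on k S f" "f ` S \<subseteq> T"
  shows "Ck_on k S (\<lambda>x. g (f x))"
  using assms(3,4)
proof (induction k arbitrary: g)
  case 0
  then show ?case using continuous_on_compose2[of T g S f] assms(5) by simp
next
  case (Suc k)
  have f: "Ck_on k S f" using Suc.prems Ck_on_mono by blast
  have "Ck_on k S (\<lambda>x. frechet_derivative g (at (f x)) 1)" using Suc.IH[of "\<lambda>y. frechet_derivative g (at y) 1"] Suc.prems f by simp
  moreover have "((\<lambda>x. g (f x)) has_derivative
      (\<lambda>h. frechet_derivative g (at (f x)) 1 * frechet_derivative f (at x) h)) (at x)" if "x \<in> S" for x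
  proof -
    have "f x \<in> T" using that assms(5) by auto
    note g' = Ck_on_SucD[OF assms(2) Suc.prems(1) this]
    note f' = Ck_on_SucD[OF assms(1) Suc.prems(2) that]
    have lin: "frechet_derivative g (at (f x)) h = frechet_derivative g (at (f x)) 1 * h" for h
      using linear_scale[OF has_derivative_linear[OF g'], of h 1] by simp
    show ?thesis using has_derivative_compose[OF f' g'] by (subst (asm) lin) simp
  qed
  ultimately show ?case using Suc.prems f by (intro Ck_on_SucI[where D="\<lambda>x h. frechet_derivative g (at (f x)) 1 * frechet_derivative f (at x) h"])
       (auto intro!: Ck_on_mult assms(1))
qed

lemma smooth_on_const: "open S \<Longrightarrow> smooth_on S (\<lambda>x. c)"
  and smooth_on_inner: "open S \<Longrightarrow> smooth_on S (\<lambda>x. x \<bullet> v)"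
  and smooth_on_add: "open S \<Longrightarrow> smooth_on S f \<Longrightarrow> smooth_on S g \<Longrightarrow> smooth_on S (\<lambda>x. f x + g x)"
  and smooth_on_mult: "open S \<Longrightarrow> smooth_on S f \<Longrightarrow> smooth_on S g \<Longrightarrow> smooth_on S (\<lambda>x. f x * g x)"
  and smooth_on_compose: "open S \<Longrightarrow> open T \<Longrightarrow> smooth_on T G \<Longrightarrow> smooth_on S f \<Longrightarrow> f ` S \<subseteq> T
        \<Longrightarrow> smooth_on S (\<lambda>x. G (f x))" unfolding smooth_on_def by (auto intro: Ck_on_const Ck_on_inner Ck_on_add Ck_on_mult Ck_on_compose)

lemma smooth_on_diff:
  assumes "open S" "smooth_on S f" "smooth_on S g"
  shows "smooth_on S (\<lambda>x. f x - g x)"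
  using smooth_on_add[OF assms(1,2) smooth_on_mult[OF assms(1) smooth_on_const[OF assms(1), of "-1"] assms(3)]] by simp

lemma smooth_on_sum:
  assumes "open S" "\<And>i. i \<in> I \<Longrightarrow> smooth_on S (f i)"
  shows "smooth_on S (\<lambda>x. \<Sum>i\<in>I. f i x)"
  using assms(2) by (induction I rule: infinite_finite_induct) (auto intro!: smooth_on_const smooth_on_add assms(1))

lemma smooth_on_prod:
  assumes "open S" "\<And>i. i \<in> I \<Longrightarrow> smooth_on S (f i)"
  shows "smooth_on S (\<lambda>x. \<Prod>i\<in>I. f i x)"
  using assms(2) by (induction I rule: infinite_finite_induct) (auto intro!: smooth_on_const smooth_on_mult assms(1))

text \<open>A coinduction principle: a family closed under differentiation takes the place of a
  formula for the k-th derivative. It is applied to polynomials in \<open>1 / t\<close> times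
  \<open>exp (- 1 / t)\<close>, and to the functions \<open>c * inverse t ^ n\<close>.\<close>

lemma smooth_on_real_coinduct:
  fixes F :: "(real \<Rightarrow> real) set"
  assumes "open T" "f \<in> F"
    and "\<And>f. f \<in> F \<Longrightarrow> \<exists>f'\<in>F. \<forall>x\<in>T. (f has_real_derivative f' x) (at x)"
  shows "smooth_on T f"
proof -
  have "Ck_on k T f" if "f \<in> F" for k f using that
  proof (induction k arbitrary: f)
    case 0
    with assms(3)[OF 0] show ?case by (auto intro!: continuous_at_imp_continuous_on DERIV_isCont)
  next
    case (Suc k)
    obtain f' where f': "f' \<in> F" "\<forall>x\<in>T. (f has_real_derivative f' x) (at x)" using assms(3)[OF Suc.prems] by blast
    show ?case using f' Suc.IH[OF f'(1)] by (intro Ck_on_SucI[where D="\<lambda>x h. f' x * h"]) (auto simp: has_field_derivative_def assms(1))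
  qed
  then show ?thesis using assms(2) by (simp add: smooth_on_def)
qed

text \<open>The classical smooth function that vanishes to infinite order at 0. Its scalings
  \<open>flat (n * t)\<close> tend to the indicator of the positive half-line, so both the box bumps
  and the truncated bubbles are built from it.\<close>

definition flat :: "real \<Rightarrow> real" where
  "flat t = (if t \<le> 0 then 0 else exp (- 1 / t))"

lemma poly_times_exp_minus_tendsto_0: "((\<lambda>x::real. poly p x * exp (- x)) \<longlongrightarrow> 0) at_top"
proof -
  have "((\<lambda>x. \<Sum>i\<le>degree p. coeff p i * (x ^ i / exp x)) \<longlongrightarrow> (\<Sum>i\<le>degree p. coeff p i * 0)) at_top" by (intro tendsto_intros tendsto_power_div_exp_0)
  then show ?thesis by (simp add: poly_altdef sum_distrib_right exp_minus divide_inverse mult.assoc)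
qed

text \<open>Differentiating \<open>p (1/t) * exp (-1/t)\<close> replaces the polynomial
  \<open>p\<close> by \<open>X^2 * (p - p')\<close>, so these functions, extended by 0, form a
  closed family.\<close>

lemma smooth_flat: "smooth_on UNIV flat"
proof -
  define h :: "real poly \<Rightarrow> real \<Rightarrow> real" where
    "h p t = (if t \<le> 0 then 0 else poly p (1 / t) * exp (- 1 / t))" for p t
  have der: "(h p has_real_derivative h ([:0, 0, 1:] * (p - pderiv p)) t) (at t)" for p t
  proof -
    consider "t < 0" | "t = 0" | "t > 0" by linarith
    then show ?thesis
    proof cases
      case 1
      have "((\<lambda>_. 0) has_real_derivative h ([:0, 0, 1:] * (p - pderiv p)) t) (at t)" using 1 by (simp add: h_def)
      then show ?thesis by (rule DERIV_cong_ev[THEN iffD1, OF refl _ refl, rotated])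
          (use 1 eventually_nhds_in_open[of "{..<0}" t] in \<open>auto simp: h_def elim!: eventually_mono\<close>)
    next
      case 3
      have "((\<lambda>t. poly p (1 / t) * exp (- 1 / t)) has_real_derivative h ([:0, 0, 1:] * (p - pderiv p)) t) (at t)"
        using 3 by (auto intro!: derivative_eq_intros simp: h_def field_simps power2_eq_square)
      then show ?thesis by (rule DERIV_cong_ev[THEN iffD1, OF refl _ refl, rotated])
          (use 3 eventually_nhds_in_open[of "{0<..}" t] in \<open>auto simp: h_def elim!: eventually_mono\<close>)
    next
      \<comment> \<open>At the origin the right difference quotient is the polynomial
        \<open>X * p\<close> at \<open>1 / s\<close> times \<open>exp (-1/s)\<close>, and
        exponential decay beats every polynomial.\<close>
      case 2
      have "((\<lambda>s. h p s / s) \<longlongrightarrow> 0) (at 0)"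
      proof (rule filterlim_split_at)
        show "((\<lambda>s. h p s / s) \<longlongrightarrow> 0) (at_left 0)" by (rule tendsto_eventually) (auto simp: eventually_at_filter h_def)
        have "((\<lambda>x. poly ([:0, 1:] * p) x * exp (- x)) \<longlongrightarrow> 0) at_top" by (rule poly_times_exp_minus_tendsto_0)
        then have "((\<lambda>s. poly ([:0, 1:] * p) (inverse s) * exp (- inverse s)) \<longlongrightarrow> 0) (at_right 0)"
          using filterlim_inverse_at_top_right by (rule filterlim_compose)
        moreover have "\<forall>\<^sub>F s in at_right 0. poly ([:0, 1:] * p) (inverse s) * exp (- inverse s) = h p s / s"
          by (auto simp: eventually_at_filter h_def field_simps)
        ultimately show "((\<lambda>s. h p s / s) \<longlongrightarrow> 0) (at_right 0)" by (rule Lim_transform_eventually)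
      qed
      then show ?thesis using 2 by (simp add: has_field_derivative_iff h_def)
    qed
  qed
  have "flat = h 1" by (auto simp: flat_def h_def)
  then show ?thesis using der by (intro smooth_on_real_coinduct[where F="range h"]) auto
qed

lemma flat_nonneg: "0 \<le> flat t" and flat_le_1: "flat t \<le> 1"
  and flat_eq_0: "flat t = 0 \<longleftrightarrow> t \<le> 0" by (auto simp: flat_def)

lemma flat_of_nat_tendsto: "(\<lambda>n. flat (real n * t)) \<longlonglongrightarrow> indicator {0<..} t"
proof (cases "t > 0")
  case True
  have "(\<lambda>n. exp (- (inverse t * inverse (real n)))) \<longlonglongrightarrow> exp (- (inverse t * 0))" by (intro tendsto_intros lim_inverse_n)
  moreover have "\<forall>\<^sub>F n in sequentially. exp (- (inverse t * inverse (real n))) = flat (real n * t)" using eventually_gt_at_top[of 0]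
  proof eventually_elim
    case (elim n)
    then have "real n * t > 0" using True by simp
    then show ?case by (simp add: flat_def field_simps)
  qed
  ultimately have "(\<lambda>n. flat (real n * t)) \<longlonglongrightarrow> exp (- (inverse t * 0))" by (rule Lim_transform_eventually)
  then show ?thesis using True by simp
next
  case False
  then have "flat (real n * t) = 0" for n by (simp add: flat_eq_0 mult_nonneg_nonpos)
  then show ?thesis using False by simp
qed

lemma smooth_on_affine_compose:
  assumes "smooth_on UNIV (G::real \<Rightarrow> real)"
  shows "smooth_on UNIV (\<lambda>x::'a::euclidean_space. G (c * (x \<bullet> v) + k))"
  by (rule smooth_on_compose[OF _ _ assms]) (auto intro!: smooth_on_add smooth_on_mult smooth_on_const smooth_on_inner)

lemma smooth_on_inverse: "smooth_on {0<..} (\<lambda>t::real. inverse t)"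
proof (rule smooth_on_real_coinduct[where F="{\<lambda>t::real. c * inverse t ^ n |c n. True}"])
  show "(\<lambda>t::real. inverse t) \<in> {\<lambda>t::real. c * inverse t ^ n |c n. True}" by (rule CollectI, rule exI[of _ 1], rule exI[of _ 1]) simp
next
  fix f :: "real \<Rightarrow> real" assume "f \<in> {\<lambda>t::real. c * inverse t ^ n |c n. True}"
  then obtain c n where f: "f = (\<lambda>t. c * inverse t ^ n)" by auto
  have "((\<lambda>t. c * inverse t ^ n) has_real_derivative (- c * real n) * inverse x ^ Suc n) (at x)" if "x > 0" for x::real
  proof (cases n)
    case (Suc k)
    show ?thesis unfolding Suc by (rule DERIV_cong[OF DERIV_cmult[OF DERIV_power_Suc[OF DERIV_inverse[of x UNIV], of k], of c]])
        (use that in \<open>simp_all add: algebra_simps\<close>)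
  qed simp
  then show "\<exists>f'\<in>{\<lambda>t::real. c * inverse t ^ n |c n. True}. \<forall>x\<in>{0<..}. (f has_real_derivative f' x) (at x)"
    unfolding f by (intro bexI[of _ "\<lambda>t. (- c * real n) * inverse t ^ Suc n"]) blast+
qed auto

lemma smooth_on_norm_sq: "smooth_on UNIV (\<lambda>x::'a::euclidean_space. (norm (x - c))\<^sup>2)"
proof -
  have eq: "(norm (x - c))\<^sup>2 = (\<Sum>b\<in>Basis. (x \<bullet> b - c \<bullet> b) * (x \<bullet> b - c \<bullet> b))" for x :: 'a
    unfolding power2_norm_eq_inner by (subst euclidean_inner) (simp add: inner_diff_left)
  show ?thesis unfolding eq by (intro smooth_on_sum smooth_on_mult smooth_on_diff smooth_on_inner smooth_on_const) auto
qed

lemma smooth_on_imp_continuous_on: "smooth_on UNIV f \<Longrightarrow> continuous_on UNIV f"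
  unfolding smooth_on_def by (metis Ck_on.simps(1))

section \<open>Test functions\<close>

lemma test_functionI:
  assumes "smooth_on UNIV \<phi>" "compact K" "K \<subseteq> \<Omega>" "\<And>x. x \<notin> K \<Longrightarrow> \<phi> x = 0"
  shows "\<phi> \<in> test_functions \<Omega>"
proof -
  have "closure {x. \<phi> x \<noteq> 0} \<subseteq> K" using assms(2,4) by (intro closure_minimal compact_imp_closed) auto
  then have "compact (closure {x. \<phi> x \<noteq> 0})" using assms(2) by (meson bounded_closure bounded_subset closed_closure compact_eq_bounded_closed)
  with \<open>closure _ \<subseteq> K\<close> assms(1,3) show ?thesis by (auto simp: test_functions_def)
qed

lemma test_functionE:
  assumes "\<phi> \<in> test_functions \<Omega>"
  obtains K where "smooth_on UNIV \<phi>" "compact K" "K \<subseteq> \<Omega>" "\<And>x. x \<notin> K \<Longrightarrow> \<phi> x = 0" using assms closure_subset[of "{x. \<phi> x \<noteq> 0}"]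
  by (intro that[of "closure {x. \<phi> x \<noteq> 0}"]) (auto simp: test_functions_def)

lemma test_functions_mono: "A \<subseteq> B \<Longrightarrow> test_functions A \<subseteq> test_functions B"
  by (auto simp: test_functions_def)

lemma test_functions_zero: "(\<lambda>x. 0) \<in> test_functions \<Omega>"
  by (rule test_functionI[of _ "{}"]) (auto intro: smooth_on_const)

lemma test_functions_scale: "\<phi> \<in> test_functions \<Omega> \<Longrightarrow> (\<lambda>x. c * \<phi> x) \<in> test_functions \<Omega>"
  by (erule test_functionE, rule test_functionI) (auto intro!: smooth_on_mult smooth_on_const)

lemma test_functions_add:
  assumes "\<phi> \<in> test_functions \<Omega>" "\<psi> \<in> test_functions \<Omega>"
  shows "(\<lambda>x. \<phi> x + \<psi> x) \<in> test_functions \<Omega>"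
proof -
  obtain K where K: "smooth_on UNIV \<phi>" "compact K" "K \<subseteq> \<Omega>" "\<And>x. x \<notin> K \<Longrightarrow> \<phi> x = 0" using test_functionE[OF assms(1)] by metis
  obtain L where L: "smooth_on UNIV \<psi>" "compact L" "L \<subseteq> \<Omega>" "\<And>x. x \<notin> L \<Longrightarrow> \<psi> x = 0" using test_functionE[OF assms(2)] by metis
  show ?thesis by (rule test_functionI[of _ "K \<union> L"]) (use K L in \<open>auto intro!: smooth_on_add\<close>)
qed

lemma test_functions_diff:
  assumes "\<phi> \<in> test_functions \<Omega>" "\<psi> \<in> test_functions \<Omega>"
  shows "(\<lambda>x. \<phi> x - \<psi> x) \<in> test_functions \<Omega>"
  using test_functions_add[OF assms(1) test_functions_scale[OF assms(2), of "-1"]] by simp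

lemma grad_unique: "(f has_derivative (\<lambda>h. g \<bullet> h)) (at x) \<Longrightarrow> grad f x = g"
  unfolding grad_def by (simp add: frechet_derivative_at[symmetric] euclidean_representation)

lemma has_derivative_grad:
  assumes "f differentiable (at x)"
  shows "(f has_derivative (\<lambda>h. grad f x \<bullet> h)) (at x)"
proof -
  have D: "(f has_derivative frechet_derivative f (at x)) (at x)" using assms by (simp add: frechet_derivative_works)
  have "frechet_derivative f (at x) h = grad f x \<bullet> h" for h
  proof -
    have "frechet_derivative f (at x) h = frechet_derivative f (at x) (\<Sum>b\<in>Basis. (h \<bullet> b) *\<^sub>R b)" by (simp add: euclidean_representation)
    also have "\<dots> = (\<Sum>b\<in>Basis. (h \<bullet> b) * frechet_derivative f (at x) b)" using has_derivative_linear[OF D] by (simp add: linear_sum linear_scale)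
    also have "\<dots> = grad f x \<bullet> h" by (simp add: grad_def inner_sum_left mult.commute) (simp add: inner_commute)
    finally show ?thesis .
  qed
  then have "frechet_derivative f (at x) = (\<lambda>h. grad f x \<bullet> h)" by auto
  with D show ?thesis by simp
qed

lemma smooth_on_has_derivative_grad:
  assumes "smooth_on UNIV f"
  shows "(f has_derivative (\<lambda>h. grad f x \<bullet> h)) (at x)"
proof -
  have "Ck_on (Suc 0) UNIV f" using assms by (simp only: smooth_on_def)
  then show ?thesis by (intro has_derivative_grad) (simp add: differentiable_on_def)
qed

lemma smooth_on_continuous_grad:
  assumes "smooth_on UNIV f"
  shows "continuous_on UNIV (grad f)"
proof -
  have "Ck_on (Suc 0) UNIV f" using assms by (simp only: smooth_on_def)
  then show ?thesis unfolding grad_def by (auto intro!: continuous_intros)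
qed

lemma grad_eq_0_off_closed:
  assumes "closed K" "\<And>x. x \<notin> K \<Longrightarrow> f x = 0" "x \<notin> K"
  shows "grad f x = 0"
proof (rule grad_unique)
  have "((\<lambda>_. 0) has_derivative (\<lambda>h. 0 \<bullet> h)) (at x)" by simp
  then show "(f has_derivative (\<lambda>h. 0 \<bullet> h)) (at x)" by (rule has_derivative_transform_within_open[of _ _ _ UNIV "- K", simplified]) (use assms in auto)
qed

lemma smooth_grad_add:
  assumes "smooth_on UNIV f" "smooth_on UNIV g"
  shows "grad (\<lambda>x. f x + g x) = (\<lambda>x. grad f x + grad g x)"
  by (rule ext, rule grad_unique) (auto intro!: derivative_eq_intros smooth_on_has_derivative_grad assms simp: inner_left_distrib)

lemma smooth_grad_scale:
  assumes "smooth_on UNIV f"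
  shows "grad (\<lambda>x. c * f x) = (\<lambda>x. c *\<^sub>R grad f x)"
  by (rule ext, rule grad_unique) (auto intro!: derivative_eq_intros smooth_on_has_derivative_grad assms)

lemma smooth_grad_mult:
  assumes "smooth_on UNIV f" "smooth_on UNIV g"
  shows "grad (\<lambda>x. f x * g x) = (\<lambda>x. f x *\<^sub>R grad g x + g x *\<^sub>R grad f x)"
  by (rule ext, rule grad_unique) (auto intro!: derivative_eq_intros smooth_on_has_derivative_grad assms simp: inner_left_distrib)

lemma integrable_continuous_compact_support:
  fixes f :: "'a::euclidean_space \<Rightarrow> 'b::euclidean_space"
  assumes "continuous_on UNIV f" "compact K" "\<And>x. x \<notin> K \<Longrightarrow> f x = 0"
  shows "integrable lborel f" "integrable lebesgue f"
proof -
  have "integrable lborel (zero_ext K f)" using assms(1,2) by (intro borel_integrable_compact) (auto intro: continuous_on_subset)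
  moreover have "(zero_ext K f) = f" using assms(3) by (auto simp: indicator_def)
  ultimately show "integrable lborel f" by simp
  then show "integrable lebesgue f" using assms(1) by (subst integrable_completion) (auto intro: borel_measurable_continuous_onI)
qed

section \<open>Weak gradients\<close>

text \<open>A smooth approximation of the indicator of a box. The product form keeps the dependence
  on one coordinate in one factor, which later allows the bump to be integrated along that
  coordinate.\<close>

definition box_bump :: "nat \<Rightarrow> 'a::euclidean_space \<Rightarrow> 'a \<Rightarrow> 'a \<Rightarrow> real" where
  "box_bump n a b x =
     (\<Prod>i\<in>Basis. flat (real n * (x \<bullet> i - a \<bullet> i)) * flat (real n * (b \<bullet> i - x \<bullet> i)))"

lemma smooth_box_bump: "smooth_on UNIV (box_bump n a b)"
proof -
  have "smooth_on UNIV (\<lambda>x. flat (real n * (x \<bullet> i) + real n * (- (a \<bullet> i))) * flat ((- real n) * (x \<bullet> i) + real n * (b \<bullet> i)))" for i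
    by (intro smooth_on_mult smooth_on_affine_compose smooth_flat open_UNIV)
  then show ?thesis unfolding box_bump_def[abs_def] by (intro smooth_on_prod open_UNIV) (simp add: algebra_simps)
qed

lemma box_bump_bounds: "0 \<le> box_bump n a b x" "box_bump n a b x \<le> 1"
  unfolding box_bump_def by (auto intro!: prod_nonneg prod_le_1 mult_nonneg_nonneg mult_le_one flat_nonneg flat_le_1)

lemma box_bump_eq_0: "x \<notin> cbox a b \<Longrightarrow> box_bump n a b x = 0"
proof -
  assume "x \<notin> cbox a b"
  then obtain i where "i \<in> Basis" "x \<bullet> i < a \<bullet> i \<or> b \<bullet> i < x \<bullet> i" by (auto simp: mem_box not_le)
  then show ?thesis unfolding box_bump_def by (intro prod_zero) (auto intro!: bexI[of _ i] simp: flat_eq_0 mult_nonneg_nonpos)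
qed

lemma box_bump_test: "cbox a b \<subseteq> \<Omega> \<Longrightarrow> box_bump n a b \<in> test_functions \<Omega>"
  by (rule test_functionI[OF smooth_box_bump compact_cbox]) (auto simp: box_bump_eq_0)

lemma box_bump_tendsto: "(\<lambda>n. box_bump n a b x) \<longlonglongrightarrow> indicator (box a b) x"
proof -
  have "(\<lambda>n. box_bump n a b x) \<longlonglongrightarrow>
    (\<Prod>i\<in>Basis. indicator {0<..} (x \<bullet> i - a \<bullet> i) * indicator {0<..} (b \<bullet> i - x \<bullet> i))"
    unfolding box_bump_def by (intro tendsto_intros flat_of_nat_tendsto)
  also have "(\<Prod>i\<in>Basis. indicator {0<..} (x \<bullet> i - a \<bullet> i) * indicator {0<..} (b \<bullet> i - x \<bullet> i))
      = (indicator (box a b) x :: real)"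
  proof (cases "x \<in> box a b")
    case True
    then show ?thesis by (simp add: mem_box)
  next
    case False
    then obtain i where "i \<in> Basis" "\<not> (a \<bullet> i < x \<bullet> i \<and> x \<bullet> i < b \<bullet> i)" by (auto simp: mem_box)
    then show ?thesis using False by (auto simp: indicator_def intro!: bexI[of _ i])
  qed
  finally show ?thesis .
qed

text \<open>A countable cover by Borel sets of finite measure serves the completion as well.\<close>

lemma sigma_finite_lebesgue: "sigma_finite_measure (lebesgue :: 'a::euclidean_space measure)"
proof
  obtain A :: "'a set set" where "countable A" "A \<subseteq> sets lborel" "\<Union>A = space lborel" "\<forall>a\<in>A. emeasure lborel a \<noteq> \<infinity>"
    using sigma_finite_measure.sigma_finite_countable[OF sigma_finite_lborel] by blast
  then show "\<exists>A::'a set set. countable A \<and> A \<subseteq> sets lebesgue \<and> \<Union>A = space lebesgue \<and> (\<forall>a\<in>A. emeasure lebesgue a \<noteq> \<infinity>)"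
    by (intro exI[of _ A]) (auto simp: subset_iff)
qed

text \<open>The Borel sets over which \<open>f\<close> integrates to 0 form a Dynkin system, and
  boxes are an intersection-stable generator. The support condition supplies the whole space; null
  sets then carry the result from Borel to Lebesgue sets.\<close>

lemma AE_zero_of_integral_box_zero:
  fixes f :: "'a::euclidean_space \<Rightarrow> 'b::euclidean_space"
  assumes f: "integrable lebesgue f" and supp: "\<And>x. x \<notin> box c d \<Longrightarrow> f x = 0"
    and box: "\<And>a b. (LINT x:box a b|lebesgue. f x) = 0"
  shows "AE x in lebesgue. f x = 0"
proof -
  have si: "set_integrable lebesgue A f" if "A \<in> sets lebesgue" for A
    unfolding set_integrable_def using f that by (intro integrable_mult_indicator) auto
  have whole: "(LINT x|lebesgue. f x) = 0"
  proof -
    have "(LINT x|lebesgue. f x) = (LINT x:box c d|lebesgue. f x)" unfolding set_lebesgue_integral_def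
      by (rule Bochner_Integration.integral_cong) (auto simp: indicator_def supp)
    with box show ?thesis by simp
  qed
  have borel_zero: "(LINT x:A|lebesgue. f x) = 0" if "A \<in> sets borel" for A :: "'a set"
  proof -
    have "A \<in> sigma_sets UNIV (range (\<lambda>(a, b). box a b))" using that unfolding borel_eq_box[where 'a='a] by (simp add: sets_measure_of)
    then show ?thesis
    proof (rule sigma_sets_induct_disjoint[of _ _ _ "\<lambda>A. (LINT x:A|lebesgue. f x) = 0", rotated 2])
      show "(LINT x:{}|lebesgue. f x) = 0" by (simp add: set_lebesgue_integral_def)
    next
      show "Int_stable (range (\<lambda>(a, b). box a b :: 'a set))" by (auto simp: Int_stable_def box_Int_box)
    next
      fix A :: "'a set" assume "A \<in> sigma_sets UNIV (range (\<lambda>(a, b). box a b))" and zero: "(LINT x:A|lebesgue. f x) = 0"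
      then have A: "A \<in> sets borel" unfolding borel_eq_box[where 'a='a] by (simp add: sets_measure_of)
      have "(LINT x:UNIV - A|lebesgue. f x) = (LINT x|lebesgue. f x - indicator A x *\<^sub>R f x)" unfolding set_lebesgue_integral_def
        by (rule Bochner_Integration.integral_cong) (auto simp: indicator_def)
      also have "\<dots> = (LINT x|lebesgue. f x) - (LINT x:A|lebesgue. f x)" unfolding set_lebesgue_integral_def
        using f si[of A] A by (subst Bochner_Integration.integral_diff) (auto simp: set_integrable_def)
      finally show "(LINT x:UNIV - A|lebesgue. f x) = 0" using zero whole by simp
    next
      fix A :: "nat \<Rightarrow> 'a set"
      assume disj: "disjoint_family A" and ran: "range A \<subseteq> sigma_sets UNIV (range (\<lambda>(a, b). box a b))"
        and zero: "\<And>i. (LINT x:A i|lebesgue. f x) = 0"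
      have A: "A i \<in> sets borel" for i using ran unfolding borel_eq_box[where 'a='a] by (auto simp: sets_measure_of)
      then have "(\<Union> (range A)) \<in> sets lebesgue" by auto
      then have "(LINT x:(\<Union>i. A i)|lebesgue. f x) = (\<Sum>i. (LINT x:(A i)|lebesgue. f x))"
        using A disj by (intro lebesgue_integral_countable_add si) (auto simp: disjoint_family_on_def)
      then show "(LINT x:\<Union> (range A)|lebesgue. f x) = 0" using zero by simp
    qed (auto simp: box)
  qed
  have "(LINT x:A|lebesgue. f x) = 0" if "A \<in> sets lebesgue" for A :: "'a set"
  proof -
    obtain S N N' where A: "A = S \<union> N" "N \<subseteq> N'" "N' \<in> null_sets lborel" "S \<in> sets lborel" using \<open>A \<in> sets lebesgue\<close> by (rule sets_completionE)
    have "AE x in lebesgue. x \<notin> N'" using A(3) by (intro AE_not_in null_sets_completionI)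
    then have "AE x in lebesgue. indicator A x *\<^sub>R f x = indicator S x *\<^sub>R f x" by eventually_elim (use A in \<open>auto simp: indicator_def\<close>)
    moreover have "S \<in> sets lebesgue" using A(4) by auto
    ultimately have "(LINT x:A|lebesgue. f x) = (LINT x:S|lebesgue. f x)" unfolding set_lebesgue_integral_def using si[of A] si[of S] that
      by (intro integral_cong_AE) (auto simp: set_integrable_def)
    then show ?thesis using borel_zero[of S] A(4) by simp
  qed
  with f show ?thesis by (intro sigma_finite_measure.density_zero[OF sigma_finite_lebesgue])
qed

text \<open>Dominated convergence turns the bumps into indicators of boxes whose closed box lies in
  \<open>\<Omega>\<close>, and countably many closed boxes cover \<open>\<Omega>\<close>. Hence
  testing with \<open>box_bump\<close> already determines \<open>g\<close>.\<close>

lemma fundamental_lemma: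
  fixes g :: "'a::euclidean_space \<Rightarrow> 'b::euclidean_space"
  assumes "open \<Omega>" and loc: "\<And>K. compact K \<Longrightarrow> K \<subseteq> \<Omega> \<Longrightarrow> set_integrable lebesgue K g"
    and zero: "\<And>n a b. cbox a b \<subseteq> \<Omega> \<Longrightarrow> (LINT x:\<Omega>|lebesgue. box_bump n a b x *\<^sub>R g x) = 0"
  shows "AE x in lebesgue. x \<in> \<Omega> \<longrightarrow> g x = 0"
proof -
  have box0: "(LINT x:box a b|lebesgue. g x) = 0" if sub: "cbox a b \<subseteq> \<Omega>" for a b
  proof -
    have "(\<lambda>n. LINT x|lebesgue. indicator \<Omega> x *\<^sub>R box_bump n a b x *\<^sub>R g x)
       \<longlonglongrightarrow> (LINT x|lebesgue. indicator (box a b) x *\<^sub>R g x)"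
    proof (rule integral_dominated_convergence[where w="\<lambda>x. norm (indicator (cbox a b) x *\<^sub>R g x)"])
      have gi: "integrable lebesgue (\<lambda>x. indicator (cbox a b) x *\<^sub>R g x)" using loc[OF compact_cbox sub] by (simp add: set_integrable_def)
      then show "integrable lebesgue (\<lambda>x. norm (indicator (cbox a b) x *\<^sub>R g x))" by (rule integrable_norm)
      have "(\<lambda>x. indicator (box a b) x *\<^sub>R indicator (cbox a b) x *\<^sub>R g x) \<in> borel_measurable lebesgue"
        by (intro borel_measurable_scaleR borel_measurable_integrable[OF gi] borel_measurable_indicator) auto
      moreover have "(\<lambda>x. indicator (box a b) x *\<^sub>R indicator (cbox a b) x *\<^sub>R g x) = (\<lambda>x. indicator (box a b) x *\<^sub>R g x)"
        using box_subset_cbox[of a b] by (auto simp: indicator_def fun_eq_iff)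
      ultimately show "(\<lambda>x. indicator (box a b) x *\<^sub>R g x) \<in> borel_measurable lebesgue" by simp
      show "(\<lambda>x. indicator \<Omega> x *\<^sub>R box_bump n a b x *\<^sub>R g x) \<in> borel_measurable lebesgue" for n
      proof -
        have "box_bump n a b \<in> borel_measurable lebesgue"
          using smooth_on_imp_continuous_on[OF smooth_box_bump] by (intro measurable_completion) (auto intro: borel_measurable_continuous_onI)
        then have "(\<lambda>x. box_bump n a b x *\<^sub>R indicator (cbox a b) x *\<^sub>R g x) \<in> borel_measurable lebesgue"
          by (intro borel_measurable_scaleR borel_measurable_integrable[OF gi])
        moreover have "(\<lambda>x. box_bump n a b x *\<^sub>R indicator (cbox a b) x *\<^sub>R g x) = (\<lambda>x. indicator \<Omega> x *\<^sub>R box_bump n a b x *\<^sub>R g x)"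
          using sub box_bump_eq_0[of _ a b n] by (auto simp: indicator_def fun_eq_iff)
        ultimately show ?thesis by simp
      qed
      show "AE x in lebesgue. (\<lambda>n. indicator \<Omega> x *\<^sub>R box_bump n a b x *\<^sub>R g x) \<longlonglongrightarrow> indicator (box a b) x *\<^sub>R g x"
      proof (rule AE_I2)
        fix x
        have "(\<lambda>n. indicator \<Omega> x *\<^sub>R box_bump n a b x *\<^sub>R g x) \<longlonglongrightarrow> indicator \<Omega> x *\<^sub>R indicator (box a b) x *\<^sub>R g x"
          by (intro tendsto_intros box_bump_tendsto)
        moreover have "indicator \<Omega> x *\<^sub>R indicator (box a b) x *\<^sub>R g x = indicator (box a b) x *\<^sub>R g x"
          using sub box_subset_cbox[of a b] by (auto simp: indicator_def)
        ultimately show "(\<lambda>n. indicator \<Omega> x *\<^sub>R box_bump n a b x *\<^sub>R g x) \<longlonglongrightarrow> indicator (box a b) x *\<^sub>R g x" by (simp only:)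
      qed
      show "AE x in lebesgue. norm (indicator \<Omega> x *\<^sub>R box_bump n a b x *\<^sub>R g x) \<le> norm (indicator (cbox a b) x *\<^sub>R g x)" for n
        using box_bump_bounds[of n a b] box_bump_eq_0[of _ a b n] by (auto simp: indicator_def mult_left_le_one_le)
    qed
    then show ?thesis using zero[OF sub] by (simp add: set_lebesgue_integral_def LIMSEQ_const_iff)
  qed
  obtain \<D> where D: "countable \<D>" "\<D> \<subseteq> Pow \<Omega>" "\<And>X. X \<in> \<D> \<Longrightarrow> \<exists>a b. X = cbox a b" "\<Union>\<D> = \<Omega>" using open_countable_Union_open_cbox[OF \<open>open \<Omega>\<close>] by metis
  have "AE x in lebesgue. x \<in> X \<longrightarrow> g x = 0" if X: "X \<in> \<D>" for X
  proof -
    obtain c d where X': "X = cbox c d" "cbox c d \<subseteq> \<Omega>" using D(2,3) X by blast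
    have gi: "integrable lebesgue (\<lambda>x. indicator (cbox c d) x *\<^sub>R g x)" using loc[OF compact_cbox X'(2)] by (simp add: set_integrable_def)
    then have "integrable lebesgue (\<lambda>x. indicator (box c d) x *\<^sub>R indicator (cbox c d) x *\<^sub>R g x)" by (rule integrable_mult_indicator[rotated]) auto
    moreover have "(\<lambda>x. indicator (box c d) x *\<^sub>R indicator (cbox c d) x *\<^sub>R g x) = (\<lambda>x. indicator (box c d) x *\<^sub>R g x)"
      using box_subset_cbox[of c d] by (auto simp: indicator_def fun_eq_iff)
    ultimately have int: "integrable lebesgue (\<lambda>x. indicator (box c d) x *\<^sub>R g x)" by simp
    have "AE x in lebesgue. indicator (box c d) x *\<^sub>R g x = 0"
    proof (rule AE_zero_of_integral_box_zero[OF int, of c d])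
      fix a b
      obtain p q where pq: "box a b \<inter> box c d = box p q" by (rule that[OF box_Int_box])
      have "(LINT x:box a b|lebesgue. indicator (box c d) x *\<^sub>R g x) = (LINT x:box p q|lebesgue. g x)"
        unfolding set_lebesgue_integral_def pq[symmetric] by (rule Bochner_Integration.integral_cong) (auto simp: indicator_def)
      also have "\<dots> = 0"
      proof (cases "box p q = {}")
        case False
        have "box p q \<subseteq> cbox c d" using pq box_subset_cbox by blast
        then have "cbox p q \<subseteq> cbox c d" using closure_minimal[OF _ closed_cbox] False by (metis closure_box)
        then show ?thesis using box0 X'(2) by blast
      qed (simp add: set_lebesgue_integral_def)
      finally show "(LINT x:box a b|lebesgue. indicator (box c d) x *\<^sub>R g x) = 0" .
    qed auto
    moreover have "AE x in lebesgue. x \<notin> cbox c d - box c d"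
      by (intro AE_not_in) (use negligible_frontier_interval[of c d] in \<open>simp add: negligible_iff_null_sets\<close>)
    ultimately show ?thesis unfolding X' by eventually_elim (auto simp: indicator_def split: if_splits)
  qed
  then have "AE x in lebesgue. \<forall>X\<in>\<D>. x \<in> X \<longrightarrow> g x = 0" by (subst AE_ball_countable[OF D(1)]) blast
  then show ?thesis by eventually_elim (use D(4) in blast)
qed

section \<open>Integration by parts for test functions\<close>

lemma set_integral_eq_integral:
  fixes f :: "'a \<Rightarrow> 'b::{banach, second_countable_topology}"
  assumes "\<And>x. x \<notin> A \<Longrightarrow> f x = 0"
  shows "(LINT x:A|M. f x) = (LINT x|M. f x)"
  unfolding set_lebesgue_integral_def by (rule Bochner_Integration.integral_cong) (auto simp: indicator_def assms)

lemma integral_lborel_translation: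
  fixes f :: "'a::euclidean_space \<Rightarrow> 'b::euclidean_space"
  assumes "f \<in> borel_measurable borel"
  shows "(LINT x|lborel. f (c + x)) = (LINT x|lborel. f x)"
proof -
  have "(LINT x|lborel. f x) = (LINT x|distr lborel borel ((+) c). f x)" by (simp add: lborel_distr_plus)
  also have "\<dots> = (LINT x|lborel. f (c + x))" using assms by (intro integral_distr) auto
  finally show ?thesis by simp
qed

lemma test_function_lipschitz:
  assumes "\<phi> \<in> test_functions \<Omega>"
  obtains L where "L > 0" "\<And>x. norm (grad \<phi> x) \<le> L" "\<And>x y. \<bar>\<phi> x - \<phi> y\<bar> \<le> L * norm (x - y)"
proof -
  obtain K where K: "smooth_on UNIV \<phi>" "compact K" "\<And>x. x \<notin> K \<Longrightarrow> \<phi> x = 0" using test_functionE[OF assms] by metis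
  have "bounded (grad \<phi> ` K)" using compact_continuous_image[OF continuous_on_subset[OF smooth_on_continuous_grad[OF K(1)]] K(2)]
    by (auto intro: compact_imp_bounded)
  then obtain L where L: "L > 0" "\<And>x. x \<in> K \<Longrightarrow> norm (grad \<phi> x) \<le> L" by (auto simp: bounded_pos)
  have L': "norm (grad \<phi> x) \<le> L" for x
  proof (cases "x \<in> K")
    case False
    then show ?thesis using grad_eq_0_off_closed[OF compact_imp_closed[OF K(2)] K(3) False] L(1) by simp
  qed (use L in auto)
  have "norm (\<phi> x - \<phi> y) \<le> L * norm (x - y)" for x y
  proof (rule differentiable_bound[where S=UNIV and f'="\<lambda>x h. grad \<phi> x \<bullet> h"])
    show "onorm (\<lambda>h. grad \<phi> z \<bullet> h) \<le> L" for z by (rule onorm_le) (metis L' Cauchy_Schwarz_ineq2 mult_right_mono norm_ge_zero order_trans real_norm_def)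
  qed (auto intro: smooth_on_has_derivative_grad[OF K(1)])
  with L(1) L' show ?thesis by (intro that) auto
qed

lemma integrable_lborel_translation:
  fixes f :: "'a::euclidean_space \<Rightarrow> 'b::euclidean_space"
  assumes "integrable lborel f"
  shows "integrable lborel (\<lambda>x. f (c + x))"
proof -
  have "integrable (distr lborel borel ((+) c)) f" using assms by (simp only: lborel_distr_plus)
  from integrable_distr[OF _ this] show ?thesis by simp
qed

text \<open>A difference quotient of \<open>\<phi>\<close> integrates to 0 by translation
  invariance; the Lipschitz constant on a fixed compact set dominates the passage to the derivative.
  All integration by parts below rests on this.\<close>

lemma integral_grad_eq_0:
  assumes "\<phi> \<in> test_functions \<Omega>"
  shows "(LINT x|lebesgue. grad \<phi> x) = 0"
proof -
  obtain K where K: "smooth_on UNIV \<phi>" "compact K" "\<And>x. x \<notin> K \<Longrightarrow> \<phi> x = 0" using test_functionE[OF assms] by metis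
  obtain L where L: "L > 0" "\<And>x. norm (grad \<phi> x) \<le> L" "\<And>x y. \<bar>\<phi> x - \<phi> y\<bar> \<le> L * norm (x - y)" using test_function_lipschitz[OF assms] by blast
  have cont: "continuous_on UNIV \<phi>" "continuous_on UNIV (grad \<phi>)" using K(1) smooth_on_imp_continuous_on smooth_on_continuous_grad by auto
  have [measurable]: "\<phi> \<in> borel_measurable borel" "grad \<phi> \<in> borel_measurable borel" using cont by (auto intro: borel_measurable_continuous_onI)
  have g0: "grad \<phi> x = 0" if "x \<notin> K" for x using grad_eq_0_off_closed[OF compact_imp_closed[OF K(2)] K(3) that] .
  have int: "integrable lborel \<phi>" "integrable lborel (grad \<phi>)" by (rule integrable_continuous_compact_support(1)[OF cont(1) K(2)], erule K(3))
      (rule integrable_continuous_compact_support(1)[OF cont(2) K(2)], erule g0)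
  have "(LINT x|lborel. grad \<phi> x \<bullet> b) = 0" if b: "b \<in> Basis" for b
  proof -
    define D where "D n x = (\<phi> (inverse (real (Suc n)) *\<^sub>R b + x) - \<phi> x) * real (Suc n)" for n x
    \<comment> \<open>Steps have length at most 1, so every difference quotient vanishes outside the
      closed unit neighbourhood of \<open>K\<close>.\<close>
    define K' where "K' = {x + y |x y. x \<in> K \<and> y \<in> cball 0 1}"
    have K': "compact K'" unfolding K'_def by (rule compact_sums[OF K(2) compact_cball])
    have "(\<lambda>n. LINT x|lborel. D n x) \<longlonglongrightarrow> (LINT x|lborel. grad \<phi> x \<bullet> b)"
    proof (rule integral_dominated_convergence[where w="\<lambda>x. L * indicator K' x"])
      show "integrable lborel (\<lambda>x. L * indicator K' x)" using K' by (intro integrable_mult_right integrable_real_indicator)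
          (auto simp: borel_compact dest: emeasure_compact_finite)
      show "(\<lambda>x. grad \<phi> x \<bullet> b) \<in> borel_measurable lborel" "D n \<in> borel_measurable lborel" for n unfolding D_def by measurable
      show "AE x in lborel. norm (D n x) \<le> L * indicator K' x" for n
      proof (rule AE_I2)
        fix x
        show "norm (D n x) \<le> L * indicator K' x"
        proof (cases "x \<in> K'")
          case True
          have "\<bar>\<phi> (inverse (real (Suc n)) *\<^sub>R b + x) - \<phi> x\<bar> \<le> L * inverse (real (Suc n))" using L(3)[of "inverse (real (Suc n)) *\<^sub>R b + x" x] b by simp
          then have "\<bar>\<phi> (inverse (real (Suc n)) *\<^sub>R b + x) - \<phi> x\<bar> * real (Suc n) \<le> L * inverse (real (Suc n)) * real (Suc n)"
            by (rule mult_right_mono) simp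
          then show ?thesis using True by (simp add: D_def abs_mult mult.assoc del: of_nat_Suc)
        next
          case False
          have "x \<notin> K" using False by (force simp: K'_def intro: exI[of _ x] exI[of _ 0])
          moreover have "inverse (real (Suc n)) *\<^sub>R b + x \<notin> K"
          proof
            assume "inverse (real (Suc n)) *\<^sub>R b + x \<in> K"
            moreover have "- (inverse (real (Suc n)) *\<^sub>R b) \<in> cball 0 1" using b by (simp add: field_simps)
            ultimately have "(inverse (real (Suc n)) *\<^sub>R b + x) + - (inverse (real (Suc n)) *\<^sub>R b) \<in> K'" unfolding K'_def by blast
            then show False using False by simp
          qed
          ultimately show ?thesis using False by (simp add: D_def K(3))
        qed
      qed
      show "AE x in lborel. (\<lambda>n. D n x) \<longlonglongrightarrow> grad \<phi> x \<bullet> b"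
      proof (rule AE_I2)
        fix x
        have "((\<lambda>t. \<phi> (x + t *\<^sub>R b)) has_derivative (\<lambda>t. grad \<phi> x \<bullet> (t *\<^sub>R b))) (at 0)"
          by (rule has_derivative_compose[of "\<lambda>t. x + t *\<^sub>R b" "\<lambda>t. t *\<^sub>R b"])
            (auto intro!: derivative_eq_intros smooth_on_has_derivative_grad[OF K(1)])
        then have "((\<lambda>t. \<phi> (x + t *\<^sub>R b)) has_real_derivative grad \<phi> x \<bullet> b) (at 0)"
          by (simp add: has_field_derivative_def mult.commute[of _ "grad \<phi> x \<bullet> b"])
        then have lim: "((\<lambda>t. (\<phi> (x + t *\<^sub>R b) - \<phi> x) / t) \<longlongrightarrow> grad \<phi> x \<bullet> b) (at 0)" by (simp add: has_field_derivative_iff)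
        have "filterlim (\<lambda>n. inverse (real (Suc n))) (at 0) sequentially" using LIMSEQ_inverse_real_of_nat by (simp add: filterlim_at)
        from filterlim_compose[OF lim this] show "(\<lambda>n. D n x) \<longlonglongrightarrow> grad \<phi> x \<bullet> b" by (simp add: D_def add.commute field_simps)
      qed
    qed
    moreover have "(LINT x|lborel. D n x) = 0" for n
    proof -
      define c where "c = inverse (real (Suc n)) *\<^sub>R b"
      have "(LINT x|lborel. \<phi> (c + x) - \<phi> x) = 0" using Bochner_Integration.integral_diff[OF integrable_lborel_translation[OF int(1), of c] int(1)]
          integral_lborel_translation[of \<phi> c] \<open>\<phi> \<in> borel_measurable borel\<close> by linarith
      then have "(LINT x|lborel. (\<phi> (c + x) - \<phi> x) * real (Suc n)) = 0" by (simp only: integral_mult_left_zero)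
      then show ?thesis by (simp only: D_def c_def)
    qed
    ultimately show ?thesis by (simp add: LIMSEQ_const_iff)
  qed
  note comp = this
  have "(LINT x|lborel. grad \<phi> x) = 0"
  proof (rule euclidean_eqI)
    fix b :: 'a assume "b \<in> Basis"
    then have "(LINT x|lborel. grad \<phi> x \<bullet> b) = 0" by (rule comp)
    then show "(LINT x|lborel. grad \<phi> x) \<bullet> b = 0 \<bullet> b" using integral_inner_left[of b lborel "grad \<phi>"] int(2) by simp
  qed
  moreover have "(LINT x|lebesgue. grad \<phi> x) = (LINT x|lborel. grad \<phi> x)" by (rule integral_completion) simp
  ultimately show ?thesis by simp
qed

text \<open>Lebesgue measure is complete, so measurability passes along almost everywhere equality,
  and a non-integrable function has integral 0 by convention on both sides. This lets
  \<open>weak_grad\<close> be replaced by an explicit gradient without side conditions.\<close>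

lemma integral_lebesgue_cong_AE:
  fixes f g :: "'a::euclidean_space \<Rightarrow> 'b::euclidean_space"
  assumes "AE x in lebesgue. f x = g x"
  shows "(LINT x|lebesgue. f x) = (LINT x|lebesgue. g x)" "integrable lebesgue f \<longleftrightarrow> integrable lebesgue g"
proof -
  have sym: "AE x in lebesgue. g x = f x" using assms by (simp add: eq_commute)
  show eq: "integrable lebesgue f \<longleftrightarrow> integrable lebesgue g" using integrable_cong_AE_imp[OF _ _ sym] integrable_cong_AE_imp[OF _ _ assms]
      borel_measurable_AE[OF _ assms] borel_measurable_AE[OF _ sym] borel_measurable_integrable by metis
  show "(LINT x|lebesgue. f x) = (LINT x|lebesgue. g x)"
  proof (cases "integrable lebesgue f")
    case True
    then show ?thesis using eq by (intro integral_cong_AE assms borel_measurable_integrable) auto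
  qed (use eq in \<open>simp add: not_integrable_integral_eq\<close>)
qed

lemma continuous_compact_support_bounded:
  fixes f :: "'a::euclidean_space \<Rightarrow> 'b::euclidean_space"
  assumes "continuous_on UNIV f" "compact K" "\<And>x. x \<notin> K \<Longrightarrow> f x = 0"
  obtains M where "M > 0" "\<And>x. norm (f x) \<le> M"
proof -
  have "bounded (f ` K)" using compact_continuous_image[OF continuous_on_subset[OF assms(1)] assms(2)] by (auto intro: compact_imp_bounded)
  then obtain M where M: "M > 0" "\<And>x. x \<in> K \<Longrightarrow> norm (f x) \<le> M" by (auto simp: bounded_pos)
  have "norm (f x) \<le> M" for x using M assms(3)[of x] by (cases "x \<in> K") auto
  with M(1) show ?thesis by (rule that)
qed

lemma integrable_scaleR_compact_support:
  fixes f :: "'a::euclidean_space \<Rightarrow> 'b::euclidean_space"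
  assumes "set_integrable lebesgue K f" "continuous_on UNIV \<psi>" "compact K" "\<And>x. x \<notin> K \<Longrightarrow> \<psi> x = 0"
  shows "integrable lebesgue (\<lambda>x. \<psi> x *\<^sub>R f x)"
proof -
  obtain M where M: "M > 0" "\<And>x. norm (\<psi> x) \<le> M" using continuous_compact_support_bounded[OF assms(2,3)] assms(4) by metis
  have i: "integrable lebesgue (zero_ext K f)" using assms(1) by (simp add: set_integrable_def)
  have m: "\<psi> \<in> borel_measurable lebesgue" using assms(2) by (intro measurable_completion) (auto intro: borel_measurable_continuous_onI)
  have "integrable lebesgue (\<lambda>x. \<psi> x *\<^sub>R (indicator K x *\<^sub>R f x))"
  proof (rule Bochner_Integration.integrable_bound[where f="\<lambda>x. M *\<^sub>R (indicator K x *\<^sub>R f x)"])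
    show "AE x in lebesgue. norm (\<psi> x *\<^sub>R (indicator K x *\<^sub>R f x)) \<le> norm (M *\<^sub>R (indicator K x *\<^sub>R f x))"
      using M by (intro AE_I2) (auto simp: indicator_def mult_right_mono)
  qed (intro integrable_scaleR_right i borel_measurable_scaleR[OF m borel_measurable_integrable[OF i]])+
  moreover have "(\<lambda>x. \<psi> x *\<^sub>R (indicator K x *\<^sub>R f x)) = (\<lambda>x. \<psi> x *\<^sub>R f x)" using assms(4) by (auto simp: indicator_def fun_eq_iff)
  ultimately show ?thesis by simp
qed

lemma integrable_scaleR_compact_support':
  fixes \<psi> :: "'a::euclidean_space \<Rightarrow> 'b::euclidean_space"
  assumes "set_integrable lebesgue K f" "continuous_on UNIV \<psi>" "compact K" "\<And>x. x \<notin> K \<Longrightarrow> \<psi> x = 0"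
  shows "integrable lebesgue (\<lambda>x. f x *\<^sub>R \<psi> x)"
proof -
  obtain M where M: "M > 0" "\<And>x. norm (\<psi> x) \<le> M" using continuous_compact_support_bounded[OF assms(2,3)] assms(4) by metis
  have i: "integrable lebesgue (zero_ext K f)" using assms(1) by (simp add: set_integrable_def)
  have m: "\<psi> \<in> borel_measurable lebesgue" using assms(2) by (intro measurable_completion) (auto intro: borel_measurable_continuous_onI)
  have "integrable lebesgue (\<lambda>x. (indicator K x *\<^sub>R f x) *\<^sub>R \<psi> x)"
  proof (rule Bochner_Integration.integrable_bound[where f="\<lambda>x. M *\<^sub>R (indicator K x *\<^sub>R f x)"])
    show "AE x in lebesgue. norm ((indicator K x *\<^sub>R f x) *\<^sub>R \<psi> x) \<le> norm (M *\<^sub>R (indicator K x *\<^sub>R f x))"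
      using M by (intro AE_I2) (auto simp: indicator_def mult_left_mono abs_mult mult.commute[of M])
  qed (use i m in \<open>auto intro!: borel_measurable_scaleR borel_measurable_integrable[OF i]\<close>)
  moreover have "(\<lambda>x. (indicator K x *\<^sub>R f x) *\<^sub>R \<psi> x) = (\<lambda>x. f x *\<^sub>R \<psi> x)" using assms(4) by (auto simp: indicator_def fun_eq_iff)
  ultimately show ?thesis by simp
qed

lemma test_function_continuous:
  assumes "\<phi> \<in> test_functions \<Omega>"
  shows "continuous_on UNIV \<phi>" "continuous_on UNIV (grad \<phi>)"
  using test_functionE[OF assms] smooth_on_imp_continuous_on smooth_on_continuous_grad by metis+

lemma test_function_off:
  assumes "\<phi> \<in> test_functions \<Omega>"
  obtains K where "compact K" "K \<subseteq> \<Omega>" "\<And>x. x \<notin> K \<Longrightarrow> \<phi> x = 0" "\<And>x. x \<notin> K \<Longrightarrow> grad \<phi> x = 0"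
proof -
  obtain K where K: "compact K" "K \<subseteq> \<Omega>" "\<And>x. x \<notin> K \<Longrightarrow> \<phi> x = 0" using test_functionE[OF assms] by metis
  show ?thesis by (rule that[OF K]) (auto intro: grad_eq_0_off_closed[OF compact_imp_closed[OF K(1)]] K(3))
qed

section \<open>Calculus of weak gradients\<close>

lemma weak_grad_test_integrable:
  assumes "is_weak_grad \<Omega> u g" "\<phi> \<in> test_functions \<Omega>"
  shows "integrable lebesgue (\<lambda>x. u x *\<^sub>R grad \<phi> x)" "integrable lebesgue (\<lambda>x. \<phi> x *\<^sub>R g x)"
proof -
  obtain K where K: "compact K" "K \<subseteq> \<Omega>" "\<And>x. x \<notin> K \<Longrightarrow> \<phi> x = 0" "\<And>x. x \<notin> K \<Longrightarrow> grad \<phi> x = 0" using test_function_off[OF assms(2)] by metis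
  have "set_integrable lebesgue K u" "set_integrable lebesgue K g" using assms(1) K(1,2) by (auto simp: is_weak_grad_def)
  then show "integrable lebesgue (\<lambda>x. u x *\<^sub>R grad \<phi> x)" "integrable lebesgue (\<lambda>x. \<phi> x *\<^sub>R g x)"
    using K test_function_continuous[OF assms(2)] by (auto intro: integrable_scaleR_compact_support integrable_scaleR_compact_support')
qed

text \<open>A test function and its gradient vanish off a compact part of \<open>\<Omega>\<close>,
  so both integrals may be taken over the whole space, where linearity and translation are at
  hand.\<close>

lemma is_weak_grad_iff:
  "is_weak_grad \<Omega> u g \<longleftrightarrow>
     (\<forall>K. compact K \<and> K \<subseteq> \<Omega> \<longrightarrow> set_integrable lebesgue K u \<and> set_integrable lebesgue K g) \<and>
     (\<forall>\<phi>\<in>test_functions \<Omega>. (LINT x|lebesgue. u x *\<^sub>R grad \<phi> x) = - (LINT x|lebesgue. \<phi> x *\<^sub>R g x))"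
proof -
  have "(LINT x:\<Omega>|lebesgue. u x *\<^sub>R grad \<phi> x) = (LINT x|lebesgue. u x *\<^sub>R grad \<phi> x)"
    "(LINT x:\<Omega>|lebesgue. \<phi> x *\<^sub>R g x) = (LINT x|lebesgue. \<phi> x *\<^sub>R g x)" if \<phi>: "\<phi> \<in> test_functions \<Omega>" for \<phi>
  proof -
    obtain K where K: "K \<subseteq> \<Omega>" "\<And>x. x \<notin> K \<Longrightarrow> \<phi> x = 0" "\<And>x. x \<notin> K \<Longrightarrow> grad \<phi> x = 0" using test_function_off[OF \<phi>] by metis
    show "(LINT x:\<Omega>|lebesgue. u x *\<^sub>R grad \<phi> x) = (LINT x|lebesgue. u x *\<^sub>R grad \<phi> x)"
      "(LINT x:\<Omega>|lebesgue. \<phi> x *\<^sub>R g x) = (LINT x|lebesgue. \<phi> x *\<^sub>R g x)" by (rule set_integral_eq_integral, use K in force)+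
  qed
  then show ?thesis unfolding is_weak_grad_def by auto
qed

lemma is_weak_grad_add:
  assumes "is_weak_grad \<Omega> u g" "is_weak_grad \<Omega> v h"
  shows "is_weak_grad \<Omega> (\<lambda>x. u x + v x) (\<lambda>x. g x + h x)"
proof -
  have "(LINT x|lebesgue. (u x + v x) *\<^sub>R grad \<phi> x) = - (LINT x|lebesgue. \<phi> x *\<^sub>R (g x + h x))"
    if \<phi>: "\<phi> \<in> test_functions \<Omega>" for \<phi> using weak_grad_test_integrable[OF assms(1) \<phi>] weak_grad_test_integrable[OF assms(2) \<phi>] assms \<phi>
    by (simp add: scaleR_left_distrib scaleR_right_distrib is_weak_grad_iff)
  moreover have "set_integrable lebesgue K (\<lambda>x. u x + v x) \<and> set_integrable lebesgue K (\<lambda>x. g x + h x)"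
    if "compact K" "K \<subseteq> \<Omega>" for K using assms that unfolding is_weak_grad_def by (auto intro: set_integral_add)
  ultimately show ?thesis by (simp add: is_weak_grad_iff)
qed

lemma is_weak_grad_scale:
  assumes "is_weak_grad \<Omega> u g"
  shows "is_weak_grad \<Omega> (\<lambda>x. c * u x) (\<lambda>x. c *\<^sub>R g x)"
proof -
  have "(LINT x|lebesgue. (c * u x) *\<^sub>R grad \<phi> x) = - (LINT x|lebesgue. \<phi> x *\<^sub>R (c *\<^sub>R g x))"
    if \<phi>: "\<phi> \<in> test_functions \<Omega>" for \<phi>
  proof -
    have "(LINT x|lebesgue. (c * u x) *\<^sub>R grad \<phi> x) = c *\<^sub>R (LINT x|lebesgue. u x *\<^sub>R grad \<phi> x)" by (subst integral_scaleR_right[symmetric]) simp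
    moreover have "(LINT x|lebesgue. \<phi> x *\<^sub>R (c *\<^sub>R g x)) = c *\<^sub>R (LINT x|lebesgue. \<phi> x *\<^sub>R g x)"
      by (subst integral_scaleR_right[symmetric]) (simp add: mult.commute)
    ultimately show ?thesis using assms \<phi> by (simp add: is_weak_grad_iff)
  qed
  moreover have "set_integrable lebesgue K (\<lambda>x. c * u x) \<and> set_integrable lebesgue K (\<lambda>x. c *\<^sub>R g x)"
    if "compact K" "K \<subseteq> \<Omega>" for K using assms that unfolding is_weak_grad_def by auto
  ultimately show ?thesis by (simp add: is_weak_grad_iff)
qed

lemma is_weak_grad_diff:
  assumes "is_weak_grad \<Omega> u g" "is_weak_grad \<Omega> v h"
  shows "is_weak_grad \<Omega> (\<lambda>x. u x - v x) (\<lambda>x. g x - h x)"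
  using is_weak_grad_add[OF assms(1) is_weak_grad_scale[OF assms(2), of "-1"]] by simp

lemma is_weak_grad_unique:
  assumes "open \<Omega>" "is_weak_grad \<Omega> u g" "is_weak_grad \<Omega> u h"
  shows "AE x in lebesgue. x \<in> \<Omega> \<longrightarrow> g x = h x"
proof -
  have D: "is_weak_grad \<Omega> (\<lambda>x. u x - u x) (\<lambda>x. g x - h x)" using is_weak_grad_diff[OF assms(2,3)] .
  have "AE x in lebesgue. x \<in> \<Omega> \<longrightarrow> g x - h x = 0"
  proof (rule fundamental_lemma[OF assms(1)])
    show "set_integrable lebesgue K (\<lambda>x. g x - h x)" if "compact K" "K \<subseteq> \<Omega>" for K using D that unfolding is_weak_grad_def by auto
    show "(LINT x:\<Omega>|lebesgue. box_bump n a b x *\<^sub>R (g x - h x)) = 0" if "cbox a b \<subseteq> \<Omega>" for n a b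
      using D box_bump_test[OF that] unfolding is_weak_grad_def by (auto simp: set_lebesgue_integral_def)
  qed
  then show ?thesis by simp
qed

text \<open>Removes the choice in \<open>weak_grad\<close>: existence makes \<open>SOME\<close>
  legitimate, and uniqueness up to null sets identifies it with whatever gradient has been
  computed.\<close>

lemma weak_grad_eqI:
  assumes "open \<Omega>" "is_weak_grad \<Omega> u g"
  shows "is_weak_grad \<Omega> u (weak_grad \<Omega> u)" "AE x in lebesgue. x \<in> \<Omega> \<longrightarrow> weak_grad \<Omega> u x = g x"
proof -
  show "is_weak_grad \<Omega> u (weak_grad \<Omega> u)" unfolding weak_grad_def by (rule someI[of "is_weak_grad \<Omega> u", OF assms(2)])
  from is_weak_grad_unique[OF assms(1) this assms(2)]
  show "AE x in lebesgue. x \<in> \<Omega> \<longrightarrow> weak_grad \<Omega> u x = g x" .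
qed

text \<open>Integration by parts: the gradient of the test function \<open>u * \<phi>\<close>
  integrates to 0.\<close>

lemma smooth_is_weak_grad:
  assumes "smooth_on UNIV u"
  shows "is_weak_grad \<Omega> u (grad u)"
proof -
  have c: "continuous_on UNIV u" "continuous_on UNIV (grad u)" using assms smooth_on_imp_continuous_on smooth_on_continuous_grad by auto
  have loc: "set_integrable lebesgue K u \<and> set_integrable lebesgue K (grad u)" if K: "compact K" for K
  proof -
    have i: "integrable lborel (zero_ext K u)" "integrable lborel (\<lambda>x. indicator K x *\<^sub>R grad u x)"
      by (intro borel_integrable_compact K continuous_on_subset[OF c(1)] continuous_on_subset[OF c(2)] subset_UNIV)+
    show ?thesis unfolding set_integrable_def using i by (simp only: integrable_completion[OF borel_measurable_integrable[OF i(1)]]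
          integrable_completion[OF borel_measurable_integrable[OF i(2)]])
  qed
  have "(LINT x|lebesgue. u x *\<^sub>R grad \<phi> x) = - (LINT x|lebesgue. \<phi> x *\<^sub>R grad u x)"
    if \<phi>: "\<phi> \<in> test_functions \<Omega>" for \<phi>
  proof -
    obtain K where K: "smooth_on UNIV \<phi>" "compact K" "\<And>x. x \<notin> K \<Longrightarrow> \<phi> x = 0" using test_functionE[OF \<phi>] by metis
    have g0: "\<And>x. x \<notin> K \<Longrightarrow> grad \<phi> x = 0" using grad_eq_0_off_closed[OF compact_imp_closed[OF K(2)] K(3)] .
    have "(\<lambda>x. u x * \<phi> x) \<in> test_functions UNIV" by (rule test_functionI[OF _ K(2)]) (use K assms in \<open>auto intro: smooth_on_mult\<close>)
    from integral_grad_eq_0[OF this] have "(LINT x|lebesgue. u x *\<^sub>R grad \<phi> x + \<phi> x *\<^sub>R grad u x) = 0" by (simp add: smooth_grad_mult[OF assms K(1)])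
    moreover have "integrable lebesgue (\<lambda>x. u x *\<^sub>R grad \<phi> x)" by (rule integrable_scaleR_compact_support'[OF _ _ K(2)])
        (use loc[OF K(2)] test_function_continuous[OF \<phi>] g0 in auto)
    moreover have "integrable lebesgue (\<lambda>x. \<phi> x *\<^sub>R grad u x)" by (rule integrable_scaleR_compact_support[OF _ _ K(2)])
        (use loc[OF K(2)] test_function_continuous[OF \<phi>] K(3) in auto)
    ultimately show ?thesis by (simp add: eq_neg_iff_add_eq_0)
  qed
  with loc show ?thesis by (simp add: is_weak_grad_iff)
qed

section \<open>Square integrable functions and completeness\<close>

text \<open>A function on \<open>\<Omega>\<close> enters through its extension
  \<open>zero_ext\<close>, so that one Hilbert space calculus on the whole space serves every
  domain.\<close>

definition L2 :: "('a::euclidean_space \<Rightarrow> 'b::euclidean_space) \<Rightarrow> bool" where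
  "L2 f \<longleftrightarrow> f \<in> borel_measurable lebesgue \<and> integrable lebesgue (\<lambda>x. (norm (f x))\<^sup>2)"

lemma norm_add_sq_le: "(norm (a + b :: 'b::real_inner))\<^sup>2 \<le> 2 * (norm a)\<^sup>2 + 2 * (norm b)\<^sup>2"
proof -
  have "0 \<le> (norm (a - b))\<^sup>2" by simp
  then show ?thesis by (simp add: power2_norm_eq_inner inner_simps inner_commute)
qed

lemma abs_inner_le_sq: "\<bar>a \<bullet> b\<bar> \<le> (norm a)\<^sup>2 + (norm (b :: 'b::real_inner))\<^sup>2"
proof -
  have "\<bar>a \<bullet> b\<bar> \<le> norm a * norm b" by (rule Cauchy_Schwarz_ineq2)
  also have "\<dots> \<le> (norm a)\<^sup>2 + (norm b)\<^sup>2"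
  proof -
    have "0 \<le> (norm a - norm b)\<^sup>2 + (norm a)\<^sup>2 + (norm b)\<^sup>2" by simp
    then show ?thesis by (simp add: power2_diff)
  qed
  finally show ?thesis .
qed

lemma L2_measurable: "L2 f \<Longrightarrow> f \<in> borel_measurable lebesgue"
  and L2_integrable: "L2 f \<Longrightarrow> integrable lebesgue (\<lambda>x. (norm (f x))\<^sup>2)" by (simp_all add: L2_def)

lemma L2_add:
  assumes "L2 f" "L2 g" shows "L2 (\<lambda>x. f x + g x)"
  unfolding L2_def
proof
  show m: "(\<lambda>x. f x + g x) \<in> borel_measurable lebesgue" using assms by (intro borel_measurable_add L2_measurable)
  show "integrable lebesgue (\<lambda>x. (norm (f x + g x))\<^sup>2)"
  proof (rule Bochner_Integration.integrable_bound)
    show "integrable lebesgue (\<lambda>x. 2 * (norm (f x))\<^sup>2 + 2 * (norm (g x))\<^sup>2)" using assms by (simp add: L2_integrable)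
    show "(\<lambda>x. (norm (f x + g x))\<^sup>2) \<in> borel_measurable lebesgue" using m by measurable
    show "AE x in lebesgue. norm ((norm (f x + g x))\<^sup>2) \<le> norm (2 * (norm (f x))\<^sup>2 + 2 * (norm (g x))\<^sup>2)"
      using norm_add_sq_le by (intro AE_I2) fastforce
  qed
qed

lemma L2_scale:
  assumes "L2 f" shows "L2 (\<lambda>x. c *\<^sub>R f x)"
  using assms unfolding L2_def by (auto simp: power_mult_distrib)

lemma L2_diff:
  assumes "L2 f" "L2 g" shows "L2 (\<lambda>x. f x - g x)"
  using L2_add[OF assms(1) L2_scale[OF assms(2), of "-1"]] by simp

lemma L2_cong_AE:
  assumes "L2 f" "AE x in lebesgue. f x = g x"
  shows "L2 g"
proof -
  have "AE x in lebesgue. (norm (f x))\<^sup>2 = (norm (g x))\<^sup>2" using assms(2) by eventually_elim simp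
  from integral_lebesgue_cong_AE(2)[OF this] borel_measurable_AE[OF _ assms(2)] assms(1)
  show ?thesis by (simp add: L2_def)
qed

lemma L2_inner_integrable:
  assumes "L2 f" "L2 g" shows "integrable lebesgue (\<lambda>x. f x \<bullet> g x)"
proof (rule Bochner_Integration.integrable_bound)
  show "integrable lebesgue (\<lambda>x. (norm (f x))\<^sup>2 + (norm (g x))\<^sup>2)" using assms by (simp add: L2_integrable)
  show "(\<lambda>x. f x \<bullet> g x) \<in> borel_measurable lebesgue" using assms by (intro borel_measurable_inner L2_measurable)
  show "AE x in lebesgue. norm (f x \<bullet> g x) \<le> norm ((norm (f x))\<^sup>2 + (norm (g x))\<^sup>2)" using abs_inner_le_sq by (intro AE_I2) fastforce
qed

lemma L2_norm_add_sq:
  assumes "L2 f" "L2 g"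
  shows "(LINT x|lebesgue. (norm (f x + g x))\<^sup>2) =
    (L2_sq f) + 2 * (LINT x|lebesgue. f x \<bullet> g x) + (L2_sq g)"
proof -
  have "(norm (f x + g x))\<^sup>2 = (norm (f x))\<^sup>2 + 2 * (f x \<bullet> g x) + (norm (g x))\<^sup>2" for x by (simp add: power2_norm_eq_inner inner_simps inner_commute)
  then show ?thesis using assms by (simp add: L2_integrable L2_inner_integrable)
qed

lemma L2_norm_add_scale_sq:
  assumes "L2 f" "L2 g"
  shows "(LINT x|lebesgue. (norm (f x + t *\<^sub>R g x))\<^sup>2) =
    (L2_sq f) + 2 * t * (LINT x|lebesgue. f x \<bullet> g x) + t\<^sup>2 * (L2_sq g)"
  using L2_norm_add_sq[OF assms(1) L2_scale[OF assms(2), of t]] by (simp add: power_mult_distrib)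

text \<open>Used twice: for Cauchy-Schwarz, and with \<open>A = 0\<close> to make the first
  variation at a minimizer vanish. The sign of \<open>C\<close> is part of the conclusion of the
  argument, so the cases \<open>C = 0\<close> and \<open>C < 0\<close> are treated
  separately.\<close>

lemma nonneg_quadratic_discriminant:
  fixes A B C :: real
  assumes "\<And>t. 0 \<le> A + 2 * t * B + t\<^sup>2 * C"
  shows "B\<^sup>2 \<le> A * C"
proof (cases "C = 0")
  case True
  then have "0 \<le> A + 2 * t * B" for t using assms[of t] by simp
  from this[of "- (A + 1) / (2 * B)"] have "B = 0" by (cases "B = 0") (auto simp: field_simps)
  then show ?thesis using True by simp
next
  case False
  have "C \<ge> 0"
  proof (rule ccontr)
    assume "\<not> C \<ge> 0"
    \<comment> \<open>Large enough that \<open>t * (- C)\<close> exceeds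
      \<open>\<bar>A\<bar> + 1 + 2 * \<bar>B\<bar>\<close>, which makes the quadratic
      negative.\<close>
    define t where "t = (\<bar>A\<bar> + 1) / (-C) + 2 * \<bar>B\<bar> / (- C) + 1"
    have "- C > 0" using \<open>\<not> C \<ge> 0\<close> by simp
    have "(\<bar>A\<bar> + 1) / (-C) \<ge> 0" "2 * \<bar>B\<bar> / (- C) \<ge> 0" using \<open>- C > 0\<close> by (auto intro!: divide_nonneg_pos simp del: divide_minus_right)
    then have t: "t \<ge> 1" "t * (- C) = \<bar>A\<bar> + 1 + 2 * \<bar>B\<bar> + (- C)" using \<open>- C > 0\<close> by (simp add: t_def) (use \<open>- C > 0\<close> in \<open>simp add: t_def field_simps\<close>)
    have "t\<^sup>2 * (-C) = t * (t * (- C))" by (simp only: power2_eq_square mult.assoc)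
    also have "\<dots> = t * (\<bar>A\<bar> + 1 + 2 * \<bar>B\<bar> + (- C))" by (simp only: t(2))
    also have "\<dots> \<ge> (\<bar>A\<bar> + 1) + 2 * t * \<bar>B\<bar>" using t(1) \<open>- C > 0\<close> mult_right_mono[OF t(1), of "\<bar>A\<bar> + 1"] mult_nonneg_nonneg[of t "- C"]
      by (simp add: algebra_simps)
    finally have "A + 2 * t * B + t\<^sup>2 * C \<le> A + 2 * t * B - (\<bar>A\<bar> + 1) - 2 * t * \<bar>B\<bar>" by simp
    also have "\<dots> < 0"
    proof -
      have "2 * t * B \<le> 2 * t * \<bar>B\<bar>" using t(1) by (intro mult_left_mono) auto
      then show ?thesis by linarith
    qed
    finally show False using assms[of t] by simp
  qed
  with False have "C > 0" by simp
  have "0 \<le> A + 2 * (- B / C) * B + (- B / C)\<^sup>2 * C" by (rule assms)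
  also have "\<dots> = A - B\<^sup>2 / C" using \<open>C > 0\<close> by (simp add: power2_eq_square)
  finally show ?thesis using \<open>C > 0\<close> by (simp add: field_simps)
qed

lemma L2_Cauchy_Schwarz:
  assumes "L2 f" "L2 g"
  shows "(LINT x|lebesgue. f x \<bullet> g x)\<^sup>2 \<le> (L2_sq f) * (L2_sq g)"
proof (rule nonneg_quadratic_discriminant)
  fix t
  have "0 \<le> (LINT x|lebesgue. (norm (f x + t *\<^sub>R g x))\<^sup>2)" by simp
  then show "0 \<le> (L2_sq f) + 2 * t * (LINT x|lebesgue. f x \<bullet> g x) + t\<^sup>2 * (L2_sq g)" by (simp add: L2_norm_add_scale_sq[OF assms])
qed

lemma L2_tendsto_inner:
  assumes "\<And>n. L2 (f n)" "L2 g" "L2 h" "(\<lambda>n. LINT x|lebesgue. (norm (f n x - g x))\<^sup>2) \<longlonglongrightarrow> 0"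
  shows "(\<lambda>n. LINT x|lebesgue. f n x \<bullet> h x) \<longlonglongrightarrow> (LINT x|lebesgue. g x \<bullet> h x)"
proof -
  have "(\<lambda>n. (LINT x|lebesgue. (f n x - g x) \<bullet> h x)\<^sup>2) \<longlonglongrightarrow> 0"
  proof (rule tendsto_sandwich[OF _ _ tendsto_const])
    show "\<forall>\<^sub>F n in sequentially. (LINT x|lebesgue. (f n x - g x) \<bullet> h x)\<^sup>2
        \<le> (LINT x|lebesgue. (norm (f n x - g x))\<^sup>2) * (L2_sq h)" by (intro always_eventually allI L2_Cauchy_Schwarz L2_diff assms)
    show "(\<lambda>n. (LINT x|lebesgue. (norm (f n x - g x))\<^sup>2) * (L2_sq h)) \<longlonglongrightarrow> 0" using tendsto_mult_left_zero[OF assms(4)] by simp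
  qed auto
  then have "(\<lambda>n. LINT x|lebesgue. (f n x - g x) \<bullet> h x) \<longlonglongrightarrow> 0" using tendsto_real_sqrt by (fastforce simp: tendsto_rabs_zero_iff)
  moreover have "(LINT x|lebesgue. (f n x - g x) \<bullet> h x) = (LINT x|lebesgue. f n x \<bullet> h x) - (LINT x|lebesgue. g x \<bullet> h x)" for n
    using assms by (simp add: inner_diff_left L2_inner_integrable)
  ultimately show ?thesis by (simp add: LIM_zero_iff)
qed

lemma L2_tendsto_norm_sq:
  assumes "\<And>n. L2 (f n)" "L2 g" "(\<lambda>n. LINT x|lebesgue. (norm (f n x - g x))\<^sup>2) \<longlonglongrightarrow> 0"
  shows "(\<lambda>n. LINT x|lebesgue. (norm (f n x))\<^sup>2) \<longlonglongrightarrow> (L2_sq g)"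
proof -
  have eq: "(LINT x|lebesgue. (norm (f n x))\<^sup>2) = (LINT x|lebesgue. (norm (f n x - g x))\<^sup>2)
      + 2 * ((LINT x|lebesgue. f n x \<bullet> g x) - (LINT x|lebesgue. g x \<bullet> g x)) + (L2_sq g)" for n
    using L2_norm_add_sq[OF L2_diff[OF assms(1)[of n] assms(2)] assms(2)] assms by (simp add: inner_diff_left L2_inner_integrable)
  have "(\<lambda>n. LINT x|lebesgue. (norm (f n x))\<^sup>2) \<longlonglongrightarrow>
     0 + 2 * ((LINT x|lebesgue. g x \<bullet> g x) - (LINT x|lebesgue. g x \<bullet> g x)) + (L2_sq g)" unfolding eq by (intro tendsto_intros assms L2_tendsto_inner)
  then show ?thesis by simp
qed

text \<open>A crude triangle inequality for p-th powers. It is called on for the integrability of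
  differences, where the constant is harmless.\<close>

lemma norm_diff_power_le:
  fixes a b :: "'b::real_normed_vector"
  shows "norm (a - b) ^ p \<le> 2 ^ p * (norm a ^ p + norm b ^ p)"
proof -
  have "norm (a - b) \<le> 2 * max (norm a) (norm b)" using norm_triangle_ineq4[of a b] by linarith
  then have "norm (a - b) ^ p \<le> (2 * max (norm a) (norm b)) ^ p" by (rule power_mono) simp
  also have "\<dots> = 2 ^ p * max (norm a) (norm b) ^ p" by (simp add: power_mult_distrib)
  also have "\<dots> \<le> 2 ^ p * (norm a ^ p + norm b ^ p)" by (intro mult_left_mono) (auto simp: max_def)
  finally show ?thesis .
qed

text \<open>Riesz--Fischer for integer exponents; Borel--Cantelli makes Minkowski's inequality unnecessary.\<close>

lemma Lp_complete:
  fixes f :: "nat \<Rightarrow> 'a \<Rightarrow> 'b::euclidean_space"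
  assumes p: "p > 0" and m: "\<And>n. f n \<in> borel_measurable M" and i: "\<And>n. integrable M (\<lambda>x. norm (f n x) ^ p)"
    and cauchy: "\<And>e. e > 0 \<Longrightarrow> \<exists>N. \<forall>m\<ge>N. \<forall>n\<ge>N. (LINT x|M. norm (f m x - f n x) ^ p) < e"
  obtains g r where "g \<in> borel_measurable M" "integrable M (\<lambda>x. norm (g x) ^ p)"
    "(\<lambda>n. LINT x|M. norm (f n x - g x) ^ p) \<longlonglongrightarrow> 0"
    "strict_mono r" "AE x in M. (\<lambda>n. f (r n) x) \<longlonglongrightarrow> g x"
proof -
  have di: "integrable M (\<lambda>x. norm (f k x - h x) ^ p)"
    if "h \<in> borel_measurable M" "integrable M (\<lambda>x. norm (h x) ^ p)" for h k
  proof (rule Bochner_Integration.integrable_bound)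
    show "integrable M (\<lambda>x. 2 ^ p * (norm (f k x) ^ p + norm (h x) ^ p))" using i that by simp
    show "(\<lambda>x. norm (f k x - h x) ^ p) \<in> borel_measurable M" using m that(1) by measurable
    show "AE x in M. norm (norm (f k x - h x) ^ p) \<le> norm (2 ^ p * (norm (f k x) ^ p + norm (h x) ^ p))"
      using norm_diff_power_le[of "f k _" "h _" p] by (intro AE_I2) fastforce
  qed
  \<comment> \<open>The rate \<open>4^(-p*k)\<close> leaves a factor \<open>2^(-p*k)\<close> after
    Markov's inequality at height \<open>2^(-k)\<close>.\<close>
  have "\<forall>k. \<exists>N. \<forall>m\<ge>N. \<forall>n\<ge>N. (LINT x|M. norm (f m x - f n x) ^ p) < (1 / 4 ^ p) ^ k" by (intro allI cauchy) simp
  then obtain N where N: "\<And>k m n. m \<ge> N k \<Longrightarrow> n \<ge> N k \<Longrightarrow> (LINT x|M. norm (f m x - f n x) ^ p) < (1 / 4 ^ p) ^ k" by metis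
  \<comment> \<open>Adding \<open>k\<close> to the partial sums makes the indices strictly
    increasing while they stay above \<open>N k\<close>.\<close>
  define r where "r k = (\<Sum>j\<le>k. N j) + k" for k
  have r: "strict_mono r" "N k \<le> r k" for k unfolding r_def strict_mono_Suc_iff by (auto intro: trans_le_add1 member_le_sum)
  have "N k \<le> r (Suc k)" for k using r(2)[of k] strict_monoD[OF r(1), of k "Suc k"] by simp
  then have rd: "(LINT x|M. norm (f (r (Suc k)) x - f (r k) x) ^ p) < (1 / 4 ^ p) ^ k" for k by (intro N r)
  \<comment> \<open>The sets of large increments have summable measure; by Borel-Cantelli almost
    every point lies in finitely many of them, and there the subsequence converges
    geometrically.\<close>
  define A where "A k = {x\<in>space M. norm (f (r (Suc k)) x - f (r k) x) ^ p \<ge> (1 / 2 ^ p) ^ k}" for k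
  have Am: "A k \<in> sets M" for k using m unfolding A_def by measurable
  have Afin: "emeasure M (A k) \<le> ennreal ((1/2) ^ k)" for k
  proof -
    have "emeasure M (A k) \<le> ennreal (1 / (1 / 2 ^ p) ^ k * (LINT x|M. norm (f (r (Suc k)) x - f (r k) x) ^ p))"
      unfolding A_def by (rule integral_Markov_inequality[OF di[OF m i]]) auto
    also have "\<dots> \<le> ennreal (1 / (1 / 2 ^ p) ^ k * (1 / 4 ^ p) ^ k)" using rd[of k] by (intro ennreal_leI mult_left_mono) auto
    also have "1 / (1 / 2 ^ p) ^ k * (1 / 4 ^ p) ^ k = ((1/2::real) ^ p) ^ k" by (simp add: power_divide field_simps flip: power_mult_distrib)
    also have "\<dots> \<le> (1/2) ^ k" using p power_decreasing[of 1 p "1/2::real"] by (intro power_mono) auto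
    finally show ?thesis by (auto intro: ennreal_leI)
  qed
  have "AE x in M. eventually (\<lambda>n. x \<in> space M - A n) sequentially"
  proof (rule borel_cantelli_AE1[OF Am])
    show "emeasure M (A n) < \<infinity>" for n using Afin[of n] by (auto intro: le_less_trans simp: ennreal_less_top)
    show "summable (\<lambda>n. measure M (A n))"
    proof (rule summable_comparison_test')
      show "summable (\<lambda>n. (1/2::real) ^ n)" by (simp add: summable_geometric)
      show "norm (measure M (A n)) \<le> (1/2) ^ n" for n using Afin[of n] unfolding measure_def by (simp add: enn2real_leI)
    qed
  qed
  then have conv: "AE x in M. convergent (\<lambda>n. f (r n) x)"
  proof eventually_elim
    case (elim x)
    then have "\<forall>\<^sub>F n in sequentially. norm (f (r (Suc n)) x - f (r n) x) \<le> (1 / 2) ^ n"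
    proof eventually_elim
      case (elim n)
      then have "norm (f (r (Suc n)) x - f (r n) x) ^ p < (1 / 2 ^ p) ^ n" by (auto simp: A_def)
      also have "(1 / 2 ^ p) ^ n = ((1/2::real) ^ n) ^ p" by (simp add: power_divide mult.commute flip: power_mult)
      finally show ?case using power_less_imp_less_base[of "norm (f (r (Suc n)) x - f (r n) x)" p "(1/2) ^ n"] by simp
    qed
    then obtain n0 where n0: "\<And>n. n \<ge> n0 \<Longrightarrow> norm (f (r (Suc n)) x - f (r n) x) \<le> (1 / 2) ^ n" by (auto simp: eventually_sequentially)
    have "summable (\<lambda>n. f (r (Suc n)) x - f (r n) x)"
      by (rule summable_comparison_test'[of "\<lambda>n. (1/2::real) ^ n" n0]) (auto simp: summable_geometric n0)
    then have "convergent (\<lambda>n. \<Sum>k<n. f (r (Suc k)) x - f (r k) x)" by (simp add: summable_iff_convergent)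
    then have "convergent (\<lambda>n. (f (r n) x - f (r 0) x) + f (r 0) x)" by (subst (asm) sum_lessThan_telescope) (intro convergent_add convergent_const)
    then show ?case by simp
  qed
  define g where "g x = lim (\<lambda>n. f (r n) x)" for x
  have gm: "g \<in> borel_measurable M" unfolding g_def[abs_def] using m by (intro borel_measurable_lim_metric)
  have lim: "AE x in M. (\<lambda>n. f (r n) x) \<longlonglongrightarrow> g x" using conv by eventually_elim (simp add: g_def convergent_LIMSEQ_iff)
  \<comment> \<open>Fatou along the subsequence transfers a Cauchy bound to the limit. It yields
    first the integrability of \<open>g\<close> and then the convergence of the full
    sequence.\<close>
  have fat: "(\<integral>\<^sup>+x. ennreal (norm (f n x - g x) ^ p) \<partial>M) \<le> ennreal e"
    if e: "\<And>k. k \<ge> n0 \<Longrightarrow> (LINT x|M. norm (f n x - f k x) ^ p) \<le> e" for n n0 e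
  proof -
    have "(\<integral>\<^sup>+x. ennreal (norm (f n x - g x) ^ p) \<partial>M) = (\<integral>\<^sup>+x. liminf (\<lambda>k. ennreal (norm (f n x - f (r k) x) ^ p)) \<partial>M)"
    proof (rule nn_integral_cong_AE)
      show "AE x in M. ennreal (norm (f n x - g x) ^ p) = liminf (\<lambda>k. ennreal (norm (f n x - f (r k) x) ^ p))" using lim
      proof eventually_elim
        case (elim x)
        then have "(\<lambda>k. ennreal (norm (f n x - f (r k) x) ^ p)) \<longlonglongrightarrow> ennreal (norm (f n x - g x) ^ p)" by (intro tendsto_intros)
        from lim_imp_Liminf[OF trivial_limit_sequentially this] show ?case by (simp only:)
      qed
    qed
    also have "\<dots> \<le> liminf (\<lambda>k. \<integral>\<^sup>+x. ennreal (norm (f n x - f (r k) x) ^ p) \<partial>M)" using m by (intro nn_integral_liminf) measurable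
    also have "\<dots> \<le> liminf (\<lambda>k. ennreal e)"
    proof (rule Liminf_mono)
      have rk: "r k \<ge> n0" if "k \<ge> n0" for k using seq_suble[OF r(1), of k] that by simp
      show "\<forall>\<^sub>F k in sequentially. (\<integral>\<^sup>+x. ennreal (norm (f n x - f (r k) x) ^ p) \<partial>M) \<le> ennreal e" using eventually_ge_at_top[of n0]
        by eventually_elim (auto intro!: ennreal_leI e dest: rk simp: nn_integral_eq_integral[OF di[OF m i]])
    qed
    also have "\<dots> = ennreal e" by (simp add: Liminf_const)
    finally show ?thesis .
  qed
  obtain n1 where n1: "\<And>m n. m \<ge> n1 \<Longrightarrow> n \<ge> n1 \<Longrightarrow> (LINT x|M. norm (f m x - f n x) ^ p) < 1" using cauchy[of 1] by auto
  have "(\<integral>\<^sup>+x. ennreal (norm (f n1 x - g x) ^ p) \<partial>M) \<le> ennreal 1" by (rule fat[of n1]) (use n1[of n1] in force)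
  then have i1: "integrable M (\<lambda>x. norm (f n1 x - g x) ^ p)"
    using m gm by (intro integrableI_bounded) (auto intro: le_less_trans simp: ennreal_one_less_top)
  have gi: "integrable M (\<lambda>x. norm (g x) ^ p)"
  proof (rule Bochner_Integration.integrable_bound)
    show "integrable M (\<lambda>x. 2 ^ p * (norm (f n1 x) ^ p + norm (f n1 x - g x) ^ p))" using i i1 by simp
    show "(\<lambda>x. norm (g x) ^ p) \<in> borel_measurable M" using gm by measurable
    show "AE x in M. norm (norm (g x) ^ p) \<le> norm (2 ^ p * (norm (f n1 x) ^ p + norm (f n1 x - g x) ^ p))"
    proof (rule AE_I2)
      fix x
      show "norm (norm (g x) ^ p) \<le> norm (2 ^ p * (norm (f n1 x) ^ p + norm (f n1 x - g x) ^ p))"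
        using norm_diff_power_le[of "f n1 x" "f n1 x - g x" p] by simp
    qed
  qed
  have "(\<lambda>n. LINT x|M. norm (f n x - g x) ^ p) \<longlonglongrightarrow> 0"
  proof (rule LIMSEQ_I)
    fix e :: real assume "e > 0"
    then obtain n2 where n2: "\<And>m n. m \<ge> n2 \<Longrightarrow> n \<ge> n2 \<Longrightarrow> (LINT x|M. norm (f m x - f n x) ^ p) < e / 2" using cauchy[of "e / 2"] by auto
    have "(LINT x|M. norm (f n x - g x) ^ p) \<le> e / 2" if "n \<ge> n2" for n
    proof -
      have "ennreal (LINT x|M. norm (f n x - g x) ^ p) \<le> ennreal (e / 2)"
        using fat[of n2 n "e / 2"] n2[OF that] by (subst nn_integral_eq_integral[symmetric, OF di[OF gm gi]]) (auto intro: less_imp_le)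
      then show ?thesis using \<open>e > 0\<close> by (simp add: ennreal_le_iff)
    qed
    then show "\<exists>n0. \<forall>n\<ge>n0. norm ((LINT x|M. norm (f n x - g x) ^ p) - 0) < e" using \<open>e > 0\<close> by (intro exI[of _ n2]) fastforce
  qed
  from that[OF gm gi this r(1) lim] show ?thesis .
qed

section \<open>Translation estimate\<close>

lemma nn_integral_lborel_translation:
  fixes f :: "'a::euclidean_space \<Rightarrow> ennreal"
  assumes "f \<in> borel_measurable borel"
  shows "(\<integral>\<^sup>+x. f (c + x) \<partial>lborel) = (\<integral>\<^sup>+x. f x \<partial>lborel)"
proof -
  have "(\<integral>\<^sup>+x. f x \<partial>lborel) = (\<integral>\<^sup>+x. f x \<partial>distr lborel borel ((+) c))" by (simp add: lborel_distr_plus)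
  also have "\<dots> = (\<integral>\<^sup>+x. f (c + x) \<partial>lborel)" using assms by (intro nn_integral_distr) auto
  finally show ?thesis by simp
qed

text \<open>Jensen's inequality, in the form that a variance is nonnegative.\<close>

lemma integral_sq_le_unit_interval:
  fixes h :: "real \<Rightarrow> real"
  assumes "continuous_on {0..1} h"
  shows "(integral {0..1} h)\<^sup>2 \<le> integral {0..1} (\<lambda>s. (h s)\<^sup>2)"
proof -
  define c where "c = integral {0..1} h"
  have i: "h integrable_on {0..1}" "(\<lambda>s. (h s)\<^sup>2) integrable_on {0..1}" using assms by (auto intro!: integrable_continuous_interval continuous_intros)
  have "0 \<le> integral {0..1} (\<lambda>s. (h s - c)\<^sup>2)" by (rule integral_nonneg) (use assms in \<open>auto intro!: integrable_continuous_interval continuous_intros\<close>)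
  also have "(\<lambda>s. (h s - c)\<^sup>2) = (\<lambda>s. ((h s)\<^sup>2 - 2 * c * h s) + c\<^sup>2)" by (auto simp: power2_diff)
  also have "integral {0..1} \<dots> = integral {0..1} (\<lambda>s. (h s)\<^sup>2) - 2 * c * integral {0..1} h + c\<^sup>2"
  proof -
    have "((\<lambda>s. ((h s)\<^sup>2 - 2 * c * h s) + c\<^sup>2) has_integral
      (integral {0..1} (\<lambda>s. (h s)\<^sup>2) - 2 * c * integral {0..1} h + (1 - 0) *\<^sub>R c\<^sup>2)) {0..1}"
      by (intro has_integral_add has_integral_diff has_integral_mult_right integrable_integral i
          ) (use has_integral_const_real[of "c\<^sup>2" 0 1] in simp)
    then show ?thesis by (simp add: integral_unique)
  qed
  also have "\<dots> = integral {0..1} (\<lambda>s. (h s)\<^sup>2) - c\<^sup>2" by (simp add: c_def power2_eq_square)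
  finally show ?thesis by (simp add: c_def)
qed

text \<open>Fundamental theorem along the segment, Jensen in the parameter, Tonelli and translation
  invariance. The right side keeps the inner product with \<open>y\<close> rather than a product of
  norms: averaged over directions it gives the Dirichlet integral without loss.\<close>

lemma translation_estimate:
  fixes \<phi> :: "'a::euclidean_space \<Rightarrow> real"
  assumes "\<phi> \<in> test_functions \<Omega>"
  shows "(\<integral>\<^sup>+x. ennreal ((\<phi> (y + x) - \<phi> x)\<^sup>2) \<partial>lborel) \<le> (\<integral>\<^sup>+x. ennreal ((grad \<phi> x \<bullet> y)\<^sup>2) \<partial>lborel)"
proof -
  have sm: "smooth_on UNIV \<phi>" using test_functionE[OF assms] by metis
  have cont: "continuous_on UNIV \<phi>" "continuous_on UNIV (grad \<phi>)" using test_function_continuous[OF assms] by auto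
  have [measurable]: "\<phi> \<in> borel_measurable borel" "grad \<phi> \<in> borel_measurable borel" using cont by (auto intro: borel_measurable_continuous_onI)
  have pw: "ennreal ((\<phi> (y + x) - \<phi> x)\<^sup>2) \<le> (\<integral>\<^sup>+s. ennreal ((grad \<phi> (s *\<^sub>R y + x) \<bullet> y)\<^sup>2) * indicator {0..1} s \<partial>lborel)" for x
  proof -
    have c: "continuous_on {0..1} (\<lambda>s. grad \<phi> (s *\<^sub>R y + x) \<bullet> y)" by (intro continuous_intros continuous_on_compose2[OF cont(2)]) auto
    have "((\<lambda>s. grad \<phi> (s *\<^sub>R y + x) \<bullet> y) has_integral (\<phi> (1 *\<^sub>R y + x) - \<phi> (0 *\<^sub>R y + x))) {0..1}"
    proof (rule fundamental_theorem_of_calculus)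
      fix s :: real
      have "((\<lambda>s. \<phi> (s *\<^sub>R y + x)) has_derivative (\<lambda>t. grad \<phi> (s *\<^sub>R y + x) \<bullet> (t *\<^sub>R y))) (at s)"
        by (rule has_derivative_compose[of "\<lambda>s. s *\<^sub>R y + x" "\<lambda>t. t *\<^sub>R y"])
          (auto intro!: derivative_eq_intros smooth_on_has_derivative_grad[OF sm])
      then show "((\<lambda>s. \<phi> (s *\<^sub>R y + x)) has_vector_derivative grad \<phi> (s *\<^sub>R y + x) \<bullet> y) (at s within {0..1})"
        by (simp add: has_vector_derivative_def has_derivative_at_withinI)
    qed simp
    then have "\<phi> (y + x) - \<phi> x = integral {0..1} (\<lambda>s. grad \<phi> (s *\<^sub>R y + x) \<bullet> y)" by (simp add: integral_unique)
    then have "(\<phi> (y + x) - \<phi> x)\<^sup>2 \<le> integral {0..1} (\<lambda>s. (grad \<phi> (s *\<^sub>R y + x) \<bullet> y)\<^sup>2)" using integral_sq_le_unit_interval[OF c] by simp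
    moreover have "((\<lambda>s. (grad \<phi> (s *\<^sub>R y + x) \<bullet> y)\<^sup>2) has_integral integral {0..1} (\<lambda>s. (grad \<phi> (s *\<^sub>R y + x) \<bullet> y)\<^sup>2)) {0..1}"
      by (intro integrable_integral integrable_continuous_interval continuous_on_power c)
    then have "(\<integral>\<^sup>+s. ennreal ((grad \<phi> (s *\<^sub>R y + x) \<bullet> y)\<^sup>2) * indicator {0..1} s \<partial>lborel) = ennreal (integral {0..1} (\<lambda>s. (grad \<phi> (s *\<^sub>R y + x) \<bullet> y)\<^sup>2))"
      by (intro nn_integral_has_integral_lebesgue') auto
    ultimately show ?thesis by (simp add: ennreal_leI)
  qed
  have "(\<integral>\<^sup>+x. ennreal ((\<phi> (y + x) - \<phi> x)\<^sup>2) \<partial>lborel)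
      \<le> (\<integral>\<^sup>+x. (\<integral>\<^sup>+s. ennreal ((grad \<phi> (s *\<^sub>R y + x) \<bullet> y)\<^sup>2) * indicator {0..1} s \<partial>lborel) \<partial>lborel)" by (intro nn_integral_mono pw)
  also have "\<dots> = (\<integral>\<^sup>+s. (\<integral>\<^sup>+x. ennreal ((grad \<phi> (s *\<^sub>R y + x) \<bullet> y)\<^sup>2) * indicator {0..1} s \<partial>lborel) \<partial>lborel)" by (rule lborel_pair.Fubini') measurable
  also have "\<dots> = (\<integral>\<^sup>+s. (\<integral>\<^sup>+x. ennreal ((grad \<phi> x \<bullet> y)\<^sup>2) \<partial>lborel) * indicator {0..1::real} s \<partial>lborel)"
  proof (rule nn_integral_cong)
    fix s :: real
    have "(\<integral>\<^sup>+x. ennreal ((grad \<phi> (s *\<^sub>R y + x) \<bullet> y)\<^sup>2) * indicator {0..1} s \<partial>lborel) = (\<integral>\<^sup>+x. ennreal ((grad \<phi> (s *\<^sub>R y + x) \<bullet> y)\<^sup>2) \<partial>lborel) * indicator {0..1} s"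
      by (rule nn_integral_multc) measurable
    also have "(\<integral>\<^sup>+x. ennreal ((grad \<phi> (s *\<^sub>R y + x) \<bullet> y)\<^sup>2) \<partial>lborel) = (\<integral>\<^sup>+x. ennreal ((grad \<phi> x \<bullet> y)\<^sup>2) \<partial>lborel)"
      by (rule nn_integral_lborel_translation[of "\<lambda>x. ennreal ((grad \<phi> x \<bullet> y)\<^sup>2)"]) measurable
    finally show "(\<integral>\<^sup>+x. ennreal ((grad \<phi> (s *\<^sub>R y + x) \<bullet> y)\<^sup>2) * indicator {0..1} s \<partial>lborel) = (\<integral>\<^sup>+x. ennreal ((grad \<phi> x \<bullet> y)\<^sup>2) \<partial>lborel) * indicator {0..1} s" .
  qed
  also have "\<dots> = (\<integral>\<^sup>+x. ennreal ((grad \<phi> x \<bullet> y)\<^sup>2) \<partial>lborel)" by (simp add: nn_integral_cmult_indicator)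
  finally show ?thesis .
qed

section \<open>Sobolev functions vanishing on the boundary\<close>

lemma L2_continuous_compact_support:
  fixes f :: "'a::euclidean_space \<Rightarrow> 'b::euclidean_space"
  assumes "continuous_on UNIV f" "compact K" "\<And>x. x \<notin> K \<Longrightarrow> f x = 0"
  shows "L2 f"
  unfolding L2_def
proof
  show "f \<in> borel_measurable lebesgue" using assms(1) by (intro measurable_completion) (auto intro: borel_measurable_continuous_onI)
  show "integrable lebesgue (\<lambda>x. (norm (f x))\<^sup>2)" by (rule integrable_continuous_compact_support(2)[OF _ assms(2)])
      (auto intro!: continuous_intros assms(1) simp: assms(3))
qed

lemma L2_test_function:
  assumes "\<phi> \<in> test_functions \<Omega>"
  shows "L2 \<phi>" "L2 (grad \<phi>)" "L2 (\<lambda>x. grad \<phi> x \<bullet> b)" "L2 (\<lambda>x. \<phi> x *\<^sub>R b)"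
proof -
  obtain K where K: "compact K" "\<And>x. x \<notin> K \<Longrightarrow> \<phi> x = 0" "\<And>x. x \<notin> K \<Longrightarrow> grad \<phi> x = 0" using test_function_off[OF assms] by metis
  show "L2 \<phi>" "L2 (grad \<phi>)" "L2 (\<lambda>x. grad \<phi> x \<bullet> b)" "L2 (\<lambda>x. \<phi> x *\<^sub>R b)" by (rule L2_continuous_compact_support[OF _ K(1)];
        auto intro!: continuous_intros test_function_continuous[OF assms] simp: K)+
qed

lemma test_function_indicator:
  assumes "\<phi> \<in> test_functions \<Omega>"
  shows "indicator \<Omega> x *\<^sub>R \<phi> x = \<phi> x" "indicator \<Omega> x *\<^sub>R grad \<phi> x = grad \<phi> x"
proof -
  obtain K where K: "K \<subseteq> \<Omega>" "\<And>x. x \<notin> K \<Longrightarrow> \<phi> x = 0" "\<And>x. x \<notin> K \<Longrightarrow> grad \<phi> x = 0" using test_function_off[OF assms] by metis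
  show "indicator \<Omega> x *\<^sub>R \<phi> x = \<phi> x" "indicator \<Omega> x *\<^sub>R grad \<phi> x = grad \<phi> x" using K(1) K(2,3)[of x] by (auto simp: indicator_def)
qed

lemma L2_locally_integrable:
  fixes f :: "'a::euclidean_space \<Rightarrow> 'b::euclidean_space"
  assumes "L2 f" "compact K"
  shows "set_integrable lebesgue K f"
  unfolding set_integrable_def
proof (rule Bochner_Integration.integrable_bound)
  have "emeasure lebesgue K < \<infinity>" "K \<in> sets lebesgue" using emeasure_compact_finite[OF assms(2)] assms(2) by (auto simp: borel_compact)
  then show "integrable lebesgue (\<lambda>x. indicator K x + (norm (f x))\<^sup>2)" using assms(1) by (auto intro!: integrable_real_indicator L2_integrable)
  show "(\<lambda>x. indicat_real K x *\<^sub>R f x) \<in> borel_measurable lebesgue"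
    using \<open>K \<in> sets lebesgue\<close> by (intro borel_measurable_scaleR L2_measurable[OF assms(1)] borel_measurable_indicator)
  have "y \<le> 1 + y\<^sup>2" for y :: real
  proof -
    have "0 \<le> (2 * y - 1)\<^sup>2" by simp
    also have "\<dots> = 4 * y\<^sup>2 - 4 * y + 1" by (simp add: power2_eq_square algebra_simps)
    finally show ?thesis by linarith
  qed
  then show "AE x in lebesgue. norm (indicat_real K x *\<^sub>R f x) \<le> norm (indicator K x + (norm (f x))\<^sup>2)" by (intro AE_I2) (auto simp: indicator_def)
qed

lemma Lp_2_iff: "u \<in> Lp 2 \<Omega> \<longleftrightarrow> L2 (zero_ext \<Omega> u)"
proof -
  have "(\<lambda>x. indicator \<Omega> x *\<^sub>R (norm (u x))\<^sup>2) = (\<lambda>x. (norm (indicator \<Omega> x *\<^sub>R u x))\<^sup>2)" by (auto simp: indicator_def fun_eq_iff)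
  then show ?thesis by (simp add: Lp_def L2_def set_borel_measurable_def set_integrable_def)
qed

lemma L2_restrict:
  assumes "L2 f" "K \<in> sets lebesgue"
  shows "L2 (zero_ext K f)"
proof -
  have "(\<lambda>x. (norm (indicator K x *\<^sub>R f x))\<^sup>2) = (\<lambda>x. indicator K x *\<^sub>R (norm (f x))\<^sup>2)" by (auto simp: indicator_def fun_eq_iff)
  then show ?thesis using integrable_mult_indicator[OF assms(2) L2_integrable[OF assms(1)]] assms(2) L2_measurable[OF assms(1)]
    unfolding L2_def by (auto intro!: borel_measurable_scaleR borel_measurable_indicator)
qed

text \<open>Functions in \<open>D12\<close> may fail to be square integrable, so the functions
  converge only on compact sets, whereas the gradients converge globally. Both sides of the weak
  identity pass to the limit by Cauchy-Schwarz, one coordinate at a time.\<close>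

lemma is_weak_grad_limit:
  assumes \<phi>: "\<And>n. \<phi> n \<in> test_functions \<Omega>"
    and u: "\<And>K. compact K \<Longrightarrow> K \<subseteq> \<Omega> \<Longrightarrow> L2 (zero_ext K u)" and g: "L2 (zero_ext \<Omega> g)"
    and limu: "\<And>K. compact K \<Longrightarrow> K \<subseteq> \<Omega> \<Longrightarrow> (\<lambda>n. LINT x|lebesgue. (norm (indicator K x *\<^sub>R \<phi> n x - indicator K x *\<^sub>R u x))\<^sup>2) \<longlonglongrightarrow> 0"
    and limg: "(\<lambda>n. LINT x|lebesgue. (norm (grad (\<phi> n) x - indicator \<Omega> x *\<^sub>R g x))\<^sup>2) \<longlonglongrightarrow> 0"
  shows "is_weak_grad \<Omega> u g"
proof -
  have loc: "set_integrable lebesgue K f" if "compact K" "K \<subseteq> S" "L2 (\<lambda>x. indicator S x *\<^sub>R f x)"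
    for K S and f :: "'a \<Rightarrow> 'b::euclidean_space"
  proof -
    have "set_integrable lebesgue K (\<lambda>x. indicator S x *\<^sub>R f x)" using L2_locally_integrable[OF that(3,1)] .
    moreover have "(\<lambda>x. indicator K x *\<^sub>R indicator S x *\<^sub>R f x) = (zero_ext K f)" using that(2) by (auto simp: indicator_def fun_eq_iff)
    ultimately show ?thesis unfolding set_integrable_def by simp
  qed
  have loc': "set_integrable lebesgue K u \<and> set_integrable lebesgue K g" if "compact K \<and> K \<subseteq> \<Omega>" for K
    using loc[of K K u] loc[of K \<Omega> g] u[of K] g that by auto
  have "(LINT x|lebesgue. u x *\<^sub>R grad \<psi> x) = - (LINT x|lebesgue. \<psi> x *\<^sub>R g x)" if \<psi>: "\<psi> \<in> test_functions \<Omega>" for \<psi>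
  proof (rule euclidean_eqI)
    fix b :: 'a assume b: "b \<in> Basis"
    obtain K where K: "compact K" "K \<subseteq> \<Omega>" "\<And>x. x \<notin> K \<Longrightarrow> \<psi> x = 0" "\<And>x. x \<notin> K \<Longrightarrow> grad \<psi> x = 0" using test_function_off[OF \<psi>] by metis
    have int: "integrable lebesgue (\<lambda>x. u x *\<^sub>R grad \<psi> x)" "integrable lebesgue (\<lambda>x. \<psi> x *\<^sub>R g x)" using loc'[of K] K
      by (intro integrable_scaleR_compact_support[of K] integrable_scaleR_compact_support'[of K] test_function_continuous[OF \<psi>]; simp)+
    have K\<psi>: "(indicator K x *\<^sub>R f) \<bullet> (grad \<psi> x \<bullet> b) = f \<bullet> (grad \<psi> x \<bullet> b)" for x f using K(4)[of x] by (cases "x \<in> K") auto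
    have "K \<in> sets lebesgue" using K(1) by (simp add: borel_compact)
    note L2K = L2_restrict[OF L2_test_function(1)[OF \<phi>] this]
    have "(\<lambda>n. LINT x|lebesgue. \<phi> n x \<bullet> (grad \<psi> x \<bullet> b)) \<longlonglongrightarrow> (LINT x|lebesgue. u x \<bullet> (grad \<psi> x \<bullet> b))"
      using L2_tendsto_inner[OF L2K u[OF K(1,2)] L2_test_function(3)[OF \<psi>, of b] limu[OF K(1,2)]] by (simp only: K\<psi>)
    moreover have "(\<lambda>n. LINT x|lebesgue. grad (\<phi> n) x \<bullet> (\<psi> x *\<^sub>R b)) \<longlonglongrightarrow> (LINT x|lebesgue. (indicator \<Omega> x *\<^sub>R g x) \<bullet> (\<psi> x *\<^sub>R b))"
      by (intro L2_tendsto_inner L2_test_function[OF \<phi>] g L2_test_function[OF \<psi>] limg)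
    moreover have "(LINT x|lebesgue. \<phi> n x \<bullet> (grad \<psi> x \<bullet> b)) = - (LINT x|lebesgue. grad (\<phi> n) x \<bullet> (\<psi> x *\<^sub>R b))" for n
    proof -
      have w: "is_weak_grad \<Omega> (\<phi> n) (grad (\<phi> n))" using \<phi>[of n] by (auto intro!: smooth_is_weak_grad elim: test_functionE)
      have "(LINT x|lebesgue. \<phi> n x *\<^sub>R grad \<psi> x) = - (LINT x|lebesgue. \<psi> x *\<^sub>R grad (\<phi> n) x)" using w \<psi> by (simp add: is_weak_grad_iff)
      then have "(LINT x|lebesgue. \<phi> n x *\<^sub>R grad \<psi> x) \<bullet> b = - ((LINT x|lebesgue. \<psi> x *\<^sub>R grad (\<phi> n) x) \<bullet> b)" by simp
      moreover have "(LINT x|lebesgue. (\<phi> n x *\<^sub>R grad \<psi> x) \<bullet> b) = (LINT x|lebesgue. \<phi> n x *\<^sub>R grad \<psi> x) \<bullet> b"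
        "(LINT x|lebesgue. (\<psi> x *\<^sub>R grad (\<phi> n) x) \<bullet> b) = (LINT x|lebesgue. \<psi> x *\<^sub>R grad (\<phi> n) x) \<bullet> b"
        by (rule integral_inner_left, rule weak_grad_test_integrable[OF w \<psi>])+
      ultimately show ?thesis by (simp only: inner_scaleR_left inner_scaleR_right inner_real_def)
    qed
    ultimately have "(\<lambda>n. - (LINT x|lebesgue. grad (\<phi> n) x \<bullet> (\<psi> x *\<^sub>R b))) \<longlonglongrightarrow> (LINT x|lebesgue. u x \<bullet> (grad \<psi> x \<bullet> b))"
       "(\<lambda>n. - (LINT x|lebesgue. grad (\<phi> n) x \<bullet> (\<psi> x *\<^sub>R b))) \<longlonglongrightarrow> - (LINT x|lebesgue. (indicator \<Omega> x *\<^sub>R g x) \<bullet> (\<psi> x *\<^sub>R b))"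
      by (simp_all add: tendsto_minus)
    from LIMSEQ_unique[OF this]
    have "(LINT x|lebesgue. u x \<bullet> (grad \<psi> x \<bullet> b)) = - (LINT x|lebesgue. (indicator \<Omega> x *\<^sub>R g x) \<bullet> (\<psi> x *\<^sub>R b))" .
    moreover have "u x \<bullet> (grad \<psi> x \<bullet> b) = (u x *\<^sub>R grad \<psi> x) \<bullet> b"
      "(indicator \<Omega> x *\<^sub>R g x) \<bullet> (\<psi> x *\<^sub>R b) = (\<psi> x *\<^sub>R g x) \<bullet> b" for x by (cases "x \<in> K"; use K(2) K(3,4)[of x] in \<open>auto simp: indicator_def\<close>)+
    moreover have "(LINT x|lebesgue. (u x *\<^sub>R grad \<psi> x) \<bullet> b) = (LINT x|lebesgue. u x *\<^sub>R grad \<psi> x) \<bullet> b"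
      "(LINT x|lebesgue. (\<psi> x *\<^sub>R g x) \<bullet> b) = (LINT x|lebesgue. \<psi> x *\<^sub>R g x) \<bullet> b" by (rule integral_inner_left, rule int)+
    ultimately show "(LINT x|lebesgue. u x *\<^sub>R grad \<psi> x) \<bullet> b = (- (LINT x|lebesgue. \<psi> x *\<^sub>R g x)) \<bullet> b" by (simp only: inner_minus_left)
  qed
  with loc' show ?thesis by (simp add: is_weak_grad_iff)
qed

text \<open>The weak gradient of a difference is almost everywhere the difference of the gradients,
  so the single integral in \<open>H1_0\<close> splits into two whole-space distances.\<close>

lemma H1_0_approx_integral:
  assumes "open \<Omega>" "\<phi> \<in> test_functions \<Omega>" "is_weak_grad \<Omega> u g"
    and u: "L2 (zero_ext \<Omega> u)" "L2 (zero_ext \<Omega> g)"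
  shows "(LINT x:\<Omega>|lebesgue. (norm (weak_grad \<Omega> (\<lambda>y. \<phi> y - u y) x))\<^sup>2 + (\<phi> x - u x)\<^sup>2) =
    (LINT x|lebesgue. (norm (grad \<phi> x - indicator \<Omega> x *\<^sub>R g x))\<^sup>2) + (LINT x|lebesgue. (norm (\<phi> x - indicator \<Omega> x *\<^sub>R u x))\<^sup>2)"
proof -
  have w: "is_weak_grad \<Omega> \<phi> (grad \<phi>)" using assms(2) by (auto intro!: smooth_is_weak_grad elim: test_functionE)
  have "AE x in lebesgue. x \<in> \<Omega> \<longrightarrow> weak_grad \<Omega> (\<lambda>y. \<phi> y - u y) x = grad \<phi> x - g x" using weak_grad_eqI(2)[OF assms(1) is_weak_grad_diff[OF w assms(3)]] .
  then have "AE x in lebesgue. indicator \<Omega> x *\<^sub>R ((norm (weak_grad \<Omega> (\<lambda>y. \<phi> y - u y) x))\<^sup>2 + (\<phi> x - u x)\<^sup>2) =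
     (norm (grad \<phi> x - indicator \<Omega> x *\<^sub>R g x))\<^sup>2 + (norm (\<phi> x - indicator \<Omega> x *\<^sub>R u x))\<^sup>2"
  proof eventually_elim
    case (elim x)
    then show ?case using test_function_indicator[OF assms(2), of x] by (cases "x \<in> \<Omega>") auto
  qed
  then have "(LINT x:\<Omega>|lebesgue. (norm (weak_grad \<Omega> (\<lambda>y. \<phi> y - u y) x))\<^sup>2 + (\<phi> x - u x)\<^sup>2) =
    (LINT x|lebesgue. (norm (grad \<phi> x - indicator \<Omega> x *\<^sub>R g x))\<^sup>2 + (norm (\<phi> x - indicator \<Omega> x *\<^sub>R u x))\<^sup>2)"
    unfolding set_lebesgue_integral_def by (rule integral_lebesgue_cong_AE)
  also have "\<dots> = (LINT x|lebesgue. (norm (grad \<phi> x - indicator \<Omega> x *\<^sub>R g x))\<^sup>2) + (LINT x|lebesgue. (norm (\<phi> x - indicator \<Omega> x *\<^sub>R u x))\<^sup>2)"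
    by (intro Bochner_Integration.integral_add L2_integrable L2_diff L2_test_function[OF assms(2)] u)
  finally show ?thesis .
qed

text \<open>The limit of the gradients is a weak gradient of the limit by
  \<open>is_weak_grad_limit\<close>; membership then only recombines the two convergences.\<close>

lemma H1_0_I:
  assumes "open \<Omega>" "\<And>n. \<phi> n \<in> test_functions \<Omega>"
    and u: "L2 (zero_ext \<Omega> u)" "L2 (zero_ext \<Omega> g)"
    and lim: "(\<lambda>n. LINT x|lebesgue. (norm (\<phi> n x - indicator \<Omega> x *\<^sub>R u x))\<^sup>2) \<longlonglongrightarrow> 0"
      "(\<lambda>n. LINT x|lebesgue. (norm (grad (\<phi> n) x - indicator \<Omega> x *\<^sub>R g x))\<^sup>2) \<longlonglongrightarrow> 0"
  shows "u \<in> H1_0 \<Omega>" "AE x in lebesgue. indicator \<Omega> x *\<^sub>R weak_grad \<Omega> u x = indicator \<Omega> x *\<^sub>R g x"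
proof -
  have w: "is_weak_grad \<Omega> u g"
  proof (rule is_weak_grad_limit[OF assms(2) _ u(2) _ lim(2)])
    fix K assume K: "compact K" "K \<subseteq> \<Omega>"
    then have Ks: "K \<in> sets lebesgue" by (simp add: borel_compact)
    have eq: "indicator K x *\<^sub>R (indicator \<Omega> x *\<^sub>R f) = indicator K x *\<^sub>R f" for x and f :: real using K(2) by (auto simp: indicator_def)
    show "L2 (zero_ext K u)" using L2_restrict[OF u(1) Ks] by (simp only: eq)
    have d: "L2 (\<lambda>x. \<phi> n x - indicator \<Omega> x *\<^sub>R u x)" for n by (intro L2_diff L2_test_function[OF assms(2)] u)
    show "(\<lambda>n. LINT x|lebesgue. (norm (indicator K x *\<^sub>R \<phi> n x - indicator K x *\<^sub>R u x))\<^sup>2) \<longlonglongrightarrow> 0"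
    proof (rule tendsto_sandwich[OF _ _ tendsto_const lim(1)]; intro always_eventually allI)
      fix n
      have le: "(norm (indicator K x *\<^sub>R \<phi> n x - indicator K x *\<^sub>R u x))\<^sup>2 \<le> (norm (\<phi> n x - indicator \<Omega> x *\<^sub>R u x))\<^sup>2" for x
        using K(2) by (auto simp: indicator_def)
      have "integrable lebesgue (\<lambda>x. (norm (indicator K x *\<^sub>R (\<phi> n x - indicator \<Omega> x *\<^sub>R u x)))\<^sup>2)" by (rule L2_integrable[OF L2_restrict[OF d Ks]])
      then have "integrable lebesgue (\<lambda>x. (norm (indicator K x *\<^sub>R \<phi> n x - indicator K x *\<^sub>R u x))\<^sup>2)" by (simp only: scaleR_diff_right eq)
      then show "(LINT x|lebesgue. (norm (indicator K x *\<^sub>R \<phi> n x - indicator K x *\<^sub>R u x))\<^sup>2)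
          \<le> (LINT x|lebesgue. (norm (\<phi> n x - indicator \<Omega> x *\<^sub>R u x))\<^sup>2)" by (rule integral_mono[OF _ L2_integrable[OF d]]) (rule le)
    qed simp
  qed
  have "u \<in> H1 \<Omega>" unfolding H1_def using u w by (auto simp: Lp_2_iff)
  moreover have "(\<lambda>n. LINT x:\<Omega>|lebesgue. (norm (weak_grad \<Omega> (\<lambda>y. \<phi> n y - u y) x))\<^sup>2 + (\<phi> n x - u x)\<^sup>2) \<longlonglongrightarrow> 0"
    unfolding H1_0_approx_integral[OF assms(1,2) w u] using tendsto_add[OF lim(2,1)] by simp
  ultimately show "u \<in> H1_0 \<Omega>" unfolding H1_0_def using assms(2) by (auto intro!: exI[of _ \<phi>])
  show "AE x in lebesgue. indicator \<Omega> x *\<^sub>R weak_grad \<Omega> u x = indicator \<Omega> x *\<^sub>R g x"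
    using weak_grad_eqI(2)[OF assms(1) w] by eventually_elim (auto simp: indicator_def)
qed

lemma H1_0_E:
  assumes "open \<Omega>" "u \<in> H1_0 \<Omega>"
  obtains \<phi> where "\<And>n. \<phi> n \<in> test_functions \<Omega>"
    "L2 (zero_ext \<Omega> u)" "L2 (zero_ext \<Omega> (weak_grad \<Omega> u))"
    "(\<lambda>n. LINT x|lebesgue. (norm (\<phi> n x - indicator \<Omega> x *\<^sub>R u x))\<^sup>2) \<longlonglongrightarrow> 0"
    "(\<lambda>n. LINT x|lebesgue. (norm (grad (\<phi> n) x - indicator \<Omega> x *\<^sub>R weak_grad \<Omega> u x))\<^sup>2) \<longlonglongrightarrow> 0"
    "is_weak_grad \<Omega> u (weak_grad \<Omega> u)"
proof -
  obtain g where g: "u \<in> Lp 2 \<Omega>" "g \<in> Lp 2 \<Omega>" "is_weak_grad \<Omega> u g" using assms(2) by (auto simp: H1_0_def H1_def)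
  obtain \<phi> where \<phi>: "\<And>n. \<phi> n \<in> test_functions \<Omega>"
    "(\<lambda>n. LINT x:\<Omega>|lebesgue. (norm (weak_grad \<Omega> (\<lambda>y. \<phi> n y - u y) x))\<^sup>2 + (\<phi> n x - u x)\<^sup>2) \<longlonglongrightarrow> 0" using assms(2) by (auto simp: H1_0_def range_subsetD)
  have u: "L2 (zero_ext \<Omega> u)" using g(1) by (simp only: Lp_2_iff)
  have "AE x in lebesgue. indicator \<Omega> x *\<^sub>R g x = indicator \<Omega> x *\<^sub>R weak_grad \<Omega> u x"
    using weak_grad_eqI(2)[OF assms(1) g(3)] by eventually_elim (auto simp: indicator_def)
  then have gu: "L2 (zero_ext \<Omega> (weak_grad \<Omega> u))" using g(2) unfolding Lp_2_iff by (rule L2_cong_AE[rotated])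
  have w: "is_weak_grad \<Omega> u (weak_grad \<Omega> u)" using weak_grad_eqI(1)[OF assms(1) g(3)] .
  have lim: "(\<lambda>n. (LINT x|lebesgue. (norm (grad (\<phi> n) x - indicator \<Omega> x *\<^sub>R weak_grad \<Omega> u x))\<^sup>2)
      + (LINT x|lebesgue. (norm (\<phi> n x - indicator \<Omega> x *\<^sub>R u x))\<^sup>2)) \<longlonglongrightarrow> 0" using \<phi>(2) unfolding H1_0_approx_integral[OF assms(1) \<phi>(1) w u gu] .
  have "(\<lambda>n. LINT x|lebesgue. (norm (\<phi> n x - indicator \<Omega> x *\<^sub>R u x))\<^sup>2) \<longlonglongrightarrow> 0"
    "(\<lambda>n. LINT x|lebesgue. (norm (grad (\<phi> n) x - indicator \<Omega> x *\<^sub>R weak_grad \<Omega> u x))\<^sup>2) \<longlonglongrightarrow> 0" by (rule tendsto_sandwich[OF _ _ tendsto_const lim]; simp)+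
  from that[OF \<phi>(1) u gu this w] show ?thesis .
qed

lemma test_function_H1_0:
  assumes "open \<Omega>" "\<phi> \<in> test_functions \<Omega>"
  shows "\<phi> \<in> H1_0 \<Omega>" "AE x in lebesgue. indicator \<Omega> x *\<^sub>R weak_grad \<Omega> \<phi> x = grad \<phi> x"
proof -
  have "(\<lambda>n::nat. LINT x|lebesgue. (norm (\<phi> x - indicator \<Omega> x *\<^sub>R \<phi> x))\<^sup>2) \<longlonglongrightarrow> 0"
    "(\<lambda>n::nat. LINT x|lebesgue. (norm (grad \<phi> x - indicator \<Omega> x *\<^sub>R grad \<phi> x))\<^sup>2) \<longlonglongrightarrow> 0"
  proof -
    have pw: "\<phi> x - indicator \<Omega> x *\<^sub>R \<phi> x = 0" "grad \<phi> x - indicator \<Omega> x *\<^sub>R grad \<phi> x = 0" for x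
      using test_function_indicator[OF assms(2), of x] by (auto simp del: real_scaleR_def)
    show "(\<lambda>n::nat. LINT x|lebesgue. (norm (\<phi> x - indicator \<Omega> x *\<^sub>R \<phi> x))\<^sup>2) \<longlonglongrightarrow> 0"
      "(\<lambda>n::nat. LINT x|lebesgue. (norm (grad \<phi> x - indicator \<Omega> x *\<^sub>R grad \<phi> x))\<^sup>2) \<longlonglongrightarrow> 0" unfolding pw by simp_all
  qed
  moreover have "L2 (zero_ext \<Omega> \<phi>)" "L2 (\<lambda>x. indicator \<Omega> x *\<^sub>R grad \<phi> x)"
    by (simp_all only: test_function_indicator[OF assms(2)] L2_test_function(1,2)[OF assms(2)])
  ultimately have *: "\<phi> \<in> H1_0 \<Omega>" "AE x in lebesgue. indicator \<Omega> x *\<^sub>R weak_grad \<Omega> \<phi> x = indicator \<Omega> x *\<^sub>R grad \<phi> x"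
    using H1_0_I[of \<Omega> "\<lambda>_. \<phi>" \<phi> "grad \<phi>"] assms by blast+
  show "\<phi> \<in> H1_0 \<Omega>" by (rule *(1))
  show "AE x in lebesgue. indicator \<Omega> x *\<^sub>R weak_grad \<Omega> \<phi> x = grad \<phi> x" using *(2) by (simp only: test_function_indicator[OF assms(2)])
qed

text \<open>Provides the variations \<open>u + t * v\<close> from which the Euler-Lagrange equation
  of the Rayleigh quotient is read off.\<close>

lemma H1_0_add_scale:
  assumes "open \<Omega>" "u \<in> H1_0 \<Omega>" "v \<in> H1_0 \<Omega>"
  shows "(\<lambda>x. u x + t * v x) \<in> H1_0 \<Omega>"
    "AE x in lebesgue. indicator \<Omega> x *\<^sub>R weak_grad \<Omega> (\<lambda>x. u x + t * v x) x
       = indicator \<Omega> x *\<^sub>R weak_grad \<Omega> u x + t *\<^sub>R (indicator \<Omega> x *\<^sub>R weak_grad \<Omega> v x)"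
proof -
  obtain \<phi> where \<phi>: "\<And>n. \<phi> n \<in> test_functions \<Omega>"
    "L2 (zero_ext \<Omega> u)" "L2 (zero_ext \<Omega> (weak_grad \<Omega> u))"
    "(\<lambda>n. LINT x|lebesgue. (norm (\<phi> n x - indicator \<Omega> x *\<^sub>R u x))\<^sup>2) \<longlonglongrightarrow> 0"
    "(\<lambda>n. LINT x|lebesgue. (norm (grad (\<phi> n) x - indicator \<Omega> x *\<^sub>R weak_grad \<Omega> u x))\<^sup>2) \<longlonglongrightarrow> 0" by (rule H1_0_E[OF assms(1,2)]) (rule that)
  obtain \<psi> where \<psi>: "\<And>n. \<psi> n \<in> test_functions \<Omega>"
    "L2 (zero_ext \<Omega> v)" "L2 (zero_ext \<Omega> (weak_grad \<Omega> v))"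
    "(\<lambda>n. LINT x|lebesgue. (norm (\<psi> n x - indicator \<Omega> x *\<^sub>R v x))\<^sup>2) \<longlonglongrightarrow> 0"
    "(\<lambda>n. LINT x|lebesgue. (norm (grad (\<psi> n) x - indicator \<Omega> x *\<^sub>R weak_grad \<Omega> v x))\<^sup>2) \<longlonglongrightarrow> 0" by (rule H1_0_E[OF assms(1,3)]) (rule that)
  have comb: "(\<lambda>n. LINT x|lebesgue. (norm ((f n x + t *\<^sub>R k n x) - (f' x + t *\<^sub>R k' x)))\<^sup>2) \<longlonglongrightarrow> 0"
    if "\<And>n. L2 (f n)" "\<And>n. L2 (k n)" "L2 f'" "L2 k'"
      "(\<lambda>n. LINT x|lebesgue. (norm (f n x - f' x))\<^sup>2) \<longlonglongrightarrow> 0" "(\<lambda>n. LINT x|lebesgue. (norm (k n x - k' x))\<^sup>2) \<longlonglongrightarrow> 0"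
    for f k :: "nat \<Rightarrow> 'a \<Rightarrow> 'b::euclidean_space" and f' k'
  proof (rule tendsto_sandwich[OF _ _ tendsto_const])
    show "\<forall>\<^sub>F n in sequentially. (LINT x|lebesgue. (norm ((f n x + t *\<^sub>R k n x) - (f' x + t *\<^sub>R k' x)))\<^sup>2)
        \<le> 2 * (LINT x|lebesgue. (norm (f n x - f' x))\<^sup>2) + 2 * t\<^sup>2 * (LINT x|lebesgue. (norm (k n x - k' x))\<^sup>2)"
    proof (intro always_eventually allI)
      fix n
      have "(LINT x|lebesgue. (norm ((f n x + t *\<^sub>R k n x) - (f' x + t *\<^sub>R k' x)))\<^sup>2)
        \<le> (LINT x|lebesgue. 2 * (norm (f n x - f' x))\<^sup>2 + 2 * t\<^sup>2 * (norm (k n x - k' x))\<^sup>2)"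
      proof (rule integral_mono)
        show "integrable lebesgue (\<lambda>x. (norm ((f n x + t *\<^sub>R k n x) - (f' x + t *\<^sub>R k' x)))\<^sup>2)" by (intro L2_integrable L2_diff L2_add L2_scale that)
        show "integrable lebesgue (\<lambda>x. 2 * (norm (f n x - f' x))\<^sup>2 + 2 * t\<^sup>2 * (norm (k n x - k' x))\<^sup>2)"
          by (intro Bochner_Integration.integrable_add integrable_mult_right L2_integrable L2_diff that)
        fix x
        have eq: "(f n x + t *\<^sub>R k n x) - (f' x + t *\<^sub>R k' x) = (f n x - f' x) + t *\<^sub>R (k n x - k' x)" by (simp add: algebra_simps)
        show "(norm ((f n x + t *\<^sub>R k n x) - (f' x + t *\<^sub>R k' x)))\<^sup>2 \<le> 2 * (norm (f n x - f' x))\<^sup>2 + 2 * t\<^sup>2 * (norm (k n x - k' x))\<^sup>2"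
          unfolding eq using norm_add_sq_le[of "f n x - f' x" "t *\<^sub>R (k n x - k' x)"] by (simp add: power_mult_distrib mult.assoc)
      qed
      also have "\<dots> = 2 * (LINT x|lebesgue. (norm (f n x - f' x))\<^sup>2) + 2 * t\<^sup>2 * (LINT x|lebesgue. (norm (k n x - k' x))\<^sup>2)"
        using L2_integrable[OF L2_diff[OF that(1)[of n] that(3)]] L2_integrable[OF L2_diff[OF that(2)[of n] that(4)]] by simp
      finally show "(LINT x|lebesgue. (norm ((f n x + t *\<^sub>R k n x) - (f' x + t *\<^sub>R k' x)))\<^sup>2)
        \<le> 2 * (LINT x|lebesgue. (norm (f n x - f' x))\<^sup>2) + 2 * t\<^sup>2 * (LINT x|lebesgue. (norm (k n x - k' x))\<^sup>2)" .
    qed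
    have "(\<lambda>n. 2 * (LINT x|lebesgue. (norm (f n x - f' x))\<^sup>2) + 2 * t\<^sup>2 * (LINT x|lebesgue. (norm (k n x - k' x))\<^sup>2))
      \<longlonglongrightarrow> 2 * 0 + 2 * t\<^sup>2 * 0" by (intro tendsto_intros that)
    then show "(\<lambda>n. 2 * (LINT x|lebesgue. (norm (f n x - f' x))\<^sup>2) + 2 * t\<^sup>2 * (LINT x|lebesgue. (norm (k n x - k' x))\<^sup>2)) \<longlonglongrightarrow> 0" by simp
  qed auto
  have sm: "smooth_on UNIV (\<phi> n)" "smooth_on UNIV (\<psi> n)" for n using \<phi>(1)[of n] \<psi>(1)[of n] by (auto elim: test_functionE)
  have gr: "grad (\<lambda>x. \<phi> n x + t * \<psi> n x) = (\<lambda>x. grad (\<phi> n) x + t *\<^sub>R grad (\<psi> n) x)" for n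
    by (simp add: smooth_grad_add[OF sm(1) smooth_on_mult[OF open_UNIV smooth_on_const[OF open_UNIV] sm(2)]] smooth_grad_scale[OF sm(2)])
  have e1: "indicator \<Omega> x *\<^sub>R (u x + t * v x) = indicator \<Omega> x *\<^sub>R u x + t *\<^sub>R (indicator \<Omega> x *\<^sub>R v x)" for x by (simp add: algebra_simps)
  have e2: "indicator \<Omega> x *\<^sub>R (weak_grad \<Omega> u x + t *\<^sub>R weak_grad \<Omega> v x) = indicator \<Omega> x *\<^sub>R weak_grad \<Omega> u x + t *\<^sub>R (indicator \<Omega> x *\<^sub>R weak_grad \<Omega> v x)" for x
    by (simp add: algebra_simps)
  note c1 = comb[OF L2_test_function(1)[OF \<phi>(1)] L2_test_function(1)[OF \<psi>(1)] \<phi>(2) \<psi>(2) \<phi>(4) \<psi>(4)]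
  note c2 = comb[OF L2_test_function(2)[OF \<phi>(1)] L2_test_function(2)[OF \<psi>(1)] \<phi>(3) \<psi>(3) \<phi>(5) \<psi>(5)]
  have T: "(\<lambda>x. \<phi> n x + t * \<psi> n x) \<in> test_functions \<Omega>" for n by (intro test_functions_add test_functions_scale \<phi>(1) \<psi>(1))
  have L: "L2 (\<lambda>x. indicator \<Omega> x *\<^sub>R (u x + t * v x))"
    "L2 (\<lambda>x. indicator \<Omega> x *\<^sub>R (weak_grad \<Omega> u x + t *\<^sub>R weak_grad \<Omega> v x))" unfolding e1 e2 by (intro L2_add L2_scale \<phi> \<psi>)+
  have lim: "(\<lambda>n. LINT x|lebesgue. (norm ((\<phi> n x + t * \<psi> n x) - indicator \<Omega> x *\<^sub>R (u x + t * v x)))\<^sup>2) \<longlonglongrightarrow> 0"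
    "(\<lambda>n. LINT x|lebesgue. (norm (grad (\<lambda>x. \<phi> n x + t * \<psi> n x) x - indicator \<Omega> x *\<^sub>R (weak_grad \<Omega> u x + t *\<^sub>R weak_grad \<Omega> v x)))\<^sup>2) \<longlonglongrightarrow> 0"
    unfolding e1 e2 gr using c1 c2 by (simp_all only: real_scaleR_def)
  show "(\<lambda>x. u x + t * v x) \<in> H1_0 \<Omega>" by (rule H1_0_I(1)[OF assms(1) T L lim])
  show "AE x in lebesgue. indicator \<Omega> x *\<^sub>R weak_grad \<Omega> (\<lambda>x. u x + t * v x) x
       = indicator \<Omega> x *\<^sub>R weak_grad \<Omega> u x + t *\<^sub>R (indicator \<Omega> x *\<^sub>R weak_grad \<Omega> v x)" using H1_0_I(2)[OF assms(1) T L lim] by (simp only: e2)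
qed

text \<open>The set where \<open>f\<close> differs from \<open>c\<close> is open and null, hence
  empty.\<close>

lemma continuous_AE_zero:
  fixes f :: "'a::euclidean_space \<Rightarrow> 'b::t1_space"
  assumes "continuous_on UNIV f" "AE x in lebesgue. f x = c"
  shows "f x = c"
proof -
  have "open (f -` (- {c}))" using assms(1) by (intro open_vimage) auto
  moreover obtain N where "N \<in> null_sets lebesgue" "{x. f x \<noteq> c} \<subseteq> N" using assms(2) by (auto simp: eventually_ae_filter)
  then have "negligible (f -` (- {c}))" by (rule_tac negligible_subset[of N]) (auto simp: negligible_iff_null_sets)
  ultimately show ?thesis using open_not_negligible[of "f -` (- {c})"] by auto
qed

lemma exists_normalized_test_function:
  assumes "open \<Omega>" "\<Omega> \<noteq> {}"
  obtains \<phi> where "\<phi> \<in> test_functions \<Omega>" "(L2_sq \<phi>) = 1"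
proof -
  obtain z where "z \<in> \<Omega>" using assms(2) by auto
  then obtain a b where ab: "z \<in> box a b" "cbox a b \<subseteq> \<Omega>" using open_contains_cbox[of \<Omega>] assms(1) by metis
  define \<psi> where "\<psi> = box_bump 1 a b"
  have \<psi>: "\<psi> \<in> test_functions \<Omega>" unfolding \<psi>_def by (rule box_bump_test[OF ab(2)])
  have "\<psi> z \<noteq> 0" using ab(1) by (auto simp: \<psi>_def box_bump_def mem_box flat_eq_0 not_le)
  have "(L2_sq \<psi>) \<noteq> 0"
  proof
    assume "(L2_sq \<psi>) = 0"
    then have "AE x in lebesgue. (norm (\<psi> x))\<^sup>2 = 0" using integral_nonneg_eq_0_iff_AE[OF L2_integrable[OF L2_test_function(1)[OF \<psi>]]] by simp
    then have "AE x in lebesgue. \<psi> x = 0" by simp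
    then show False using continuous_AE_zero[OF test_function_continuous(1)[OF \<psi>]] \<open>\<psi> z \<noteq> 0\<close> by blast
  qed
  then have pos: "(L2_sq \<psi>) > 0" by (simp add: order_less_le)
  define c where "c = 1 / sqrt (L2_sq \<psi>)"
  have "(LINT x|lebesgue. (norm (c * \<psi> x))\<^sup>2) = c\<^sup>2 * (L2_sq \<psi>)" by (simp add: power_mult_distrib)
  also have "\<dots> = 1" using pos by (simp add: c_def power_divide)
  finally show ?thesis using test_functions_scale[OF \<psi>] by (intro that)
qed

section \<open>Rellich compactness and the first eigenvalue\<close>

text \<open>Plays the role of a mollifier: at a fixed radius the averages of a bounded sequence are
  uniformly bounded and equi-Lipschitz, and they approximate in \<open>L^2\<close> at rate
  \<open>h\<close>.\<close>

definition ball_avg :: "real \<Rightarrow> ('a::euclidean_space \<Rightarrow> real) \<Rightarrow> 'a \<Rightarrow> real" where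
  "ball_avg h f x = (LINT y|lborel. indicator (cball 0 h) y *\<^sub>R f (y + x)) / measure lborel (cball (0::'a) h)"

lemma integrable_indicator_cball_continuous:
  fixes f :: "'a::euclidean_space \<Rightarrow> real"
  assumes "continuous_on UNIV f"
  shows "integrable lborel (\<lambda>y. indicator (cball c h) y *\<^sub>R f y)"
  by (rule borel_integrable_compact[OF compact_cball continuous_on_subset[OF assms]]) simp

lemma test_function_integrals:
  assumes "\<phi> \<in> test_functions \<Omega>"
  shows "integrable lborel (\<lambda>x. (\<phi> x)\<^sup>2)" "(LINT x|lborel. (\<phi> x)\<^sup>2) = L2_sq \<phi>"
    "integrable lborel (\<lambda>x. (norm (grad \<phi> x))\<^sup>2)" "(LINT x|lborel. (norm (grad \<phi> x))\<^sup>2) = L2_sq (grad \<phi>)"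
proof -
  have [measurable]: "\<phi> \<in> borel_measurable borel" "grad \<phi> \<in> borel_measurable borel"
    using test_function_continuous[OF assms] by (auto intro: borel_measurable_continuous_onI)
  have m: "(\<lambda>x. (\<phi> x)\<^sup>2) \<in> borel_measurable lborel" "(\<lambda>x. (norm (grad \<phi> x))\<^sup>2) \<in> borel_measurable lborel" by measurable
  show "integrable lborel (\<lambda>x. (\<phi> x)\<^sup>2)" "integrable lborel (\<lambda>x. (norm (grad \<phi> x))\<^sup>2)"
    using L2_integrable[OF L2_test_function(1)[OF assms]] L2_integrable[OF L2_test_function(2)[OF assms]] by (simp_all add: integrable_completion m)
  show "(LINT x|lborel. (\<phi> x)\<^sup>2) = L2_sq \<phi>" "(LINT x|lborel. (norm (grad \<phi> x))\<^sup>2) = L2_sq (grad \<phi>)" by (simp_all add: integral_completion m)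
qed

lemma translation_estimate_grad:
  assumes "\<phi> \<in> test_functions \<Omega>"
  shows "(\<integral>\<^sup>+x. ennreal ((\<phi> (y + x) - \<phi> x)\<^sup>2) \<partial>lborel) \<le> ennreal ((norm y)\<^sup>2 * (L2_sq (grad \<phi>)))"
proof -
  have "(\<integral>\<^sup>+x. ennreal ((\<phi> (y + x) - \<phi> x)\<^sup>2) \<partial>lborel) \<le> (\<integral>\<^sup>+x. ennreal ((grad \<phi> x \<bullet> y)\<^sup>2) \<partial>lborel)" by (rule translation_estimate[OF assms])
  also have "\<dots> \<le> (\<integral>\<^sup>+x. ennreal ((norm y)\<^sup>2 * (norm (grad \<phi> x))\<^sup>2) \<partial>lborel)"
  proof (intro nn_integral_mono ennreal_leI)
    fix x
    have "(grad \<phi> x \<bullet> y)\<^sup>2 = \<bar>grad \<phi> x \<bullet> y\<bar>\<^sup>2" by simp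
    also have "\<dots> \<le> (norm (grad \<phi> x) * norm y)\<^sup>2" by (intro power_mono Cauchy_Schwarz_ineq2) simp
    finally show "(grad \<phi> x \<bullet> y)\<^sup>2 \<le> (norm y)\<^sup>2 * (norm (grad \<phi> x))\<^sup>2" by (simp add: power_mult_distrib mult.commute)
  qed
  also have "\<dots> = ennreal (LINT x|lborel. (norm y)\<^sup>2 * (norm (grad \<phi> x))\<^sup>2)"
    using test_function_integrals(3)[OF assms] by (intro nn_integral_eq_integral) auto
  finally show ?thesis by (simp add: test_function_integrals(4)[OF assms])
qed

lemma translation_estimate_real:
  assumes "\<phi> \<in> test_functions \<Omega>"
  shows "integrable lborel (\<lambda>x. (\<phi> (y + x) - \<phi> x)\<^sup>2)"
    "(LINT x|lborel. (\<phi> (y + x) - \<phi> x)\<^sup>2) \<le> (norm y)\<^sup>2 * (L2_sq (grad \<phi>))"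
proof -
  have [measurable]: "\<phi> \<in> borel_measurable borel" using test_function_continuous[OF assms] by (auto intro: borel_measurable_continuous_onI)
  show i: "integrable lborel (\<lambda>x. (\<phi> (y + x) - \<phi> x)\<^sup>2)"
  proof (rule Bochner_Integration.integrable_bound)
    show "integrable lborel (\<lambda>x. 2 * (\<phi> (y + x))\<^sup>2 + 2 * (\<phi> x)\<^sup>2)"
      using test_function_integrals(1)[OF assms] integrable_lborel_translation[of "\<lambda>x. (\<phi> x)\<^sup>2" y] by simp
    show "AE x in lborel. norm ((\<phi> (y + x) - \<phi> x)\<^sup>2) \<le> norm (2 * (\<phi> (y + x))\<^sup>2 + 2 * (\<phi> x)\<^sup>2)"
    proof (rule AE_I2)
      fix x
      show "norm ((\<phi> (y + x) - \<phi> x)\<^sup>2) \<le> norm (2 * (\<phi> (y + x))\<^sup>2 + 2 * (\<phi> x)\<^sup>2)" using norm_add_sq_le[of "\<phi> (y + x)" "- \<phi> x"] by simp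
    qed
  qed measurable
  have "ennreal (LINT x|lborel. (\<phi> (y + x) - \<phi> x)\<^sup>2) \<le> ennreal ((norm y)\<^sup>2 * (L2_sq (grad \<phi>)))"
    using translation_estimate_grad[OF assms, of y] by (simp add: nn_integral_eq_integral[OF i])
  then show "(LINT x|lborel. (\<phi> (y + x) - \<phi> x)\<^sup>2) \<le> (norm y)\<^sup>2 * (L2_sq (grad \<phi>))" by (subst (asm) ennreal_le_iff) auto
qed

lemma measure_cball_pos: "h > 0 \<Longrightarrow> measure lborel (cball (0::'a::euclidean_space) h) > 0"
  using content_cball_pos[of h "0::'a"] by simp

text \<open>Nonnegativity of the variance of \<open>f (y + x) - f x\<close> over the ball of radius
  \<open>h\<close>.\<close>

lemma ball_avg_deviation:
  fixes f :: "'a::euclidean_space \<Rightarrow> real"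
  assumes "continuous_on UNIV f" "h > 0"
  shows "ennreal (measure lborel (cball (0::'a) h) * (ball_avg h f x - f x)\<^sup>2)
    \<le> (\<integral>\<^sup>+y. ennreal ((f (y + x) - f x)\<^sup>2) * indicator (cball 0 h) y \<partial>lborel)"
proof -
  define V where "V = measure lborel (cball (0::'a) h)"
  have V: "V > 0" using measure_cball_pos[OF assms(2)] by (simp add: V_def)
  define D where "D y = f (y + x) - f x" for y
  have cf: "continuous_on UNIV (\<lambda>y. f (y + x))" by (rule continuous_on_compose2[OF assms(1)]) (auto intro!: continuous_intros)
  then have cD: "continuous_on UNIV D" unfolding D_def by (intro continuous_intros)
  have iD: "integrable lborel (\<lambda>y. indicator (cball 0 h) y *\<^sub>R D y)" by (rule integrable_indicator_cball_continuous[OF cD])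
  have iD2: "integrable lborel (\<lambda>y. indicator (cball 0 h) y *\<^sub>R (D y)\<^sup>2)" by (rule integrable_indicator_cball_continuous) (intro continuous_intros cD)
  have ic: "integrable lborel (\<lambda>y. indicator (cball 0 h) y *\<^sub>R c)" for c :: real
    by (rule integrable_indicator_cball_continuous) (intro continuous_intros)
  define c where "c = ball_avg h f x - f x"
  have "(LINT y|lborel. indicator (cball 0 h) y *\<^sub>R D y) = (LINT y|lborel. indicator (cball 0 h) y *\<^sub>R f (y + x) - indicator (cball 0 h) y *\<^sub>R f x)"
    by (rule Bochner_Integration.integral_cong) (auto simp: D_def algebra_simps)
  also have "\<dots> = V * ball_avg h f x - V * f x" using integrable_indicator_cball_continuous[OF cf, of 0 h] ic[of "f x"] V
    by (subst Bochner_Integration.integral_diff) (auto simp: ball_avg_def V_def)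
  finally have I1: "(LINT y|lborel. indicator (cball 0 h) y *\<^sub>R D y) = V * c" by (simp add: c_def algebra_simps)
  have "0 \<le> (LINT y|lborel. indicator (cball 0 h) y *\<^sub>R (D y - c)\<^sup>2)" by (simp add: integral_nonneg_AE)
  also have "\<dots> = (LINT y|lborel. indicator (cball 0 h) y *\<^sub>R (D y)\<^sup>2 - (2 * c) * (indicator (cball 0 h) y *\<^sub>R D y) + indicator (cball 0 h) y *\<^sub>R c\<^sup>2)"
    by (rule Bochner_Integration.integral_cong) (auto simp: indicator_def power2_diff)
  also have "\<dots> = (LINT y|lborel. indicator (cball 0 h) y *\<^sub>R (D y)\<^sup>2) - (2 * c) * (LINT y|lborel. indicator (cball 0 h) y *\<^sub>R D y) + V * c\<^sup>2"
    using iD iD2 ic[of "c\<^sup>2"] by (subst Bochner_Integration.integral_add) (auto simp: V_def)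
  also have "\<dots> = (LINT y|lborel. indicator (cball 0 h) y *\<^sub>R (D y)\<^sup>2) - V * c\<^sup>2" unfolding I1 by (simp add: power2_eq_square algebra_simps)
  finally have "ennreal (V * c\<^sup>2) \<le> ennreal (LINT y|lborel. indicator (cball 0 h) y *\<^sub>R (D y)\<^sup>2)" by (intro ennreal_leI) simp
  also have "\<dots> = (\<integral>\<^sup>+y. ennreal (indicator (cball 0 h) y *\<^sub>R (D y)\<^sup>2) \<partial>lborel)" using iD2 by (intro nn_integral_eq_integral[symmetric]) auto
  also have "\<dots> = (\<integral>\<^sup>+y. ennreal ((f (y + x) - f x)\<^sup>2) * indicator (cball 0 h) y \<partial>lborel)" by (intro nn_integral_cong) (auto simp: indicator_def D_def)
  finally show ?thesis by (simp add: V_def c_def)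
qed

text \<open>The averages at \<open>x\<close> and \<open>x'\<close> differ by the average of a
  difference of translates, whose \<open>L^2\<close> norm is at most \<open>norm (x - x')\<close>
  times that of the gradient.\<close>

lemma ball_avg_lipschitz:
  assumes "\<phi> \<in> test_functions \<Omega>" "h > 0"
  shows "\<bar>ball_avg h \<phi> x - ball_avg h \<phi> x'\<bar> \<le>
    (1 + (L2_sq (grad \<phi>)) / measure lborel (cball (0::'a::euclidean_space) h)) * norm (x - x' :: 'a)"
proof (cases "x = x'")
  case False
  define V where "V = measure lborel (cball (0::'a) h)"
  have V: "V > 0" using measure_cball_pos[OF assms(2)] by (simp add: V_def)
  define Q where "Q = L2_sq (grad \<phi>)"
  define s where "s = norm (x - x')"
  have s: "s > 0" using False by (simp add: s_def)
  have cont: "continuous_on UNIV (\<lambda>y. \<phi> (y + z))" for z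
    by (rule continuous_on_compose2[OF test_function_continuous(1)[OF assms(1)]]) (auto intro!: continuous_intros)
  note ii = integrable_indicator_cball_continuous[OF cont, of 0 h]
  have tr: "integrable lborel (\<lambda>y. (\<phi> (y + x) - \<phi> (y + x'))\<^sup>2)"
    "(LINT y|lborel. (\<phi> (y + x) - \<phi> (y + x'))\<^sup>2) \<le> s\<^sup>2 * Q"
  proof -
    have [measurable]: "\<phi> \<in> borel_measurable borel" using test_function_continuous[OF assms(1)] by (auto intro: borel_measurable_continuous_onI)
    have eq: "(\<phi> (y + x) - \<phi> (y + x'))\<^sup>2 = (\<lambda>z. (\<phi> ((x - x') + z) - \<phi> z)\<^sup>2) (x' + y)" for y by (simp add: algebra_simps)
    show "integrable lborel (\<lambda>y. (\<phi> (y + x) - \<phi> (y + x'))\<^sup>2)"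
      unfolding eq by (rule integrable_lborel_translation[OF translation_estimate_real(1)[OF assms(1)]])
    have "(LINT y|lborel. (\<phi> (y + x) - \<phi> (y + x'))\<^sup>2) = (LINT z|lborel. (\<phi> ((x - x') + z) - \<phi> z)\<^sup>2)"
      unfolding eq by (rule integral_lborel_translation) measurable
    then show "(LINT y|lborel. (\<phi> (y + x) - \<phi> (y + x'))\<^sup>2) \<le> s\<^sup>2 * Q"
      using translation_estimate_real(2)[OF assms(1), of "x - x'"] by (simp add: s_def Q_def)
  qed
  have "ball_avg h \<phi> x - ball_avg h \<phi> x' = (LINT y|lborel. indicator (cball 0 h) y *\<^sub>R (\<phi> (y + x) - \<phi> (y + x'))) / V"
    unfolding ball_avg_def V_def[symmetric] diff_divide_distrib[symmetric] scaleR_right_diff_distrib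
    by (simp only: Bochner_Integration.integral_diff[OF ii ii])
  then have "\<bar>ball_avg h \<phi> x - ball_avg h \<phi> x'\<bar> = \<bar>LINT y|lborel. indicator (cball 0 h) y *\<^sub>R (\<phi> (y + x) - \<phi> (y + x'))\<bar> / V" using V by simp
  also have "\<dots> \<le> (LINT y|lborel. \<bar>indicator (cball 0 h) y *\<^sub>R (\<phi> (y + x) - \<phi> (y + x'))\<bar>) / V"
    using V by (intro divide_right_mono integral_abs_bound) auto
  also have "\<dots> \<le> (LINT y|lborel. indicator (cball 0 h) y *\<^sub>R s + (\<phi> (y + x) - \<phi> (y + x'))\<^sup>2 / s) / V"
  proof (intro divide_right_mono integral_mono)
    show "integrable lborel (\<lambda>y. \<bar>indicator (cball 0 h) y *\<^sub>R (\<phi> (y + x) - \<phi> (y + x'))\<bar>)"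
      by (intro integrable_abs integrable_indicator_cball_continuous continuous_intros cont)
    show "integrable lborel (\<lambda>y. indicator (cball 0 h) y *\<^sub>R s + (\<phi> (y + x) - \<phi> (y + x'))\<^sup>2 / s)"
      by (intro Bochner_Integration.integrable_add integrable_indicator_cball_continuous integrable_divide tr continuous_intros)
    fix y
    \<comment> \<open>Splitting at the scale \<open>s = norm (x - x')\<close> balances the terms:
      the constant and the quadratic part both integrate to at most a multiple of
      \<open>s\<close>.\<close>
    have "\<bar>a\<bar> \<le> s + a\<^sup>2 / s" for a :: real
    proof -
      have "0 \<le> (s - \<bar>a\<bar>)\<^sup>2" by simp
      also have "\<dots> = s * s - 2 * (s * \<bar>a\<bar>) + a\<^sup>2" by (simp add: power2_eq_square algebra_simps)
      finally have "s * \<bar>a\<bar> \<le> s * s + a\<^sup>2" using mult_nonneg_nonneg[of s "\<bar>a\<bar>"] s by linarith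
      then show ?thesis using s by (simp add: field_simps power2_eq_square)
    qed
    moreover have "0 \<le> (\<phi> (y + x) - \<phi> (y + x'))\<^sup>2 / s" using s by simp
    ultimately show "\<bar>indicator (cball 0 h) y *\<^sub>R (\<phi> (y + x) - \<phi> (y + x'))\<bar> \<le> indicator (cball 0 h) y *\<^sub>R s + (\<phi> (y + x) - \<phi> (y + x'))\<^sup>2 / s"
      by (auto simp: indicator_def)
  qed (use V in auto)
  also have "(LINT y|lborel. indicator (cball 0 h) y *\<^sub>R s + (\<phi> (y + x) - \<phi> (y + x'))\<^sup>2 / s) =
     V * s + (LINT y|lborel. (\<phi> (y + x) - \<phi> (y + x'))\<^sup>2) / s" using tr(1) integrable_indicator_cball_continuous[OF continuous_on_const, of 0 h s]
    by (subst Bochner_Integration.integral_add) (auto simp: V_def)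
  also have "(V * s + (LINT y|lborel. (\<phi> (y + x) - \<phi> (y + x'))\<^sup>2) / s) / V \<le> (V * s + (s\<^sup>2 * Q) / s) / V"
    using tr(2) V s by (intro divide_right_mono add_left_mono) auto
  also have "\<dots> = (1 + Q / V) * s" using V s by (simp add: field_simps power2_eq_square)
  finally show ?thesis by (simp add: Q_def V_def s_def)
qed simp

lemma ball_avg_bound:
  assumes "\<phi> \<in> test_functions \<Omega>" "h > 0"
  shows "\<bar>ball_avg h \<phi> (x::'a::euclidean_space)\<bar> \<le> 1 + (L2_sq \<phi>) / measure lborel (cball (0::'a) h)"
proof -
  define V where "V = measure lborel (cball (0::'a) h)"
  have V: "V > 0" using measure_cball_pos[OF assms(2)] by (simp add: V_def)
  have [measurable]: "\<phi> \<in> borel_measurable borel" using test_function_continuous[OF assms(1)] by (auto intro: borel_measurable_continuous_onI)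
  have cont: "continuous_on UNIV (\<lambda>y. \<phi> (y + x))"
    by (rule continuous_on_compose2[OF test_function_continuous(1)[OF assms(1)]]) (auto intro!: continuous_intros)
  have i2: "integrable lborel (\<lambda>y. (\<phi> (y + x))\<^sup>2)"
    using integrable_lborel_translation[OF test_function_integrals(1)[OF assms(1)], of x] by (simp add: add.commute)
  have "\<bar>ball_avg h \<phi> x\<bar> = \<bar>LINT y|lborel. indicator (cball 0 h) y *\<^sub>R \<phi> (y + x)\<bar> / V" using V by (simp add: ball_avg_def V_def)
  also have "\<dots> \<le> (LINT y|lborel. \<bar>indicator (cball 0 h) y *\<^sub>R \<phi> (y + x)\<bar>) / V" using V by (intro divide_right_mono integral_abs_bound) auto
  also have "\<dots> \<le> (LINT y|lborel. indicator (cball 0 h) y *\<^sub>R 1 + (\<phi> (y + x))\<^sup>2) / V"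
  proof (intro divide_right_mono integral_mono)
    show "integrable lborel (\<lambda>y. \<bar>indicator (cball 0 h) y *\<^sub>R \<phi> (y + x)\<bar>)" by (intro integrable_abs integrable_indicator_cball_continuous cont)
    show "integrable lborel (\<lambda>y. indicator (cball 0 h) y *\<^sub>R 1 + (\<phi> (y + x))\<^sup>2)"
      by (intro Bochner_Integration.integrable_add integrable_indicator_cball_continuous i2 continuous_intros)
    fix y
    have "\<bar>a\<bar> \<le> 1 + a\<^sup>2" for a :: real
    proof -
      have "0 \<le> (2 * \<bar>a\<bar> - 1)\<^sup>2" by simp
      also have "\<dots> = 4 * a\<^sup>2 - 4 * \<bar>a\<bar> + 1" by (simp add: power2_diff power_mult_distrib)
      finally show ?thesis by linarith
    qed
    then show "\<bar>indicator (cball 0 h) y *\<^sub>R \<phi> (y + x)\<bar> \<le> indicator (cball 0 h) y *\<^sub>R 1 + (\<phi> (y + x))\<^sup>2" by (auto simp: indicator_def)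
  qed (use V in auto)
  also have "(LINT y|lborel. indicator (cball 0 h) y *\<^sub>R 1 + (\<phi> (y + x))\<^sup>2) = V + (LINT y|lborel. (\<phi> (y + x))\<^sup>2)"
    using i2 integrable_indicator_cball_continuous[OF continuous_on_const, of 0 h 1] by (subst Bochner_Integration.integral_add) (auto simp: V_def)
  also have "(LINT y|lborel. (\<phi> (y + x))\<^sup>2) = L2_sq \<phi>"
    using integral_lborel_translation[of "\<lambda>x. (\<phi> x)\<^sup>2" x] test_function_integrals(2)[OF assms(1)] by (simp add: add.commute)
  finally show ?thesis using V by (simp add: V_def add_divide_distrib)
qed

lemma ball_avg_continuous:
  assumes "\<phi> \<in> test_functions \<Omega>" "h > 0"
  shows "continuous_on UNIV (ball_avg h \<phi>)"
proof -
  define C where "C = 1 + (L2_sq (grad \<phi>)) / measure lborel (cball (0::'a) h)"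
  have "C \<ge> 0" using measure_cball_pos[OF assms(2), where 'a='a] by (auto simp: C_def intro!: add_nonneg_nonneg divide_nonneg_nonneg)
  then have "C-lipschitz_on UNIV (ball_avg h \<phi>)"
    by (intro lipschitz_onI) (simp_all only: dist_norm real_norm_def ball_avg_lipschitz[OF assms, folded C_def])
  then show ?thesis by (rule lipschitz_on_continuous_on)
qed

text \<open>Tonelli reduces the error to translations by vectors of norm at most \<open>h\<close>,
  each controlled by \<open>translation_estimate_grad\<close>.\<close>

lemma ball_avg_L2_error:
  assumes "\<phi> \<in> test_functions \<Omega>" "h > 0"
  shows "(\<integral>\<^sup>+x. ennreal ((ball_avg h \<phi> x - \<phi> x)\<^sup>2) \<partial>lborel) \<le> ennreal (h\<^sup>2 * (LINT x::'a::euclidean_space|lebesgue. (norm (grad \<phi> x))\<^sup>2))"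
proof -
  define V where "V = measure lborel (cball (0::'a) h)"
  have V: "V > 0" using measure_cball_pos[OF assms(2)] by (simp add: V_def)
  define Q where "Q = L2_sq (grad \<phi>)"
  have Q: "Q \<ge> 0" by (simp add: Q_def)
  have [measurable]: "\<phi> \<in> borel_measurable borel" "ball_avg h \<phi> \<in> borel_measurable borel"
    using test_function_continuous[OF assms(1)] ball_avg_continuous[OF assms] by (auto intro: borel_measurable_continuous_onI)
  have [measurable]: "cball (0::'a) h \<in> sets borel" by simp
  have "ennreal V * (\<integral>\<^sup>+x. ennreal ((ball_avg h \<phi> x - \<phi> x)\<^sup>2) \<partial>lborel) = (\<integral>\<^sup>+x. ennreal (V * (ball_avg h \<phi> x - \<phi> x)\<^sup>2) \<partial>lborel)"
    using V by (subst nn_integral_cmult[symmetric]) (auto simp: ennreal_mult)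
  also have "\<dots> \<le> (\<integral>\<^sup>+x. (\<integral>\<^sup>+y. ennreal ((\<phi> (y + x) - \<phi> x)\<^sup>2) * indicator (cball 0 h) y \<partial>lborel) \<partial>lborel)"
    unfolding V_def by (intro nn_integral_mono ball_avg_deviation test_function_continuous[OF assms(1)] assms(2))
  also have "\<dots> = (\<integral>\<^sup>+y. (\<integral>\<^sup>+x. ennreal ((\<phi> (y + x) - \<phi> x)\<^sup>2) * indicator (cball 0 h) y \<partial>lborel) \<partial>lborel)" by (rule lborel_pair.Fubini') measurable
  also have "\<dots> \<le> (\<integral>\<^sup>+y. ennreal (h\<^sup>2 * Q) * indicator (cball (0::'a) h) y \<partial>lborel)"
  proof (rule nn_integral_mono)
    fix y :: 'a
    have "(\<integral>\<^sup>+x. ennreal ((\<phi> (y + x) - \<phi> x)\<^sup>2) * indicator (cball 0 h) y \<partial>lborel) = (\<integral>\<^sup>+x. ennreal ((\<phi> (y + x) - \<phi> x)\<^sup>2) \<partial>lborel) * indicator (cball 0 h) y"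
      by (rule nn_integral_multc) measurable
    also have "\<dots> \<le> ennreal ((norm y)\<^sup>2 * Q) * indicator (cball 0 h) y"
      unfolding Q_def by (intro mult_right_mono translation_estimate_grad[OF assms(1)]) simp
    also have "\<dots> \<le> ennreal (h\<^sup>2 * Q) * indicator (cball 0 h) y" using Q by (auto simp: indicator_def intro!: ennreal_leI mult_right_mono power_mono)
    finally show "(\<integral>\<^sup>+x. ennreal ((\<phi> (y + x) - \<phi> x)\<^sup>2) * indicator (cball 0 h) y \<partial>lborel) \<le> ennreal (h\<^sup>2 * Q) * indicator (cball 0 h) y" .
  qed
  also have "\<dots> = ennreal (h\<^sup>2 * Q) * ennreal V"
  proof -
    have "emeasure lborel (cball (0::'a) h) = ennreal V"
      unfolding V_def using emeasure_lborel_cball_finite[of "0::'a" h] by (intro emeasure_eq_ennreal_measure) (auto simp: top_unique)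
    then show ?thesis by (simp add: nn_integral_cmult_indicator)
  qed
  finally have "ennreal V * (\<integral>\<^sup>+x. ennreal ((ball_avg h \<phi> x - \<phi> x)\<^sup>2) \<partial>lborel) \<le> ennreal V * ennreal (h\<^sup>2 * Q)" by (simp add: mult.commute)
  then show ?thesis using V by (subst (asm) ennreal_mult_le_mult_iff) (auto simp: Q_def)
qed

text \<open>Kolmogorov's argument. For each tolerance the ball averages at a suitable radius are
  compact by Arzela-Ascoli on a ball containing \<open>\<Omega>\<close>, and the averaging error is
  uniformly small; a diagonal sequence serves all tolerances.\<close>

lemma rellich:
  fixes \<phi> :: "nat \<Rightarrow> 'a::euclidean_space \<Rightarrow> real"
  assumes "bounded \<Omega>" and t: "\<And>n. \<phi> n \<in> test_functions \<Omega>"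
    and N: "\<And>n. (LINT x|lebesgue. (norm (\<phi> n x))\<^sup>2) \<le> M"
    and Q: "\<And>n. (L2_sq (grad (\<phi> n))) \<le> M"
  obtains r :: "nat \<Rightarrow> nat" where "strict_mono r"
    "\<And>e. e > 0 \<Longrightarrow> \<exists>k. \<forall>m\<ge>k. \<forall>n\<ge>k. (LINT x|lebesgue. (norm (\<phi> (r m) x - \<phi> (r n) x))\<^sup>2) < e"
proof -
  obtain R where R: "R > 0" "\<Omega> \<subseteq> cball 0 R" using assms(1) by (auto simp: bounded_pos subset_iff)
  define W where "W = measure lborel (cball (0::'a) R)"
  have W: "W > 0" using measure_cball_pos[OF R(1)] by (simp add: W_def)
  have "M \<ge> 0" using N[of 0] by (rule order_trans[rotated]) simp
  define P where "P k s \<longleftrightarrow> (\<exists>N. \<forall>m\<ge>N. \<forall>n\<ge>N. (LINT x|lebesgue. (norm (\<phi> (s m) x - \<phi> (s n) x))\<^sup>2) < 1 / real (Suc k))"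
    for k and s :: "nat \<Rightarrow> nat"
  have step: "\<exists>r'. strict_mono r' \<and> P k (s \<circ> r')" if "strict_mono s" for k and s :: "nat \<Rightarrow> nat"
  proof -
    define e where "e = 1 / real (Suc k)"
    have e: "e > 0" by (simp add: e_def)
    \<comment> \<open>The two averaging errors and the uniform error,
      \<open>\<eta>\<^sup>2 * W\<close> below, are each at most \<open>e / 24\<close>. Squaring a
      sum of three terms costs a factor 3, so the total is \<open>3 * e / 8 < e\<close>.\<close>
    define h where "h = sqrt (e / (24 * (M + 1)))"
    have h: "h > 0" "h\<^sup>2 = e / (24 * (M + 1))" using e \<open>M \<ge> 0\<close> by (simp_all add: h_def)
    have hM: "h\<^sup>2 * M \<le> e / 24" unfolding h(2) using e \<open>M \<ge> 0\<close> by (simp add: field_simps)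
    define \<eta> where "\<eta> = sqrt (e / (24 * W))"
    have \<eta>: "\<eta> > 0" "\<eta>\<^sup>2 = e / (24 * W)" using e W by (simp_all add: \<eta>_def)
    define V where "V = measure lborel (cball (0::'a) h)"
    have V: "V > 0" using measure_cball_pos[OF h(1)] by (simp add: V_def)
    define F where "F n = ball_avg h (\<phi> (s n))" for n
    have FL: "\<bar>F n x - F n y\<bar> \<le> (1 + M / V) * norm (x - y)" for n x y
    proof -
      have "\<bar>F n x - F n y\<bar> \<le> (1 + (LINT x|lebesgue. (norm (grad (\<phi> (s n)) x))\<^sup>2) / V) * norm (x - y)"
        unfolding F_def V_def by (rule ball_avg_lipschitz[OF t h(1)])
      also have "\<dots> \<le> (1 + M / V) * norm (x - y)" using Q V by (intro mult_right_mono add_left_mono divide_right_mono) auto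
      finally show ?thesis .
    qed
    have FB: "\<bar>F n x\<bar> \<le> 1 + M / V" for n x
    proof -
      have "\<bar>F n x\<bar> \<le> 1 + (LINT x|lebesgue. (norm (\<phi> (s n) x))\<^sup>2) / V" unfolding F_def V_def by (rule ball_avg_bound[OF t h(1)])
      also have "\<dots> \<le> 1 + M / V" using N V by (intro add_left_mono divide_right_mono) auto
      finally show ?thesis .
    qed
    obtain g r where r: "strict_mono (r :: nat \<Rightarrow> nat)"
      "\<And>e. 0 < e \<Longrightarrow> \<exists>N. \<forall>n x. n \<ge> N \<and> x \<in> cball 0 R \<longrightarrow> norm (F (r n) x - g x) < e"
    proof (rule Arzela_Ascoli[of "cball (0::'a) R" F "1 + M / V"])
      show "norm (F n x) \<le> 1 + M / V" for n x using FB by simp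
      fix x :: 'a and e :: real assume "0 < e"
      define d where "d = e / (1 + M / V)"
      have pos: "1 + M / V > 0" using V \<open>M \<ge> 0\<close> by (simp add: add_pos_nonneg)
      have "norm (F n x - F n y) < e" if "norm (x - y) < d" for n y
      proof -
        have "norm (F n x - F n y) \<le> (1 + M / V) * norm (x - y)" using FL by simp
        also have "\<dots> < (1 + M / V) * d" using that pos by (rule mult_strict_left_mono)
        also have "\<dots> = e" using pos by (simp add: d_def)
        finally show ?thesis .
      qed
      then show "\<exists>d>0. \<forall>n y. y \<in> cball 0 R \<and> norm (x - y) < d \<longrightarrow> norm (F n x - F n y) < e" using pos \<open>0 < e\<close> by (intro exI[of _ d]) (auto simp: d_def)
    qed (auto intro: that)
    obtain N0 where N0: "\<And>n x. n \<ge> N0 \<Longrightarrow> x \<in> cball 0 R \<Longrightarrow> norm (F (r n) x - g x) < \<eta> / 2" using r(2)[of "\<eta> / 2"] \<eta>(1) by auto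
    have "(LINT x|lebesgue. (norm (\<phi> (s (r m)) x - \<phi> (s (r n)) x))\<^sup>2) < e" if mn: "m \<ge> N0" "n \<ge> N0" for m n
    proof -
      define \<psi> \<zeta> where "\<psi> = \<phi> (s (r m))" and "\<zeta> = \<phi> (s (r n))"
      have t': "\<psi> \<in> test_functions \<Omega>" "\<zeta> \<in> test_functions \<Omega>" unfolding \<psi>_def \<zeta>_def by (rule t)+
      define A B where "A = F (r m)" and "B = F (r n)"
      have AB: "A = ball_avg h \<psi>" "B = ball_avg h \<zeta>" by (simp_all add: A_def B_def F_def \<psi>_def \<zeta>_def)
      have [measurable]: "\<psi> \<in> borel_measurable borel" "\<zeta> \<in> borel_measurable borel"
        "A \<in> borel_measurable borel" "B \<in> borel_measurable borel" using test_function_continuous[OF t'(1)] test_function_continuous[OF t'(2)]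
          ball_avg_continuous[OF t'(1) h(1)] ball_avg_continuous[OF t'(2) h(1)] by (auto intro: borel_measurable_continuous_onI simp: AB)
      have [measurable]: "cball (0::'a) R \<in> sets borel" by simp
      have AB': "\<bar>A x - B x\<bar> \<le> \<eta>" if "x \<in> cball 0 R" for x using N0[OF mn(1) that] N0[OF mn(2) that] unfolding A_def B_def real_norm_def by linarith
      have pw: "ennreal ((\<psi> x - \<zeta> x)\<^sup>2) \<le> ennreal 3 * ennreal ((A x - \<psi> x)\<^sup>2) + ennreal 3 * ennreal ((B x - \<zeta> x)\<^sup>2) + ennreal (3 * \<eta>\<^sup>2) * indicator (cball 0 R) x" for x
      proof (cases "x \<in> cball 0 R")
        case True
        have "(\<psi> x - \<zeta> x)\<^sup>2 \<le> 3 * (A x - \<psi> x)\<^sup>2 + 3 * (B x - \<zeta> x)\<^sup>2 + 3 * (A x - B x)\<^sup>2"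
        proof -
          have "(p + q + w)\<^sup>2 \<le> 3 * p\<^sup>2 + 3 * q\<^sup>2 + 3 * w\<^sup>2" for p q w :: real
          proof -
            have "0 \<le> (p - q)\<^sup>2 + (q - w)\<^sup>2 + (p - w)\<^sup>2" by simp
            then show ?thesis by (simp add: power2_eq_square algebra_simps)
          qed
          from this[of "-(A x - \<psi> x)" "B x - \<zeta> x" "A x - B x"] show ?thesis by (simp add: power2_commute)
        qed
        also have "(A x - B x)\<^sup>2 \<le> \<eta>\<^sup>2" using AB'[OF True] by (metis abs_le_square_iff abs_of_pos \<eta>(1))
        finally have "(\<psi> x - \<zeta> x)\<^sup>2 \<le> 3 * (A x - \<psi> x)\<^sup>2 + 3 * (B x - \<zeta> x)\<^sup>2 + 3 * \<eta>\<^sup>2" by simp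
        then have "ennreal ((\<psi> x - \<zeta> x)\<^sup>2) \<le> ennreal (3 * (A x - \<psi> x)\<^sup>2 + 3 * (B x - \<zeta> x)\<^sup>2 + 3 * \<eta>\<^sup>2)" by (rule ennreal_leI)
        then show ?thesis using True by (simp add: ennreal_mult)
      next
        case False
        then have "x \<notin> \<Omega>" using R(2) by auto
        then have "\<psi> x = 0" "\<zeta> x = 0" using test_function_indicator(1)[OF t'(1), of x] test_function_indicator(1)[OF t'(2), of x] by auto
        then show ?thesis by simp
      qed
      have "(\<integral>\<^sup>+x. ennreal ((\<psi> x - \<zeta> x)\<^sup>2) \<partial>lborel) \<le>
        (\<integral>\<^sup>+x. ennreal 3 * ennreal ((A x - \<psi> x)\<^sup>2) + ennreal 3 * ennreal ((B x - \<zeta> x)\<^sup>2) + ennreal (3 * \<eta>\<^sup>2) * indicator (cball 0 R) x \<partial>lborel)"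
        by (intro nn_integral_mono pw)
      also have "\<dots> = ennreal 3 * (\<integral>\<^sup>+x. ennreal ((A x - \<psi> x)\<^sup>2) \<partial>lborel) + ennreal 3 * (\<integral>\<^sup>+x. ennreal ((B x - \<zeta> x)\<^sup>2) \<partial>lborel)
          + ennreal (3 * \<eta>\<^sup>2) * emeasure lborel (cball (0::'a) R)" by (simp add: nn_integral_add nn_integral_cmult)
      also have "\<dots> \<le> ennreal 3 * ennreal (e / 24) + ennreal 3 * ennreal (e / 24) + ennreal (3 * \<eta>\<^sup>2) * ennreal W"
      proof (intro add_mono mult_left_mono)
        have le: "(\<integral>\<^sup>+x. ennreal ((ball_avg h f x - f x)\<^sup>2) \<partial>lborel) \<le> ennreal (e / 24)"
          if f: "f \<in> test_functions \<Omega>" "(L2_sq (grad f)) \<le> M" for f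
        proof -
          have "h\<^sup>2 * (L2_sq (grad f)) \<le> h\<^sup>2 * M" using f(2) by (intro mult_left_mono) auto
          then have "ennreal (h\<^sup>2 * (L2_sq (grad f))) \<le> ennreal (e / 24)" using hM by (intro ennreal_leI) simp
          with ball_avg_L2_error[OF f(1) h(1)] show ?thesis by (rule order_trans)
        qed
        show "(\<integral>\<^sup>+x. ennreal ((A x - \<psi> x)\<^sup>2) \<partial>lborel) \<le> ennreal (e / 24)" "(\<integral>\<^sup>+x. ennreal ((B x - \<zeta> x)\<^sup>2) \<partial>lborel) \<le> ennreal (e / 24)"
          unfolding AB by (rule le, use t' Q in \<open>simp_all add: \<psi>_def \<zeta>_def\<close>)+
        show "emeasure lborel (cball (0::'a) R) \<le> ennreal W"
          unfolding W_def using emeasure_lborel_cball_finite[of "0::'a" R] by (subst emeasure_eq_ennreal_measure) (auto simp: top_unique)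
      qed auto
      also have "\<dots> = ennreal (3 * (e / 24) + 3 * (e / 24) + 3 * \<eta>\<^sup>2 * W)"
      proof -
        have nn: "0 \<le> (3::real)" "0 \<le> e / 24" "0 \<le> W" "0 \<le> 3 * \<eta>\<^sup>2" "0 \<le> 3 * (e / 24)"
          "0 \<le> 3 * (e / 24) + 3 * (e / 24)" "0 \<le> 3 * \<eta>\<^sup>2 * W" using e W by auto
        show ?thesis by (simp only: ennreal_mult[symmetric] ennreal_plus[symmetric] nn)
      qed
      also have "3 * (e / 24) + 3 * (e / 24) + 3 * \<eta>\<^sup>2 * W = 3 * e / 8" using W \<eta>(2) by (simp add: field_simps)
      finally have "ennreal (LINT x|lborel. (\<psi> x - \<zeta> x)\<^sup>2) \<le> ennreal (3 * e / 8)"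
        using test_function_integrals(1)[OF test_functions_diff[OF t']] by (subst (asm) nn_integral_eq_integral) auto
      then have "(LINT x|lborel. (\<psi> x - \<zeta> x)\<^sup>2) \<le> 3 * e / 8" using e by (subst (asm) ennreal_le_iff) auto
      then show ?thesis using e test_function_integrals(2)[OF test_functions_diff[OF t']] by (simp add: \<psi>_def \<zeta>_def)
    qed
    then show ?thesis using r(1) by (auto simp: P_def e_def intro!: exI[of _ r] exI[of _ N0])
  qed
  interpret subseqs P by unfold_locales (rule step)
  \<comment> \<open>The Cauchy property up to a fixed tolerance is inherited by subsequences, as the
    diagonal construction demands.\<close>
  have stable: "P n (s \<circ> r)" if "strict_mono r" and Ps: "P n s" for r s n
  proof -
    obtain N where N: "\<And>m k. m \<ge> N \<Longrightarrow> k \<ge> N \<Longrightarrow> (LINT x|lebesgue. (norm (\<phi> (s m) x - \<phi> (s k) x))\<^sup>2) < 1 / real (Suc n)" using Ps by (auto simp: P_def)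
    have rN: "r m \<ge> N" if "m \<ge> N" for m using seq_suble[OF \<open>strict_mono r\<close>, of m] that by simp
    show ?thesis unfolding P_def o_def by (rule exI[of _ N], intro allI impI) (rule N[OF rN rN])
  qed
  show ?thesis
  proof (rule that[OF subseq_diagseq])
    fix e :: real assume "e > 0"
    then obtain k where k: "1 / real (Suc k) < e" using nat_approx_posE by blast
    \<comment> \<open>From index \<open>Suc k\<close> on, the diagonal sequence is a subsequence of
      the selection made for tolerance \<open>k\<close>, hence the shift.\<close>
    have "P k (diagseq \<circ> ((+) (Suc k)))" by (rule diagseq_holds[OF stable])
    then obtain N where N: "\<And>m n. m \<ge> N \<Longrightarrow> n \<ge> N \<Longrightarrow>
        (LINT x|lebesgue. (norm (\<phi> (diagseq (Suc k + m)) x - \<phi> (diagseq (Suc k + n)) x))\<^sup>2) < 1 / real (Suc k)" by (auto simp: P_def)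
    have "(LINT x|lebesgue. (norm (\<phi> (diagseq m) x - \<phi> (diagseq n) x))\<^sup>2) < e" if "m \<ge> N + Suc k" "n \<ge> N + Suc k" for m n
    proof -
      have "N \<le> m - Suc k" "N \<le> n - Suc k" "Suc k + (m - Suc k) = m" "Suc k + (n - Suc k) = n" using that by auto
      with N[of "m - Suc k" "n - Suc k"] k show ?thesis by (simp del: of_nat_Suc)
    qed
    then show "\<exists>k. \<forall>m\<ge>k. \<forall>n\<ge>k. (LINT x|lebesgue. (norm (\<phi> (diagseq m) x - \<phi> (diagseq n) x))\<^sup>2) < e" by blast
  qed
qed

section \<open>The first eigenvalue as the minimum of the Rayleigh quotient\<close>

lemma L2_parallelogram:
  assumes "L2 f" "L2 g"
  shows "(LINT x|lebesgue. (norm (f x - g x))\<^sup>2) + (LINT x|lebesgue. (norm (f x + g x))\<^sup>2) =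
    2 * (L2_sq f) + 2 * (L2_sq g)" using L2_norm_add_sq[OF assms] L2_norm_add_scale_sq[OF assms, of "-1"] by simp

lemma zero_on_iff_L2_norm:
  assumes "L2 (zero_ext \<Omega> u)"
  shows "zero_on \<Omega> u \<longleftrightarrow> (LINT x|lebesgue. (norm (indicator \<Omega> x *\<^sub>R u x))\<^sup>2) = 0"
proof -
  have "(LINT x|lebesgue. (norm (indicator \<Omega> x *\<^sub>R u x))\<^sup>2) = 0 \<longleftrightarrow> (AE x in lebesgue. (norm (indicator \<Omega> x *\<^sub>R u x))\<^sup>2 = 0)"
    by (rule integral_nonneg_eq_0_iff_AE[OF L2_integrable[OF assms]]) simp
  moreover have "(norm (indicator \<Omega> x *\<^sub>R u x))\<^sup>2 = 0 \<longleftrightarrow> (x \<in> \<Omega> \<longrightarrow> u x = 0)" for x by (auto simp: indicator_def)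
  ultimately show ?thesis by (simp add: zero_on_def)
qed

lemma set_lebesgue_inner:
  fixes f g :: "'a::euclidean_space \<Rightarrow> 'b::euclidean_space"
  shows "(LINT x:\<Omega>|lebesgue. f x \<bullet> g x) = (LINT x|lebesgue. (indicator \<Omega> x *\<^sub>R f x) \<bullet> (indicator \<Omega> x *\<^sub>R g x))"
  unfolding set_lebesgue_integral_def by (rule Bochner_Integration.integral_cong) (auto simp: indicator_def)

text \<open>\<open>LEAST\<close> over the reals says nothing until a least eigenvalue is exhibited.
  The infimum \<open>\<mu>\<close> of the Rayleigh quotient over test functions is attained by a
  limit of a minimizing sequence, the minimizer is an eigenfunction, and every eigenvalue is itself
  a Rayleigh quotient, hence at least \<open>\<mu>\<close>.\<close>

theorem first_dirichlet_eigenvalue_rayleigh: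
  fixes \<Omega> :: "'a::euclidean_space set"
  assumes "open \<Omega>" "bounded \<Omega>" "\<Omega> \<noteq> {}" "v \<in> H1_0 \<Omega>"
  shows "first_dirichlet_eigenvalue \<Omega> * (LINT x|lebesgue. (norm (indicator \<Omega> x *\<^sub>R v x))\<^sup>2)
    \<le> (LINT x|lebesgue. (norm (indicator \<Omega> x *\<^sub>R weak_grad \<Omega> v x))\<^sup>2)"
proof -
  define N where "N \<phi> = L2_sq \<phi>" for \<phi> :: "'a \<Rightarrow> real"
  define Q where "Q g = L2_sq g" for g :: "'a \<Rightarrow> 'a"
  have nonneg: "0 \<le> N \<phi>" "0 \<le> Q g" for \<phi> g by (simp_all add: N_def Q_def)
  define S where "S = {Q (grad \<phi>) |\<phi>. \<phi> \<in> test_functions \<Omega> \<and> N \<phi> = 1}"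
  define \<mu> where "\<mu> = Inf S"
  obtain \<phi>0 where "\<phi>0 \<in> test_functions \<Omega>" "N \<phi>0 = 1" using exists_normalized_test_function[OF assms(1,3)] unfolding N_def by blast
  then have S_ne: "S \<noteq> {}" by (auto simp: S_def)
  have S_bdd: "bdd_below S" by (rule bdd_belowI[of _ 0]) (auto simp: S_def nonneg)
  have \<mu>0: "\<mu> \<ge> 0" unfolding \<mu>_def by (rule cInf_greatest[OF S_ne]) (auto simp: S_def nonneg)
  have R1: "\<mu> * N \<phi> \<le> Q (grad \<phi>)" if \<phi>: "\<phi> \<in> test_functions \<Omega>" for \<phi>
  proof (cases "N \<phi> = 0")
    case False
    then have pos: "N \<phi> > 0" using nonneg(1)[of \<phi>] by simp
    define c where "c = 1 / sqrt (N \<phi>)"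
    have c2: "c\<^sup>2 = 1 / N \<phi>" using pos by (simp add: c_def power_divide)
    have "smooth_on UNIV \<phi>" using \<phi> by (auto elim: test_functionE)
    then have "Q (grad (\<lambda>x. c * \<phi> x)) = c\<^sup>2 * Q (grad \<phi>)" by (simp add: smooth_grad_scale Q_def power_mult_distrib)
    moreover have "N (\<lambda>x. c * \<phi> x) = c\<^sup>2 * N \<phi>" by (simp add: N_def power_mult_distrib)
    then have "N (\<lambda>x. c * \<phi> x) = 1" using c2 pos by simp
    ultimately have "c\<^sup>2 * Q (grad \<phi>) \<in> S" unfolding S_def using test_functions_scale[OF \<phi>, of c] by (intro CollectI exI[of _ "\<lambda>x. c * \<phi> x"]) auto
    then have "\<mu> \<le> c\<^sup>2 * Q (grad \<phi>)" unfolding \<mu>_def by (rule cInf_lower[OF _ S_bdd])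
    then show ?thesis using pos by (simp add: c2 field_simps)
  qed (use nonneg in simp)
  have R2: "\<mu> * N (zero_ext \<Omega> w) \<le> Q (zero_ext \<Omega> (weak_grad \<Omega> w))" if w: "w \<in> H1_0 \<Omega>" for w
  proof -
    obtain \<phi> where \<phi>: "\<And>n. \<phi> n \<in> test_functions \<Omega>"
      "L2 (zero_ext \<Omega> w)" "L2 (zero_ext \<Omega> (weak_grad \<Omega> w))"
      "(\<lambda>n. LINT x|lebesgue. (norm (\<phi> n x - indicator \<Omega> x *\<^sub>R w x))\<^sup>2) \<longlonglongrightarrow> 0"
      "(\<lambda>n. LINT x|lebesgue. (norm (grad (\<phi> n) x - indicator \<Omega> x *\<^sub>R weak_grad \<Omega> w x))\<^sup>2) \<longlonglongrightarrow> 0" by (rule H1_0_E[OF assms(1) w]) (rule that)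
    have "(\<lambda>n. N (\<phi> n)) \<longlonglongrightarrow> N (zero_ext \<Omega> w)" unfolding N_def by (rule L2_tendsto_norm_sq[OF L2_test_function(1)[OF \<phi>(1)] \<phi>(2,4)])
    then have "(\<lambda>n. \<mu> * N (\<phi> n)) \<longlonglongrightarrow> \<mu> * N (zero_ext \<Omega> w)" by (intro tendsto_mult_left)
    moreover have "(\<lambda>n. Q (grad (\<phi> n))) \<longlonglongrightarrow> Q (zero_ext \<Omega> (weak_grad \<Omega> w))"
      unfolding Q_def by (rule L2_tendsto_norm_sq[OF L2_test_function(2)[OF \<phi>(1)] \<phi>(3,5)])
    ultimately show ?thesis by (rule LIMSEQ_le) (use R1[OF \<phi>(1)] in auto)
  qed
  have "\<exists>\<phi>. \<phi> \<in> test_functions \<Omega> \<and> N \<phi> = 1 \<and> Q (grad \<phi>) < \<mu> + 1 / real (Suc n)" for n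
  proof -
    have "Inf S < \<mu> + 1 / real (Suc n)" by (simp add: \<mu>_def)
    from cInf_lessD[OF S_ne this] show ?thesis unfolding S_def by blast
  qed
  then obtain \<phi> :: "nat \<Rightarrow> 'a \<Rightarrow> real" where \<phi>: "\<And>n. \<phi> n \<in> test_functions \<Omega>" "\<And>n. N (\<phi> n) = 1" "\<And>n. Q (grad (\<phi> n)) < \<mu> + 1 / real (Suc n)" by metis
  have Qb: "Q (grad (\<phi> n)) \<le> \<mu> + 1" for n
  proof -
    have "1 / real (Suc n) \<le> 1" by simp
    then show ?thesis using \<phi>(3)[of n] by linarith
  qed
  obtain r :: "nat \<Rightarrow> nat" where r: "strict_mono r"
    "\<And>e. e > 0 \<Longrightarrow> \<exists>k. \<forall>m\<ge>k. \<forall>n\<ge>k. (LINT x|lebesgue. (norm (\<phi> (r m) x - \<phi> (r n) x))\<^sup>2) < e"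
  proof (rule rellich[where M="\<mu> + 1", OF assms(2) \<phi>(1)])
    show "(LINT x|lebesgue. (norm (\<phi> n x))\<^sup>2) \<le> \<mu> + 1" for n using \<phi>(2)[of n] \<mu>0 by (simp add: N_def)
    show "(L2_sq (grad (\<phi> n))) \<le> \<mu> + 1" for n using Qb by (simp add: Q_def)
  qed (rule that)
  define \<psi> where "\<psi> n = \<phi> (r n)" for n
  have \<psi>: "\<psi> n \<in> test_functions \<Omega>" "N (\<psi> n) = 1" for n by (simp_all add: \<psi>_def \<phi>)
  have \<psi>Q: "Q (grad (\<psi> n)) < \<mu> + 1 / real (Suc n)" for n
  proof -
    have "1 / real (Suc (r n)) \<le> 1 / real (Suc n)" using seq_suble[OF r(1), of n] by (intro divide_left_mono) auto
    then show ?thesis using \<phi>(3)[of "r n"] by (simp add: \<psi>_def)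
  qed
  have sm: "smooth_on UNIV (\<psi> n)" for n using \<psi>(1)[of n] by (auto elim: test_functionE)
  \<comment> \<open>Parallelogram law for functions and gradients: since the sum also satisfies the
    Rayleigh bound, the gradients are Cauchy as soon as the functions are. The minimizing sequence
    thus converges strongly.\<close>
  have Qc: "Q (\<lambda>x. grad (\<psi> m) x - grad (\<psi> n) x) \<le> 2 / real (Suc m) + 2 / real (Suc n) + \<mu> * N (\<lambda>x. \<psi> m x - \<psi> n x)" for m n
  proof -
    have "\<mu> * N (\<lambda>x. \<psi> m x + \<psi> n x) \<le> Q (grad (\<lambda>x. \<psi> m x + \<psi> n x))" by (rule R1[OF test_functions_add[OF \<psi>(1) \<psi>(1)]])
    also have "grad (\<lambda>x. \<psi> m x + \<psi> n x) = (\<lambda>x. grad (\<psi> m) x + grad (\<psi> n) x)" by (rule smooth_grad_add[OF sm sm])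
    finally have 1: "\<mu> * N (\<lambda>x. \<psi> m x + \<psi> n x) \<le> Q (\<lambda>x. grad (\<psi> m) x + grad (\<psi> n) x)" .
    have "N (\<lambda>x. \<psi> m x - \<psi> n x) + N (\<lambda>x. \<psi> m x + \<psi> n x) = 4"
      using L2_parallelogram[OF L2_test_function(1)[OF \<psi>(1)[of m]] L2_test_function(1)[OF \<psi>(1)[of n]]] \<psi>(2)[of m] \<psi>(2)[of n] by (simp add: N_def)
    then have "N (\<lambda>x. \<psi> m x + \<psi> n x) = 4 - N (\<lambda>x. \<psi> m x - \<psi> n x)" by simp
    with 1 have 2: "\<mu> * 4 - \<mu> * N (\<lambda>x. \<psi> m x - \<psi> n x) \<le> Q (\<lambda>x. grad (\<psi> m) x + grad (\<psi> n) x)" by (simp add: right_diff_distrib)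
    have "Q (\<lambda>x. grad (\<psi> m) x - grad (\<psi> n) x) + Q (\<lambda>x. grad (\<psi> m) x + grad (\<psi> n) x) = 2 * Q (grad (\<psi> m)) + 2 * Q (grad (\<psi> n))"
      unfolding Q_def by (rule L2_parallelogram[OF L2_test_function(2)[OF \<psi>(1)] L2_test_function(2)[OF \<psi>(1)]])
    moreover have "2 / real (Suc k) = 2 * (1 / real (Suc k))" for k by simp
    ultimately show ?thesis using 2 \<psi>Q[of m] \<psi>Q[of n] by linarith
  qed
  have Nc: "\<exists>k. \<forall>m\<ge>k. \<forall>n\<ge>k. N (\<lambda>x. \<psi> m x - \<psi> n x) < e" if "e > 0" for e using r(2)[OF that] by (simp add: \<psi>_def N_def)
  have Qcauchy: "\<exists>k. \<forall>m\<ge>k. \<forall>n\<ge>k. Q (\<lambda>x. grad (\<psi> m) x - grad (\<psi> n) x) < e" if e: "e > 0" for e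
  proof -
    have "e / (2 * (\<mu> + 1)) > 0" using e \<mu>0 by simp
    then obtain k1 where k1: "\<And>m n. m \<ge> k1 \<Longrightarrow> n \<ge> k1 \<Longrightarrow> N (\<lambda>x. \<psi> m x - \<psi> n x) < e / (2 * (\<mu> + 1))" using Nc by blast
    obtain k2 where k2: "1 / real (Suc k2) < e / 8" using e nat_approx_posE[of "e / 8"] by auto
    have "Q (\<lambda>x. grad (\<psi> m) x - grad (\<psi> n) x) < e" if mn: "m \<ge> max k1 k2" "n \<ge> max k1 k2" for m n
    proof -
      have s: "2 / real (Suc j) < e / 4" if "j \<ge> max k1 k2" for j
      proof -
        have "1 / real (Suc j) \<le> 1 / real (Suc k2)" using that by (intro divide_left_mono) auto
        moreover have "2 / real (Suc j) = 2 * (1 / real (Suc j))" by simp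
        ultimately show ?thesis using k2 by linarith
      qed
      have "\<mu> * N (\<lambda>x. \<psi> m x - \<psi> n x) \<le> (\<mu> + 1) * N (\<lambda>x. \<psi> m x - \<psi> n x)" using nonneg by (intro mult_right_mono) auto
      also have "\<dots> < (\<mu> + 1) * (e / (2 * (\<mu> + 1)))" using k1[of m n] mn \<mu>0 by (intro mult_strict_left_mono) auto
      also have "\<dots> = e / 2" using \<mu>0 by (simp add: field_simps)
      finally show ?thesis using Qc[of m n] s[OF mn(1)] s[OF mn(2)] by linarith
    qed
    then show ?thesis by blast
  qed
  obtain u r1 where u: "u \<in> borel_measurable lebesgue" "integrable lebesgue (\<lambda>x. norm (u x) ^ 2)"
    "(\<lambda>n. LINT x|lebesgue. norm (\<psi> n x - u x) ^ 2) \<longlonglongrightarrow> 0" "strict_mono (r1 :: nat \<Rightarrow> nat)"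
    "AE x in lebesgue. (\<lambda>n. \<psi> (r1 n) x) \<longlonglongrightarrow> u x"
  proof (rule Lp_complete[of 2 \<psi> lebesgue])
    show "\<psi> n \<in> borel_measurable lebesgue" "integrable lebesgue (\<lambda>x. norm (\<psi> n x) ^ 2)" for n
      using L2_test_function(1)[OF \<psi>(1)] unfolding L2_def by blast+
    show "\<exists>N. \<forall>m\<ge>N. \<forall>n\<ge>N. (LINT x|lebesgue. norm (\<psi> m x - \<psi> n x) ^ 2) < e" if "e > 0" for e using Nc[OF that] unfolding N_def .
    show "(0::nat) < 2" by simp
  qed (rule that)
  obtain g r2 where g: "g \<in> borel_measurable lebesgue" "integrable lebesgue (\<lambda>x. norm (g x) ^ 2)"
    "(\<lambda>n. LINT x|lebesgue. norm (grad (\<psi> n) x - g x) ^ 2) \<longlonglongrightarrow> 0" "strict_mono (r2 :: nat \<Rightarrow> nat)"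
    "AE x in lebesgue. (\<lambda>n. grad (\<psi> (r2 n)) x) \<longlonglongrightarrow> g x"
  proof (rule Lp_complete[of 2 "\<lambda>n. grad (\<psi> n)" lebesgue])
    show "grad (\<psi> n) \<in> borel_measurable lebesgue" "integrable lebesgue (\<lambda>x. norm (grad (\<psi> n) x) ^ 2)" for n
      using L2_test_function(2)[OF \<psi>(1)] unfolding L2_def by blast+
    show "\<exists>N. \<forall>m\<ge>N. \<forall>n\<ge>N. (LINT x|lebesgue. norm (grad (\<psi> m) x - grad (\<psi> n) x) ^ 2) < e" if "e > 0" for e using Qcauchy[OF that] unfolding Q_def .
    show "(0::nat) < 2" by simp
  qed (rule that)
  \<comment> \<open>Limits are first taken on the whole space. Cutting them off outside
    \<open>\<Omega>\<close> does not move them away from functions supported in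
    \<open>\<Omega>\<close>.\<close>
  have restr: "L2 (zero_ext \<Omega> f) \<and> (\<lambda>n. LINT x|lebesgue. (norm (F n x - indicator \<Omega> x *\<^sub>R f x))\<^sup>2) \<longlonglongrightarrow> 0"
    if f: "L2 f" and F: "\<And>n. L2 (F n)" "\<And>n x. indicator \<Omega> x *\<^sub>R F n x = F n x"
      "(\<lambda>n. LINT x|lebesgue. (norm (F n x - f x))\<^sup>2) \<longlonglongrightarrow> 0" for f :: "'a \<Rightarrow> 'b::euclidean_space" and F
  proof
    have "\<Omega> \<in> sets lebesgue" using assms(1) by auto
    then have m: "(\<lambda>x. indicat_real \<Omega> x *\<^sub>R f x) \<in> borel_measurable lebesgue"
      by (intro borel_measurable_scaleR borel_measurable_indicator L2_measurable[OF f])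
    show L: "L2 (zero_ext \<Omega> f)" unfolding L2_def
    proof (rule conjI[OF m], rule Bochner_Integration.integrable_bound[OF L2_integrable[OF f]])
      show "(\<lambda>x. (norm (indicat_real \<Omega> x *\<^sub>R f x))\<^sup>2) \<in> borel_measurable lebesgue" using m by measurable
    qed (auto simp: indicator_def)
    show "(\<lambda>n. LINT x|lebesgue. (norm (F n x - indicator \<Omega> x *\<^sub>R f x))\<^sup>2) \<longlonglongrightarrow> 0"
    proof (rule tendsto_sandwich[OF _ _ tendsto_const F(3)]; intro always_eventually allI)
      fix n
      show "(LINT x|lebesgue. (norm (F n x - indicator \<Omega> x *\<^sub>R f x))\<^sup>2) \<le> (LINT x|lebesgue. (norm (F n x - f x))\<^sup>2)"
      proof (rule integral_mono)
        show "integrable lebesgue (\<lambda>x. (norm (F n x - indicat_real \<Omega> x *\<^sub>R f x))\<^sup>2)" by (intro L2_integrable L2_diff F(1) L)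
        show "integrable lebesgue (\<lambda>x. (norm (F n x - f x))\<^sup>2)" by (intro L2_integrable L2_diff F(1) f)
        show "(norm (F n x - indicat_real \<Omega> x *\<^sub>R f x))\<^sup>2 \<le> (norm (F n x - f x))\<^sup>2" for x using F(2)[of x n] by (cases "x \<in> \<Omega>") auto
      qed
    qed simp
  qed
  have u2: "L2 (zero_ext \<Omega> u)" "(\<lambda>n. LINT x|lebesgue. (norm (\<psi> n x - indicator \<Omega> x *\<^sub>R u x))\<^sup>2) \<longlonglongrightarrow> 0"
    using restr[of u \<psi>] u L2_test_function(1)[OF \<psi>(1)] test_function_indicator(1)[OF \<psi>(1)] by (simp_all add: L2_def)
  have g2: "L2 (zero_ext \<Omega> g)" "(\<lambda>n. LINT x|lebesgue. (norm (grad (\<psi> n) x - indicator \<Omega> x *\<^sub>R g x))\<^sup>2) \<longlonglongrightarrow> 0"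
    using restr[of g "\<lambda>n. grad (\<psi> n)"] g L2_test_function(2)[OF \<psi>(1)] test_function_indicator(2)[OF \<psi>(1)] by (simp_all add: L2_def)
  note uH = H1_0_I[OF assms(1) \<psi>(1) u2(1) g2(1) u2(2) g2(2)]
  have Lw: "L2 (zero_ext \<Omega> (weak_grad \<Omega> u))" by (rule L2_cong_AE[OF g2(1)]) (use uH(2) in eventually_elim, simp only:)
  have "(\<lambda>n. N (\<psi> n)) \<longlonglongrightarrow> N (zero_ext \<Omega> u)" unfolding N_def by (rule L2_tendsto_norm_sq[OF L2_test_function(1)[OF \<psi>(1)] u2])
  then have Nu: "N (zero_ext \<Omega> u) = 1" using \<psi>(2) by (simp add: LIMSEQ_const_iff)
  have "(\<lambda>n. Q (grad (\<psi> n))) \<longlonglongrightarrow> Q (zero_ext \<Omega> g)" unfolding Q_def by (rule L2_tendsto_norm_sq[OF L2_test_function(2)[OF \<psi>(1)] g2])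
  moreover have "(\<lambda>n. Q (grad (\<psi> n))) \<longlonglongrightarrow> \<mu>"
  proof (rule tendsto_sandwich[OF _ _ tendsto_const])
    show "\<forall>\<^sub>F n in sequentially. \<mu> \<le> Q (grad (\<psi> n))" using R1[OF \<psi>(1)] \<psi>(2) by (intro always_eventually allI) simp
    show "\<forall>\<^sub>F n in sequentially. Q (grad (\<psi> n)) \<le> \<mu> + 1 / real (Suc n)" using \<psi>Q by (intro always_eventually allI less_imp_le)
    have "(\<lambda>n. \<mu> + inverse (real (Suc n))) \<longlonglongrightarrow> \<mu> + 0" by (intro tendsto_intros LIMSEQ_inverse_real_of_nat)
    then show "(\<lambda>n. \<mu> + 1 / real (Suc n)) \<longlonglongrightarrow> \<mu>" by (simp add: inverse_eq_divide)
  qed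
  ultimately have "Q (zero_ext \<Omega> g) = \<mu>" by (rule LIMSEQ_unique)
  moreover have "Q (zero_ext \<Omega> (weak_grad \<Omega> u)) = Q (zero_ext \<Omega> g)"
    unfolding Q_def by (rule integral_lebesgue_cong_AE) (use uH(2) in eventually_elim, simp only:)
  ultimately have Qu: "Q (zero_ext \<Omega> (weak_grad \<Omega> u)) = \<mu>" by simp
  have EL: "(LINT x:\<Omega>|lebesgue. weak_grad \<Omega> u x \<bullet> weak_grad \<Omega> w x) = \<mu> * (LINT x:\<Omega>|lebesgue. u x * w x)" if w: "w \<in> H1_0 \<Omega>" for w
  proof -
    have wL: "L2 (zero_ext \<Omega> w)" "L2 (zero_ext \<Omega> (weak_grad \<Omega> w))" by (rule H1_0_E[OF assms(1) w], assumption)+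
    define b1 where "b1 = (LINT x|lebesgue. (indicator \<Omega> x *\<^sub>R weak_grad \<Omega> u x) \<bullet> (indicator \<Omega> x *\<^sub>R weak_grad \<Omega> w x))"
    define b0 where "b0 = (LINT x|lebesgue. (indicator \<Omega> x *\<^sub>R u x) \<bullet> (indicator \<Omega> x *\<^sub>R w x))"
    define C where "C = Q (zero_ext \<Omega> (weak_grad \<Omega> w)) - \<mu> * N (zero_ext \<Omega> w)"
    \<comment> \<open>The Rayleigh inequality for \<open>u + t * w\<close> is a nonnegative
      quadratic in \<open>t\<close> without constant term, because \<open>u\<close> attains
      equality; its linear coefficient must vanish.\<close>
    have "(b1 - \<mu> * b0)\<^sup>2 \<le> 0 * C"
    proof (rule nonneg_quadratic_discriminant)
      fix t :: real
      note H = H1_0_add_scale[OF assms(1) uH(1) w, of t]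
      have "N (\<lambda>x. indicator \<Omega> x *\<^sub>R (u x + t * w x)) = N (\<lambda>x. indicator \<Omega> x *\<^sub>R u x + t *\<^sub>R (indicator \<Omega> x *\<^sub>R w x))" by (simp add: algebra_simps)
      also have "\<dots> = 1 + 2 * t * b0 + t\<^sup>2 * N (zero_ext \<Omega> w)"
        unfolding N_def b0_def by (subst L2_norm_add_scale_sq[OF u2(1) wL(1)]) (use Nu in \<open>simp add: N_def\<close>)
      finally have eN: "N (\<lambda>x. indicator \<Omega> x *\<^sub>R (u x + t * w x)) = 1 + 2 * t * b0 + t\<^sup>2 * N (zero_ext \<Omega> w)" .
      have "Q (\<lambda>x. indicator \<Omega> x *\<^sub>R weak_grad \<Omega> (\<lambda>x. u x + t * w x) x)
        = Q (\<lambda>x. indicator \<Omega> x *\<^sub>R weak_grad \<Omega> u x + t *\<^sub>R (indicator \<Omega> x *\<^sub>R weak_grad \<Omega> w x))"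
        unfolding Q_def by (rule integral_lebesgue_cong_AE) (use H(2) in eventually_elim, simp only:)
      also have "\<dots> = \<mu> + 2 * t * b1 + t\<^sup>2 * Q (zero_ext \<Omega> (weak_grad \<Omega> w))"
        unfolding Q_def b1_def by (subst L2_norm_add_scale_sq[OF Lw wL(2)]) (use Qu in \<open>simp add: Q_def\<close>)
      finally show "0 \<le> 0 + 2 * t * (b1 - \<mu> * b0) + t\<^sup>2 * C" using R2[OF H(1)] unfolding eN C_def by (simp add: algebra_simps)
    qed
    then have "b1 = \<mu> * b0" by simp
    then show ?thesis using set_lebesgue_inner[of \<Omega> u w] by (simp add: set_lebesgue_inner b1_def b0_def)
  qed
  have "\<not> zero_on \<Omega> u" using Nu zero_on_iff_L2_norm[OF u2(1)] by (simp add: N_def)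
  then have ev: "dirichlet_eigenvalue \<Omega> \<mu>" unfolding dirichlet_eigenvalue_def using uH(1) EL by blast
  \<comment> \<open>Testing the eigenvalue equation with the eigenfunction itself exhibits
    \<open>\<nu>\<close> as a Rayleigh quotient.\<close>
  have least: "\<mu> \<le> \<nu>" if ev\<nu>: "dirichlet_eigenvalue \<Omega> \<nu>" for \<nu>
  proof -
    obtain w where w: "w \<in> H1_0 \<Omega>" "\<not> zero_on \<Omega> w"
      and w_all: "\<forall>v\<in>H1_0 \<Omega>. (LINT x:\<Omega>|lebesgue. weak_grad \<Omega> w x \<bullet> weak_grad \<Omega> v x) = \<nu> * (LINT x:\<Omega>|lebesgue. w x * v x)"
      using ev\<nu> unfolding dirichlet_eigenvalue_def by blast
    note w = w w_all[rule_format, OF w(1)]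
    have wL: "L2 (zero_ext \<Omega> w)" by (rule H1_0_E[OF assms(1) w(1)])
    have "Q (zero_ext \<Omega> (weak_grad \<Omega> w)) = \<nu> * N (zero_ext \<Omega> w)"
      using w(3) set_lebesgue_inner[of \<Omega> w w] set_lebesgue_inner[of \<Omega> "weak_grad \<Omega> w" "weak_grad \<Omega> w"]
      unfolding Q_def N_def power2_norm_eq_inner by (simp only: inner_real_def)
    with R2[OF w(1)] have "\<mu> * N (zero_ext \<Omega> w) \<le> \<nu> * N (zero_ext \<Omega> w)" by simp
    moreover have "N (zero_ext \<Omega> w) > 0"
      using w(2) zero_on_iff_L2_norm[OF wL] nonneg(1)[of "\<lambda>x. indicator \<Omega> x *\<^sub>R w x"] by (simp add: N_def order_less_le)
    ultimately show ?thesis by simp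
  qed
  have "first_dirichlet_eigenvalue \<Omega> = \<mu>" unfolding first_dirichlet_eigenvalue_def using ev least by (rule Least_equality)
  then show ?thesis using R2[OF assms(4)] by (simp add: N_def Q_def)
qed

section \<open>Symmetrization by polarization\<close>

definition hrefl :: "'a::real_inner \<Rightarrow> real \<Rightarrow> 'a \<Rightarrow> 'a" where
  "hrefl w c x = x - (2 * (x \<bullet> w - c) / (w \<bullet> w)) *\<^sub>R w"

lemma hrefl_inner: "w \<noteq> 0 \<Longrightarrow> hrefl w c x \<bullet> w - c = - (x \<bullet> w - c)"
  by (simp add: hrefl_def inner_diff_left field_simps)

lemma hrefl_hrefl: "w \<noteq> 0 \<Longrightarrow> hrefl w c (hrefl w c x) = x"
proof -
  assume "w \<noteq> 0"
  have "hrefl w c (hrefl w c x) = hrefl w c x - (2 * (hrefl w c x \<bullet> w - c) / (w \<bullet> w)) *\<^sub>R w" by (rule hrefl_def)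
  also have "2 * (hrefl w c x \<bullet> w - c) / (w \<bullet> w) = - (2 * (x \<bullet> w - c) / (w \<bullet> w))"
    unfolding hrefl_inner[OF \<open>w \<noteq> 0\<close>] by (simp only: mult_minus_right minus_divide_left)
  finally show ?thesis by (simp only: hrefl_def scaleR_minus_left) simp
qed

text \<open>The sign of the last term decides all later comparisons: two points on the same side of
  the hyperplane are at most as far apart as one is from the mirror image of the other, and on
  opposite sides the comparison is reversed.\<close>

lemma norm_diff_hrefl_sq:
  assumes "w \<noteq> 0"
  shows "(norm (x - hrefl w c y))\<^sup>2 = (norm (x - y))\<^sup>2 + 4 * (x \<bullet> w - c) * (y \<bullet> w - c) / (w \<bullet> w)"
proof -
  define k where "k = 2 * (y \<bullet> w - c) / (w \<bullet> w)"
  have kw: "k * (w \<bullet> w) = 2 * (y \<bullet> w - c)" using assms by (simp add: k_def)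
  have e: "x - hrefl w c y = (x - y) + k *\<^sub>R w" by (simp add: hrefl_def k_def)
  have "(norm (x - hrefl w c y))\<^sup>2 = (norm (x - y))\<^sup>2 + 2 * k * ((x - y) \<bullet> w) + k * (k * (w \<bullet> w))"
    unfolding e by (simp add: power2_norm_eq_inner inner_simps inner_commute algebra_simps)
  also have "\<dots> = (norm (x - y))\<^sup>2 + 2 * k * (x \<bullet> w - c)" unfolding kw by (simp add: inner_diff_left algebra_simps)
  finally show ?thesis by (simp add: k_def algebra_simps)
qed

lemma dist_hrefl:
  assumes "w \<noteq> 0"
  shows "norm (hrefl w c x - hrefl w c y) = norm (x - y)"
proof -
  have ab: "2 * (x \<bullet> w - c) / (w \<bullet> w) - 2 * (y \<bullet> w - c) / (w \<bullet> w) = 2 * ((x - y) \<bullet> w - 0) / (w \<bullet> w)"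
    by (simp add: inner_diff_left algebra_simps flip: diff_divide_distrib)
  have "hrefl w c x - hrefl w c y = hrefl w 0 (x - y)" unfolding hrefl_def ab[symmetric] scaleR_diff_left by simp
  then have "norm (hrefl w c x - hrefl w c y) = norm (hrefl w 0 (x - y))" by simp
  moreover have "(norm (0 - hrefl w 0 (x - y)))\<^sup>2 = (norm (0 - (x - y)))\<^sup>2" using norm_diff_hrefl_sq[OF assms, of 0 0 "x - y"] by simp
  then have "norm (hrefl w 0 (x - y)) = norm (x - y)" by (simp add: norm_minus_commute)
  ultimately show ?thesis by simp
qed

lemma norm_hrefl_diff:
  assumes "w \<noteq> 0"
  shows "norm (hrefl w c x - y) = norm (x - hrefl w c y)"
  using dist_hrefl[OF assms, of c x "hrefl w c y"] hrefl_hrefl[OF assms, of c y] by simp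

lemma continuous_hrefl: "continuous_on UNIV (hrefl w c)"
proof (cases "w = 0")
  case True
  then show ?thesis by (simp add: hrefl_def[abs_def])
next
  case False
  then show ?thesis unfolding hrefl_def[abs_def] by (intro continuous_intros) simp
qed

lemma orthogonal_transformation_hrefl0:
  assumes "w \<noteq> (0::'a::euclidean_space)"
  shows "orthogonal_transformation (hrefl w 0)"
proof -
  have "linear (hrefl w 0)" by (rule linearI) (simp_all add: hrefl_def inner_simps algebra_simps add_divide_distrib)
  moreover have "norm (hrefl w 0 v) = norm v" for v using dist_hrefl[OF assms, of 0 v 0] by (simp add: hrefl_def)
  ultimately show ?thesis by (simp add: orthogonal_transformation)
qed

text \<open>The reflection is an orthogonal map followed by a translation, so it preserves volume;
  it is enough to see this on boxes, which determine Lebesgue measure.\<close>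

lemma distr_lborel_hrefl:
  assumes "w \<noteq> (0::real^4)"
  shows "distr lborel borel (hrefl w c) = lborel"
proof (rule lborel_eqI[symmetric])
  have m: "hrefl w c \<in> borel_measurable borel" by (rule borel_measurable_continuous_onI[OF continuous_hrefl])
  fix l u :: "real^4" assume lu: "\<And>b. b \<in> Basis \<Longrightarrow> l \<bullet> b \<le> u \<bullet> b"
  have nn: "0 \<le> (\<Prod>b\<in>Basis. (u - l) \<bullet> b)" using lu by (intro prod_nonneg) (simp add: inner_diff_left)
  define B where "B = box l u"
  have B: "B \<in> lmeasurable" "emeasure lborel B = ennreal (measure lebesgue B)" "measure lebesgue B = (\<Prod>b\<in>Basis. (u - l) \<bullet> b)"
    using lu nn by (auto simp: B_def emeasure_lborel_box_eq measure_def emeasure_lborel_box enn2real_ennreal[OF nn])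
  have eq: "hrefl w c -` B = (+) ((2 * c / (w \<bullet> w)) *\<^sub>R w) ` (hrefl w 0 ` B)"
  proof -
    have h: "hrefl w c x = (2 * c / (w \<bullet> w)) *\<^sub>R w + hrefl w 0 x" for x by (simp add: hrefl_def diff_divide_distrib algebra_simps)
    have "hrefl w c -` B = hrefl w c ` B"
    proof (intro equalityI subsetI)
      fix x assume "x \<in> hrefl w c -` B"
      then show "x \<in> hrefl w c ` B" using hrefl_hrefl[OF assms, of c x] by (intro image_eqI[of _ _ "hrefl w c x"]) auto
    qed (auto simp: hrefl_hrefl[OF assms])
    also have "\<dots> = (+) ((2 * c / (w \<bullet> w)) *\<^sub>R w) ` (hrefl w 0 ` B)" unfolding image_image by (intro image_cong refl h)
    finally show ?thesis .
  qed
  have 1: "hrefl w 0 ` B \<in> lmeasurable" "measure lebesgue (hrefl w 0 ` B) = measure lebesgue B"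
    using measurable_orthogonal_image[OF orthogonal_transformation_hrefl0[OF assms] B(1)]
      measure_orthogonal_image[OF orthogonal_transformation_hrefl0[OF assms] B(1)] by auto
  then have 2: "hrefl w c -` B \<in> lmeasurable" "measure lebesgue (hrefl w c -` B) = measure lebesgue B"
    unfolding eq by (auto simp: measurable_translation measure_translation)
  have sb: "hrefl w c -` B \<in> sets borel" using measurable_sets[OF m, of B] by (simp add: B_def)
  have "emeasure (distr lborel borel (hrefl w c)) B = emeasure lborel (hrefl w c -` B)" using m by (subst emeasure_distr) (auto simp: B_def)
  also have "\<dots> = emeasure lebesgue (hrefl w c -` B)" using sb by simp
  also have "\<dots> = ennreal (measure lebesgue (hrefl w c -` B))" using 2(1) by (simp add: emeasure_eq_measure2)
  also have "\<dots> = (\<Prod>b\<in>Basis. (u - l) \<bullet> b)" using 2(2) B(3) by simp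
  finally show "emeasure (distr lborel borel (hrefl w c)) (box l u) = (\<Prod>b\<in>Basis. (u - l) \<bullet> b)" by (simp add: B_def)
qed simp

lemma nn_integral_hrefl:
  assumes "w \<noteq> (0::real^4)" "f \<in> borel_measurable borel"
  shows "(\<integral>\<^sup>+x. f (hrefl w c x) \<partial>lborel) = (\<integral>\<^sup>+x. f x \<partial>lborel)"
proof -
  have "(\<integral>\<^sup>+x. f x \<partial>lborel) = (\<integral>\<^sup>+x. f x \<partial>distr lborel borel (hrefl w c))" by (simp add: distr_lborel_hrefl[OF assms(1)])
  also have "\<dots> = (\<integral>\<^sup>+x. f (hrefl w c x) \<partial>lborel)" using assms(2) borel_measurable_continuous_onI[OF continuous_hrefl] by (intro nn_integral_distr) auto
  finally show ?thesis by simp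
qed

section \<open>Polarization with respect to a half-space\<close>

definition polarize :: "'a::real_inner \<Rightarrow> real \<Rightarrow> ('a \<Rightarrow> real) \<Rightarrow> 'a \<Rightarrow> real" where
  "polarize w c v x = (if x \<bullet> w \<le> c then max (v x) (v (hrefl w c x)) else min (v x) (v (hrefl w c x)))"

text \<open>Polarization acts on each mirror pair separately and places the larger value on the side
  \<open>x \<bullet> w <= c\<close>. On the hyperplane both points of the pair coincide, so the
  non-strict inequality causes no conflict.\<close>

lemma polarize_pair:
  assumes "w \<noteq> 0"
  shows "x \<bullet> w \<le> c \<Longrightarrow> polarize w c v x = max (v x) (v (hrefl w c x)) \<and> polarize w c v (hrefl w c x) = min (v x) (v (hrefl w c x))"
    "\<not> x \<bullet> w \<le> c \<Longrightarrow> polarize w c v x = min (v x) (v (hrefl w c x)) \<and> polarize w c v (hrefl w c x) = max (v x) (v (hrefl w c x))"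
proof -
  note i = hrefl_inner[OF assms, of c x] and h = hrefl_hrefl[OF assms, of c x]
  show "polarize w c v x = max (v x) (v (hrefl w c x)) \<and> polarize w c v (hrefl w c x) = min (v x) (v (hrefl w c x))" if le: "x \<bullet> w \<le> c"
  proof (cases "x \<bullet> w = c")
    case True
    then have "hrefl w c x = x" by (simp add: hrefl_def)
    then show ?thesis using le by (simp add: polarize_def)
  next
    case False
    then have "\<not> hrefl w c x \<bullet> w \<le> c" using i le by linarith
    then show ?thesis using le h by (simp add: polarize_def min.commute)
  qed
  show "polarize w c v x = min (v x) (v (hrefl w c x)) \<and> polarize w c v (hrefl w c x) = max (v x) (v (hrefl w c x))" if gt: "\<not> x \<bullet> w \<le> c"
  proof -
    have "hrefl w c x \<bullet> w \<le> c" using i gt by linarith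
    then show ?thesis using gt h by (simp add: polarize_def max.commute)
  qed
qed

text \<open>Sorting both pairs in the same order aligns large with large. Whenever the order of
  exactly one pair changes, the gain is \<open>2 * (k1 - k2) * (a - b) * (e - c)\<close>, and the
  larger weight sits on the aligned pairing.\<close>

lemma two_point_inequality:
  fixes a b c e k1 k2 :: real
  assumes "k2 \<le> k1"
  shows "((max a b - max c e)\<^sup>2 + (min a b - min c e)\<^sup>2) * k1 + ((max a b - min c e)\<^sup>2 + (min a b - max c e)\<^sup>2) * k2
    \<le> ((a - c)\<^sup>2 + (b - e)\<^sup>2) * k1 + ((a - e)\<^sup>2 + (b - c)\<^sup>2) * k2"
proof -
  have key: "((a - e)\<^sup>2 + (b - c)\<^sup>2) * k1 + ((a - c)\<^sup>2 + (b - e)\<^sup>2) * k2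
      \<le> ((a - c)\<^sup>2 + (b - e)\<^sup>2) * k1 + ((a - e)\<^sup>2 + (b - c)\<^sup>2) * k2" if "0 \<le> (a - b) * (e - c)"
  proof -
    have "0 \<le> 2 * ((k1 - k2) * ((a - b) * (e - c)))" using assms that by simp
    also have "\<dots> = (((a - c)\<^sup>2 + (b - e)\<^sup>2) * k1 + ((a - e)\<^sup>2 + (b - c)\<^sup>2) * k2) - (((a - e)\<^sup>2 + (b - c)\<^sup>2) * k1 + ((a - c)\<^sup>2 + (b - e)\<^sup>2) * k2)"
      by (simp add: power2_eq_square algebra_simps)
    finally show ?thesis by simp
  qed
  consider "b \<le> a" "e \<le> c" | "b \<le> a" "c < e" | "a < b" "e \<le> c" | "a < b" "c < e" by linarith
  then show ?thesis
  proof cases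
    case 1
    then have m: "max a b = a" "min a b = b" "max c e = c" "min c e = e" by auto
    show ?thesis unfolding m by simp
  next
    case 2
    then have m: "max a b = a" "min a b = b" "max c e = e" "min c e = c" by auto
    have "0 \<le> (a - b) * (e - c)" using 2 by (intro mult_nonneg_nonneg) auto
    from key[OF this] show ?thesis unfolding m .
  next
    case 3
    then have m: "max a b = b" "min a b = a" "max c e = c" "min c e = e" by auto
    have "0 \<le> (a - b) * (e - c)" using 3 by (intro mult_nonpos_nonpos) auto
    from key[OF this] show ?thesis unfolding m by (simp only: add.commute)
  next
    case 4
    then have m: "max a b = b" "min a b = a" "max c e = e" "min c e = c" by auto
    show ?thesis unfolding m by (simp add: add.commute)
  qed
qed

text \<open>For points on opposite sides, replacing one by its mirror image does not increase the
  distance, so exchanged values still obey the old constant.\<close>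

lemma polarize_lipschitz:
  assumes w: "w \<noteq> 0" and lip: "\<And>x y. \<bar>v x - v y\<bar> \<le> L * norm (x - y)" and L: "L \<ge> 0"
  shows "\<bar>polarize w c v x - polarize w c v y\<bar> \<le> L * norm (x - y)"
proof -
  let ?s = "hrefl w c"
  have d1: "\<bar>v x - v y\<bar> \<le> L * norm (x - y)" "\<bar>v (?s x) - v (?s y)\<bar> \<le> L * norm (x - y)"
    using lip[of x y] lip[of "?s x" "?s y"] dist_hrefl[OF w, of c x y] by simp_all
  have d2: "\<bar>v x - v (?s y)\<bar> \<le> L * norm (x - y)" "\<bar>v (?s x) - v y\<bar> \<le> L * norm (x - y)"
    if "(x \<bullet> w - c) * (y \<bullet> w - c) \<le> 0"
  proof -
    have "4 * (x \<bullet> w - c) * (y \<bullet> w - c) \<le> 0" using that by linarith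
    then have "4 * (x \<bullet> w - c) * (y \<bullet> w - c) / (w \<bullet> w) \<le> 0" by (rule divide_nonpos_pos) (use w in simp)
    then have "(norm (x - ?s y))\<^sup>2 \<le> (norm (x - y))\<^sup>2" using norm_diff_hrefl_sq[OF w, of x c y] by linarith
    then have le: "norm (x - ?s y) \<le> norm (x - y)" by (rule power2_le_imp_le) simp
    then have "L * norm (x - ?s y) \<le> L * norm (x - y)" using L by (intro mult_left_mono)
    then show "\<bar>v x - v (?s y)\<bar> \<le> L * norm (x - y)" "\<bar>v (?s x) - v y\<bar> \<le> L * norm (x - y)"
      using lip[of x "?s y"] lip[of "?s x" y] norm_hrefl_diff[OF w, of c x y] by simp_all
  qed
  consider "(x \<bullet> w \<le> c) = (y \<bullet> w \<le> c)" | "x \<bullet> w \<le> c" "\<not> y \<bullet> w \<le> c" | "\<not> x \<bullet> w \<le> c" "y \<bullet> w \<le> c" by blast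
  then show ?thesis
  proof cases
    case 1
    then show ?thesis using d1 by (auto simp: polarize_def max_def min_def)
  next
    case 2
    then have "(x \<bullet> w - c) * (y \<bullet> w - c) \<le> 0" by (intro mult_nonpos_nonneg) auto
    from d1 2 d2[OF this]
    show ?thesis by (auto simp: polarize_def max_def min_def)
  next
    case 3
    then have "(x \<bullet> w - c) * (y \<bullet> w - c) \<le> 0" by (intro mult_nonneg_nonpos) auto
    from d1 3 d2[OF this]
    show ?thesis by (auto simp: polarize_def max_def min_def)
  qed
qed

text \<open>For \<open>0 <= c\<close> the half-space \<open>x \<bullet> w <= c\<close> contains the
  origin, so its points are at least as near to it as their mirror images.\<close>

lemma norm_le_hrefl:
  assumes "w \<noteq> 0" "0 \<le> c" "x \<bullet> w \<le> c"
  shows "norm x \<le> norm (hrefl w c x)"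
proof -
  have "0 \<le> (0 \<bullet> w - c) * (x \<bullet> w - c)" using assms by (intro mult_nonpos_nonpos) auto
  then have "0 \<le> 4 * (0 \<bullet> w - c) * (x \<bullet> w - c)" by linarith
  then have "0 \<le> 4 * (0 \<bullet> w - c) * (x \<bullet> w - c) / (w \<bullet> w)" by (rule divide_nonneg_nonneg) (rule inner_ge_zero)
  then have "(norm (0 - x))\<^sup>2 \<le> (norm (0 - hrefl w c x))\<^sup>2" using norm_diff_hrefl_sq[OF assms(1), of 0 c x] by linarith
  then have "norm (0 - x) \<le> norm (0 - hrefl w c x)" by (rule power2_le_imp_le) simp
  then show ?thesis by simp
qed

lemma polarize_support:
  assumes "w \<noteq> 0" "0 \<le> c" "\<And>x. 0 \<le> v x" "\<And>x. R < norm x \<Longrightarrow> v x = 0" "R < norm x"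
  shows "polarize w c v x = 0"
  using norm_le_hrefl[OF assms(1,2), of x] assms(3)[of "hrefl w c x"] assms(4)[of x] assms(4)[of "hrefl w c x"] assms(5) by (auto simp: polarize_def)

section \<open>Nonlocal energies and their behaviour under polarization\<close>

definition jump_kernel :: "real \<Rightarrow> ('a::real_normed_vector \<Rightarrow> real) \<Rightarrow> 'a \<Rightarrow> 'a \<Rightarrow> real" where
  "jump_kernel h v x y = (v x - v y)\<^sup>2 * indicator (cball 0 h) (x - y)"

abbreviation jump_density :: "real \<Rightarrow> ('a::euclidean_space \<Rightarrow> real) \<Rightarrow> 'a \<Rightarrow> ennreal" where
  "jump_density h v x \<equiv> \<integral>\<^sup>+y. ennreal (jump_kernel h v x y) \<partial>lborel"

text \<open>A Dirichlet energy at scale \<open>h\<close> without derivatives. Polarization leaves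
  functions merely Lipschitz, and pairs of points are exactly what the two-point inequality
  compares.\<close>

definition jump_energy :: "real \<Rightarrow> ('a::euclidean_space \<Rightarrow> real) \<Rightarrow> ennreal" where
  "jump_energy h v = (\<integral>\<^sup>+x. (jump_density h v x) \<partial>lborel)"

lemma jump_kernel_nonneg: "0 \<le> jump_kernel h v x y" by (simp add: jump_kernel_def)

lemma jump_kernel_measurable [measurable]:
  fixes v :: "'a::euclidean_space \<Rightarrow> real"
  assumes [measurable]: "v \<in> borel_measurable borel"
  shows "(\<lambda>(x, y). jump_kernel h v x y) \<in> borel_measurable (borel \<Otimes>\<^sub>M borel)"
proof -
  have [measurable]: "cball (0::'a) h \<in> sets borel" by simp
  show ?thesis unfolding jump_kernel_def by measurable
qed

text \<open>Over the four pairs formed by \<open>x\<close>, \<open>y\<close> and their mirror images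
  only two weights occur, one for straight and one for crossed distances. The kernel decreases with
  distance, so the larger weight belongs to points on a common side, as
  \<open>two_point_inequality\<close> demands.\<close>

lemma jump_kernel_polarize:
  fixes w :: "'a::real_inner" and c :: real and v :: "'a \<Rightarrow> real"
  assumes w: "w \<noteq> 0"
  defines "s \<equiv> hrefl w c" and "p \<equiv> polarize w c v"
  shows "jump_kernel h p x y + jump_kernel h p (s x) (s y) + jump_kernel h p x (s y) + jump_kernel h p (s x) y
    \<le> jump_kernel h v x y + jump_kernel h v (s x) (s y) + jump_kernel h v x (s y) + jump_kernel h v (s x) y"
proof -
  define k1 k2 :: real where "k1 = indicator (cball 0 h) (x - y)" and "k2 = indicator (cball 0 h) (x - s y)"
  have n: "norm (s x - s y) = norm (x - y)" "norm (s x - y) = norm (x - s y)" unfolding s_def by (rule dist_hrefl[OF w], rule norm_hrefl_diff[OF w])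
  have k: "indicator (cball 0 h) (s x - s y) = k1" "indicator (cball 0 h) (s x - y) = k2" using n by (auto simp: k1_def k2_def indicator_def)
  have sum: "jump_kernel h f x y + jump_kernel h f (s x) (s y) + jump_kernel h f x (s y) + jump_kernel h f (s x) y =
     ((f x - f y)\<^sup>2 + (f (s x) - f (s y))\<^sup>2) * k1 + ((f x - f (s y))\<^sup>2 + (f (s x) - f y)\<^sup>2) * k2" for f
    by (simp add: jump_kernel_def k) (simp add: k1_def k2_def algebra_simps)
  have nsq: "(norm (x - s y))\<^sup>2 = (norm (x - y))\<^sup>2 + 4 * ((x \<bullet> w - c) * (y \<bullet> w - c)) / (w \<bullet> w)"
    using norm_diff_hrefl_sq[OF w, of x c y] by (simp add: s_def mult.assoc)
  have k12: "k2 \<le> k1" if "0 \<le> (x \<bullet> w - c) * (y \<bullet> w - c)"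
  proof -
    have "(norm (x - y))\<^sup>2 \<le> (norm (x - s y))\<^sup>2" using nsq that w by simp
    then have "norm (x - y) \<le> norm (x - s y)" by (rule power2_le_imp_le) simp
    then show ?thesis by (auto simp: k1_def k2_def indicator_def)
  qed
  have k21: "k1 \<le> k2" if "(x \<bullet> w - c) * (y \<bullet> w - c) \<le> 0"
  proof -
    have "4 * ((x \<bullet> w - c) * (y \<bullet> w - c)) / (w \<bullet> w) \<le> 0" using that w by (simp add: divide_nonpos_pos)
    then have "(norm (x - s y))\<^sup>2 \<le> (norm (x - y))\<^sup>2" using nsq by linarith
    then have "norm (x - s y) \<le> norm (x - y)" by (rule power2_le_imp_le) simp
    then show ?thesis by (auto simp: k1_def k2_def indicator_def)
  qed
  note px = polarize_pair[OF w, of x c v, folded s_def p_def] and py = polarize_pair[OF w, of y c v, folded s_def p_def]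
  note tp = two_point_inequality[of k2 k1 "v x" "v (s x)" "v y" "v (s y)"]
    and tp' = two_point_inequality[of k1 k2 "v x" "v (s x)" "v y" "v (s y)"]
  \<comment> \<open>For points on opposite sides, \<open>y\<close> and its mirror image exchange
    their roles, and with them the two weights.\<close>
  have tp'': "((max (v x) (v (s x)) - min (v y) (v (s y)))\<^sup>2 + (min (v x) (v (s x)) - max (v y) (v (s y)))\<^sup>2) * k1
     + ((max (v x) (v (s x)) - max (v y) (v (s y)))\<^sup>2 + (min (v x) (v (s x)) - min (v y) (v (s y)))\<^sup>2) * k2
     \<le> ((v x - v y)\<^sup>2 + (v (s x) - v (s y))\<^sup>2) * k1 + ((v x - v (s y))\<^sup>2 + (v (s x) - v y)\<^sup>2) * k2" if "k1 \<le> k2"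
    using two_point_inequality[OF that, of "v x" "v (s x)" "v (s y)" "v y"]
    by (simp add: max.commute[of "v (s y)"] min.commute[of "v (s y)"] add.commute)
  show ?thesis
  proof (cases "x \<bullet> w \<le> c"; cases "y \<bullet> w \<le> c")
    assume "x \<bullet> w \<le> c" "y \<bullet> w \<le> c"
    then have "0 \<le> (x \<bullet> w - c) * (y \<bullet> w - c)" by (intro mult_nonpos_nonpos) auto
    then show ?thesis unfolding sum using tp[OF k12] px(1) py(1) \<open>x \<bullet> w \<le> c\<close> \<open>y \<bullet> w \<le> c\<close> by simp
  next
    assume a: "x \<bullet> w \<le> c" "\<not> y \<bullet> w \<le> c"
    then have "(x \<bullet> w - c) * (y \<bullet> w - c) \<le> 0" by (intro mult_nonpos_nonneg) auto
    then show ?thesis unfolding sum using tp''[OF k21] px(1) py(2) a by simp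
  next
    assume a: "\<not> x \<bullet> w \<le> c" "y \<bullet> w \<le> c"
    then have "(x \<bullet> w - c) * (y \<bullet> w - c) \<le> 0" by (intro mult_nonneg_nonpos) auto
    then show ?thesis unfolding sum using tp''[OF k21] px(2) py(1) a by (simp add: add.commute)
  next
    assume a: "\<not> x \<bullet> w \<le> c" "\<not> y \<bullet> w \<le> c"
    then have "0 \<le> (x \<bullet> w - c) * (y \<bullet> w - c)" by (intro mult_nonneg_nonneg) auto
    then show ?thesis unfolding sum using tp[OF k12] px(2) py(2) a by (simp add: add.commute)
  qed
qed

text \<open>Reflecting either variable preserves Lebesgue measure, so all four terms integrate to
  the same energy.\<close>

lemma jump_energy_four:
  fixes c :: real
  assumes w: "w \<noteq> (0::real^4)" and m [measurable]: "v \<in> borel_measurable borel"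
  defines "s \<equiv> hrefl w c"
  shows "(\<integral>\<^sup>+x. (\<integral>\<^sup>+y. ennreal (jump_kernel h v x y + jump_kernel h v (s x) (s y) + jump_kernel h v x (s y) + jump_kernel h v (s x) y) \<partial>lborel) \<partial>lborel)
    = jump_energy h v + jump_energy h v + jump_energy h v + jump_energy h v"
proof -
  have [measurable]: "s \<in> borel_measurable borel" unfolding s_def by (rule borel_measurable_continuous_onI[OF continuous_hrefl])
  have inner: "(\<integral>\<^sup>+y. ennreal (jump_kernel h v z (s y)) \<partial>lborel) = (\<integral>\<^sup>+y. ennreal (jump_kernel h v z y) \<partial>lborel)" for z
    unfolding s_def by (rule nn_integral_hrefl[OF w, of "\<lambda>y. ennreal (jump_kernel h v z y)"]) measurable
  have outer: "(\<integral>\<^sup>+x. (jump_density h v (s x)) \<partial>lborel) = jump_energy h v" unfolding jump_energy_def s_def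
    by (rule nn_integral_hrefl[OF w, of "\<lambda>z. (\<integral>\<^sup>+y. ennreal (jump_kernel h v z y) \<partial>lborel)"]) measurable
  have "(\<integral>\<^sup>+x. (\<integral>\<^sup>+y. ennreal (jump_kernel h v x y + jump_kernel h v (s x) (s y) + jump_kernel h v x (s y) + jump_kernel h v (s x) y) \<partial>lborel) \<partial>lborel)
    = (\<integral>\<^sup>+x. ((jump_density h v x) + (jump_density h v (s x))
        + (jump_density h v x) + (jump_density h v (s x))) \<partial>lborel)"
  proof (rule nn_integral_cong)
    fix x :: "real^4"
    have "(\<integral>\<^sup>+y. ennreal (jump_kernel h v x y + jump_kernel h v (s x) (s y) + jump_kernel h v x (s y) + jump_kernel h v (s x) y) \<partial>lborel)
      = (\<integral>\<^sup>+y. ennreal (jump_kernel h v x y) + ennreal (jump_kernel h v (s x) (s y)) + ennreal (jump_kernel h v x (s y)) + ennreal (jump_kernel h v (s x) y) \<partial>lborel)"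
      by (simp add: jump_kernel_nonneg)
    also have "\<dots> = (jump_density h v x) + (\<integral>\<^sup>+y. ennreal (jump_kernel h v (s x) (s y)) \<partial>lborel)
        + (\<integral>\<^sup>+y. ennreal (jump_kernel h v x (s y)) \<partial>lborel) + (jump_density h v (s x))" by (simp add: nn_integral_add)
    finally show "(\<integral>\<^sup>+y. ennreal (jump_kernel h v x y + jump_kernel h v (s x) (s y) + jump_kernel h v x (s y) + jump_kernel h v (s x) y) \<partial>lborel)
      = (jump_density h v x) + (jump_density h v (s x))
        + (jump_density h v x) + (jump_density h v (s x))" by (simp only: inner)
  qed
  also have "\<dots> = jump_energy h v + jump_energy h v + jump_energy h v + jump_energy h v" by (simp add: nn_integral_add outer) (simp add: jump_energy_def)
  finally show ?thesis .
qed

lemma jump_energy_polarize: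
  assumes w: "w \<noteq> (0::real^4)" and m: "v \<in> borel_measurable borel" "polarize w c v \<in> borel_measurable borel"
  shows "jump_energy h (polarize w c v) \<le> jump_energy h v"
proof -
  have "jump_energy h (polarize w c v) + jump_energy h (polarize w c v) + jump_energy h (polarize w c v) + jump_energy h (polarize w c v)
     \<le> jump_energy h v + jump_energy h v + jump_energy h v + jump_energy h v"
    unfolding jump_energy_four[OF w m(1), of h c, symmetric] jump_energy_four[OF w m(2), of h c, symmetric]
    by (intro nn_integral_mono ennreal_leI jump_kernel_polarize[OF w])
  moreover have "z + z + z + z = 4 * z" for z :: ennreal
  proof -
    have "4 = (1 + 1 + 1 + 1 :: ennreal)" by simp
    then show ?thesis by (simp only: distrib_right mult_1)
  qed
  ultimately have "4 * jump_energy h (polarize w c v) \<le> 4 * jump_energy h v" by simp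
  then show ?thesis using ennreal_mult_le_mult_iff[of 4 "jump_energy h (polarize w c v)" "jump_energy h v"] by simp
qed

text \<open>The hyperplane is the perpendicular bisector of \<open>p\<close> and \<open>q\<close>;
  its offset \<open>c\<close> is positive exactly when \<open>p\<close> is the point nearer to the
  origin.\<close>

lemma hrefl_swap:
  assumes "w = q - p" "c = ((norm q)\<^sup>2 - (norm p)\<^sup>2) / 2" "p \<noteq> q"
  shows "hrefl w c p = q"
proof -
  have "w \<noteq> 0" using assms by simp
  have "p \<bullet> w - c = - (w \<bullet> w) / 2" unfolding assms(1,2) by (simp add: power2_norm_eq_inner inner_simps inner_commute field_simps)
  then have "2 * (p \<bullet> w - c) / (w \<bullet> w) = -1" using \<open>w \<noteq> 0\<close> by (simp add: field_simps)
  then show ?thesis unfolding hrefl_def by (simp only:) (simp add: assms(1))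
qed

section \<open>Existence of a radial competitor\<close>

lemma integral_hrefl:
  fixes f :: "real^4 \<Rightarrow> real"
  assumes "w \<noteq> 0" "integrable lborel f"
  shows "integrable lborel (\<lambda>x. f (hrefl w c x))" "(LINT x|lborel. f (hrefl w c x)) = (LINT x|lborel. f x)"
proof -
  have m: "hrefl w c \<in> borel_measurable borel" by (rule borel_measurable_continuous_onI[OF continuous_hrefl])
  have i: "integrable (distr lborel borel (hrefl w c)) f" by (simp only: distr_lborel_hrefl[OF assms(1)] assms(2))
  show "integrable lborel (\<lambda>x. f (hrefl w c x))" using integrable_distr[of "hrefl w c" lborel borel f] m i by simp
  have "(LINT x|distr lborel borel (hrefl w c). f x) = (LINT x|lborel. f (hrefl w c x))" using m assms(2) by (intro integral_distr) auto
  then show "(LINT x|lborel. f (hrefl w c x)) = (LINT x|lborel. f x)" by (simp only: distr_lborel_hrefl[OF assms(1)])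
qed

lemma lipschitz_continuous_on_UNIV:
  fixes v :: "'a::real_normed_vector \<Rightarrow> real"
  assumes "\<And>x y. \<bar>v x - v y\<bar> \<le> L * norm (x - y)" "L \<ge> 0"
  shows "continuous_on UNIV v"
proof -
  have "L-lipschitz_on UNIV v" by (rule lipschitz_onI) (use assms in \<open>simp_all only: dist_norm real_norm_def\<close>)
  then show ?thesis by (rule lipschitz_on_continuous_on)
qed

text \<open>A variational choice takes the place of rearranging level sets. In the class of
  functions with these bounds, the same \<open>L^4\<close> integral and no larger
  \<open>jump_energy\<close> at any scale, a maximizer of a Gaussian-weighted integral exists by
  Arzela-Ascoli. Polarizing it stays in the class and would raise the weighted integral, unless
  larger values already lie nearer to the origin.\<close>

lemma radial_competitor:
  fixes u :: "real^4 \<Rightarrow> real"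
  assumes u: "\<And>x. 0 \<le> u x" "\<And>x y. \<bar>u x - u y\<bar> \<le> L * norm (x - y)" "\<And>x. R < norm x \<Longrightarrow> u x = 0"
    and LR: "L \<ge> 0" "R > 0"
  obtains v :: "real^4 \<Rightarrow> real" where "\<And>x. 0 \<le> v x" "\<And>x y. \<bar>v x - v y\<bar> \<le> L * norm (x - y)" "\<And>x. R < norm x \<Longrightarrow> v x = 0"
    "\<And>p q. norm p = norm q \<Longrightarrow> v p = v q"
    "(nn_pow4 lborel v) = (nn_pow4 lborel u)"
    "\<And>h. jump_energy h v \<le> jump_energy h u"
proof -
  define K :: "(real^4 \<Rightarrow> real) set" where "K = {v. (\<forall>x. 0 \<le> v x) \<and> (\<forall>x y. \<bar>v x - v y\<bar> \<le> L * norm (x - y)) \<and> (\<forall>x. R < norm x \<longrightarrow> v x = 0)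
     \<and> (nn_pow4 lborel v) = (nn_pow4 lborel u)
     \<and> (\<forall>h. jump_energy h v \<le> jump_energy h u)}"
  \<comment> \<open>Strict radial decrease is the property that matters: it turns equality of the
    weighted integrals into equality of values on mirror pairs at different distances from the
    origin.\<close>
  define g :: "real^4 \<Rightarrow> real" where "g x = exp (- (norm x)\<^sup>2)" for x
  define P where "P v = (LINT x|lborel. v x * g x)" for v :: "real^4 \<Rightarrow> real"
  \<comment> \<open>A common bound for the class: each value is compared with the value 0 taken at
    distance \<open>R + 1\<close> from the origin.\<close>
  define B where "B = L * (2 * R + 1)"
  have B0: "B \<ge> 0" using LR by (simp add: B_def)
  have gm: "continuous_on UNIV g" unfolding g_def by (intro continuous_intros)
  have g01: "0 < g x" "g x \<le> 1" for x by (simp_all add: g_def)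
  have uK: "u \<in> K" using u by (simp add: K_def)
  have KD: "0 \<le> v x" "\<bar>v x - v y\<bar> \<le> L * norm (x - y)" "R < norm x \<Longrightarrow> v x = 0"
     "(nn_pow4 lborel v) = (nn_pow4 lborel u)" "jump_energy h v \<le> jump_energy h u"
    if "v \<in> K" for v x y h using that unfolding K_def by blast+
  have Kc: "continuous_on UNIV v" if "v \<in> K" for v by (rule lipschitz_continuous_on_UNIV[OF KD(2)[OF that] LR(1)])
  have KB: "v x \<le> B" if "v \<in> K" for v x
  proof (cases "R < norm x")
    case False
    obtain b :: "real^4" where b: "b \<in> Basis" using nonempty_Basis by blast
    define y where "y = (R + 1) *\<^sub>R b"
    have ny: "norm y = R + 1" using b LR by (simp add: y_def)
    have "v x = \<bar>v x - v y\<bar>" using KD(1,3)[OF that] ny by simp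
    also have "\<dots> \<le> L * norm (x - y)" by (rule KD(2)[OF that])
    also have "\<dots> \<le> L * (2 * R + 1)" using LR False ny norm_triangle_ineq4[of x y] by (intro mult_left_mono) auto
    finally show ?thesis by (simp add: B_def)
  qed (use KD(3)[OF that] B0 in simp)
  define W where "W = (\<lambda>x::real^4. B * indicator (cball 0 R) x)"
  have Wi: "integrable lborel W" unfolding W_def using emeasure_lborel_cball_finite[of "0::real^4" R]
    by (intro integrable_mult_right integrable_real_indicator) auto
  have Kg: "integrable lborel (\<lambda>x. v x * g x)" "\<bar>v x * g x\<bar> \<le> W x" if "v \<in> K" for v x
  proof -
    show bd: "\<bar>v x * g x\<bar> \<le> W x" for x
    proof (cases "R < norm x")
      case False
      have "\<bar>v x * g x\<bar> = v x * g x" using KD(1)[OF that, of x] g01[of x] by simp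
      also have "\<dots> \<le> B * 1" using KB[OF that, of x] KD(1)[OF that, of x] g01[of x] B0 by (intro mult_mono) auto
      finally show ?thesis using False by (simp add: W_def)
    qed (use KD(3)[OF that] B0 in \<open>simp add: W_def\<close>)
    show "integrable lborel (\<lambda>x. v x * g x)"
    proof (rule Bochner_Integration.integrable_bound[OF Wi])
      have "continuous_on UNIV (\<lambda>x. v x * g x)" by (intro continuous_intros Kc[OF that] gm)
      then show "(\<lambda>x. v x * g x) \<in> borel_measurable lborel" by (auto intro: borel_measurable_continuous_onI)
      show "AE x in lborel. norm (v x * g x) \<le> norm (W x)" by (rule AE_I2) (simp only: real_norm_def order_trans[OF bd abs_ge_self])
    qed
  qed
  have PB: "P v \<le> (LINT x|lborel. W x)" if "v \<in> K" for v unfolding P_def using Kg[OF that] by (intro integral_mono Wi) (auto intro: abs_le_D1)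
  define s where "s = Sup (P ` K)"
  have bdd: "bdd_above (P ` K)" by (rule bdd_aboveI[of _ "LINT x|lborel. W x"]) (use PB in auto)
  have "\<exists>v\<in>K. s - 1 / real (Suc n) < P v" for n
  proof -
    have "s - 1 / real (Suc n) < Sup (P ` K)" by (simp add: s_def)
    then show ?thesis using less_cSup_iff[of "P ` K" "s - 1 / real (Suc n)"] uK bdd by auto
  qed
  then obtain V :: "nat \<Rightarrow> real^4 \<Rightarrow> real" where V: "\<And>n. V n \<in> K" "\<And>n. s - 1 / real (Suc n) < P (V n)" by metis
  obtain G k where k: "strict_mono (k :: nat \<Rightarrow> nat)"
    "\<And>e. 0 < e \<Longrightarrow> \<exists>N. \<forall>n x. n \<ge> N \<and> x \<in> cball 0 R \<longrightarrow> norm (V (k n) x - G x) < e"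
  proof (rule Arzela_Ascoli[of "cball (0::real^4) R" V B])
    show "norm (V n x) \<le> B" for n x using KB[OF V(1)] KD(1)[OF V(1)] by simp
    fix x :: "real^4" and e :: real assume "0 < e"
    have "norm (V n x - V n y) < e" if "norm (x - y) < e / (L + 1)" for n y
    proof -
      have "norm (V n x - V n y) \<le> L * norm (x - y)" using KD(2)[OF V(1)] by simp
      also have "\<dots> \<le> (L + 1) * norm (x - y)" by (intro mult_right_mono) auto
      also have "\<dots> < (L + 1) * (e / (L + 1))" using that LR by (intro mult_strict_left_mono) auto
      finally show ?thesis using LR by simp
    qed
    then show "\<exists>d>0. \<forall>n y. y \<in> cball 0 R \<and> norm (x - y) < d \<longrightarrow> norm (V n x - V n y) < e" using LR \<open>0 < e\<close> by (intro exI[of _ "e / (L + 1)"]) auto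
  qed (auto intro: that)
  define v where "v x = (if norm x \<le> R then G x else 0)" for x
  have lim: "(\<lambda>n. V (k n) x) \<longlonglongrightarrow> v x" for x
  proof (cases "norm x \<le> R")
    case True
    show ?thesis
    proof (rule LIMSEQ_I)
      fix e :: real assume "0 < e"
      from k(2)[OF this] show "\<exists>N. \<forall>n\<ge>N. norm (V (k n) x - v x) < e" using True by (auto simp: v_def)
    qed
  next
    case False
    then show ?thesis using KD(3)[OF V(1), of x] by (simp add: v_def)
  qed
  have [measurable]: "cball (0::real^4) R \<in> sets borel" by simp
  have Vm [measurable]: "V n \<in> borel_measurable borel" for n by (rule borel_measurable_continuous_onI[OF Kc[OF V(1)]])
  have v1: "0 \<le> v x" for x by (rule LIMSEQ_le_const[OF lim]) (use KD(1)[OF V(1)] in auto)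
  have v2: "\<bar>v x - v y\<bar> \<le> L * norm (x - y)" for x y
    by (rule LIMSEQ_le_const2[OF tendsto_rabs[OF tendsto_diff[OF lim lim]]]) (use KD(2)[OF V(1)] in auto)
  have v3: "v x = 0" if "R < norm x" for x using that by (simp add: v_def)
  have vc: "continuous_on UNIV v" by (rule lipschitz_continuous_on_UNIV[OF v2 LR(1)])
  have vm [measurable]: "v \<in> borel_measurable borel" by (rule borel_measurable_continuous_onI[OF vc])
  \<comment> \<open>The \<open>L^4\<close> integral must be preserved exactly, hence dominated
    convergence; for the energies lower semicontinuity is enough.\<close>
  have v4: "(nn_pow4 lborel v) = (nn_pow4 lborel u)"
  proof -
    have "(\<lambda>n. \<integral>\<^sup>+x. ennreal ((V (k n) x) ^ 4) \<partial>lborel) \<longlonglongrightarrow> (nn_pow4 lborel v)"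
    proof (rule nn_integral_dominated_convergence[where w="\<lambda>x. ennreal (B ^ 4 * indicator (cball 0 R) x)"])
      show "(\<integral>\<^sup>+x. ennreal (B ^ 4 * indicator (cball (0::real^4) R) x) \<partial>lborel) < \<infinity>"
      proof -
        have "(\<integral>\<^sup>+x. ennreal (B ^ 4 * indicator (cball (0::real^4) R) x) \<partial>lborel) = (\<integral>\<^sup>+x. ennreal (B ^ 4) * indicator (cball (0::real^4) R) x \<partial>lborel)"
          by (intro nn_integral_cong) (auto simp: indicator_def)
        also have "\<dots> = ennreal (B ^ 4) * emeasure lborel (cball (0::real^4) R)" by (simp add: nn_integral_cmult_indicator)
        also have "\<dots> < \<infinity>" using emeasure_lborel_cball_finite[of "0::real^4" R] by (simp add: ennreal_mult_less_top)
        finally show ?thesis .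
      qed
      show "AE x in lborel. ennreal ((V (k n) x) ^ 4) \<le> ennreal (B ^ 4 * indicator (cball 0 R) x)" for n
      proof (rule AE_I2)
        fix x :: "real^4"
        show "ennreal ((V (k n) x) ^ 4) \<le> ennreal (B ^ 4 * indicator (cball 0 R) x)"
          using KB[OF V(1)[of "k n"], of x] KD(1)[OF V(1)[of "k n"], of x] KD(3)[OF V(1)[of "k n"], of x]
          by (cases "R < norm x") (auto intro!: ennreal_leI power_mono)
      qed
      show "AE x in lborel. (\<lambda>n. ennreal ((V (k n) x) ^ 4)) \<longlonglongrightarrow> ennreal ((v x) ^ 4)" by (intro AE_I2 tendsto_ennrealI tendsto_power lim)
    qed measurable
    then show ?thesis using KD(4)[OF V(1)] by (simp add: LIMSEQ_const_iff)
  qed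
  have v5: "jump_energy h v \<le> jump_energy h u" for h
  proof -
    have pw: "ennreal (jump_kernel h v x y) = liminf (\<lambda>n. ennreal (jump_kernel h (V (k n)) x y))" for x y :: "real^4"
    proof -
      have "(\<lambda>n. ennreal (jump_kernel h (V (k n)) x y)) \<longlonglongrightarrow> ennreal (jump_kernel h v x y)"
        unfolding jump_kernel_def by (intro tendsto_ennrealI tendsto_mult tendsto_power tendsto_diff lim tendsto_const)
      from lim_imp_Liminf[OF trivial_limit_sequentially this] show ?thesis by (simp only:)
    qed
    have "jump_energy h v \<le> (\<integral>\<^sup>+x. liminf (\<lambda>n. \<integral>\<^sup>+y. ennreal (jump_kernel h (V (k n)) x y) \<partial>lborel) \<partial>lborel)"
      unfolding jump_energy_def pw by (intro nn_integral_mono nn_integral_liminf) measurable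
    also have "\<dots> \<le> liminf (\<lambda>n. jump_energy h (V (k n)))" unfolding jump_energy_def by (intro nn_integral_liminf) measurable
    also have "\<dots> \<le> liminf (\<lambda>n. jump_energy h u)" by (intro Liminf_mono always_eventually allI KD(5)[OF V(1)])
    finally show ?thesis by (simp add: Liminf_const)
  qed
  have vK: "v \<in> K" unfolding K_def using v1 v2 v3 v4 v5 by blast
  have Pv: "P v = s"
  proof -
    have "(\<lambda>n. P (V (k n))) \<longlonglongrightarrow> P v" unfolding P_def
    proof (rule integral_dominated_convergence[where w=W])
      show "AE x in lborel. (\<lambda>n. V (k n) x * g x) \<longlonglongrightarrow> v x * g x" by (intro AE_I2 tendsto_mult lim tendsto_const)
      show "AE x in lborel. norm (V (k n) x * g x) \<le> W x" for n using Kg(2)[OF V(1)] by (intro AE_I2) simp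
    qed (use Kg(1)[OF vK] Kg(1)[OF V(1)] Wi in auto)
    moreover have "(\<lambda>n. P (V (k n))) \<longlonglongrightarrow> s"
    proof (rule tendsto_sandwich[OF _ _ _ tendsto_const])
      show "\<forall>\<^sub>F n in sequentially. P (V (k n)) \<le> s" unfolding s_def by (intro always_eventually allI cSup_upper bdd) (use V(1) in auto)
      show "\<forall>\<^sub>F n in sequentially. s - inverse (real (Suc n)) \<le> P (V (k n))"
      proof (intro always_eventually allI)
        fix n
        have "1 / real (Suc (k n)) \<le> 1 / real (Suc n)" using seq_suble[OF k(1), of n] by (intro divide_left_mono) auto
        then show "s - inverse (real (Suc n)) \<le> P (V (k n))" using V(2)[of "k n"] by (simp add: inverse_eq_divide)
      qed
      have "(\<lambda>n. s - inverse (real (Suc n))) \<longlonglongrightarrow> s - 0" by (intro tendsto_intros LIMSEQ_inverse_real_of_nat)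
      then show "(\<lambda>n. s - inverse (real (Suc n))) \<longlonglongrightarrow> s" by simp
    qed
    ultimately show ?thesis by (rule LIMSEQ_unique)
  qed
  \<comment> \<open>Polarize with respect to the bisector of \<open>p\<close> and \<open>q\<close>.
    The side of \<open>p\<close> contains the origin, and maximality leaves the value at
    \<open>p\<close> unchanged, so it was already the larger one.\<close>
  have mono: "v q \<le> v p" if pq: "norm p < norm q" for p q
  proof -
    define w where "w = q - p"
    define c where "c = ((norm q)\<^sup>2 - (norm p)\<^sup>2) / 2"
    have "p \<noteq> q" using pq by auto
    then have w: "w \<noteq> 0" by (simp add: w_def)
    have "(norm p)\<^sup>2 < (norm q)\<^sup>2" using pq by (intro power_strict_mono) auto
    then have c: "c > 0" by (simp add: c_def)
    define \<tau> where "\<tau> = hrefl w c"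
    define z where "z = polarize w c v"
    have \<tau>p: "\<tau> p = q" unfolding \<tau>_def by (rule hrefl_swap[OF w_def c_def \<open>p \<noteq> q\<close>])
    have z2: "\<bar>z x - z y\<bar> \<le> L * norm (x - y)" for x y unfolding z_def by (rule polarize_lipschitz[OF w v2 LR(1)])
    have zc: "continuous_on UNIV z" by (rule lipschitz_continuous_on_UNIV[OF z2 LR(1)])
    have zm [measurable]: "z \<in> borel_measurable borel" by (rule borel_measurable_continuous_onI[OF zc])
    have \<tau>c: "continuous_on UNIV \<tau>" unfolding \<tau>_def by (rule continuous_hrefl)
    have \<tau>m [measurable]: "\<tau> \<in> borel_measurable borel" by (rule borel_measurable_continuous_onI[OF \<tau>c])
    note pair = polarize_pair[OF w, of _ c v, folded \<tau>_def z_def]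
    have z4: "(nn_pow4 lborel z) = (nn_pow4 lborel v)"
    proof -
      have two: "(\<integral>\<^sup>+x. ennreal ((f x) ^ 4) + ennreal ((f (\<tau> x)) ^ 4) \<partial>lborel) = 2 * (nn_pow4 lborel f)"
        if [measurable]: "f \<in> borel_measurable borel" for f :: "real^4 \<Rightarrow> real"
      proof -
        have "(\<integral>\<^sup>+x. ennreal ((f (\<tau> x)) ^ 4) \<partial>lborel) = (nn_pow4 lborel f)"
          unfolding \<tau>_def by (rule nn_integral_hrefl[OF w, of "\<lambda>x. ennreal ((f x) ^ 4)"]) measurable
        then show ?thesis by (subst nn_integral_add) (auto simp: mult_2)
      qed
      have "ennreal ((z x) ^ 4) + ennreal ((z (\<tau> x)) ^ 4) = ennreal ((v x) ^ 4) + ennreal ((v (\<tau> x)) ^ 4)" for x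
        using pair[of x] by (cases "x \<bullet> w \<le> c"; cases "v x \<le> v (\<tau> x)") (auto simp: max_def min_def add.commute)
      then have "2 * (nn_pow4 lborel z) = 2 * (nn_pow4 lborel v)" using two[OF zm] two[OF vm] by simp
      then show ?thesis by (subst (asm) ennreal_mult_cancel_left) auto
    qed
    have zK: "z \<in> K" unfolding K_def
    proof (intro CollectI conjI allI impI z2)
      show "0 \<le> z x" for x using v1[of x] v1[of "\<tau> x"] by (auto simp: z_def polarize_def \<tau>_def max_def)
      show "z x = 0" if "R < norm x" for x unfolding z_def by (rule polarize_support[OF w _ v1 v3 that]) (use c in auto)
      show "(nn_pow4 lborel z) = (nn_pow4 lborel u)" using z4 v4 by simp
      show "jump_energy h z \<le> jump_energy h u" for h
        using jump_energy_polarize[OF w vm, of c h] zm v5[of h] unfolding z_def by (auto intro: order_trans)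
    qed
    \<comment> \<open>Grouping each point with its mirror image makes the gain in the weighted
      integral pointwise nonnegative. Maximality forces its integral, and by continuity the function
      itself, to vanish.\<close>
    define D where "D x = (z x * g x + z (\<tau> x) * g (\<tau> x)) - (v x * g x + v (\<tau> x) * g (\<tau> x))" for x
    have Dpos: "0 \<le> D x" for x
    proof (cases "x \<bullet> w \<le> c")
      case True
      then have "norm x \<le> norm (\<tau> x)" unfolding \<tau>_def using c by (intro norm_le_hrefl[OF w]) auto
      then have "g (\<tau> x) \<le> g x" by (simp add: g_def power_mono)
      moreover have "D x = (z x - v x) * (g x - g (\<tau> x))" using pair(1)[OF True] by (auto simp: D_def max_def min_def algebra_simps)
      moreover have "z x - v x \<ge> 0" using pair(1)[OF True] by simp
      ultimately show ?thesis by simp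
    next
      case False
      have "\<tau> x \<bullet> w \<le> c" using hrefl_inner[OF w, of c x] False by (simp add: \<tau>_def)
      then have "norm (\<tau> x) \<le> norm x" using norm_le_hrefl[OF w, of c "\<tau> x"] c hrefl_hrefl[OF w, of c x] by (simp add: \<tau>_def)
      then have "g x \<le> g (\<tau> x)" by (simp add: g_def power_mono)
      moreover have "D x = (z (\<tau> x) - v (\<tau> x)) * (g (\<tau> x) - g x)" using pair(2)[OF False] by (auto simp: D_def max_def min_def algebra_simps)
      moreover have "z (\<tau> x) - v (\<tau> x) \<ge> 0" using pair(2)[OF False] by simp
      ultimately show ?thesis by simp
    qed
    have i: "integrable lborel (\<lambda>x. f x * g x)" "integrable lborel (\<lambda>x. f (\<tau> x) * g (\<tau> x))"
      "(LINT x|lborel. f (\<tau> x) * g (\<tau> x)) = P f" if "f \<in> K" for f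
      using Kg(1)[OF that] integral_hrefl[OF w Kg(1)[OF that], of c] by (simp_all add: \<tau>_def P_def)
    have Di: "integrable lborel D" unfolding D_def using i[OF zK] i[OF vK] by simp
    have "(LINT x|lborel. D x) = 2 * (P z - P v)" unfolding D_def using i[OF zK] i[OF vK] by (simp add: P_def[symmetric])
    also have "P z \<le> P v" unfolding Pv s_def by (rule cSup_upper[OF _ bdd]) (use zK in auto)
    finally have "(LINT x|lborel. D x) \<le> 0" by simp
    moreover have "(LINT x|lborel. D x) \<ge> 0" using Dpos by simp
    ultimately have "(LINT x|lborel. D x) = 0" by (rule antisym)
    then have "AE x in lborel. D x = 0" using integral_nonneg_eq_0_iff_AE[OF Di] Dpos by simp
    then have "AE x in lebesgue. D x = 0" by (rule AE_completion)
    moreover have "continuous_on UNIV D"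
      unfolding D_def by (intro continuous_intros zc vc gm continuous_on_compose2[OF zc \<tau>c] continuous_on_compose2[OF vc \<tau>c] continuous_on_compose2[OF gm \<tau>c]) auto
    ultimately have D0: "D p = 0" using continuous_AE_zero by blast
    have "2 * (p \<bullet> w - c) = - (w \<bullet> w)" unfolding w_def c_def by (simp add: power2_norm_eq_inner inner_simps inner_commute field_simps)
    then have "2 * (p \<bullet> w - c) \<le> 0" by (simp only: neg_le_0_iff_le inner_ge_zero)
    then have pH: "p \<bullet> w \<le> c" by simp
    have "D p = (z p - v p) * (g p - g q)" using pair(1)[OF pH] \<tau>p by (auto simp: D_def max_def min_def algebra_simps)
    moreover have "g q < g p" using \<open>(norm p)\<^sup>2 < (norm q)\<^sup>2\<close> by (simp add: g_def)
    ultimately have "z p = v p" using D0 by simp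
    then show ?thesis using pair(1)[OF pH] \<tau>p by simp
  qed
  have le: "v q \<le> v p" if pq: "norm p = norm q" for p q
  proof (cases "p = 0")
    case False
    show ?thesis
    proof (rule field_le_epsilon)
      fix e :: real assume "e > 0"
      \<comment> \<open>Points of equal norm are reached from the strict case by pulling
        \<open>p\<close> slightly towards the origin; the Lipschitz bound keeps the loss below
        \<open>e\<close>.\<close>
      define t where "t = min 1 (e / (L * norm p + 1))"
      have pos: "L * norm p + 1 > 0" using LR by (simp add: add_nonneg_pos)
      have t: "0 < t" "t \<le> 1" "t \<le> e / (L * norm p + 1)" using \<open>e > 0\<close> pos by (simp_all add: t_def)
      have "(1 - t) * norm p < 1 * norm p" using t(1) False by (intro mult_strict_right_mono) auto
      then have "norm ((1 - t) *\<^sub>R p) < norm q" using t(1,2) pq by simp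
      then have "v q \<le> v ((1 - t) *\<^sub>R p)" by (rule mono)
      also have "\<dots> \<le> v p + L * norm ((1 - t) *\<^sub>R p - p)" using v2[of "(1 - t) *\<^sub>R p" p] by simp
      also have "(1 - t) *\<^sub>R p - p = - (t *\<^sub>R p)" by (simp add: algebra_simps)
      also have "L * norm (- (t *\<^sub>R p)) = t * (L * norm p)" using t by simp
      also have "t * (L * norm p) \<le> t * (L * norm p + 1)" using t by simp
      also have "\<dots> \<le> e" using t(3) pos by (simp add: field_simps)
      finally show "v q \<le> v p + e" by simp
    qed
  qed (use pq in simp)
  have veq: "v p = v q" if "norm p = norm q" for p q using le[of p q] le[of q p] that by simp
  show ?thesis by (rule that[of v], fact v1, fact v2, fact v3, fact veq, fact v4, fact v5)
qed

section \<open>From nonlocal energies back to gradients\<close>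

lemma nn_integral_lborel_affine:
  fixes F :: "'a::euclidean_space \<Rightarrow> ennreal"
  assumes [measurable]: "F \<in> borel_measurable borel" and "h > 0"
  shows "(\<integral>\<^sup>+y. F y \<partial>lborel) = ennreal (h ^ DIM('a)) * (\<integral>\<^sup>+z. F (t + h *\<^sub>R z) \<partial>lborel)"
proof -
  have "(\<integral>\<^sup>+y. F y \<partial>lborel) = (\<integral>\<^sup>+y. F y \<partial>density (distr lborel borel (\<lambda>x. t + h *\<^sub>R x)) (\<lambda>_. ennreal (\<bar>h\<bar> ^ DIM('a))))"
    using lborel_affine[of h t] assms(2) by simp
  also have "\<dots> = (\<integral>\<^sup>+z. ennreal (\<bar>h\<bar> ^ DIM('a)) * F (t + h *\<^sub>R z) \<partial>lborel)" by (simp add: nn_integral_density nn_integral_distr)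
  finally show ?thesis using assms(2) by (simp add: nn_integral_cmult)
qed

text \<open>The form of \<open>jump_energy\<close> after the substitution
  \<open>y = x + h z\<close>, with the volume factor removed. Divided by \<open>h^2\<close> it
  approximates, for small \<open>h\<close>, the Dirichlet integral times a fixed moment of the
  ball.\<close>

definition diff_energy :: "real \<Rightarrow> ('a::euclidean_space \<Rightarrow> real) \<Rightarrow> ennreal" where
  "diff_energy h v = (\<integral>\<^sup>+x. (\<integral>\<^sup>+z. ennreal ((v (x + h *\<^sub>R z) - v x)\<^sup>2) * indicator (cball 0 1) z \<partial>lborel) \<partial>lborel)"

lemma jump_energy_eq_diff_energy:
  fixes v :: "'a::euclidean_space \<Rightarrow> real"
  assumes [measurable]: "v \<in> borel_measurable borel" and h: "h > 0"
  shows "jump_energy h v = ennreal (h ^ DIM('a)) * diff_energy h v"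
proof -
  have [measurable]: "cball (0::'a) h \<in> sets borel" "cball (0::'a) 1 \<in> sets borel" by simp_all
  have "(jump_density h v x) =
    ennreal (h ^ DIM('a)) * (\<integral>\<^sup>+z. ennreal ((v (x + h *\<^sub>R z) - v x)\<^sup>2) * indicator (cball 0 1) z \<partial>lborel)" for x
  proof -
    have "(jump_density h v x) = ennreal (h ^ DIM('a)) * (\<integral>\<^sup>+z. ennreal (jump_kernel h v x (x + h *\<^sub>R z)) \<partial>lborel)"
      by (rule nn_integral_lborel_affine[OF _ h]) measurable
    also have "(\<integral>\<^sup>+z. ennreal (jump_kernel h v x (x + h *\<^sub>R z)) \<partial>lborel) = (\<integral>\<^sup>+z. ennreal ((v (x + h *\<^sub>R z) - v x)\<^sup>2) * indicator (cball 0 1) z \<partial>lborel)"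
      using h by (intro nn_integral_cong) (auto simp: jump_kernel_def indicator_def power2_commute)
    finally show ?thesis .
  qed
  then show ?thesis unfolding jump_energy_def diff_energy_def by (subst nn_integral_cmult[symmetric]) (auto intro!: nn_integral_cong)
qed

lemma diff_energy_le_of_jump_energy_le:
  fixes v u :: "'a::euclidean_space \<Rightarrow> real"
  assumes "v \<in> borel_measurable borel" "u \<in> borel_measurable borel" "h > 0" "jump_energy h v \<le> jump_energy h u"
  shows "diff_energy h v \<le> diff_energy h u"
  using assms(4) assms(3) unfolding jump_energy_eq_diff_energy[OF assms(1,3)] jump_energy_eq_diff_energy[OF assms(2,3)]
  by (subst (asm) ennreal_mult_le_mult_iff) auto

text \<open>Second moment of the unit ball in one direction. Only its positivity and finiteness
  count, since it cancels between the upper and the lower estimate.\<close>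

definition isotropy_const :: ennreal where
  "isotropy_const = (\<integral>\<^sup>+z. ennreal ((axis 1 1 \<bullet> z)\<^sup>2) * indicator (cball 0 1) z \<partial>(lborel :: (real^4) measure))"

lemma hrefl_0_inner: "hrefl w 0 a \<bullet> z = a \<bullet> hrefl w 0 z"
  by (simp add: hrefl_def inner_diff_left inner_diff_right inner_commute)

text \<open>A reflection carries \<open>a\<close> to \<open>norm a *\<^sub>R axis 1 1\<close> and
  preserves both the ball and the measure.\<close>

lemma isotropy:
  fixes a :: "real^4"
  shows "(\<integral>\<^sup>+z. ennreal ((a \<bullet> z)\<^sup>2) * indicator (cball 0 1) z \<partial>lborel) = ennreal ((norm a)\<^sup>2) * isotropy_const"
proof -
  define b :: "real^4" where "b = norm a *\<^sub>R axis 1 1"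
  have nb: "norm b = norm a" by (simp add: b_def)
  have [measurable]: "cball (0::real^4) 1 \<in> sets borel" by simp
  have "(\<integral>\<^sup>+z. ennreal ((a \<bullet> z)\<^sup>2) * indicator (cball 0 1) z \<partial>lborel) = (\<integral>\<^sup>+z. ennreal ((b \<bullet> z)\<^sup>2) * indicator (cball 0 1) z \<partial>lborel)"
  proof (cases "a = b")
    case False
    define w where "w = b - a"
    have w: "w \<noteq> 0" using False by (simp add: w_def)
    have wa: "hrefl w 0 a = b" by (rule hrefl_swap[OF w_def _ False]) (simp add: nb)
    then have wb: "hrefl w 0 b = a" using hrefl_hrefl[OF w, of 0 a] by simp
    have nh: "norm (hrefl w 0 z) = norm z" for z using dist_hrefl[OF w, of 0 z 0] by (simp add: hrefl_def)
    have "(\<integral>\<^sup>+z. ennreal ((b \<bullet> z)\<^sup>2) * indicator (cball 0 1) z \<partial>lborel) =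
       (\<integral>\<^sup>+z. ennreal ((b \<bullet> hrefl w 0 z)\<^sup>2) * indicator (cball 0 1) (hrefl w 0 z) \<partial>lborel)"
      by (rule nn_integral_hrefl[OF w, of "\<lambda>z. ennreal ((b \<bullet> z)\<^sup>2) * indicator (cball 0 1) z", symmetric]) measurable
    also have "\<dots> = (\<integral>\<^sup>+z. ennreal ((a \<bullet> z)\<^sup>2) * indicator (cball 0 1) z \<partial>lborel)"
      unfolding hrefl_0_inner[symmetric] wb by (intro nn_integral_cong) (auto simp: indicator_def nh)
    finally show ?thesis by simp
  qed simp
  also have "\<dots> = (\<integral>\<^sup>+z. ennreal ((norm a)\<^sup>2) * (ennreal (((axis 1 1 :: real^4) \<bullet> z)\<^sup>2) * indicator (cball 0 1) z) \<partial>lborel)"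
    by (intro nn_integral_cong) (simp add: b_def power_mult_distrib ennreal_mult mult.assoc)
  also have "\<dots> = ennreal ((norm a)\<^sup>2) * isotropy_const" unfolding isotropy_const_def by (rule nn_integral_cmult) measurable
  finally show ?thesis .
qed

lemma isotropy_const_pos: "isotropy_const \<noteq> 0" "isotropy_const < \<infinity>"
proof -
  have [measurable]: "cball (0::real^4) 1 \<in> sets borel" by simp
  define e :: "real^4" where "e = axis 1 1"
  have ne: "norm e = 1" by (simp add: e_def)
  show "isotropy_const \<noteq> 0"
  proof
    assume "isotropy_const = 0"
    then have "AE z in lborel. ennreal ((e \<bullet> z)\<^sup>2) * indicator (cball 0 1) z = 0"
      unfolding isotropy_const_def e_def[symmetric] by (subst (asm) nn_integral_0_iff_AE) auto
    then have "AE z in lborel. (e \<bullet> z)\<^sup>2 * max 0 (1 - norm z) = 0" by eventually_elim (auto simp: indicator_def max_def split: if_splits)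
    then have "AE z in lebesgue. (e \<bullet> z)\<^sup>2 * max 0 (1 - norm z) = 0" by (rule AE_completion)
    moreover have "continuous_on UNIV (\<lambda>z. (e \<bullet> z)\<^sup>2 * max 0 (1 - norm z))" by (intro continuous_intros)
    ultimately have "(e \<bullet> ((1/2) *\<^sub>R e))\<^sup>2 * max 0 (1 - norm ((1/2) *\<^sub>R e)) = 0"
      using continuous_AE_zero[of "\<lambda>z. (e \<bullet> z)\<^sup>2 * max 0 (1 - norm z)" 0] by blast
    then show False using ne by (simp add: norm_eq_1 norm_eq_sqrt_inner)
  qed
  have "isotropy_const \<le> (\<integral>\<^sup>+z. indicator (cball 0 1) z \<partial>(lborel :: (real^4) measure))" unfolding isotropy_const_def e_def[symmetric]
  proof (intro nn_integral_mono)
    fix z :: "real^4"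
    show "ennreal ((e \<bullet> z)\<^sup>2) * indicator (cball 0 1) z \<le> indicator (cball 0 1) z"
    proof (cases "norm z \<le> 1")
      case True
      have "\<bar>e \<bullet> z\<bar> \<le> 1" using Cauchy_Schwarz_ineq2[of e z] True ne by simp
      then have "(e \<bullet> z)\<^sup>2 \<le> 1" by (simp add: abs_square_le_1)
      then have "ennreal ((e \<bullet> z)\<^sup>2) \<le> ennreal 1" by (rule ennreal_leI)
      then show ?thesis by (simp add: indicator_def)
    qed (simp add: indicator_def)
  qed
  also have "\<dots> < \<infinity>" using emeasure_lborel_cball_finite[of "0::real^4" 1] by simp
  finally show "isotropy_const < \<infinity>" .
qed

text \<open>Valid at every scale with the exact limiting constant, because
  \<open>translation_estimate\<close> keeps the direction and \<open>isotropy\<close> averages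
  it.\<close>

lemma diff_energy_test_function:
  fixes u :: "real^4 \<Rightarrow> real"
  assumes u: "u \<in> test_functions \<Omega>" and h: "h \<ge> 0"
  shows "diff_energy h u \<le> ennreal (h\<^sup>2) * (isotropy_const * (nn_sq (grad u)))"
proof -
  have [measurable]: "u \<in> borel_measurable borel" "grad u \<in> borel_measurable borel" "cball (0::real^4) 1 \<in> sets borel"
    using test_function_continuous[OF u] by (auto intro: borel_measurable_continuous_onI)
  have "diff_energy h u = (\<integral>\<^sup>+z. (\<integral>\<^sup>+x. ennreal ((u (x + h *\<^sub>R z) - u x)\<^sup>2) * indicator (cball 0 1) z \<partial>lborel) \<partial>lborel)"
    unfolding diff_energy_def by (rule lborel_pair.Fubini') measurable
  also have "\<dots> \<le> (\<integral>\<^sup>+z. (\<integral>\<^sup>+x. ennreal ((grad u x \<bullet> (h *\<^sub>R z))\<^sup>2) * indicator (cball 0 1) z \<partial>lborel) \<partial>lborel)"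
  proof (rule nn_integral_mono)
    fix z :: "real^4"
    have "(\<integral>\<^sup>+x. ennreal ((u (x + h *\<^sub>R z) - u x)\<^sup>2) \<partial>lborel) \<le> (\<integral>\<^sup>+x. ennreal ((grad u x \<bullet> (h *\<^sub>R z))\<^sup>2) \<partial>lborel)"
      using translation_estimate[OF u, of "h *\<^sub>R z"] by (simp add: add.commute)
    then have "(\<integral>\<^sup>+x. ennreal ((u (x + h *\<^sub>R z) - u x)\<^sup>2) \<partial>lborel) * indicator (cball 0 1) z \<le> (\<integral>\<^sup>+x. ennreal ((grad u x \<bullet> (h *\<^sub>R z))\<^sup>2) \<partial>lborel) * indicator (cball 0 1) z"
      by (rule mult_right_mono) simp
    then show "(\<integral>\<^sup>+x. ennreal ((u (x + h *\<^sub>R z) - u x)\<^sup>2) * indicator (cball 0 1) z \<partial>lborel)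
       \<le> (\<integral>\<^sup>+x. ennreal ((grad u x \<bullet> (h *\<^sub>R z))\<^sup>2) * indicator (cball 0 1) z \<partial>lborel)" by (subst (1 2) nn_integral_multc) auto
  qed
  also have "\<dots> = (\<integral>\<^sup>+x. (\<integral>\<^sup>+z. ennreal ((grad u x \<bullet> (h *\<^sub>R z))\<^sup>2) * indicator (cball 0 1) z \<partial>lborel) \<partial>lborel)" by (rule lborel_pair.Fubini') measurable
  also have "\<dots> = (\<integral>\<^sup>+x. (ennreal (h\<^sup>2) * isotropy_const) * ennreal ((norm (grad u x))\<^sup>2) \<partial>lborel)"
  proof (rule nn_integral_cong)
    fix x
    have "(\<integral>\<^sup>+z. ennreal ((grad u x \<bullet> (h *\<^sub>R z))\<^sup>2) * indicator (cball 0 1) z \<partial>lborel) = (\<integral>\<^sup>+z. ennreal (((h *\<^sub>R grad u x) \<bullet> z)\<^sup>2) * indicator (cball 0 1) z \<partial>lborel)"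
      by simp
    also have "\<dots> = ennreal ((norm (h *\<^sub>R grad u x))\<^sup>2) * isotropy_const" by (rule isotropy)
    also have "\<dots> = (ennreal (h\<^sup>2) * isotropy_const) * ennreal ((norm (grad u x))\<^sup>2)" by (simp add: power_mult_distrib ennreal_mult mult_ac)
    finally show "(\<integral>\<^sup>+z. ennreal ((grad u x \<bullet> (h *\<^sub>R z))\<^sup>2) * indicator (cball 0 1) z \<partial>lborel) = (ennreal (h\<^sup>2) * isotropy_const) * ennreal ((norm (grad u x))\<^sup>2)" .
  qed
  also have "\<dots> = ennreal (h\<^sup>2) * (isotropy_const * (nn_sq (grad u)))" by (subst nn_integral_cmult) (auto simp: mult.assoc)
  finally show ?thesis .
qed

text \<open>Fatou along \<open>h = 1 / Suc n\<close>: the difference quotients converge to the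
  derivative off the origin. A radial function may have a corner at the origin, and a single point
  is null.\<close>

lemma gradient_energy_le_diff_energy:
  fixes v :: "real^4 \<Rightarrow> real"
  assumes [measurable]: "v \<in> borel_measurable borel" "G \<in> borel_measurable borel"
    and der: "\<And>x. x \<noteq> 0 \<Longrightarrow> (v has_derivative (\<lambda>k. G x \<bullet> k)) (at x)"
    and le: "\<And>h. h > 0 \<Longrightarrow> diff_energy h v \<le> ennreal (h\<^sup>2) * T"
  shows "isotropy_const * (nn_sq G) \<le> T"
proof -
  have [measurable]: "cball (0::real^4) 1 \<in> sets borel" by simp
  define h where "h n = inverse (real (Suc n))" for n
  have h: "h n > 0" for n by (simp add: h_def)
  have lim: "(\<lambda>n. ((v (x + h n *\<^sub>R z) - v x) / h n)\<^sup>2) \<longlonglongrightarrow> (G x \<bullet> z)\<^sup>2" if "x \<noteq> 0" for x z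
  proof -
    have "((\<lambda>t. v (x + t *\<^sub>R z)) has_derivative (\<lambda>t. G x \<bullet> (t *\<^sub>R z))) (at 0)"
      by (rule has_derivative_compose[of "\<lambda>t. x + t *\<^sub>R z" "\<lambda>t. t *\<^sub>R z"]) (auto intro!: derivative_eq_intros der[OF that])
    then have "((\<lambda>t. v (x + t *\<^sub>R z)) has_real_derivative G x \<bullet> z) (at 0)" by (simp add: has_field_derivative_def mult.commute[of _ "G x \<bullet> z"])
    then have l: "((\<lambda>t. (v (x + t *\<^sub>R z) - v x) / t) \<longlongrightarrow> G x \<bullet> z) (at 0)" by (simp add: has_field_derivative_iff)
    have "filterlim h (at 0) sequentially" unfolding h_def using LIMSEQ_inverse_real_of_nat by (simp add: filterlim_at)
    from filterlim_compose[OF l this] show ?thesis by (intro tendsto_power)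
  qed
  define k where "k n x z = ennreal (((v (x + h n *\<^sub>R z) - v x) / h n)\<^sup>2) * indicator (cball 0 1) z" for n x z
  have km [measurable]: "(\<lambda>(x, z). k n x z) \<in> borel_measurable (borel \<Otimes>\<^sub>M borel)" for n unfolding k_def by measurable
  have kE: "(\<integral>\<^sup>+x. (\<integral>\<^sup>+z. k n x z \<partial>lborel) \<partial>lborel) \<le> T" for n
  proof -
    have "k n x z = ennreal (1 / (h n)\<^sup>2) * (ennreal ((v (x + h n *\<^sub>R z) - v x)\<^sup>2) * indicator (cball 0 1) z)" for x z
    proof -
      have "ennreal ((a / h n)\<^sup>2) = ennreal (1 / (h n)\<^sup>2) * ennreal (a\<^sup>2)" for a by (subst ennreal_mult'[symmetric]) (auto simp: power_divide)
      then show ?thesis by (simp only: k_def mult.assoc)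
    qed
    then have "(\<integral>\<^sup>+x. (\<integral>\<^sup>+z. k n x z \<partial>lborel) \<partial>lborel) = ennreal (1 / (h n)\<^sup>2) * diff_energy (h n) v" by (simp add: nn_integral_cmult diff_energy_def)
    also have "\<dots> \<le> ennreal (1 / (h n)\<^sup>2) * (ennreal ((h n)\<^sup>2) * T)" by (intro mult_left_mono le h) simp
    also have "\<dots> = T" using h[of n] by (simp add: mult.assoc[symmetric] ennreal_mult[symmetric])
    finally show ?thesis .
  qed
  have "isotropy_const * (nn_sq G) = (\<integral>\<^sup>+x. isotropy_const * ennreal ((norm (G x))\<^sup>2) \<partial>lborel)" by (simp add: nn_integral_cmult)
  also have "\<dots> = (\<integral>\<^sup>+x. (\<integral>\<^sup>+z. ennreal ((G x \<bullet> z)\<^sup>2) * indicator (cball 0 1) z \<partial>lborel) \<partial>lborel)"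
    by (simp only: isotropy mult.commute[of isotropy_const])
  also have "\<dots> \<le> (\<integral>\<^sup>+x. liminf (\<lambda>n. \<integral>\<^sup>+z. k n x z \<partial>lborel) \<partial>lborel)"
  proof (rule nn_integral_mono_AE)
    have "AE x in lborel. x \<noteq> (0::real^4)" by (rule AE_lborel_singleton)
    then show "AE x in lborel. (\<integral>\<^sup>+z. ennreal ((G x \<bullet> z)\<^sup>2) * indicator (cball 0 1) z \<partial>lborel) \<le> liminf (\<lambda>n. \<integral>\<^sup>+z. k n x z \<partial>lborel)"
    proof eventually_elim
      case (elim x)
      have eq: "ennreal ((G x \<bullet> z)\<^sup>2) * indicator (cball 0 1) z = liminf (\<lambda>n. k n x z)" for z
      proof -
        have "(\<lambda>n. k n x z) \<longlonglongrightarrow> ennreal ((G x \<bullet> z)\<^sup>2) * indicator (cball 0 1) z" unfolding k_def using tendsto_ennrealI[OF lim[OF elim, of z]]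
          by (cases "z \<in> cball 0 1") (auto simp: indicator_def)
        from lim_imp_Liminf[OF trivial_limit_sequentially this] show ?thesis by (simp only:)
      qed
      show ?case unfolding eq by (rule nn_integral_liminf) measurable
    qed
  qed
  also have "\<dots> \<le> liminf (\<lambda>n. \<integral>\<^sup>+x. (\<integral>\<^sup>+z. k n x z \<partial>lborel) \<partial>lborel)" by (rule nn_integral_liminf) measurable
  also have "\<dots> \<le> liminf (\<lambda>n::nat. T)" by (intro Liminf_mono always_eventually allI kE)
  finally show ?thesis by (simp add: Liminf_const)
qed

text \<open>Jensen in the averaging parameter, then scaling: passing to
  \<open>v (l *\<^sub>R x)\<close> multiplies the energy bound by \<open>l^2 / l^4\<close>, which is
  at most 1 because only factors \<open>l = exp (d * s) >= 1\<close> occur.\<close>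

lemma diff_energy_dilation_average:
  fixes v :: "real^4 \<Rightarrow> real"
  assumes vc: "continuous_on UNIV v" and d: "d > 0"
    and le: "\<And>h. h > 0 \<Longrightarrow> diff_energy h v \<le> ennreal (h\<^sup>2) * T" and h: "h > 0"
  shows "diff_energy h (\<lambda>x. integral {0..1} (\<lambda>s. v (exp (d * s) *\<^sub>R x))) \<le> ennreal (h\<^sup>2) * T"
proof -
  have [measurable]: "v \<in> borel_measurable borel" using vc by (rule borel_measurable_continuous_onI)
  have [measurable]: "cball (0::real^4) 1 \<in> sets borel" by simp
  define w where "w x = integral {0..1} (\<lambda>s. v (exp (d * s) *\<^sub>R x))" for x
  define k where "k x z s = ennreal ((v (exp (d * s) *\<^sub>R x + (exp (d * s) * h) *\<^sub>R z) - v (exp (d * s) *\<^sub>R x))\<^sup>2)" for x z s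
  have km [measurable (raw)]: "(\<lambda>y. k (f1 y) (f2 y) (f3 y)) \<in> borel_measurable M"
    if [measurable]: "f1 \<in> borel_measurable M" "f2 \<in> borel_measurable M" "f3 \<in> borel_measurable M"
    for f1 f2 f3 and M :: "'c measure" unfolding k_def by measurable
  have c: "continuous_on {0..1} (\<lambda>s. v (exp (d * s) *\<^sub>R x))" for x by (rule continuous_on_compose2[OF vc]) (auto intro!: continuous_intros)
  have pw: "ennreal ((w (x + h *\<^sub>R z) - w x)\<^sup>2) \<le> (\<integral>\<^sup>+s. k x z s * indicator {0..1} s \<partial>lborel)" for x z
  proof -
    define D where "D s = v (exp (d * s) *\<^sub>R (x + h *\<^sub>R z)) - v (exp (d * s) *\<^sub>R x)" for s
    have cD: "continuous_on {0..1} D" unfolding D_def by (intro continuous_intros c)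
    have "w (x + h *\<^sub>R z) - w x = integral {0..1} D"
      unfolding w_def D_def by (rule Henstock_Kurzweil_Integration.integral_diff[symmetric]; intro integrable_continuous_interval c)
    then have "(w (x + h *\<^sub>R z) - w x)\<^sup>2 \<le> integral {0..1} (\<lambda>s. (D s)\<^sup>2)" using integral_sq_le_unit_interval[OF cD] by simp
    moreover have "((\<lambda>s. (D s)\<^sup>2) has_integral integral {0..1} (\<lambda>s. (D s)\<^sup>2)) {0..1}"
      by (intro integrable_integral integrable_continuous_interval continuous_on_power cD)
    then have "(\<integral>\<^sup>+s. ennreal ((D s)\<^sup>2) * indicator {0..1} s \<partial>lborel) = ennreal (integral {0..1} (\<lambda>s. (D s)\<^sup>2))"
      by (intro nn_integral_has_integral_lebesgue') auto
    moreover have "ennreal ((D s)\<^sup>2) = k x z s" for s by (simp add: D_def k_def scaleR_add_right mult.commute)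
    ultimately show ?thesis by (simp add: ennreal_leI)
  qed
  have "diff_energy h w \<le> (\<integral>\<^sup>+x. (\<integral>\<^sup>+z. (\<integral>\<^sup>+s. k x z s * indicator {0..1} s * indicator (cball 0 1) z \<partial>lborel) \<partial>lborel) \<partial>lborel)"
    unfolding diff_energy_def
  proof (intro nn_integral_mono)
    fix x z
    have "ennreal ((w (x + h *\<^sub>R z) - w x)\<^sup>2) * indicator (cball 0 1) z \<le> (\<integral>\<^sup>+s. k x z s * indicator {0..1} s \<partial>lborel) * indicator (cball 0 1) z"
      by (intro mult_right_mono pw) simp
    also have "\<dots> = (\<integral>\<^sup>+s. k x z s * indicator {0..1} s * indicator (cball 0 1) z \<partial>lborel)" by (rule nn_integral_multc[symmetric]) measurable
    finally show "ennreal ((w (x + h *\<^sub>R z) - w x)\<^sup>2) * indicator (cball 0 1) z \<le> (\<integral>\<^sup>+s. k x z s * indicator {0..1} s * indicator (cball 0 1) z \<partial>lborel)" .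
  qed
  also have "\<dots> = (\<integral>\<^sup>+x. (\<integral>\<^sup>+s. (\<integral>\<^sup>+z. k x z s * indicator {0..1} s * indicator (cball 0 1) z \<partial>lborel) \<partial>lborel) \<partial>lborel)"
    by (intro nn_integral_cong lborel_pair.Fubini') measurable
  also have "\<dots> = (\<integral>\<^sup>+s. (\<integral>\<^sup>+x. (\<integral>\<^sup>+z. k x z s * indicator {0..1} s * indicator (cball 0 1) z \<partial>lborel) \<partial>lborel) \<partial>lborel)"
    by (rule lborel_pair.Fubini') measurable
  also have "\<dots> \<le> (\<integral>\<^sup>+s. (ennreal (h\<^sup>2) * T) * indicator {0..1::real} s \<partial>lborel)"
  proof (rule nn_integral_mono)
    fix s :: real
    show "(\<integral>\<^sup>+x. (\<integral>\<^sup>+z. k x z s * indicator {0..1} s * indicator (cball 0 1) z \<partial>lborel) \<partial>lborel) \<le> (ennreal (h\<^sup>2) * T) * indicator {0..1} s"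
    proof (cases "s \<in> {0..1}")
      case True
      define l where "l = exp (d * s)"
      have l: "l \<ge> 1" using True d by (simp add: l_def)
      define Y where "Y = (\<integral>\<^sup>+x. (\<integral>\<^sup>+z. ennreal ((v (l *\<^sub>R x + (l * h) *\<^sub>R z) - v (l *\<^sub>R x))\<^sup>2) * indicator (cball 0 1) z \<partial>lborel) \<partial>lborel)"
      have "diff_energy (l * h) v = ennreal (l ^ DIM(real^4)) * Y" unfolding diff_energy_def Y_def
        by (subst nn_integral_lborel_affine[of "\<lambda>x. \<integral>\<^sup>+z. ennreal ((v (x + (l * h) *\<^sub>R z) - v x)\<^sup>2) * indicator (cball 0 1) z \<partial>lborel" l 0]) (use l in auto)
      then have "ennreal (l ^ 4) * Y = diff_energy (l * h) v" by simp
      also have "\<dots> \<le> ennreal ((l * h)\<^sup>2) * T" using l h by (intro le) simp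
      also have "\<dots> \<le> ennreal (l ^ 4 * h\<^sup>2) * T"
      proof (intro mult_right_mono ennreal_leI)
        have "l\<^sup>2 \<le> l ^ 4" using l by (intro power_increasing) auto
        then show "(l * h)\<^sup>2 \<le> l ^ 4 * h\<^sup>2" by (simp add: power_mult_distrib mult_right_mono)
      qed simp
      also have "\<dots> = ennreal (l ^ 4) * (ennreal (h\<^sup>2) * T)" using l by (simp add: ennreal_mult mult.assoc)
      finally have "Y \<le> ennreal (h\<^sup>2) * T" using l by (subst (asm) ennreal_mult_le_mult_iff) auto
      then show ?thesis using True by (simp add: Y_def k_def l_def)
    qed simp
  qed
  also have "\<dots> = ennreal (h\<^sup>2) * T" by (simp add: nn_integral_cmult_indicator)
  finally show ?thesis unfolding w_def[abs_def] .
qed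

text \<open>The logarithm of a radius runs over the whole line, so one antiderivative valid
  everywhere is built by integrating from 0 in both directions.\<close>

lemma continuous_antiderivative:
  fixes F :: "real \<Rightarrow> real"
  assumes "continuous_on UNIV F"
  shows "\<exists>P. \<forall>x. (P has_real_derivative F x) (at x)"
proof -
  define P where "P x = (if 0 \<le> x then integral {0..x} F else - integral {x..0} F)" for x
  have "(P has_real_derivative F x) (at x)" for x
  proof -
    define A where "A = \<bar>x\<bar> + 1"
    have A0: "0 < A" by (simp add: A_def)
    have int: "F integrable_on {a..b}" for a b using assms by (intro integrable_continuous_interval) (auto intro: continuous_on_subset)
    have eq: "integral {-A..y} F - integral {-A..0} F = P y" if "y \<in> {-A<..<A}" for y
    proof (cases "0 \<le> y")
      case True
      then show ?thesis using Henstock_Kurzweil_Integration.integral_combine[of "-A" 0 y F] int A0 by (simp add: P_def)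
    next
      case False
      then show ?thesis using Henstock_Kurzweil_Integration.integral_combine[of "-A" y 0 F] int that by (simp add: P_def)
    qed
    have "((\<lambda>y. integral {-A..y} F) has_real_derivative F x) (at x within {-A..A})"
      by (rule integral_has_real_derivative) (auto simp: A_def intro: continuous_on_subset[OF assms])
    then have "((\<lambda>y. integral {-A..y} F) has_real_derivative F x) (at x)" by (subst (asm) at_within_interior) (auto simp: A_def)
    then have "((\<lambda>y. integral {-A..y} F - integral {-A..0} F) has_real_derivative F x) (at x)" by (auto intro!: derivative_eq_intros)
    then show ?thesis
    proof (rule has_field_derivative_transform_within_open[of _ _ _ "{-A<..<A}"])
      show "integral {-A..y} F - integral {-A..0} F = P y" if "y \<in> {-A<..<A}" for y by (rule eq[OF that])
    qed (auto simp: A_def)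
  qed
  then show ?thesis by blast
qed

text \<open>In the variable \<open>ln r\<close> the dilation average is a moving average, hence a
  difference quotient of an antiderivative; differentiating gives a difference quotient of
  \<open>f\<close>. A continuous \<open>f\<close> thus becomes continuously differentiable on
  \<open>r > 0\<close>.\<close>

lemma has_real_derivative_dilation_average:
  fixes f :: "real \<Rightarrow> real"
  assumes "continuous_on {0<..} f" and d: "d > 0" and r: "r > 0"
  shows "((\<lambda>r. integral {0..1} (\<lambda>s. f (exp (d * s) * r))) has_real_derivative (f (exp d * r) - f r) / (d * r)) (at r)"
proof -
  have "continuous_on UNIV (\<lambda>t. f (exp t))" by (rule continuous_on_compose2[OF assms(1)]) (auto intro!: continuous_intros)
  from continuous_antiderivative[OF this] obtain P where P: "\<And>t. (P has_real_derivative f (exp t)) (at t)" by blast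
  have eq: "(P (ln q + d) - P (ln q)) / d = integral {0..1} (\<lambda>s. f (exp (d * s) * q))" if q: "q > 0" for q
  proof -
    have "((\<lambda>s. f (exp (d * s) * q)) has_integral (P (ln q + d * 1) / d - P (ln q + d * 0) / d)) {0..1}"
    proof (rule fundamental_theorem_of_calculus)
      fix s :: real
      have "((\<lambda>s. P (ln q + d * s)) has_real_derivative f (exp (ln q + d * s)) * d) (at s)"
        by (rule DERIV_chain2[OF P]) (auto intro!: derivative_eq_intros)
      from DERIV_cdivide[OF this, of d] have "((\<lambda>s. P (ln q + d * s) / d) has_real_derivative f (exp (d * s) * q)) (at s)"
        using d q by (simp add: exp_add mult.commute)
      then show "((\<lambda>s. P (ln q + d * s) / d) has_vector_derivative f (exp (d * s) * q)) (at s within {0..1})"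
        by (simp add: has_real_derivative_iff_has_vector_derivative has_vector_derivative_at_within)
    qed simp
    then show ?thesis by (simp add: integral_unique diff_divide_distrib)
  qed
  have 1: "((\<lambda>q. P (ln q + d)) has_real_derivative f (exp (ln r + d)) * (1 / r)) (at r)"
    by (rule DERIV_chain2[OF P]) (use r in \<open>auto intro!: derivative_eq_intros\<close>)
  have 2: "((\<lambda>q. P (ln q)) has_real_derivative f (exp (ln r)) * (1 / r)) (at r)"
    by (rule DERIV_chain2[OF P]) (use r in \<open>auto intro!: derivative_eq_intros\<close>)
  have "((\<lambda>q. (P (ln q + d) - P (ln q)) / d) has_real_derivative (f (exp d * r) - f r) / (d * r)) (at r)"
    using DERIV_cdivide[OF DERIV_diff[OF 1 2], of d] r d by (simp add: exp_add mult.commute field_simps)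
  then show ?thesis by (rule has_field_derivative_transform_within_open[of _ _ _ "{0<..}"]) (use r eq in auto)
qed

text \<open>The radial profile is merely Lipschitz, so its gradient is recorded through difference
  quotients between the radii \<open>r\<close> and \<open>exp d * r\<close>. These are the exact
  radial derivatives of its dilation averages, and the nonlocal energies pass the bound by the
  Dirichlet integral of \<open>u\<close> down to them.\<close>

lemma radial_reduction:
  fixes u :: "real^4 \<Rightarrow> real"
  assumes u: "u \<in> test_functions \<Omega>"
  obtains f :: "real \<Rightarrow> real" and L R :: real where "L \<ge> 0" "R > 0" "\<And>r. 0 \<le> f r" "\<And>r s. 0 \<le> r \<Longrightarrow> 0 \<le> s \<Longrightarrow> \<bar>f r - f s\<bar> \<le> L * \<bar>r - s\<bar>"
    "\<And>r. R < r \<Longrightarrow> f r = 0"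
    "(\<integral>\<^sup>+x. ennreal ((f (norm (x::real^4))) ^ 4) \<partial>lborel) = (nn_pow4 lborel u)"
    "\<And>d. d > 0 \<Longrightarrow> (\<integral>\<^sup>+x. ennreal (((f (exp d * norm (x::real^4)) - f (norm x)) / (d * norm x))\<^sup>2) \<partial>lborel)
        \<le> (nn_sq (grad u))"
proof -
  obtain K where K: "compact K" "\<And>x. x \<notin> K \<Longrightarrow> u x = 0" using test_function_off[OF u] by metis
  obtain L where L: "L > 0" "\<And>x y. \<bar>u x - u y\<bar> \<le> L * norm (x - y)" using test_function_lipschitz[OF u] by metis
  obtain R where R: "R > 0" "\<And>x. x \<in> K \<Longrightarrow> norm x \<le> R" using compact_imp_bounded[OF K(1)] by (auto simp: bounded_pos)
  have uc: "continuous_on UNIV u" by (rule test_function_continuous(1)[OF u])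
  have um [measurable]: "u \<in> borel_measurable borel" by (rule borel_measurable_continuous_onI[OF uc])
  obtain v :: "real^4 \<Rightarrow> real" where v: "\<And>x. 0 \<le> v x" "\<And>x y. \<bar>v x - v y\<bar> \<le> L * norm (x - y)" "\<And>x. R < norm x \<Longrightarrow> v x = 0"
    "\<And>p q. norm p = norm q \<Longrightarrow> v p = v q"
    "(nn_pow4 lborel v) = (\<integral>\<^sup>+x. ennreal (\<bar>u x\<bar> ^ 4) \<partial>lborel)"
    "\<And>h. jump_energy h v \<le> jump_energy h (\<lambda>x. \<bar>u x\<bar>)"
  proof (rule radial_competitor[of "\<lambda>x. \<bar>u x\<bar>" L R])
    show "\<bar>\<bar>u x\<bar> - \<bar>u y\<bar>\<bar> \<le> L * norm (x - y)" for x y using L(2)[of x y] by linarith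
    show "\<bar>u x\<bar> = 0" if "R < norm x" for x using K(2)[of x] R(2)[of x] that by auto
    show "0 \<le> \<bar>u x\<bar>" "0 \<le> L" "0 < R" for x using L(1) R(1) by simp_all
  qed (rule that)
  have vc: "continuous_on UNIV v" by (rule lipschitz_continuous_on_UNIV[OF v(2)]) (use L in simp)
  have vm [measurable]: "v \<in> borel_measurable borel" by (rule borel_measurable_continuous_onI[OF vc])
  define e :: "real^4" where "e = axis 1 1"
  have ne: "norm e = 1" by (simp add: e_def)
  define f where "f r = v (r *\<^sub>R e)" for r
  have vf: "v x = f (norm x)" for x unfolding f_def by (rule v(4)) (simp add: ne)
  define D where "D = (nn_sq (grad u))"
  have E: "diff_energy h v \<le> ennreal (h\<^sup>2) * (isotropy_const * D)" if h: "h > 0" for h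
  proof -
    \<comment> \<open>Taking absolute values contracts differences, so the energy does not grow and
      the competitor may be taken nonnegative.\<close>
    have "jump_energy h (\<lambda>x. \<bar>u x\<bar>) \<le> jump_energy h u" unfolding jump_energy_def jump_kernel_def
    proof (intro nn_integral_mono ennreal_leI mult_right_mono)
      fix x y
      have "\<bar>\<bar>u x\<bar> - \<bar>u y\<bar>\<bar> \<le> \<bar>u x - u y\<bar>" by linarith
      then show "(\<bar>u x\<bar> - \<bar>u y\<bar>)\<^sup>2 \<le> (u x - u y)\<^sup>2" by (simp add: abs_le_square_iff)
    qed simp
    then have "jump_energy h v \<le> jump_energy h u" using v(6)[of h] by (rule order_trans[rotated])
    then have "diff_energy h v \<le> diff_energy h u" by (rule diff_energy_le_of_jump_energy_le[OF vm um h])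
    also have "\<dots> \<le> ennreal (h\<^sup>2) * (isotropy_const * D)" unfolding D_def using h by (intro diff_energy_test_function[OF u]) simp
    finally show ?thesis .
  qed
  have fl: "\<bar>f r - f s\<bar> \<le> L * \<bar>r - s\<bar>" for r s using v(2)[of "r *\<^sub>R e" "s *\<^sub>R e"] by (simp add: f_def scaleR_diff_left[symmetric] ne)
  have fc: "continuous_on UNIV f" by (rule lipschitz_continuous_on_UNIV[of f L]) (use fl L in auto)
  have av: "(\<integral>\<^sup>+x. ennreal (((f (exp d * norm (x::real^4)) - f (norm x)) / (d * norm x))\<^sup>2) \<partial>lborel) \<le> D" if d: "d > 0" for d
  proof -
    define w where "w x = integral {0..1} (\<lambda>s. v (exp (d * s) *\<^sub>R x))" for x
    \<comment> \<open>The radial derivative of the average times the unit vector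
      \<open>x / norm x\<close>; at the origin the formula evaluates to 0.\<close>
    define G where "G x = ((v (exp d *\<^sub>R x) - v x) / (d * (norm x)\<^sup>2)) *\<^sub>R x" for x
    have wl: "\<bar>w x - w y\<bar> \<le> (L * exp d) * norm (x - y)" for x y
    proof -
      have c: "continuous_on {0..1} (\<lambda>s. v (exp (d * s) *\<^sub>R x))" for x by (rule continuous_on_compose2[OF vc]) (auto intro!: continuous_intros)
      have "w x - w y = integral {0..1} (\<lambda>s. v (exp (d * s) *\<^sub>R x) - v (exp (d * s) *\<^sub>R y))"
        unfolding w_def by (rule Henstock_Kurzweil_Integration.integral_diff[symmetric]; intro integrable_continuous_interval c)
      also have "norm \<dots> \<le> ((L * exp d) * norm (x - y)) * (1 - 0)"
      proof (rule integral_bound)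
        fix s :: real assume s: "s \<in> {0..1}"
        have "norm (v (exp (d * s) *\<^sub>R x) - v (exp (d * s) *\<^sub>R y)) \<le> L * norm (exp (d * s) *\<^sub>R x - exp (d * s) *\<^sub>R y)" using v(2) by simp
        also have "\<dots> = L * (exp (d * s) * norm (x - y))" by (simp add: scaleR_diff_right[symmetric])
        also have "\<dots> \<le> L * (exp d * norm (x - y))" using s d L by (intro mult_left_mono mult_right_mono) auto
        finally show "norm (v (exp (d * s) *\<^sub>R x) - v (exp (d * s) *\<^sub>R y)) \<le> (L * exp d) * norm (x - y)" by simp
      qed (auto intro!: continuous_intros c)
      finally show ?thesis by simp
    qed
    have wc: "continuous_on UNIV w" by (rule lipschitz_continuous_on_UNIV[OF wl]) (use L in simp)
    have wm: "w \<in> borel_measurable borel" by (rule borel_measurable_continuous_onI[OF wc])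
    have Gm: "G \<in> borel_measurable borel" unfolding G_def[abs_def] by measurable
    have wf: "w x = integral {0..1} (\<lambda>s. f (exp (d * s) * norm x))" for x by (simp add: w_def vf)
    have der: "(w has_derivative (\<lambda>k. G x \<bullet> k)) (at x)" if x: "x \<noteq> 0" for x
    proof -
      have 1: "((\<lambda>r. integral {0..1} (\<lambda>s. f (exp (d * s) * r))) has_derivative (\<lambda>k. ((f (exp d * norm x) - f (norm x)) / (d * norm x)) * k)) (at (norm x))"
        using has_real_derivative_dilation_average[OF continuous_on_subset[OF fc subset_UNIV] d, of "norm x"] x
        by (simp only: has_field_derivative_def zero_less_norm_iff not_False_eq_True)
      have 2: "(norm has_derivative (\<lambda>k. k \<bullet> sgn x)) (at x)" using has_derivative_norm[OF x] by (simp add: inner_commute)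
      have "(w has_derivative (\<lambda>k. ((f (exp d * norm x) - f (norm x)) / (d * norm x)) * (k \<bullet> sgn x))) (at x)"
      proof -
        have weq: "w = (\<lambda>x. integral {0..1} (\<lambda>s. f (exp (d * s) * norm x)))" by (rule ext) (rule wf)
        show ?thesis unfolding weq using has_derivative_compose[OF 2 1] .
      qed
      moreover have "((f (exp d * norm x) - f (norm x)) / (d * norm x)) * (k \<bullet> sgn x) = G x \<bullet> k" for k
        by (simp add: G_def vf sgn_div_norm inner_commute power2_eq_square divide_inverse)
      ultimately show ?thesis by simp
    qed
    have "isotropy_const * (nn_sq G) \<le> isotropy_const * D"
    proof (rule gradient_energy_le_diff_energy[OF wm Gm])
      show "(w has_derivative (\<lambda>k. G x \<bullet> k)) (at x)" if "x \<noteq> 0" for x by (rule der[OF that])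
      show "diff_energy h w \<le> ennreal (h\<^sup>2) * (isotropy_const * D)" if "h > 0" for h
        unfolding w_def[abs_def] by (rule diff_energy_dilation_average[OF vc d E that])
    qed
    then have "(nn_sq G) \<le> D" using isotropy_const_pos by (subst (asm) ennreal_mult_le_mult_iff) auto
    moreover have "(norm (G x))\<^sup>2 = ((f (exp d * norm x) - f (norm x)) / (d * norm x))\<^sup>2" for x
    proof (cases "x = 0")
      case False
      have "norm (G x) = \<bar>f (exp d * norm x) - f (norm x)\<bar> / (d * norm x)" using d False by (simp add: G_def vf power2_eq_square)
      then show ?thesis by (simp add: power_divide)
    qed (simp add: G_def)
    ultimately show ?thesis by simp
  qed
  show ?thesis
  proof (rule that[of L R f])
    show "0 \<le> f r" for r by (simp add: f_def v(1))
    show "f r = 0" if "R < r" for r using v(3)[of "r *\<^sub>R e"] that R(1) by (simp add: f_def ne)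
    show "(\<integral>\<^sup>+x. ennreal ((f (norm (x::real^4))) ^ 4) \<partial>lborel) = (nn_pow4 lborel u)" using v(5) by (simp add: vf)
    show "0 \<le> L" "0 < R" using L(1) R(1) by simp_all
    show "\<bar>f r - f s\<bar> \<le> L * \<bar>r - s\<bar>" for r s by (rule fl)
    show "(\<integral>\<^sup>+x. ennreal (((f (exp d * norm (x::real^4)) - f (norm x)) / (d * norm x))\<^sup>2) \<partial>lborel)
        \<le> (nn_sq (grad u))" if "d > 0" for d using av[OF that] by (simp only: D_def)
  qed
qed

section \<open>The sharp Sobolev inequality in dimension four\<close>

text \<open>Area of the unit sphere in dimension four, as the derivative of the ball volume
  \<open>unit_ball_vol 4 * r ^ 4\<close> at \<open>r = 1\<close>.\<close>

definition sphere_area :: real where "sphere_area = 4 * unit_ball_vol 4"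

lemma sphere_area_pos: "sphere_area > 0" by (simp add: sphere_area_def)

text \<open>The image of Lebesgue measure under \<open>norm\<close> has the volume of balls as its
  distribution function; differentiating gives the density
  \<open>sphere_area * r ^ 3\<close>.\<close>

lemma radial_nn_integral:
  assumes [measurable]: "F \<in> borel_measurable borel"
  shows "(\<integral>\<^sup>+x. F (norm (x::real^4)) \<partial>lborel) = ennreal sphere_area * (\<integral>\<^sup>+r. F r * ennreal (r ^ 3) * indicator {0..} r \<partial>lborel)"
proof -
  define N where "N = density lborel (\<lambda>r. ennreal (sphere_area * r ^ 3) * indicator {0..} r)"
  have "distr (lborel :: (real^4) measure) borel norm = N"
  proof (rule measure_eqI_generator_eq[where E="range (\<lambda>a. {..a})" and \<Omega>=UNIV and A="\<lambda>i. {..real i}"])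
    show "Int_stable (range (\<lambda>a::real. {..a}))" by (auto simp: Int_stable_def)
    have s: "sets borel = sigma_sets UNIV (range (\<lambda>a::real. {..a}))" by (simp add: borel_eq_atMost sets_measure_of)
    show "sets (distr (lborel :: (real^4) measure) borel norm) = sigma_sets UNIV (range (\<lambda>a. {..a}))" by (simp add: s)
    show "sets N = sigma_sets UNIV (range (\<lambda>a. {..a}))" by (simp add: s N_def)
    have M: "emeasure (distr (lborel :: (real^4) measure) borel norm) {..a} = (if 0 \<le> a then ennreal (unit_ball_vol 4 * a ^ 4) else 0)" for a
    proof -
      have "emeasure (distr (lborel :: (real^4) measure) borel norm) {..a} = emeasure lborel (norm -` {..a} :: (real^4) set)"
        by (subst emeasure_distr) auto
      also have "norm -` {..a} = cball (0::real^4) a" by auto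
      also have "emeasure lborel (cball (0::real^4) a) = (if 0 \<le> a then ennreal (unit_ball_vol 4 * a ^ 4) else 0)" by (auto simp: emeasure_cball)
      finally show ?thesis .
    qed
    show "emeasure (distr (lborel :: (real^4) measure) borel norm) {..real i} \<noteq> \<infinity>" for i by (simp add: M)
    fix X :: "real set" assume "X \<in> range (\<lambda>a. {..a})"
    then obtain a where X: "X = {..a}" by auto
    have "emeasure N {..a} = (\<integral>\<^sup>+r. ennreal (sphere_area * r ^ 3) * indicator {0..a} r \<partial>lborel)"
      unfolding N_def by (subst emeasure_density) (auto intro!: nn_integral_cong simp: indicator_def)
    also have "\<dots> = (if 0 \<le> a then ennreal (unit_ball_vol 4 * a ^ 4) else 0)"
    proof (cases "0 \<le> a")
      case True
      have "(\<integral>\<^sup>+r. ennreal (sphere_area * r ^ 3) * indicator {0..a} r \<partial>lborel) = unit_ball_vol 4 * a ^ 4 - unit_ball_vol 4 * 0 ^ 4"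
        by (rule nn_integral_FTC_Icc) (use True in \<open>auto simp: sphere_area_def intro!: derivative_eq_intros\<close>)
      then show ?thesis using True by simp
    qed (simp add: indicator_def)
    finally show "emeasure (distr (lborel :: (real^4) measure) borel norm) X = emeasure N X" by (simp add: M X)
  qed (auto intro: real_arch_simple)
  moreover have "(\<integral>\<^sup>+x. F (norm (x::real^4)) \<partial>lborel) = (\<integral>\<^sup>+r. F r \<partial>distr (lborel :: (real^4) measure) borel norm)" by (subst nn_integral_distr) auto
  ultimately have "(\<integral>\<^sup>+x. F (norm (x::real^4)) \<partial>lborel) = (\<integral>\<^sup>+r. F r \<partial>N)" by simp
  also have "\<dots> = (\<integral>\<^sup>+r. ennreal sphere_area * (F r * ennreal (r ^ 3) * indicator {0..} r) \<partial>lborel)" unfolding N_def using sphere_area_pos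
    by (subst nn_integral_density) (auto intro!: nn_integral_cong simp: indicator_def ennreal_mult mult_ac)
  also have "\<dots> = ennreal sphere_area * (\<integral>\<^sup>+r. F r * ennreal (r ^ 3) * indicator {0..} r \<partial>lborel)" by (rule nn_integral_cmult) measurable
  finally show ?thesis .
qed

text \<open>In the variable \<open>\<phi> = r g\<close> the gradient term is \<open>(r \<phi>' - \<phi>)\<^sup>2 / r\<close>.  Completing the square against
  \<open>\<phi> sqrt (1 - q \<phi>\<^sup>2)\<close>, with opposite signs on the two sides of the maximum point of \<open>\<phi>\<close>, leaves a total
  derivative; \<open>q\<close> is then sent to \<open>1 / (max \<phi>)\<^sup>2\<close>, which makes the bound sharp.\<close>

lemma bliss:
  fixes g g' :: "real \<Rightarrow> real"
  assumes der: "\<And>r. r > 0 \<Longrightarrow> (g has_real_derivative g' r) (at r)" and g'c: "continuous_on {0<..} g'"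
    and nonneg: "\<And>r. r > 0 \<Longrightarrow> 0 \<le> g r" and bound: "\<And>r. r > 0 \<Longrightarrow> g r \<le> B"
    and supp: "\<And>r. r \<ge> R \<Longrightarrow> g r = 0" and "R > 0" and a0: "0 \<le> a"
    and A: "(\<integral>\<^sup>+r. ennreal ((g' r)\<^sup>2 * r ^ 3) * indicator {0<..} r \<partial>lborel) \<le> ennreal a"
  shows "(\<integral>\<^sup>+r. ennreal ((g r) ^ 4 * r ^ 3) * indicator {0<..} r \<partial>lborel) \<le> ennreal (3 / 16 * a\<^sup>2)"
proof -
  define \<phi> where "\<phi> r = r * g r" for r
  define \<phi>' where "\<phi>' r = g r + r * g' r" for r
  have gc: "continuous_on {0<..} g" using der by (auto intro!: continuous_at_imp_continuous_on DERIV_isCont)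
  have \<phi>c: "continuous_on {0<..} \<phi>" unfolding \<phi>_def by (intro continuous_intros gc)
  have \<phi>der: "(\<phi> has_real_derivative \<phi>' r) (at r)" if "r > 0" for r unfolding \<phi>_def \<phi>'_def using der[OF that] by (auto intro!: derivative_eq_intros)
  have \<phi>0: "0 \<le> \<phi> r" if "r > 0" for r using nonneg[OF that] that by (simp add: \<phi>_def)
  have \<phi>R: "\<phi> r = 0" if "r \<ge> R" for r using supp[OF that] by (simp add: \<phi>_def)
  show ?thesis
  proof (cases "\<forall>r>0. \<phi> r = 0")
    case True
    then have "ennreal ((g r) ^ 4 * r ^ 3) * indicator {0<..} r = 0" for r by (auto simp: \<phi>_def indicator_def)
    note z = this
    show ?thesis unfolding z by simp
  next
    case False
    then obtain r1 where r1: "r1 > 0" "\<phi> r1 > 0" using \<phi>0 by force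
    have "r1 < R" using \<phi>R[of r1] r1(2) by force
    have B0: "B \<ge> 0" using nonneg[OF r1(1)] bound[OF r1(1)] by simp
    have \<phi>B: "\<phi> r \<le> r * B" if "r > 0" for r using bound[OF that] that by (simp add: \<phi>_def mult_left_mono)
    \<comment> \<open>Near 0 the bound \<open>\<phi> r <= r * B\<close> keeps \<open>\<phi>\<close>
      below its value at \<open>r1\<close>, so the maximum over all radii is found on a compact
      interval.\<close>
    define \<epsilon>1 where "\<epsilon>1 = min r1 (\<phi> r1 / (B + 1))"
    have \<epsilon>1: "\<epsilon>1 > 0" "\<epsilon>1 \<le> r1" "\<epsilon>1 \<le> \<phi> r1 / (B + 1)" using r1 B0 by (auto simp: \<epsilon>1_def)
    have "\<exists>r0\<in>{\<epsilon>1..R}. \<forall>r\<in>{\<epsilon>1..R}. \<phi> r \<le> \<phi> r0"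
    proof (rule continuous_attains_sup)
      show "continuous_on {\<epsilon>1..R} \<phi>" by (rule continuous_on_subset[OF \<phi>c]) (use \<epsilon>1 in auto)
    qed (use \<epsilon>1 \<open>r1 < R\<close> in auto)
    then obtain r0 where r0: "r0 \<in> {\<epsilon>1..R}" "\<And>r. r \<in> {\<epsilon>1..R} \<Longrightarrow> \<phi> r \<le> \<phi> r0" by blast
    define m where "m = \<phi> r0"
    have m1: "\<phi> r1 \<le> m" unfolding m_def using r0(2)[of r1] \<epsilon>1 \<open>r1 < R\<close> by simp
    have m: "m > 0" using m1 r1(2) by simp
    have r0p: "r0 > 0" using r0(1) \<epsilon>1 by simp
    have r0R: "r0 < R" using \<phi>R[of r0] m by (force simp: m_def)
    have \<phi>m: "\<phi> r \<le> m" if "r > 0" for r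
    proof -
      consider "r < \<epsilon>1" | "r \<in> {\<epsilon>1..R}" | "R < r" by fastforce
      then show ?thesis
      proof cases
        case 1
        have "\<phi> r \<le> r * B" by (rule \<phi>B[OF that])
        also have "\<dots> \<le> \<epsilon>1 * (B + 1)" using 1 that B0 by (intro mult_mono) auto
        also have "\<dots> \<le> \<phi> r1" using \<epsilon>1(3) B0 by (simp add: field_simps)
        finally show ?thesis using m1 by simp
      qed (use r0(2)[of r] \<phi>R[of r] m in \<open>auto simp: m_def\<close>)
    qed
    define P where "P r = (g' r)\<^sup>2 * r ^ 3" for r
    define Q where "Q r = (g r) ^ 4 * r ^ 3" for r
    have PQc: "continuous_on {s..t} P" "continuous_on {s..t} Q" if "s > 0" for s t
    proof -
      have "continuous_on {s..t} g'" "continuous_on {s..t} g"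
        by (rule continuous_on_subset[OF g'c], use that in force) (rule continuous_on_subset[OF gc], use that in force)
      then show "continuous_on {s..t} P" "continuous_on {s..t} Q" unfolding P_def Q_def by (auto intro!: continuous_intros)
    qed
    have PQi: "P integrable_on {s..t}" "Q integrable_on {s..t}" if "s > 0" for s t using PQc[OF that] by (auto intro: integrable_continuous_interval)
    have Qn: "0 \<le> Q r" if "r > 0" for r using that nonneg[OF that] by (simp add: Q_def)
    have Pn: "0 \<le> P r" if "r > 0" for r using that by (simp add: P_def)
    \<comment> \<open>Write \<open>S\<close> for the root
      \<open>sqrt (1 - q * \<phi>\<^sup>2)\<close>. The cross term of the square
      \<open>(r * \<phi>' - \<tau> * \<phi> * S)\<^sup>2\<close> and the term
      \<open>- 2 * \<phi> * \<phi>'\<close> from expanding \<open>P\<close> form the derivative of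
      \<open>H\<close>, for either sign \<open>\<tau>\<close>. The strict bound
      \<open>q * m\<^sup>2 < 1\<close> keeps the root differentiable.\<close>
    have step: "q * integral {s..t} Q + (- \<tau> * (2 / (3 * q)) * sqrt (1 - q * (\<phi> t)\<^sup>2) ^ 3 - (\<phi> t)\<^sup>2)
        - (- \<tau> * (2 / (3 * q)) * sqrt (1 - q * (\<phi> s)\<^sup>2) ^ 3 - (\<phi> s)\<^sup>2) \<le> integral {s..t} P"
      if st: "0 < s" "s \<le> t" and q: "q > 0" "q * m\<^sup>2 < 1" and \<tau>: "\<tau>\<^sup>2 = 1" for s t q \<tau>
    proof -
      define S where "S r = sqrt (1 - q * (\<phi> r)\<^sup>2)" for r
      have Sp: "0 < 1 - q * (\<phi> r)\<^sup>2" if "r > 0" for r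
      proof -
        have "(\<phi> r)\<^sup>2 \<le> m\<^sup>2" using \<phi>0[OF that] \<phi>m[OF that] by (intro power_mono) auto
        then have "q * (\<phi> r)\<^sup>2 \<le> q * m\<^sup>2" using q by (intro mult_left_mono) auto
        then show ?thesis using q(2) by linarith
      qed
      have S2: "(S r)\<^sup>2 = 1 - q * (\<phi> r)\<^sup>2" "S r > 0" if "r > 0" for r using Sp[OF that] by (simp_all add: S_def)
      define H where "H r = - \<tau> * (2 / (3 * q)) * S r ^ 3 - (\<phi> r)\<^sup>2" for r
      have Hder: "(H has_real_derivative (2 * \<tau> * \<phi> r * \<phi>' r * S r - 2 * \<phi> r * \<phi>' r)) (at r)" if r: "r > 0" for r
      proof -
        have "((\<lambda>r. 1 - q * (\<phi> r)\<^sup>2) has_real_derivative (- 2 * q * \<phi> r * \<phi>' r)) (at r)" using \<phi>der[OF r] by (auto intro!: derivative_eq_intros)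
        note d1 = this
        have "(S has_real_derivative (- 2 * q * \<phi> r * \<phi>' r) * (inverse (S r) / 2)) (at r)"
          unfolding S_def using DERIV_chain2[where f=sqrt and g="\<lambda>r. 1 - q * (\<phi> r)\<^sup>2", OF DERIV_real_sqrt[OF Sp[OF r]] d1] by (simp add: mult.commute)
        then have Sd: "(S has_real_derivative (- (q * \<phi> r * \<phi>' r) / S r)) (at r)" by (rule DERIV_cong) (use S2(2)[OF r] in \<open>simp add: field_simps\<close>)
        have "(H has_real_derivative (- \<tau> * (2 / (3 * q)) * (3 * (S r)\<^sup>2 * (- (q * \<phi> r * \<phi>' r) / S r)) - 2 * \<phi> r * \<phi>' r)) (at r)"
          unfolding H_def by (rule derivative_eq_intros refl Sd \<phi>der[OF r])+ (simp add: power2_eq_square)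
        moreover have "- \<tau> * (2 / (3 * q)) * (3 * (S r)\<^sup>2 * (- (q * \<phi> r * \<phi>' r) / S r)) = 2 * \<tau> * \<phi> r * \<phi>' r * S r"
          using q S2(2)[OF r] by (simp add: field_simps power2_eq_square)
        ultimately show ?thesis by simp
      qed
      have "((\<lambda>r. q * Q r + (2 * \<tau> * \<phi> r * \<phi>' r * S r - 2 * \<phi> r * \<phi>' r)) has_integral (q * integral {s..t} Q + (H t - H s))) {s..t}"
      proof (intro has_integral_add has_integral_mult_right integrable_integral PQi(2) st(1))
        show "((\<lambda>r. 2 * \<tau> * \<phi> r * \<phi>' r * S r - 2 * \<phi> r * \<phi>' r) has_integral (H t - H s)) {s..t}"
        proof (rule fundamental_theorem_of_calculus[OF st(2)])
          fix r assume "r \<in> {s..t}"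
          then have "r > 0" using st by simp
          from Hder[OF this] show "(H has_vector_derivative 2 * \<tau> * \<phi> r * \<phi>' r * S r - 2 * \<phi> r * \<phi>' r) (at r within {s..t})"
            by (simp add: has_real_derivative_iff_has_vector_derivative has_vector_derivative_at_within)
        qed
      qed
      then have "q * integral {s..t} Q + (H t - H s) \<le> integral {s..t} P"
      proof (rule has_integral_le[OF _ integrable_integral[OF PQi(1)[OF st(1)]]])
        fix r assume "r \<in> {s..t}"
        then have r: "r > 0" using st by simp
        have "0 \<le> (r * \<phi>' r - \<tau> * \<phi> r * S r)\<^sup>2 / r" using r by simp
        also have "(r * \<phi>' r - \<tau> * \<phi> r * S r)\<^sup>2 = r\<^sup>2 * (\<phi>' r)\<^sup>2 - 2 * \<tau> * r * \<phi> r * \<phi>' r * S r + \<tau>\<^sup>2 * (\<phi> r)\<^sup>2 * (S r)\<^sup>2"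
          by (simp add: power2_eq_square algebra_simps)
        also have "\<dots> / r = (r\<^sup>2 * (\<phi>' r)\<^sup>2 - 2 * r * \<phi> r * \<phi>' r + (\<phi> r)\<^sup>2) / r - (q * (\<phi> r) ^ 4 / r + (2 * \<tau> * \<phi> r * \<phi>' r * S r - 2 * \<phi> r * \<phi>' r))"
          unfolding \<tau> S2(1)[OF r] using r by (simp add: field_simps power2_eq_square power4_eq_xxxx)
        also have "r\<^sup>2 * (\<phi>' r)\<^sup>2 - 2 * r * \<phi> r * \<phi>' r + (\<phi> r)\<^sup>2 = (r * \<phi>' r - \<phi> r)\<^sup>2" by (simp add: power2_eq_square algebra_simps)
        also have "r * \<phi>' r - \<phi> r = r\<^sup>2 * g' r" by (simp add: \<phi>_def \<phi>'_def power2_eq_square algebra_simps)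
        also have "(r\<^sup>2 * g' r)\<^sup>2 / r = P r" using r by (simp add: P_def field_simps numeral_eq_Suc)
        also have "q * (\<phi> r) ^ 4 / r = q * Q r" using r by (simp add: Q_def \<phi>_def field_simps numeral_eq_Suc)
        finally show "q * Q r + (2 * \<tau> * \<phi> r * \<phi>' r * S r - 2 * \<phi> r * \<phi>' r) \<le> P r" by simp
      qed
      then show ?thesis by (simp add: H_def S_def)
    qed
    have Pa: "integral {s..R} P \<le> a" if "s > 0" for s
    proof -
      have "ennreal (integral {s..R} P) = (\<integral>\<^sup>+r. ennreal (P r) * indicator {s..R} r \<partial>lborel)"
        by (rule nn_integral_has_integral_lebesgue'[OF _ integrable_integral[OF PQi(1)[OF that]], symmetric]) (use Pn that in auto)
      also have "\<dots> \<le> (\<integral>\<^sup>+r. ennreal ((g' r)\<^sup>2 * r ^ 3) * indicator {0<..} r \<partial>lborel)"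
        by (intro nn_integral_mono) (use that in \<open>auto simp: P_def indicator_def\<close>)
      also have "\<dots> \<le> ennreal a" by (rule A)
      finally show ?thesis using a0 by (simp add: ennreal_le_iff)
    qed
    have main: "integral {s..R} Q \<le> 3 / 16 * a\<^sup>2" if s: "0 < s" "s \<le> r0" for s
    proof -
      define J0 where "J0 = integral {s..R} Q"
      have J0: "J0 \<ge> 0" unfolding J0_def by (rule integral_nonneg[OF PQi(2)[OF s(1)]]) (use Qn s in auto)
      \<comment> \<open>The parameter \<open>\<theta>\<close> is the value of the root at the
        maximum point \<open>r0\<close>, so \<open>q = (1 - \<theta>\<^sup>2) / m\<^sup>2\<close>.
        Positive \<open>\<theta>\<close> is admissible in \<open>step\<close>; its limit 0 is taken
        afterwards.\<close>
      have 1: "(1 - \<theta>\<^sup>2) * J0 / m\<^sup>2 + (4 * m\<^sup>2 / 3) * (1 - \<theta> ^ 3) \<le> a" if \<theta>: "0 < \<theta>" "\<theta> < 1" for \<theta>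
      proof -
        have \<theta>2: "\<theta>\<^sup>2 < 1" "\<theta>\<^sup>2 > 0" using \<theta> by (auto simp: power_less_one_iff)
        define q where "q = (1 - \<theta>\<^sup>2) / m\<^sup>2"
        have q: "q > 0" "q * m\<^sup>2 = 1 - \<theta>\<^sup>2" using \<theta>2 m by (simp_all add: q_def)
        have q1: "q * m\<^sup>2 < 1" using q \<theta>2 by simp
        have "sqrt (1 - q * (\<phi> r0)\<^sup>2) = \<theta>" using q(2) \<theta> by (simp add: m_def[symmetric])
        note r0S = this[folded m_def]
        \<comment> \<open>The profile is controlled by continuity only away from 0, hence the cut at
          \<open>\<epsilon>\<close>; the boundary term there costs at most
          \<open>(B * \<epsilon>)\<^sup>2\<close>.\<close>
        have 2: "q * J0 + (4 / (3 * q)) * (1 - \<theta> ^ 3) - (B * \<epsilon>)\<^sup>2 \<le> a" if \<epsilon>: "0 < \<epsilon>" "\<epsilon> \<le> s" for \<epsilon>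
        proof -
          define k where "k = q * (\<phi> \<epsilon>)\<^sup>2"
          have k: "0 \<le> k" "k < 1"
          proof -
            have "(\<phi> \<epsilon>)\<^sup>2 \<le> m\<^sup>2" using \<phi>0[OF \<epsilon>(1)] \<phi>m[OF \<epsilon>(1)] by (intro power_mono) auto
            then have "k \<le> q * m\<^sup>2" unfolding k_def using q by (intro mult_left_mono) auto
            then show "k < 1" using q1 by simp
          qed (use q in \<open>simp add: k_def\<close>)
          \<comment> \<open>The root lies in [0, 1], so its cube is at least its fourth power
            \<open>(1 - k)\<^sup>2\<close>; this bounds the boundary term at
            \<open>\<epsilon>\<close> linearly in \<open>k\<close>.\<close>
          have S3: "1 - 2 * k \<le> sqrt (1 - k) ^ 3"
          proof -
            have "1 - 2 * k \<le> (1 - k)\<^sup>2" by (simp add: power2_diff)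
            also have "\<dots> = sqrt (1 - k) ^ 4" using k by (simp add: power4_eq_xxxx power2_eq_square)
            also have "\<dots> \<le> sqrt (1 - k) ^ 3" using k by (intro power_decreasing) auto
            finally show ?thesis .
          qed
          have "(2 / (3 * q)) * (1 - 2 * k) \<le> (2 / (3 * q)) * sqrt (1 - k) ^ 3" using S3 q by (intro mult_left_mono) auto
          moreover have "(2 / (3 * q)) * (1 - 2 * k) = 2 / (3 * q) - (4 / 3) * (\<phi> \<epsilon>)\<^sup>2" using q by (simp add: k_def field_simps)
          ultimately have S4: "2 / (3 * q) - (4 / 3) * (\<phi> \<epsilon>)\<^sup>2 \<le> (2 / (3 * q)) * sqrt (1 - k) ^ 3" by simp
          \<comment> \<open>Sign \<open>\<tau> = 1\<close> before the maximum point, and -1 after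
            it. The contributions of the two outer ends then add up to about
            \<open>4 / (3 * q)\<close>, while the terms \<open>m\<^sup>2\<close> at
            \<open>r0\<close> cancel.\<close>
          have a1: "q * integral {\<epsilon>..r0} Q + (- (2 / (3 * q)) * \<theta> ^ 3 - m\<^sup>2) - (- (2 / (3 * q)) * sqrt (1 - k) ^ 3 - (\<phi> \<epsilon>)\<^sup>2) \<le> integral {\<epsilon>..r0} P"
          proof -
            have "\<epsilon> \<le> r0" "(1::real)\<^sup>2 = 1" using \<epsilon> s by auto
            from step[OF \<epsilon>(1) this(1) q(1) q1 this(2)] show ?thesis by (simp only: r0S k_def m_def[symmetric] mult_minus1)
          qed
          have a2: "q * integral {r0..R} Q + 2 / (3 * q) - ((2 / (3 * q)) * \<theta> ^ 3 - m\<^sup>2) \<le> integral {r0..R} P"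
          proof -
            have "r0 \<le> R" "(-1::real)\<^sup>2 = 1" using r0R by auto
            from step[OF r0p this(1) q(1) q1 this(2)] show ?thesis by (simp only: r0S \<phi>R[OF order_refl] m_def[symmetric] minus_minus mult_1) simp
          qed
          have c: "integral {\<epsilon>..r0} Q + integral {r0..R} Q = integral {\<epsilon>..R} Q" "integral {\<epsilon>..r0} P + integral {r0..R} P = integral {\<epsilon>..R} P"
            using PQi[OF \<epsilon>(1)] \<epsilon> s r0R by (auto intro!: Henstock_Kurzweil_Integration.integral_combine)
          have JJ: "J0 \<le> integral {\<epsilon>..R} Q" unfolding J0_def by (rule integral_subset_le) (use PQi s \<epsilon> Qn in auto)
          have ph: "(\<phi> \<epsilon>)\<^sup>2 \<le> (B * \<epsilon>)\<^sup>2" using \<phi>B[OF \<epsilon>(1)] \<phi>0[OF \<epsilon>(1)] by (intro power_mono) (auto simp: mult.commute)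
          have "q * J0 \<le> q * integral {\<epsilon>..R} Q" using JJ q by (intro mult_left_mono) auto
          also have "\<dots> = q * integral {\<epsilon>..r0} Q + q * integral {r0..R} Q" by (simp add: c(1)[symmetric] distrib_left)
          finally have "q * J0 + (- (2 / (3 * q)) * \<theta> ^ 3 - m\<^sup>2) - (- (2 / (3 * q)) * sqrt (1 - k) ^ 3 - (\<phi> \<epsilon>)\<^sup>2) + 2 / (3 * q) - ((2 / (3 * q)) * \<theta> ^ 3 - m\<^sup>2) \<le> integral {\<epsilon>..R} P"
            using a1 a2 c(2) by linarith
          moreover have "(4 / (3 * q)) * (1 - \<theta> ^ 3) = 2 * (2 / (3 * q)) - 2 * ((2 / (3 * q)) * \<theta> ^ 3)" using q by (simp add: field_simps)
          ultimately show ?thesis using S4 Pa[OF \<epsilon>(1)] ph zero_le_power2[of "\<phi> \<epsilon>"] by linarith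
        qed
        have "((\<lambda>\<epsilon>. q * J0 + (4 / (3 * q)) * (1 - \<theta> ^ 3) - (B * \<epsilon>)\<^sup>2) \<longlongrightarrow> q * J0 + (4 / (3 * q)) * (1 - \<theta> ^ 3) - (B * 0)\<^sup>2) (at_right 0)"
          by (intro tendsto_intros)
        moreover have "\<forall>\<^sub>F \<epsilon> in at_right 0. q * J0 + (4 / (3 * q)) * (1 - \<theta> ^ 3) - (B * \<epsilon>)\<^sup>2 \<le> a"
          using eventually_at_right_less eventually_at_right_real[OF s(1)] by eventually_elim (use 2 in auto)
        ultimately have "q * J0 + (4 / (3 * q)) * (1 - \<theta> ^ 3) - (B * 0)\<^sup>2 \<le> a" by (rule tendsto_upperbound) simp
        moreover have "(4 * m\<^sup>2 / 3) * (1 - \<theta> ^ 3) \<le> (4 / (3 * q)) * (1 - \<theta> ^ 3)"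
        proof (rule mult_right_mono)
          have "m\<^sup>2 * q \<le> 1" using q1 by (simp only: mult.commute[of "m\<^sup>2"] less_imp_le)
          then show "4 * m\<^sup>2 / 3 \<le> 4 / (3 * q)" using q(1) by (simp add: field_simps)
          show "0 \<le> 1 - \<theta> ^ 3" using \<theta> by (simp add: power_le_one)
        qed
        ultimately show ?thesis by (simp add: q_def)
      qed
      have "((\<lambda>\<theta>. (1 - \<theta>\<^sup>2) * J0 / m\<^sup>2 + (4 * m\<^sup>2 / 3) * (1 - \<theta> ^ 3)) \<longlongrightarrow> (1 - 0\<^sup>2) * J0 / m\<^sup>2 + (4 * m\<^sup>2 / 3) * (1 - 0 ^ 3)) (at_right 0)"
        using m by (intro tendsto_intros) auto
      moreover have "\<forall>\<^sub>F \<theta> in at_right 0. (1 - \<theta>\<^sup>2) * J0 / m\<^sup>2 + (4 * m\<^sup>2 / 3) * (1 - \<theta> ^ 3) \<le> a"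
        using eventually_at_right_less eventually_at_right_real[OF zero_less_one] by eventually_elim (use 1 in auto)
      ultimately have "(1 - 0\<^sup>2) * J0 / m\<^sup>2 + (4 * m\<^sup>2 / 3) * (1 - 0 ^ 3) \<le> a" by (rule tendsto_upperbound) simp
      then have le: "J0 / m\<^sup>2 + 4 * m\<^sup>2 / 3 \<le> a" by simp
      \<comment> \<open>Arithmetic-geometric mean: the unknown height \<open>m\<close> cancels from
        the product \<open>X * Y\<close>, which is \<open>4 / 3 * J0\<close>. This is where the
        constant 3/16 comes from.\<close>
      define X Y where "X = J0 / m\<^sup>2" and "Y = 4 * m\<^sup>2 / 3"
      have XY: "X * Y = 4 / 3 * J0" "0 \<le> X" "0 \<le> Y" using m J0 by (simp_all add: X_def Y_def)
      have "(X + Y)\<^sup>2 \<le> a\<^sup>2" using le XY by (intro power_mono) (auto simp: X_def Y_def)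
      moreover have "(X + Y)\<^sup>2 = (X - Y)\<^sup>2 + 4 * (X * Y)" by (simp add: power2_eq_square algebra_simps)
      ultimately have "4 * (X * Y) \<le> a\<^sup>2" using zero_le_power2[of "X - Y"] by linarith
      then show ?thesis unfolding XY(1) J0_def by simp
    qed
    \<comment> \<open>Exhaustion of \<open>{0<..R}\<close> by compact intervals; the bound is
      uniform and Fatou carries it to the limit.\<close>
    define c where "c n = r0 / real (Suc n)" for n
    have c: "0 < c n" "c n \<le> r0" for n using r0p by (auto simp: c_def field_simps)
    define F where "F n r = ennreal (indicator {c n..R} r *\<^sub>R Q r)" for n r
    have Fm [measurable]: "F n \<in> borel_measurable lborel" for n
    proof -
      have "(\<lambda>r. indicator {c n..R} r *\<^sub>R Q r) \<in> borel_measurable borel"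
        by (rule borel_measurable_continuous_on_indicator) (use PQc(2)[OF c(1)] in auto)
      then show ?thesis unfolding F_def by measurable
    qed
    have "(\<integral>\<^sup>+r. ennreal ((g r) ^ 4 * r ^ 3) * indicator {0<..} r \<partial>lborel) \<le> (\<integral>\<^sup>+r. liminf (\<lambda>n. F n r) \<partial>lborel)"
    proof (rule nn_integral_mono)
      fix r :: real
      show "ennreal ((g r) ^ 4 * r ^ 3) * indicator {0<..} r \<le> liminf (\<lambda>n. F n r)"
      proof (cases "0 < r \<and> r \<le> R")
        case True
        have "(\<lambda>n. r0 * inverse (real (Suc n))) \<longlonglongrightarrow> r0 * 0" by (intro tendsto_intros LIMSEQ_inverse_real_of_nat)
        then have "c \<longlonglongrightarrow> 0" by (simp add: c_def[abs_def] divide_inverse)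
        then have "\<forall>\<^sub>F n in sequentially. c n < r" using True by (intro order_tendstoD(2)) auto
        then have "\<forall>\<^sub>F n in sequentially. F n r = ennreal (Q r)" by eventually_elim (use True in \<open>auto simp: F_def\<close>)
        then have "(\<lambda>n. F n r) \<longlonglongrightarrow> ennreal (Q r)" by (rule tendsto_eventually)
        from lim_imp_Liminf[OF trivial_limit_sequentially this] show ?thesis using True by (simp add: Q_def)
      next
        case False
        then have "ennreal ((g r) ^ 4 * r ^ 3) * indicator {0<..} r = 0" using supp[of r] by (auto simp: indicator_def)
        then show ?thesis by (simp only: zero_le)
      qed
    qed
    also have "\<dots> \<le> liminf (\<lambda>n. \<integral>\<^sup>+r. F n r \<partial>lborel)" by (rule nn_integral_liminf) measurable
    also have "\<dots> \<le> liminf (\<lambda>n::nat. ennreal (3 / 16 * a\<^sup>2))"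
    proof (intro Liminf_mono always_eventually allI)
      fix n
      have "(\<integral>\<^sup>+r. F n r \<partial>lborel) = ennreal (integral {c n..R} Q)" unfolding F_def real_scaleR_def
        by (rule nn_integral_has_integral_lebesgue[OF _ integrable_integral[OF PQi(2)[OF c(1)]]]) (use Qn less_le_trans[OF c(1)] in auto)
      also have "\<dots> \<le> ennreal (3 / 16 * a\<^sup>2)" by (intro ennreal_leI main c)
      finally show "(\<integral>\<^sup>+r. F n r \<partial>lborel) \<le> ennreal (3 / 16 * a\<^sup>2)" .
    qed
    finally show ?thesis by (simp add: Liminf_const)
  qed
qed

text \<open>The one-dimensional inequality is applied to the dilation averages of the radial
  profile, whose derivative is continuous away from 0; as the width \<open>d\<close> shrinks, Fatou
  recovers the profile itself.\<close>

lemma sharp_sobolev_test: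
  fixes u :: "real^4 \<Rightarrow> real"
  assumes u: "u \<in> test_functions \<Omega>"
  shows "(nn_pow4 lborel u) \<le> ennreal (3 / (16 * sphere_area) * (L2_sq (grad u))\<^sup>2)"
proof -
  define D where "D = L2_sq (grad u)"
  have D0: "D \<ge> 0" by (simp add: D_def)
  have Dn: "(nn_sq (grad u)) = ennreal D" using test_function_integrals(3,4)[OF u] by (simp add: nn_integral_eq_integral D_def)
  obtain f0 :: "real \<Rightarrow> real" and L R :: real where f0: "L \<ge> 0" "R > 0" "\<And>r. 0 \<le> f0 r"
    "\<And>r s. 0 \<le> r \<Longrightarrow> 0 \<le> s \<Longrightarrow> \<bar>f0 r - f0 s\<bar> \<le> L * \<bar>r - s\<bar>" "\<And>r. R < r \<Longrightarrow> f0 r = 0"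
    "(\<integral>\<^sup>+x. ennreal ((f0 (norm (x::real^4))) ^ 4) \<partial>lborel) = (nn_pow4 lborel u)"
    "\<And>d. d > 0 \<Longrightarrow> (\<integral>\<^sup>+x. ennreal (((f0 (exp d * norm (x::real^4)) - f0 (norm x)) / (d * norm x))\<^sup>2) \<partial>lborel)
        \<le> (nn_sq (grad u))" by (rule radial_reduction[OF u]) (rule that)
  \<comment> \<open>The reduction gives the Lipschitz bound for \<open>f0\<close> only on
    nonnegative radii; the even extension makes it Lipschitz on the whole line.\<close>
  define f where "f r = f0 \<bar>r\<bar>" for r
  have ff0: "f r = f0 r" if "r \<ge> 0" for r using that by (simp add: f_def)
  have fl: "\<bar>f r - f s\<bar> \<le> L * norm (r - s)" for r s
  proof -
    have "\<bar>f r - f s\<bar> \<le> L * \<bar>\<bar>r\<bar> - \<bar>s\<bar>\<bar>" unfolding f_def by (rule f0(4)) auto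
    also have "\<dots> \<le> L * \<bar>r - s\<bar>" using f0(1) by (intro mult_left_mono) auto
    finally show ?thesis by simp
  qed
  have fc: "continuous_on UNIV f" by (rule lipschitz_continuous_on_UNIV[OF fl f0(1)])
  have fn: "0 \<le> f r" for r by (simp add: f_def f0(3))
  have fR: "f r = 0" if "R < r" for r using f0(5)[of "\<bar>r\<bar>"] that by (simp add: f_def)
  have fB: "f r \<le> L * (2 * R + 1)" if "0 \<le> r" for r
  proof (cases "R < r")
    case False
    have "f r = \<bar>f r - f (R + 1)\<bar>" using fn[of r] fR[of "R + 1"] by simp
    also have "\<dots> \<le> L * norm (r - (R + 1))" by (rule fl)
    also have "\<dots> \<le> L * (2 * R + 1)" using f0(1) False that f0(2) by (intro mult_left_mono) auto
    finally show ?thesis .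
  qed (use fR[of r] f0(1,2) in simp)
  define g where "g d r = integral {0..1} (\<lambda>s. f (exp (d * s) * r))" for d r
  define C where "C = 3 / (16 * sphere_area) * D\<^sup>2"
  have gc: "continuous_on {0..1} (\<lambda>s. f (exp (d * s) * r))" for d r by (rule continuous_on_compose2[OF fc]) (auto intro!: continuous_intros)
  have est: "(\<integral>\<^sup>+x. ennreal (indicator {0<..} (norm (x::real^4)) *\<^sub>R (g d (norm x)) ^ 4) \<partial>lborel) \<le> ennreal C"
    and gm: "(\<lambda>r. ennreal (indicator {0<..} r *\<^sub>R (g d r) ^ 4)) \<in> borel_measurable borel" if d: "d > 0" for d
  proof -
    \<comment> \<open>Polar coordinates and the one-dimensional inequality differ only at
      \<open>r = 0\<close>. The indicator of \<open>{0<..}\<close> confines measurability to the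
      range where \<open>g d\<close> and \<open>g'\<close> are continuous.\<close>
    have shift: "ennreal (indicator {0<..} r *\<^sub>R y) * ennreal (r ^ 3) * indicator {0..} r = ennreal (y * r ^ 3) * indicator {0<..} r"
      if "0 \<le> y" for r y :: real using that by (cases "0 < r") (auto simp: indicator_def ennreal_mult)
    define g' where "g' r = (f (exp d * r) - f r) / (d * r)" for r
    have der: "(g d has_real_derivative g' r) (at r)" if "r > 0" for r
      unfolding g_def[abs_def] g'_def by (rule has_real_derivative_dilation_average[OF continuous_on_subset[OF fc] d that]) simp
    have g'c: "continuous_on {0<..} g'" unfolding g'_def[abs_def] using d by (intro continuous_intros continuous_on_compose2[OF fc]) auto
    have gcont: "continuous_on {0<..} (g d)" using der by (auto intro!: continuous_at_imp_continuous_on DERIV_isCont)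
    show gm: "(\<lambda>r. ennreal (indicator {0<..} r *\<^sub>R (g d r) ^ 4)) \<in> borel_measurable borel"
      by (intro measurable_compose[OF _ measurable_ennreal] borel_measurable_continuous_on_indicator continuous_on_power gcont) auto
    have g'm: "(\<lambda>r. ennreal (indicator {0<..} r *\<^sub>R (g' r)\<^sup>2)) \<in> borel_measurable borel"
      by (intro measurable_compose[OF _ measurable_ennreal] borel_measurable_continuous_on_indicator continuous_on_power g'c) auto
    have "ennreal sphere_area * (\<integral>\<^sup>+r. ennreal ((g' r)\<^sup>2 * r ^ 3) * indicator {0<..} r \<partial>lborel)
      = (\<integral>\<^sup>+x. ennreal (indicator {0<..} (norm (x::real^4)) *\<^sub>R (g' (norm x))\<^sup>2) \<partial>lborel)"
      by (simp only: radial_nn_integral[OF g'm] shift zero_le_power2)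
    also have "\<dots> \<le> (\<integral>\<^sup>+x. ennreal (((f0 (exp d * norm (x::real^4)) - f0 (norm x)) / (d * norm x))\<^sup>2) \<partial>lborel)"
      by (intro nn_integral_mono ennreal_leI) (auto simp: indicator_def g'_def ff0)
    also have "\<dots> \<le> ennreal D" using f0(7)[OF d] by (simp only: Dn)
    also have "\<dots> = ennreal sphere_area * ennreal (D / sphere_area)" using sphere_area_pos D0 by (simp flip: ennreal_mult)
    finally have A: "(\<integral>\<^sup>+r. ennreal ((g' r)\<^sup>2 * r ^ 3) * indicator {0<..} r \<partial>lborel) \<le> ennreal (D / sphere_area)"
      using sphere_area_pos by (subst (asm) ennreal_mult_le_mult_iff) auto
    have gn: "0 \<le> g d r" for r unfolding g_def by (rule integral_nonneg[OF integrable_continuous_interval[OF gc]]) (simp add: fn)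
    have "(\<integral>\<^sup>+r. ennreal ((g d r) ^ 4 * r ^ 3) * indicator {0<..} r \<partial>lborel) \<le> ennreal (3 / 16 * (D / sphere_area)\<^sup>2)"
    proof (rule bliss[OF der g'c _ _ _ _ _ A])
      show "0 \<le> g d r" for r by (rule gn)
      show "g d r \<le> L * (2 * R + 1)" if "r > 0" for r
      proof -
        have "norm (g d r) \<le> (L * (2 * R + 1)) * (1 - 0)" unfolding g_def by (rule integral_bound[OF _ gc]) (use fn fB that in auto)
        then show ?thesis by simp
      qed
      show "g d r = 0" if "r \<ge> R + 1" for r
      proof -
        have "f (exp (d * s) * r) = 0" if "s \<in> {0..1}" for s
        proof (rule fR)
          have "1 * r \<le> exp (d * s) * r" using that d f0(2) \<open>r \<ge> R + 1\<close> by (intro mult_right_mono) auto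
          then show "R < exp (d * s) * r" using \<open>r \<ge> R + 1\<close> by simp
        qed
        then have "g d r = integral {0..1} (\<lambda>s::real. 0::real)" unfolding g_def by (intro Henstock_Kurzweil_Integration.integral_cong) auto
        then show ?thesis by simp
      qed
    qed (use f0(2) D0 sphere_area_pos in auto)
    then have "ennreal sphere_area * (\<integral>\<^sup>+r. ennreal ((g d r) ^ 4 * r ^ 3) * indicator {0<..} r \<partial>lborel)
       \<le> ennreal sphere_area * ennreal (3 / 16 * (D / sphere_area)\<^sup>2)" by (intro mult_left_mono) auto
    also have "\<dots> = ennreal C" using sphere_area_pos by (simp add: C_def power2_eq_square field_simps flip: ennreal_mult)
    finally show "(\<integral>\<^sup>+x. ennreal (indicator {0<..} (norm (x::real^4)) *\<^sub>R (g d (norm x)) ^ 4) \<partial>lborel) \<le> ennreal C"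
      by (simp only: radial_nn_integral[OF gm] shift zero_le_power gn)
  qed
  define k where "k n x = ennreal (indicator {0<..} (norm (x::real^4)) *\<^sub>R (g (inverse (real (Suc n))) (norm x)) ^ 4)" for n x
  have km [measurable]: "k n \<in> borel_measurable borel" for n
  proof -
    have "inverse (real (Suc n)) > 0" by simp
    from gm[OF this] show ?thesis unfolding k_def by (rule measurable_compose[rotated]) simp
  qed
  have "(nn_pow4 lborel u) = (\<integral>\<^sup>+x. ennreal ((f (norm (x::real^4))) ^ 4) \<partial>lborel)" using f0(6) by (simp add: ff0)
  also have "\<dots> \<le> (\<integral>\<^sup>+x. liminf (\<lambda>n. k n x) \<partial>lborel)"
  proof (rule nn_integral_mono_AE)
    have "AE x in lborel. x \<noteq> (0::real^4)" by (rule AE_lborel_singleton)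
    then show "AE x in lborel. ennreal ((f (norm (x::real^4))) ^ 4) \<le> liminf (\<lambda>n. k n x)"
    proof eventually_elim
      case (elim x)
      define r where "r = norm x"
      have r: "r > 0" using elim by (simp add: r_def)
      have gl: "\<bar>g d r - f r\<bar> \<le> L * r * (exp d - 1)" if d: "d > 0" for d
      proof -
        have "g d r - f r = integral {0..1} (\<lambda>s. f (exp (d * s) * r) - f r)"
        proof -
          have "(\<lambda>_. f r) integrable_on {0..1::real}" by (intro integrable_continuous_interval continuous_intros)
          from Henstock_Kurzweil_Integration.integral_diff[OF integrable_continuous_interval[OF gc[of d r]] this] show ?thesis by (simp add: g_def)
        qed
        also have "norm \<dots> \<le> (L * r * (exp d - 1)) * (1 - 0)"
        proof (rule integral_bound)
          fix s :: real assume s: "s \<in> {0..1}"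
          have e: "1 \<le> exp (d * s)" "exp (d * s) \<le> exp d" using s d by auto
          have "norm (f (exp (d * s) * r) - f r) \<le> L * norm (exp (d * s) * r - r)" using fl by simp
          also have "exp (d * s) * r - r = (exp (d * s) - 1) * r" by (simp add: algebra_simps)
          also have "norm ((exp (d * s) - 1) * r) = (exp (d * s) - 1) * r" using e r by simp
          also have "L * ((exp (d * s) - 1) * r) \<le> L * ((exp d - 1) * r)" using e r f0(1) by (intro mult_left_mono mult_right_mono) auto
          finally show "norm (f (exp (d * s) * r) - f r) \<le> L * r * (exp d - 1)" by (simp add: mult_ac)
        qed (auto intro!: continuous_intros gc)
        finally show ?thesis by simp
      qed
      have "(\<lambda>n. g (inverse (real (Suc n))) r - f r) \<longlonglongrightarrow> 0"
      proof (rule Lim_null_comparison)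
        show "\<forall>\<^sub>F n in sequentially. norm (g (inverse (real (Suc n))) r - f r) \<le> L * r * (exp (inverse (real (Suc n))) - 1)"
          by (intro always_eventually allI) (simp only: real_norm_def, rule gl, simp)
        have "(\<lambda>n. L * r * (exp (inverse (real (Suc n))) - 1)) \<longlonglongrightarrow> L * r * (exp 0 - 1)" by (intro tendsto_intros LIMSEQ_inverse_real_of_nat)
        then show "(\<lambda>n. L * r * (exp (inverse (real (Suc n))) - 1)) \<longlonglongrightarrow> 0" by simp
      qed
      then have "(\<lambda>n. g (inverse (real (Suc n))) r) \<longlonglongrightarrow> f r" by (rule LIM_zero_cancel)
      then have "(\<lambda>n. ennreal ((g (inverse (real (Suc n))) r) ^ 4)) \<longlonglongrightarrow> ennreal (f r ^ 4)" by (intro tendsto_ennrealI tendsto_power)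
      from lim_imp_Liminf[OF trivial_limit_sequentially this] show ?case using r by (simp add: k_def r_def)
    qed
  qed
  also have "\<dots> \<le> liminf (\<lambda>n. \<integral>\<^sup>+x. k n x \<partial>lborel)" by (rule nn_integral_liminf) measurable
  also have "\<dots> \<le> liminf (\<lambda>n::nat. ennreal C)" unfolding k_def by (intro Liminf_mono always_eventually allI est) simp
  finally show ?thesis by (simp add: Liminf_const C_def D_def)
qed

section \<open>The Sobolev inequality by completion\<close>

text \<open>Square of the best Sobolev constant: it equals 32 * pi^2 / 3, as the area of the unit
  sphere in dimension four is 2 * pi^2. The square is the natural form for comparing an
  \<open>L^4\<close> integral with a squared Dirichlet integral.\<close>

definition sobolev_sq :: real where "sobolev_sq = 16 * sphere_area / 3"

lemma sobolev_sq_pos: "sobolev_sq > 0" using sphere_area_pos by (simp add: sobolev_sq_def)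

lemma sobolev_test_nn:
  fixes u :: "real^4 \<Rightarrow> real"
  assumes u: "u \<in> test_functions \<Omega>"
  shows "(nn_pow4 lebesgue u) \<le> ennreal ((L2_sq (grad u))\<^sup>2 / sobolev_sq)"
proof -
  have [measurable]: "u \<in> borel_measurable borel" using test_function_continuous[OF u] by (auto intro: borel_measurable_continuous_onI)
  have "(nn_pow4 lebesgue u) = (nn_pow4 lborel u)" by (rule nn_integral_completion)
  also have "\<dots> \<le> ennreal (3 / (16 * sphere_area) * (L2_sq (grad u))\<^sup>2)" by (rule sharp_sobolev_test[OF u])
  finally show ?thesis by (simp add: sobolev_sq_def mult.commute)
qed

text \<open>Fatou handles the left side, so almost everywhere convergence together with convergence
  of the Dirichlet integrals carries the inequality to the limit.\<close>

lemma sobolev_limit: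
  fixes w :: "real^4 \<Rightarrow> real"
  assumes \<phi>: "\<And>n. \<phi> n \<in> test_functions \<Omega>" and ae: "AE x in lebesgue. (\<lambda>n. \<phi> n x) \<longlonglongrightarrow> w x"
    and Q: "(\<lambda>n. L2_sq (grad (\<phi> n))) \<longlonglongrightarrow> q" and w: "w \<in> borel_measurable lebesgue"
  shows "integrable lebesgue (\<lambda>x. (w x) ^ 4)" "sobolev_sq * (LINT x|lebesgue. (w x) ^ 4) \<le> q\<^sup>2"
proof -
  have \<phi>m: "\<phi> n \<in> borel_measurable lebesgue" for n using L2_test_function(1)[OF \<phi>] by (rule L2_measurable)
  have "(nn_pow4 lebesgue w) \<le> (\<integral>\<^sup>+x. liminf (\<lambda>n. ennreal ((\<phi> n x) ^ 4)) \<partial>lebesgue)"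
  proof (rule nn_integral_mono_AE)
    show "AE x in lebesgue. ennreal ((w x) ^ 4) \<le> liminf (\<lambda>n. ennreal ((\<phi> n x) ^ 4))" using ae
    proof eventually_elim
      case (elim x)
      then have "(\<lambda>n. ennreal ((\<phi> n x) ^ 4)) \<longlonglongrightarrow> ennreal ((w x) ^ 4)" by (intro tendsto_ennrealI tendsto_power)
      from lim_imp_Liminf[OF trivial_limit_sequentially this] show ?case by (simp only: order_refl)
    qed
  qed
  also have "\<dots> \<le> liminf (\<lambda>n. \<integral>\<^sup>+x. ennreal ((\<phi> n x) ^ 4) \<partial>lebesgue)" using \<phi>m by (intro nn_integral_liminf) measurable
  also have "\<dots> \<le> liminf (\<lambda>n. ennreal ((L2_sq (grad (\<phi> n)))\<^sup>2 / sobolev_sq))" by (intro Liminf_mono always_eventually allI sobolev_test_nn[OF \<phi>])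
  also have "\<dots> = ennreal (q\<^sup>2 / sobolev_sq)"
    using sobolev_sq_pos by (intro lim_imp_Liminf tendsto_ennrealI tendsto_divide tendsto_power Q tendsto_const) auto
  finally have le: "(nn_pow4 lebesgue w) \<le> ennreal (q\<^sup>2 / sobolev_sq)" .
  show i: "integrable lebesgue (\<lambda>x. (w x) ^ 4)" by (rule integrableI_nonneg) (use w le in \<open>auto intro: le_less_trans\<close>)
  have "ennreal (LINT x|lebesgue. (w x) ^ 4) \<le> ennreal (q\<^sup>2 / sobolev_sq)" using le by (subst (asm) nn_integral_eq_integral[OF i]) auto
  then have "(LINT x|lebesgue. (w x) ^ 4) \<le> q\<^sup>2 / sobolev_sq" using sobolev_sq_pos by (subst (asm) ennreal_le_iff) auto
  then show "sobolev_sq * (LINT x|lebesgue. (w x) ^ 4) \<le> q\<^sup>2" using sobolev_sq_pos by (simp add: field_simps)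
qed

text \<open>Splitting at the height \<open>\<eta>\<close> separates a small multiple of
  \<open>b\<close> from the fourth power of \<open>a\<close>. In the estimate of far translates this
  does the work of Hoelder's inequality.\<close>

lemma abs_mult_le_power4:
  fixes a b \<eta> :: real
  assumes "\<eta> > 0" "0 \<le> b" "b \<le> M"
  shows "\<bar>a * b\<bar> \<le> \<eta> * b + M / \<eta> ^ 3 * a ^ 4"
proof -
  have pos: "0 \<le> M / \<eta> ^ 3 * a ^ 4" using assms by (intro mult_nonneg_nonneg divide_nonneg_nonneg) auto
  show ?thesis
  proof (cases "\<bar>a\<bar> \<le> \<eta>")
    case True
    then have "\<bar>a * b\<bar> \<le> \<eta> * b" using assms by (simp add: abs_mult mult_right_mono)
    then show ?thesis using pos by linarith
  next
    case False
    have "\<eta> ^ 3 * \<bar>a\<bar> \<le> \<bar>a\<bar> ^ 3 * \<bar>a\<bar>" using False assms by (intro mult_right_mono power_mono) auto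
    also have "\<bar>a\<bar> ^ 3 * \<bar>a\<bar> = a ^ 4" by (simp add: power4_eq_xxxx power3_eq_cube abs_mult[symmetric])
    finally have "\<bar>a\<bar> \<le> a ^ 4 / \<eta> ^ 3" using assms by (simp add: field_simps)
    then have "\<bar>a\<bar> * b \<le> (a ^ 4 / \<eta> ^ 3) * M" using assms by (intro mult_mono) auto
    moreover have "0 \<le> \<eta> * b" using assms by simp
    moreover have "\<bar>a * b\<bar> = \<bar>a\<bar> * b" using assms by (simp add: abs_mult)
    moreover have "(a ^ 4 / \<eta> ^ 3) * M = M / \<eta> ^ 3 * a ^ 4" by simp
    ultimately show ?thesis by linarith
  qed
qed

text \<open>Cauchy-Schwarz for the square of \<open>a\<close> against the indicator of
  \<open>K\<close>.\<close>

lemma L2_power4: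
  fixes a :: "'a::euclidean_space \<Rightarrow> real"
  assumes a: "a \<in> borel_measurable lebesgue" "integrable lebesgue (\<lambda>x. (a x) ^ 4)" and K: "compact K"
  shows "L2 (zero_ext K a)"
    "(LINT x|lebesgue. (norm (indicator K x *\<^sub>R a x))\<^sup>2)\<^sup>2 \<le> (LINT x|lebesgue. (a x) ^ 4) * measure lebesgue K"
proof -
  have K': "emeasure lebesgue K < \<infinity>" "K \<in> sets lebesgue" using emeasure_compact_finite[OF K] K by (auto simp: borel_compact)
  have sq: "L2 (\<lambda>x. (a x)\<^sup>2)" unfolding L2_def using a by (simp add: power_mult[symmetric])
  have ind: "L2 (indicator K :: 'a \<Rightarrow> real)"
  proof -
    have "(\<lambda>x. (norm (indicat_real K x))\<^sup>2) = indicat_real K" by (auto simp: indicator_def)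
    then show ?thesis unfolding L2_def using K' by (auto intro!: integrable_real_indicator)
  qed
  have eq: "(a x)\<^sup>2 \<bullet> indicat_real K x = (norm (indicator K x *\<^sub>R a x))\<^sup>2" for x by (simp add: indicator_def)
  have 1: "integrable lebesgue (\<lambda>x. (norm (indicator K x *\<^sub>R a x))\<^sup>2)" using L2_inner_integrable[OF sq ind] by (simp only: eq)
  moreover have "(zero_ext K a) \<in> borel_measurable lebesgue" using K'(2) by (intro borel_measurable_scaleR a borel_measurable_indicator)
  ultimately show "L2 (zero_ext K a)" unfolding L2_def by blast
  have "(LINT x|lebesgue. (norm (indicat_real K x))\<^sup>2) = (LINT x|lebesgue. indicat_real K x)"
    by (intro Bochner_Integration.integral_cong refl) (auto simp: indicator_def)
  also have "\<dots> = measure lebesgue K" using K' by simp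
  finally have "(LINT x|lebesgue. (norm (indicat_real K x))\<^sup>2) = measure lebesgue K" .
  moreover have "(LINT x|lebesgue. (norm ((a x)\<^sup>2))\<^sup>2) = (LINT x|lebesgue. (a x) ^ 4)" by (simp add: power_mult[symmetric])
  ultimately show "(LINT x|lebesgue. (norm (indicator K x *\<^sub>R a x))\<^sup>2)\<^sup>2 \<le> (LINT x|lebesgue. (a x) ^ 4) * measure lebesgue K"
    using L2_Cauchy_Schwarz[OF sq ind] by (simp only: eq)
qed

section \<open>Functions in \<open>L^4\<close> with vanishing weak gradient\<close>

lemma power4_locally_integrable:
  fixes v :: "'a::euclidean_space \<Rightarrow> real"
  assumes "v \<in> borel_measurable lebesgue" "integrable lebesgue (\<lambda>x. (v x) ^ 4)" "compact K"
  shows "set_integrable lebesgue K v"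
proof -
  have "set_integrable lebesgue K (zero_ext K v)" by (rule L2_locally_integrable[OF L2_power4(1)[OF assms] assms(3)])
  moreover have "(\<lambda>x. indicator K x *\<^sub>R indicator K x *\<^sub>R v x) = (zero_ext K v)" by (auto simp: indicator_def)
  ultimately show ?thesis unfolding set_integrable_def by simp
qed

text \<open>The difference of a bump and its translate along a coordinate is a directional
  derivative of a test function, so \<open>z\<close> has the same pairing with all translates. Far
  translates see only the tail of the integral of \<open>z ^ 4\<close>, which tends to 0; hence
  every pairing with a bump is 0.\<close>

lemma L4_zero_weak_grad:
  fixes z :: "'a::euclidean_space \<Rightarrow> real"
  assumes zm: "z \<in> borel_measurable lebesgue" and z4: "integrable lebesgue (\<lambda>x. (z x) ^ 4)"
    and wg: "is_weak_grad UNIV z (\<lambda>x. 0)"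
  shows "AE x in lebesgue. z x = 0"
proof -
  have loc: "set_integrable lebesgue K z" if "compact K" for K by (rule power4_locally_integrable[OF zm z4 that])
  have "(LINT x:UNIV|lebesgue. box_bump n a b x *\<^sub>R z x) = 0" for n a b
  proof -
    obtain e :: 'a where e: "e \<in> Basis" using nonempty_Basis by blast
    \<comment> \<open>The factor depending on the coordinate \<open>e\<close> is isolated; its
      antiderivative \<open>H\<close> is constant on either side of the support of
      \<open>p\<close>.\<close>
    define p where "p s = flat (real n * (s - a \<bullet> e)) * flat (real n * (b \<bullet> e - s))" for s
    define rest where "rest x = (\<Prod>i\<in>Basis - {e}. flat (real n * (x \<bullet> i - a \<bullet> i)) * flat (real n * (b \<bullet> i - x \<bullet> i)))" for x
    have bump: "box_bump n a b x = p (x \<bullet> e) * rest x" for x unfolding box_bump_def p_def rest_def by (rule prod.remove[OF finite_Basis e])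
    have ps: "smooth_on UNIV p"
    proof -
      have "smooth_on UNIV (\<lambda>s::real. flat (real n * (s \<bullet> 1) + real n * (- (a \<bullet> e))) * flat ((- real n) * (s \<bullet> 1) + real n * (b \<bullet> e)))"
        by (intro smooth_on_mult smooth_on_affine_compose smooth_flat open_UNIV)
      then show ?thesis unfolding p_def[abs_def] by (simp add: algebra_simps)
    qed
    have pc: "continuous_on UNIV p" by (rule smooth_on_imp_continuous_on[OF ps])
    from continuous_antiderivative[OF pc] obtain H where H: "\<And>s. (H has_real_derivative p s) (at s)" by blast
    have Hs: "smooth_on UNIV H" unfolding smooth_on_def
    proof
      fix k
      have "Ck_on (Suc k) UNIV H" by (rule Ck_on_SucI[where D="\<lambda>s h. p s * h"])
          (use H ps in \<open>auto simp: has_field_derivative_def smooth_on_def\<close>)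
      then show "Ck_on k UNIV H" by (rule Ck_on_mono)
    qed
    have p0: "p s = 0" if "s \<notin> {a \<bullet> e..b \<bullet> e}" for s using that by (auto simp: p_def flat_eq_0 mult_nonneg_nonpos not_le)
    have Hconst: "H s = H s'" if "s \<le> s'" "s' \<le> a \<bullet> e \<or> b \<bullet> e \<le> s" for s s'
    proof (cases "s = s'")
      case False
      then have "\<exists>c>s. c < s' \<and> H s' - H s = (s' - s) * p c" using that(1) H by (intro MVT2) auto
      then obtain c where "s < c" "c < s'" "H s' - H s = (s' - s) * p c" by blast
      then show ?thesis using p0[of c] that(2) by auto
    qed simp
    have rest_smooth: "smooth_on UNIV rest"
    proof -
      have "smooth_on UNIV (\<lambda>x. flat (real n * (x \<bullet> i) + real n * (- (a \<bullet> i))) * flat ((- real n) * (x \<bullet> i) + real n * (b \<bullet> i)))" for i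
        by (intro smooth_on_mult smooth_on_affine_compose smooth_flat open_UNIV)
      then show ?thesis unfolding rest_def[abs_def] by (intro smooth_on_prod open_UNIV) (simp add: algebra_simps)
    qed
    have rest_shift: "rest (x + s *\<^sub>R e) = rest x" for x s
      unfolding rest_def using e by (intro prod.cong refl) (auto simp: inner_add_left inner_not_same_Basis)
    define I where "I = (LINT x|lebesgue. box_bump n a b x * z x)"
    have bump_m: "continuous_on UNIV (box_bump n a b)" by (rule smooth_on_imp_continuous_on[OF smooth_box_bump])
    have shift: "(LINT x|lebesgue. box_bump n a b (x - t *\<^sub>R e) * z x) = I
        \<and> integrable lebesgue (\<lambda>x. box_bump n a b (x - t *\<^sub>R e) * z x)" if t: "t > 0" for t
    proof -
      \<comment> \<open>A difference of two shifted antiderivatives vanishes far out in both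
        directions, although \<open>H\<close> itself may tend to different constants; this gives
        compact support.\<close>
      define \<psi> where "\<psi> x = (H (x \<bullet> e) - H (x \<bullet> e - t)) * rest x" for x
      have \<psi>s: "smooth_on UNIV \<psi>"
      proof -
        have "smooth_on UNIV (\<lambda>x. (H (1 * (x \<bullet> e) + 0) - H (1 * (x \<bullet> e) + (- t))) * rest x)"
          by (intro smooth_on_mult smooth_on_diff smooth_on_affine_compose Hs rest_smooth open_UNIV)
        then show ?thesis by (simp add: \<psi>_def[abs_def])
      qed
      have \<psi>0: "\<psi> x = 0" if "x \<notin> cbox a (b + t *\<^sub>R e)" for x
      proof -
        obtain i where i: "i \<in> Basis" "x \<bullet> i < a \<bullet> i \<or> (b + t *\<^sub>R e) \<bullet> i < x \<bullet> i" using \<open>x \<notin> _\<close> by (auto simp: mem_box not_le)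
        show ?thesis
        proof (cases "i = e")
          case True
          then have "x \<bullet> e < a \<bullet> e \<or> b \<bullet> e + t < x \<bullet> e" using i e by (simp add: inner_add_left)
          then have "H (x \<bullet> e - t) = H (x \<bullet> e)" using t by (intro Hconst) auto
          then show ?thesis by (simp add: \<psi>_def)
        next
          case False
          then have "x \<bullet> i < a \<bullet> i \<or> b \<bullet> i < x \<bullet> i" using i e by (auto simp: inner_add_left inner_not_same_Basis)
          then have "rest x = 0" unfolding rest_def using i(1) False by (intro prod_zero) (auto intro!: bexI[of _ i] simp: flat_eq_0 mult_nonneg_nonpos)
          then show ?thesis by (simp add: \<psi>_def)
        qed
      qed
      have \<psi>t: "\<psi> \<in> test_functions UNIV" by (rule test_functionI[OF \<psi>s compact_cbox[of a "b + t *\<^sub>R e"]]) (use \<psi>0 in auto)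
      have gr: "grad \<psi> x \<bullet> e = box_bump n a b x - box_bump n a b (x - t *\<^sub>R e)" for x
      proof -
        have "((\<lambda>s. \<psi> (x + s *\<^sub>R e)) has_derivative (\<lambda>s. grad \<psi> x \<bullet> (s *\<^sub>R e))) (at 0)"
          by (rule has_derivative_compose[of "\<lambda>s. x + s *\<^sub>R e" "\<lambda>s. s *\<^sub>R e"])
            (auto intro!: derivative_eq_intros smooth_on_has_derivative_grad[OF \<psi>s])
        then have 1: "((\<lambda>s. \<psi> (x + s *\<^sub>R e)) has_real_derivative grad \<psi> x \<bullet> e) (at 0)"
          by (simp add: has_field_derivative_def mult.commute[of _ "grad \<psi> x \<bullet> e"])
        have "(\<lambda>s. \<psi> (x + s *\<^sub>R e)) = (\<lambda>s. (H (x \<bullet> e + s) - H (x \<bullet> e + s - t)) * rest x)" using e by (auto simp: \<psi>_def rest_shift inner_add_left)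
        moreover have Hd: "((\<lambda>s. H (k + s)) has_real_derivative p k) (at 0)" for k
        proof -
          have d: "((\<lambda>s. k + s) has_real_derivative 1) (at 0)" by (auto intro!: derivative_eq_intros)
          show ?thesis using DERIV_chain2[where f=H and g="\<lambda>s. k + s", OF H d] by simp
        qed
        moreover have "((\<lambda>s. H (x \<bullet> e + s - t)) has_real_derivative p (x \<bullet> e - t)) (at 0)" using Hd[of "x \<bullet> e - t"] by (simp add: algebra_simps)
        ultimately have "((\<lambda>s. \<psi> (x + s *\<^sub>R e)) has_real_derivative (p (x \<bullet> e) - p (x \<bullet> e - t)) * rest x) (at 0)"
          by (auto intro!: DERIV_cmult_right DERIV_diff)
        with 1 have "grad \<psi> x \<bullet> e = (p (x \<bullet> e) - p (x \<bullet> e - t)) * rest x" by (rule DERIV_unique)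
        then show ?thesis using e rest_shift[of x "- t"] by (simp add: bump inner_diff_left left_diff_distrib)
      qed
      have ib: "integrable lebesgue (\<lambda>x. box_bump n a b x *\<^sub>R z x)"
        by (rule integrable_scaleR_compact_support[OF loc[OF compact_cbox] bump_m compact_cbox[of a b]]) (rule box_bump_eq_0)
      have cs: "continuous_on UNIV (\<lambda>x. box_bump n a b (x - t *\<^sub>R e))" by (rule continuous_on_compose2[OF bump_m]) (auto intro!: continuous_intros)
      have it: "integrable lebesgue (\<lambda>x. box_bump n a b (x - t *\<^sub>R e) *\<^sub>R z x)"
      proof (rule integrable_scaleR_compact_support[OF loc[OF compact_cbox] cs compact_cbox[of "a + t *\<^sub>R e" "b + t *\<^sub>R e"]])
        fix x assume "x \<notin> cbox (a + t *\<^sub>R e) (b + t *\<^sub>R e)"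
        then have "x - t *\<^sub>R e \<notin> cbox a b" by (auto simp: mem_box inner_add_left inner_diff_left algebra_simps)
        then show "box_bump n a b (x - t *\<^sub>R e) = 0" by (rule box_bump_eq_0)
      qed
      have "(LINT x|lebesgue. z x *\<^sub>R grad \<psi> x) = 0" using wg \<psi>t by (simp add: is_weak_grad_iff)
      then have "(LINT x|lebesgue. (z x *\<^sub>R grad \<psi> x) \<bullet> e) = 0"
        using integral_inner_left[of e lebesgue "\<lambda>x. z x *\<^sub>R grad \<psi> x"] weak_grad_test_integrable(1)[OF wg \<psi>t] by simp
      moreover have "(z x *\<^sub>R grad \<psi> x) \<bullet> e = box_bump n a b x * z x - box_bump n a b (x - t *\<^sub>R e) * z x" for x by (simp add: gr algebra_simps)
      ultimately have "I - (LINT x|lebesgue. box_bump n a b (x - t *\<^sub>R e) * z x) = 0" unfolding I_def using ib it by simp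
      then show ?thesis using it by simp
    qed
    define W where "W = (LINT x|lebesgue. box_bump n a b x)"
    have W: "(LINT x|lebesgue. box_bump n a b (x - t *\<^sub>R e)) = W" "integrable lebesgue (\<lambda>x. box_bump n a b (x - t *\<^sub>R e))" for t
    proof -
      have cs: "continuous_on UNIV (\<lambda>x. box_bump n a b (x - t *\<^sub>R e))" for t
        by (rule continuous_on_compose2[OF bump_m]) (auto intro!: continuous_intros)
      have m: "(\<lambda>x. box_bump n a b (x - t *\<^sub>R e)) \<in> borel_measurable borel" "box_bump n a b \<in> borel_measurable borel" for t
        using cs bump_m by (auto intro: borel_measurable_continuous_onI)
      have i0: "integrable lborel (box_bump n a b)"
        by (rule integrable_continuous_compact_support(1)[OF bump_m compact_cbox[of a b]]) (rule box_bump_eq_0)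
      show "integrable lebesgue (\<lambda>x. box_bump n a b (x - t *\<^sub>R e))"
        using integrable_lborel_translation[OF i0, of "- (t *\<^sub>R e)"] m(1)[of t] by (subst integrable_completion) auto
      show "(LINT x|lebesgue. box_bump n a b (x - t *\<^sub>R e)) = W"
        using integral_lborel_translation[of "box_bump n a b" "- (t *\<^sub>R e)"] m unfolding W_def by (simp add: integral_completion)
    qed
    have tail: "(\<lambda>k::nat. LINT x|lebesgue. indicator {x. a \<bullet> e + real k \<le> x \<bullet> e} x * (z x) ^ 4) \<longlonglongrightarrow> (LINT x::'a|lebesgue. 0)"
    proof (rule integral_dominated_convergence[where w="\<lambda>x. (z x) ^ 4"])
      have S: "{x. a \<bullet> e + real k \<le> x \<bullet> e} \<in> sets lebesgue" for k
        using closed_halfspace_ge[of "a \<bullet> e + real k" e] by (simp add: inner_commute borel_closed)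
      show "(\<lambda>x. indicator {x. a \<bullet> e + real k \<le> x \<bullet> e} x * (z x) ^ 4) \<in> borel_measurable lebesgue" for k
        using S[of k] zm by (intro borel_measurable_times borel_measurable_indicator borel_measurable_power)
      show "AE x in lebesgue. (\<lambda>k::nat. indicator {x. a \<bullet> e + real k \<le> x \<bullet> e} x * (z x) ^ 4) \<longlonglongrightarrow> 0"
      proof (rule AE_I2)
        fix x
        obtain k0 :: nat where k0: "x \<bullet> e - a \<bullet> e < real k0" using reals_Archimedean2 by blast
        have "\<forall>\<^sub>F k in sequentially. indicator {x. a \<bullet> e + real k \<le> x \<bullet> e} x * (z x) ^ 4 = 0"
          using eventually_ge_at_top[of k0] by eventually_elim (use k0 in \<open>auto simp: indicator_def\<close>)
        then show "(\<lambda>k::nat. indicator {x. a \<bullet> e + real k \<le> x \<bullet> e} x * (z x) ^ 4) \<longlonglongrightarrow> 0" by (rule tendsto_eventually)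
      qed
    qed (use z4 in \<open>auto simp: indicator_def\<close>)
    \<comment> \<open>The translate by \<open>t = Suc k\<close> lives where
      \<open>x \<bullet> e >= a \<bullet> e + t\<close>. The bump has values in [0, 1] and mass
      \<open>W\<close> independent of the shift, so one term is \<open>\<eta> * W\<close> and the
      other a tail. First \<open>k\<close> tends to infinity, then \<open>\<eta>\<close> to
      0.\<close>
    have Ile: "\<bar>I\<bar> \<le> \<eta> * W + 1 / \<eta> ^ 3 * (LINT x|lebesgue. indicator {x. a \<bullet> e + real (Suc k) \<le> x \<bullet> e} x * (z x) ^ 4)" if \<eta>: "\<eta> > 0" for \<eta> k
    proof -
      define t where "t = real (Suc k)"
      have t: "t > 0" by (simp add: t_def)
      define E where "E = {x. a \<bullet> e + t \<le> x \<bullet> e}"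
      have E: "E \<in> sets lebesgue" using closed_halfspace_ge[of "a \<bullet> e + t" e] by (simp add: E_def inner_commute borel_closed)
      have iE: "integrable lebesgue (\<lambda>x. indicator E x * (z x) ^ 4)" using integrable_mult_indicator[OF E z4] by simp
      have "\<bar>I\<bar> = \<bar>LINT x|lebesgue. box_bump n a b (x - t *\<^sub>R e) * z x\<bar>" using shift[OF t] by simp
      also have "\<dots> \<le> (LINT x|lebesgue. \<bar>box_bump n a b (x - t *\<^sub>R e) * z x\<bar>)" by (rule integral_abs_bound)
      also have "\<dots> \<le> (LINT x|lebesgue. \<eta> * box_bump n a b (x - t *\<^sub>R e) + 1 / \<eta> ^ 3 * (indicator E x * (z x) ^ 4))"
      proof (rule integral_mono)
        show "integrable lebesgue (\<lambda>x. \<bar>box_bump n a b (x - t *\<^sub>R e) * z x\<bar>)" using shift[OF t] by (intro integrable_abs) simp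
        show "integrable lebesgue (\<lambda>x. \<eta> * box_bump n a b (x - t *\<^sub>R e) + 1 / \<eta> ^ 3 * (indicator E x * (z x) ^ 4))"
          by (intro Bochner_Integration.integrable_add integrable_mult_right W(2) iE)
        fix x
        show "\<bar>box_bump n a b (x - t *\<^sub>R e) * z x\<bar> \<le> \<eta> * box_bump n a b (x - t *\<^sub>R e) + 1 / \<eta> ^ 3 * (indicator E x * (z x) ^ 4)"
        proof (cases "x \<in> E")
          case True
          then show ?thesis using abs_mult_le_power4[OF \<eta> box_bump_bounds(1,2), of "z x" n a b "x - t *\<^sub>R e"] by (simp add: mult.commute)
        next
          case False
          then have "x - t *\<^sub>R e \<notin> cbox a b" using e by (auto simp: E_def mem_box inner_diff_left intro!: bexI[of _ e])
          then have "box_bump n a b (x - t *\<^sub>R e) = 0" by (rule box_bump_eq_0)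
          then show ?thesis using False by simp
        qed
      qed
      also have "\<dots> = \<eta> * W + 1 / \<eta> ^ 3 * (LINT x|lebesgue. indicator E x * (z x) ^ 4)" using W(2)[of t] iE by (simp add: W(1))
      finally show ?thesis by (simp add: E_def t_def)
    qed
    have "\<bar>I\<bar> \<le> \<eta> * W" if \<eta>: "\<eta> > 0" for \<eta>
    proof -
      have "(\<lambda>k. \<eta> * W + 1 / \<eta> ^ 3 * (LINT x|lebesgue. indicator {x. a \<bullet> e + real (Suc k) \<le> x \<bullet> e} x * (z x) ^ 4)) \<longlonglongrightarrow> \<eta> * W + 1 / \<eta> ^ 3 * (LINT x::'a|lebesgue. 0)"
        by (intro tendsto_intros LIMSEQ_Suc[OF tail])
      then have "\<bar>I\<bar> \<le> \<eta> * W + 1 / \<eta> ^ 3 * (LINT x::'a|lebesgue. 0)" by (rule LIMSEQ_le_const) (use Ile[OF \<eta>] in auto)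
      then show ?thesis by simp
    qed
    note small = this
    have "((\<lambda>\<eta>. \<eta> * W) \<longlongrightarrow> 0 * W) (at_right 0)" by (intro tendsto_intros)
    then have "\<bar>I\<bar> \<le> 0 * W" by (rule tendsto_lowerbound) (auto intro!: eventually_at_rightI[of 0 1] small)
    then have "I = 0" by simp
    then show ?thesis by (simp add: I_def set_lebesgue_integral_def)
  qed
  from fundamental_lemma[OF open_UNIV loc this] show ?thesis by simp
qed

text \<open>On a compact set convergence in \<open>L^4\<close> implies convergence in
  \<open>L^2\<close> by \<open>L2_power4\<close>, which is the local convergence that
  \<open>is_weak_grad_limit\<close> asks for.\<close>

lemma is_weak_grad_limit_L4:
  fixes w :: "'a::euclidean_space \<Rightarrow> real"
  assumes \<phi>: "\<And>n. \<phi> n \<in> test_functions UNIV"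
    and i: "\<And>n. integrable lebesgue (\<lambda>x. (\<phi> n x - w x) ^ 4)"
    and w: "w \<in> borel_measurable lebesgue" "integrable lebesgue (\<lambda>x. (w x) ^ 4)" and g: "L2 g"
    and lim: "(\<lambda>n. LINT x|lebesgue. (\<phi> n x - w x) ^ 4) \<longlonglongrightarrow> 0"
      "(\<lambda>n. LINT x|lebesgue. (norm (grad (\<phi> n) x - g x))\<^sup>2) \<longlonglongrightarrow> 0"
  shows "is_weak_grad UNIV w g"
proof (rule is_weak_grad_limit[OF \<phi>])
  fix K :: "'a set" assume K: "compact K"
  have m: "\<phi> n \<in> borel_measurable lebesgue" for n using L2_test_function(1)[OF \<phi>] by (rule L2_measurable)
  show "L2 (zero_ext K w)" by (rule L2_power4[OF w K])
  show "(\<lambda>n. LINT x|lebesgue. (norm (indicator K x *\<^sub>R \<phi> n x - indicator K x *\<^sub>R w x))\<^sup>2) \<longlonglongrightarrow> 0"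
  proof -
    let ?A = "\<lambda>n. LINT x|lebesgue. (norm (indicator K x *\<^sub>R (\<phi> n x - w x)))\<^sup>2"
    have "(\<lambda>n. (?A n)\<^sup>2) \<longlonglongrightarrow> 0"
    proof (rule tendsto_sandwich[OF _ _ tendsto_const])
      show "\<forall>\<^sub>F n in sequentially. (?A n)\<^sup>2 \<le> (LINT x|lebesgue. (\<phi> n x - w x) ^ 4) * measure lebesgue K"
        by (intro always_eventually allI L2_power4(2) borel_measurable_diff m w i K)
      show "(\<lambda>n. (LINT x|lebesgue. (\<phi> n x - w x) ^ 4) * measure lebesgue K) \<longlonglongrightarrow> 0" by (rule tendsto_mult_left_zero[OF lim(1)])
    qed simp
    from tendsto_real_sqrt[OF this] show ?thesis by (simp add: algebra_simps)
  qed
qed (use g lim(2) in auto)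

lemma sobolev_test:
  fixes u :: "real^4 \<Rightarrow> real"
  assumes u: "u \<in> test_functions \<Omega>"
  shows "integrable lebesgue (\<lambda>x. (u x) ^ 4)"
    "sobolev_sq * (LINT x|lebesgue. (u x) ^ 4) \<le> (L2_sq (grad u))\<^sup>2"
  using sobolev_limit[of "\<lambda>n. u" \<Omega> u "L2_sq (grad u)"] u L2_measurable[OF L2_test_function(1)[OF u]] by simp_all

text \<open>The definition gives convergence of gradients only. The inequality for differences of
  test functions makes the sequence Cauchy in \<open>L^4\<close>; its limit has the same weak
  gradient as \<open>v\<close>, so the two agree by \<open>L4_zero_weak_grad\<close>, and
  \<open>sobolev_limit\<close> applies along an almost everywhere convergent subsequence.\<close>

lemma D12_sobolev:
  assumes "v \<in> D12"
  shows "v \<in> borel_measurable lebesgue" "integrable lebesgue (\<lambda>x. (v x) ^ 4)" "L2 (weak_grad UNIV v)"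
    "is_weak_grad UNIV v (weak_grad UNIV v)"
    "sobolev_sq * (LINT x|lebesgue. (v x) ^ 4) \<le> (L2_sq (weak_grad UNIV v))\<^sup>2"
proof -
  have p4: "norm y ^ 4 = y ^ 4" for y :: real by simp
  obtain g \<phi> where g: "g \<in> Lp 2 UNIV" "is_weak_grad UNIV v g" and r: "range \<phi> \<subseteq> test_functions UNIV"
    and lim: "(\<lambda>n. LINT x|lebesgue. (norm (weak_grad UNIV (\<lambda>y. \<phi> n y - v y) x))\<^sup>2) \<longlonglongrightarrow> 0" using assms by (auto simp: D12_def)
  have \<phi>: "\<phi> n \<in> test_functions UNIV" for n using r by auto
  have vm: "v \<in> borel_measurable lebesgue" and v4: "integrable lebesgue (\<lambda>x. (v x) ^ 4)"
    using assms by (auto simp: D12_def Lp_def set_borel_measurable_def set_integrable_def)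
  define G where "G = weak_grad UNIV v"
  have wg: "is_weak_grad UNIV v G" and Gg: "AE x in lebesgue. G x = g x" using weak_grad_eqI[OF open_UNIV g(2)] by (simp_all add: G_def)
  have L2g: "L2 g" using g(1) by (simp add: Lp_2_iff)
  have L2G: "L2 G" by (rule L2_cong_AE[OF L2g]) (use Gg in \<open>eventually_elim, simp\<close>)
  have limG: "(\<lambda>n. LINT x|lebesgue. (norm (grad (\<phi> n) x - G x))\<^sup>2) \<longlonglongrightarrow> 0"
  proof -
    have "(LINT x|lebesgue. (norm (weak_grad UNIV (\<lambda>y. \<phi> n y - v y) x))\<^sup>2) = (LINT x|lebesgue. (norm (grad (\<phi> n) x - G x))\<^sup>2)" for n
    proof (rule integral_lebesgue_cong_AE(1))
      have "is_weak_grad UNIV (\<phi> n) (grad (\<phi> n))" by (rule smooth_is_weak_grad) (use \<phi>[of n] in \<open>simp add: test_functions_def\<close>)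
      from weak_grad_eqI(2)[OF open_UNIV is_weak_grad_diff[OF this wg]]
      show "AE x in lebesgue. (norm (weak_grad UNIV (\<lambda>y. \<phi> n y - v y) x))\<^sup>2 = (norm (grad (\<phi> n) x - G x))\<^sup>2" by eventually_elim simp
    qed
    then show ?thesis using lim by simp
  qed
  have \<phi>m: "\<phi> n \<in> borel_measurable lebesgue" for n using L2_test_function(1)[OF \<phi>] by (rule L2_measurable)
  have cauchy: "\<exists>N. \<forall>m\<ge>N. \<forall>n\<ge>N. (LINT x|lebesgue. norm (\<phi> m x - \<phi> n x) ^ 4) < e" if e: "e > 0" for e
  proof -
    \<comment> \<open>Chosen so that \<open>(4 * \<eta>)\<^sup>2 = sobolev_sq * e\<close>; the 4
      collects two gradient distances, each with the factor 2 of
      \<open>norm_add_sq_le\<close>.\<close>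
    define \<eta> where "\<eta> = sqrt (sobolev_sq * e) / 4"
    have \<eta>: "\<eta> > 0" using e sobolev_sq_pos by (simp add: \<eta>_def)
    obtain N where N: "\<And>n. n \<ge> N \<Longrightarrow> (LINT x|lebesgue. (norm (grad (\<phi> n) x - G x))\<^sup>2) < \<eta>"
      using order_tendstoD(2)[OF limG \<eta>] by (auto simp: eventually_sequentially)
    have "(LINT x|lebesgue. norm (\<phi> m x - \<phi> n x) ^ 4) < e" if mn: "m \<ge> N" "n \<ge> N" for m n
    proof -
      let ?d = "\<lambda>x. \<phi> m x - \<phi> n x"
      have d: "?d \<in> test_functions UNIV" by (intro test_functions_diff \<phi>)
      have sm: "smooth_on UNIV (\<phi> m)" "smooth_on UNIV (\<phi> n)" using \<phi> by (auto simp: test_functions_def)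
      have gd: "grad ?d x = grad (\<phi> m) x - grad (\<phi> n) x" for x
        by (rule grad_unique) (auto intro!: derivative_eq_intros smooth_on_has_derivative_grad sm simp: inner_diff_left)
      have "(LINT x|lebesgue. (norm (grad ?d x))\<^sup>2) \<le> (LINT x|lebesgue. 2 * (norm (grad (\<phi> m) x - G x))\<^sup>2 + 2 * (norm (grad (\<phi> n) x - G x))\<^sup>2)"
      proof (rule integral_mono)
        show "integrable lebesgue (\<lambda>x. (norm (grad ?d x))\<^sup>2)" by (intro L2_integrable L2_test_function(2)[OF d])
        show "integrable lebesgue (\<lambda>x. 2 * (norm (grad (\<phi> m) x - G x))\<^sup>2 + 2 * (norm (grad (\<phi> n) x - G x))\<^sup>2)"
          by (intro Bochner_Integration.integrable_add integrable_mult_right L2_integrable L2_diff L2_test_function(2)[OF \<phi>] L2G)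
        show "(norm (grad ?d x))\<^sup>2 \<le> 2 * (norm (grad (\<phi> m) x - G x))\<^sup>2 + 2 * (norm (grad (\<phi> n) x - G x))\<^sup>2" for x
          using norm_add_sq_le[of "grad (\<phi> m) x - G x" "G x - grad (\<phi> n) x"] by (simp add: gd norm_minus_commute)
      qed
      also have "\<dots> = 2 * (LINT x|lebesgue. (norm (grad (\<phi> m) x - G x))\<^sup>2) + 2 * (LINT x|lebesgue. (norm (grad (\<phi> n) x - G x))\<^sup>2)"
        using L2_integrable[OF L2_diff[OF L2_test_function(2)[OF \<phi>] L2G]] by simp
      also have "\<dots> < 4 * \<eta>" using N[OF mn(1)] N[OF mn(2)] by simp
      finally have "(LINT x|lebesgue. (norm (grad ?d x))\<^sup>2)\<^sup>2 < (4 * \<eta>)\<^sup>2" by (intro power_strict_mono) auto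
      also have "\<dots> = sobolev_sq * e" using e sobolev_sq_pos by (simp add: \<eta>_def)
      finally have "sobolev_sq * (LINT x|lebesgue. ?d x ^ 4) < sobolev_sq * e" using sobolev_test(2)[OF d] by linarith
      then show ?thesis using sobolev_sq_pos by simp
    qed
    then show ?thesis by blast
  qed
  obtain w r where w: "w \<in> borel_measurable lebesgue" "integrable lebesgue (\<lambda>x. norm (w x) ^ 4)"
    "(\<lambda>n. LINT x|lebesgue. norm (\<phi> n x - w x) ^ 4) \<longlonglongrightarrow> 0"
    "strict_mono r" "AE x in lebesgue. (\<lambda>n. \<phi> (r n) x) \<longlonglongrightarrow> w x"
  proof (rule Lp_complete[of 4 \<phi> lebesgue])
    show "integrable lebesgue (\<lambda>x. norm (\<phi> n x) ^ 4)" for n using sobolev_test(1)[OF \<phi>[of n]] by simp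
  qed (use \<phi>m cauchy in auto)
  have diff4: "integrable lebesgue (\<lambda>x. (f x - h x) ^ 4)"
    if "f \<in> borel_measurable lebesgue" "h \<in> borel_measurable lebesgue" "integrable lebesgue (\<lambda>x. (f x) ^ 4)" "integrable lebesgue (\<lambda>x. (h x) ^ 4)"
    for f h :: "real^4 \<Rightarrow> real"
  proof (rule Bochner_Integration.integrable_bound)
    show "integrable lebesgue (\<lambda>x. 2 ^ 4 * ((f x) ^ 4 + (h x) ^ 4))" using that by (intro integrable_mult_right Bochner_Integration.integrable_add)
    show "(\<lambda>x. (f x - h x) ^ 4) \<in> borel_measurable lebesgue" using that by (intro borel_measurable_power borel_measurable_diff)
    show "AE x in lebesgue. norm ((f x - h x) ^ 4) \<le> norm (2 ^ 4 * ((f x) ^ 4 + (h x) ^ 4))"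
    proof (rule AE_I2)
      fix x show "norm ((f x - h x) ^ 4) \<le> norm (2 ^ 4 * ((f x) ^ 4 + (h x) ^ 4))"
        using norm_diff_power_le[of "f x" "h x" 4] by (simp only: p4 norm_power) (simp add: abs_mult)
    qed
  qed
  have w4: "integrable lebesgue (\<lambda>x. (w x) ^ 4)" using w(2) by simp
  have "is_weak_grad UNIV w G" by (rule is_weak_grad_limit_L4[OF \<phi> diff4[OF \<phi>m w(1) sobolev_test(1)[OF \<phi>] w4] w(1) w4 L2G _ limG])
      (use w(3) in simp)
  from is_weak_grad_diff[OF this wg] have "is_weak_grad UNIV (\<lambda>x. w x - v x) (\<lambda>x. 0)" by simp
  from L4_zero_weak_grad[OF _ diff4[OF w(1) vm w4 v4] this] w(1) vm have "AE x in lebesgue. w x - v x = 0" by auto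
  with w(5) have ae: "AE x in lebesgue. (\<lambda>n. \<phi> (r n) x) \<longlonglongrightarrow> v x" by eventually_elim simp
  have "(\<lambda>n. L2_sq (grad (\<phi> n))) \<longlonglongrightarrow> (L2_sq G)" by (rule L2_tendsto_norm_sq[OF L2_test_function(2)[OF \<phi>] L2G limG])
  from LIMSEQ_subseq_LIMSEQ[OF this w(4)]
  have "(\<lambda>n. LINT x|lebesgue. (norm (grad (\<phi> (r n)) x))\<^sup>2) \<longlonglongrightarrow> (L2_sq G)" by (simp only: o_def)
  from sobolev_limit(2)[OF \<phi> ae this vm]
  show "sobolev_sq * (LINT x|lebesgue. (v x) ^ 4) \<le> (L2_sq (weak_grad UNIV v))\<^sup>2" by (simp add: G_def)
  show "v \<in> borel_measurable lebesgue" "integrable lebesgue (\<lambda>x. (v x) ^ 4)" by (fact vm v4)+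
  show "L2 (weak_grad UNIV v)" "is_weak_grad UNIV v (weak_grad UNIV v)" using L2G wg by (simp_all add: G_def)
qed

section \<open>Truncated bubbles\<close>

text \<open>Reduces the lower bounds on the bubble to one variable: a minorant \<open>f\<close> of
  the radial density has the explicit antiderivative \<open>F\<close>, and the rest of the space
  contributes nonnegatively.\<close>

lemma radial_integral_lower_bound:
  fixes x0 :: "real^4" and G f F :: "real \<Rightarrow> real"
  assumes G: "continuous_on UNIV G" "\<And>r. 0 \<le> G r" "integrable lborel (\<lambda>x. G (norm (x - x0)))"
    and \<rho>: "0 \<le> \<rho>" and F: "\<And>r. (F has_real_derivative f r) (at r)" and fc: "continuous_on UNIV f"
    and le: "\<And>r. 0 \<le> r \<Longrightarrow> r \<le> \<rho> \<Longrightarrow> f r \<le> G r * r ^ 3"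
  shows "sphere_area * (F \<rho> - F 0) \<le> (LINT x|lborel. G (norm (x - x0)))"
proof -
  have [measurable]: "G \<in> borel_measurable borel" using G(1) by (rule borel_measurable_continuous_onI)
  have iG: "integrable lborel (\<lambda>r. (G r * r ^ 3) * indicator {0..\<rho>} r)" using borel_integrable_atLeastAtMost[of 0 \<rho> "\<lambda>r. G r * r ^ 3"] G(1)
    by (auto simp: continuous_on_eq_continuous_at intro!: continuous_intros)
  have if_: "has_bochner_integral lborel (\<lambda>r. f r * indicator {0..\<rho>} r) (F \<rho> - F 0)"
    by (rule has_bochner_integral_FTC_Icc_real[OF \<rho> F]) (use fc in \<open>simp add: continuous_on_eq_continuous_at\<close>)
  have "F \<rho> - F 0 = (LINT r|lborel. f r * indicator {0..\<rho>} r)" using if_ by (simp add: has_bochner_integral_iff)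
  also have "\<dots> \<le> (LINT r|lborel. (G r * r ^ 3) * indicator {0..\<rho>} r)"
    by (rule integral_mono) (use if_ iG le in \<open>auto simp: has_bochner_integral_iff indicator_def\<close>)
  finally have "ennreal (F \<rho> - F 0) \<le> (\<integral>\<^sup>+r. ennreal ((G r * r ^ 3) * indicator {0..\<rho>} r) \<partial>lborel)"
    using G(2) by (subst nn_integral_eq_integral[OF iG]) (auto simp: indicator_def intro!: ennreal_leI)
  also have "\<dots> \<le> (\<integral>\<^sup>+r. ennreal (G r) * ennreal (r ^ 3) * indicator {0..} r \<partial>lborel)"
    using G(2) by (intro nn_integral_mono) (auto simp: indicator_def ennreal_mult)
  finally have "ennreal sphere_area * ennreal (F \<rho> - F 0) \<le> (\<integral>\<^sup>+x. ennreal (G (norm (x::real^4))) \<partial>lborel)"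
    by (subst radial_nn_integral) (auto intro!: mult_left_mono)
  also have "\<dots> = (\<integral>\<^sup>+x. ennreal (G (norm (x - x0))) \<partial>lborel)" using nn_integral_lborel_translation[of "\<lambda>x. ennreal (G (norm x))" "- x0"] by simp
  also have "\<dots> = ennreal (LINT x|lborel. G (norm (x - x0)))" using G(2,3) by (intro nn_integral_eq_integral) auto
  finally have "ennreal (sphere_area * (F \<rho> - F 0)) \<le> ennreal (LINT x|lborel. G (norm (x - x0)))" using sphere_area_pos by (simp add: ennreal_mult')
  then show ?thesis using G(2) by (subst (asm) ennreal_le_iff) (auto intro!: Bochner_Integration.integral_nonneg)
qed

text \<open>Antiderivatives of radial densities for the unnormalized bubble
  \<open>p r = 1 / (e + r\<^sup>2)\<close>: two for the quartic integral, one for the square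
  integral, where the logarithm appears, and one for the gradient, as
  \<open>4 * r ^ 5 * p r ^ 4\<close> is the squared derivative of \<open>p\<close> times
  \<open>r ^ 3\<close>. All of them reduce to \<open>p r * (e + r\<^sup>2) = 1\<close>.\<close>

lemma bubble_derivatives:
  fixes e r :: real
  assumes e: "e > 0"
  defines "p \<equiv> \<lambda>r. inverse (e + r\<^sup>2)"
  shows "((\<lambda>r. e / 6 * p r ^ 3 - (p r)\<^sup>2 / 4) has_real_derivative r ^ 3 * p r ^ 4) (at r)"
    "((\<lambda>r. e / 4 * (p r)\<^sup>2 - p r / 2) has_real_derivative r ^ 3 * p r ^ 3) (at r)"
    "((\<lambda>r. (ln (e + r\<^sup>2) + e * p r) / 2) has_real_derivative r ^ 3 * (p r)\<^sup>2) (at r)"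
    "((\<lambda>r. 2 / (3 * e) * (1 - e * p r) ^ 3) has_real_derivative 4 * r ^ 5 * p r ^ 4) (at r)"
proof -
  have pos: "e + r\<^sup>2 > 0" using e by (simp add: add_pos_nonneg)
  then have 1: "p r * (e + r\<^sup>2) = 1" by (simp add: p_def)
  have dp: "(p has_real_derivative - (2 * r * (p r)\<^sup>2)) (at r)" unfolding p_def using pos by (auto intro!: derivative_eq_intros simp: power2_eq_square)
  note D = derivative_eq_intros dp
  have "((\<lambda>r. e / 6 * p r ^ 3 - (p r)\<^sup>2 / 4) has_real_derivative r * p r ^ 3 * 1 - e * r * p r ^ 4) (at r)"
    by (auto intro!: D simp: power2_eq_square power3_eq_cube power4_eq_xxxx)
  also have "r * p r ^ 3 * 1 - e * r * p r ^ 4 = r ^ 3 * p r ^ 4"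
    by (subst 1[symmetric]) (simp add: power2_eq_square power3_eq_cube power4_eq_xxxx algebra_simps)
  finally show "((\<lambda>r. e / 6 * p r ^ 3 - (p r)\<^sup>2 / 4) has_real_derivative r ^ 3 * p r ^ 4) (at r)" .
  have "((\<lambda>r. e / 4 * (p r)\<^sup>2 - p r / 2) has_real_derivative r * (p r)\<^sup>2 * 1 - e * r * p r ^ 3) (at r)"
    by (auto intro!: D simp: power2_eq_square power3_eq_cube)
  also have "r * (p r)\<^sup>2 * 1 - e * r * p r ^ 3 = r ^ 3 * p r ^ 3" by (subst 1[symmetric]) (simp add: power2_eq_square power3_eq_cube algebra_simps)
  finally show "((\<lambda>r. e / 4 * (p r)\<^sup>2 - p r / 2) has_real_derivative r ^ 3 * p r ^ 3) (at r)" .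
  have dl: "((\<lambda>r. ln (e + r\<^sup>2)) has_real_derivative 2 * r * p r) (at r)"
    using pos unfolding p_def by (auto intro!: derivative_eq_intros simp: divide_inverse)
  have "((\<lambda>r. (ln (e + r\<^sup>2) + e * p r) / 2) has_real_derivative (2 * r * p r + e * - (2 * r * (p r)\<^sup>2)) / 2) (at r)"
    by (rule DERIV_cdivide[OF DERIV_add[OF dl DERIV_cmult[OF dp]]])
  also have "(2 * r * p r + e * - (2 * r * (p r)\<^sup>2)) / 2 = r * p r * 1 - e * r * (p r)\<^sup>2" by simp
  also have "\<dots> = r ^ 3 * (p r)\<^sup>2" by (subst 1[symmetric]) (simp add: power2_eq_square power3_eq_cube algebra_simps)
  finally show "((\<lambda>r. (ln (e + r\<^sup>2) + e * p r) / 2) has_real_derivative r ^ 3 * (p r)\<^sup>2) (at r)" .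
  have "((\<lambda>r. 2 / (3 * e) * (1 - e * p r) ^ 3) has_real_derivative 4 * r * (p r)\<^sup>2 * (1 - e * p r)\<^sup>2) (at r)"
    using e by (auto intro!: D simp: field_simps power2_eq_square)
  also have "1 - e * p r = r\<^sup>2 * p r" using 1 by (simp add: algebra_simps)
  also have "4 * r * (p r)\<^sup>2 * (r\<^sup>2 * p r)\<^sup>2 = 4 * r ^ 5 * p r ^ 4" by (simp add: eval_nat_numeral)
  finally show "((\<lambda>r. 2 / (3 * e) * (1 - e * p r) ^ 3) has_real_derivative 4 * r ^ 5 * p r ^ 4) (at r)" .
qed

text \<open>Convexity of the fourth power: its tangent at \<open>p\<close> lies below it, the
  remainder being a sum of squares.\<close>

lemma power4_diff_ge:
  fixes p q :: real
  assumes "0 \<le> q" "q \<le> p"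
  shows "p ^ 4 - 4 * q * p ^ 3 \<le> (p - q) ^ 4"
proof -
  have "(p - q) ^ 4 - (p ^ 4 - 4 * q * p ^ 3) = q\<^sup>2 * (2 * p\<^sup>2 + (2 * p - q)\<^sup>2)"
    by (simp add: power2_eq_square power3_eq_cube power4_eq_xxxx algebra_simps)
  also have "\<dots> \<ge> 0" by simp
  finally show ?thesis by simp
qed

text \<open>The truncation \<open>t \<mapsto> t * flat (n * t)\<close> is smooth, monotone and 1-Lipschitz, so it does not
  increase the Dirichlet integral.\<close>

lemma truncated_bubble:
  fixes x0 :: "'a::euclidean_space" and e \<rho> :: real
  assumes e: "e > 0" and \<rho>: "\<rho> > 0" and n: "n > 0"
  defines "h \<equiv> \<lambda>x. inverse (e + (norm (x - x0))\<^sup>2) - inverse (e + \<rho>\<^sup>2)"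
  defines "w \<equiv> \<lambda>x. h x * flat (real n * h x)"
  shows "w \<in> test_functions (cball x0 \<rho>)"
    "(norm (grad w x))\<^sup>2 \<le> 4 * (norm (x - x0))\<^sup>2 * inverse (e + (norm (x - x0))\<^sup>2) ^ 4"
proof -
  have pos: "e + (norm (x - x0))\<^sup>2 > 0" for x using e by (simp add: add_pos_nonneg)
  have hs: "smooth_on UNIV h"
  proof -
    have "smooth_on UNIV (\<lambda>x. inverse (e + (norm (x - x0))\<^sup>2))" by (rule smooth_on_compose[of UNIV "{0<..}" inverse "\<lambda>x. e + (norm (x - x0))\<^sup>2"])
        (use pos in \<open>auto intro!: smooth_on_inverse smooth_on_add smooth_on_const smooth_on_norm_sq\<close>)
    then show ?thesis unfolding h_def by (intro smooth_on_diff smooth_on_const open_UNIV)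
  qed
  have ws: "smooth_on UNIV w"
  proof -
    have "smooth_on UNIV (\<lambda>x. flat (real n * h x))" by (rule smooth_on_compose[of UNIV UNIV flat "\<lambda>x. real n * h x"])
        (auto intro!: smooth_flat smooth_on_mult smooth_on_const hs)
    then show ?thesis unfolding w_def by (intro smooth_on_mult hs open_UNIV)
  qed
  have w0: "w x = 0" if "h x \<le> 0" for x using that by (simp add: w_def flat_eq_0 mult_nonneg_nonpos)
  show "w \<in> test_functions (cball x0 \<rho>)"
  proof (rule test_functionI[OF ws compact_cball subset_refl])
    fix x assume "x \<notin> cball x0 \<rho>"
    then have "\<rho> \<le> norm (x - x0)" by (simp add: dist_norm norm_minus_commute)
    then have "\<rho>\<^sup>2 \<le> (norm (x - x0))\<^sup>2" using \<rho> by (intro power_mono) auto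
    then have "h x \<le> 0" unfolding h_def using e \<rho> by (simp add: le_imp_inverse_le add_pos_nonneg)
    then show "w x = 0" by (rule w0)
  qed
  show "(norm (grad w x))\<^sup>2 \<le> 4 * (norm (x - x0))\<^sup>2 * inverse (e + (norm (x - x0))\<^sup>2) ^ 4"
  proof (cases "h x \<le> 0")
    case True
    \<comment> \<open>Where the cutoff is 0 the nonnegative function \<open>w\<close> has a minimum,
      so its gradient vanishes there.\<close>
    have "w x \<le> w y" for y
    proof (cases "h y \<le> 0")
      case False
      then have "0 \<le> w y" by (simp add: w_def flat_nonneg)
      then show ?thesis using w0[OF True] by simp
    qed (simp add: w0 True)
    then have "(\<lambda>v. grad w x \<bullet> v) = (\<lambda>v. 0)" by (intro differential_zero_maxmin[OF UNIV_I open_UNIV smooth_on_has_derivative_grad[OF ws]]) auto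
    then have "grad w x \<bullet> grad w x = 0" by (rule fun_cong)
    then show ?thesis using pos[of x] by simp
  next
    case False
    then have hx: "h x > 0" by simp
    define P where "P = inverse (e + (norm (x - x0))\<^sup>2)"
    \<comment> \<open>The slope of \<open>t * exp (- 1 / (n * t))\<close> at \<open>h x\<close>.
      With \<open>y = 1 / (n * h x)\<close> it is \<open>exp (- y) * (1 + y)\<close>, hence at most
      1.\<close>
    define c where "c = exp (- 1 / (real n * h x)) * (1 + 1 / (real n * h x))"
    have c01: "0 \<le> c" "c \<le> 1"
    proof -
      define y where "y = 1 / (real n * h x)"
      have y: "y \<ge> 0" using hx n by (simp add: y_def)
      have "c = exp (- y) * (1 + y)" by (simp add: c_def y_def)
      moreover have "exp (- y) * (1 + y) \<le> exp (- y) * exp y" by (intro mult_left_mono exp_ge_add_one_self) auto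
      ultimately show "0 \<le> c" "c \<le> 1" using y by (simp_all add: exp_minus)
    qed
    have "((\<lambda>y. (y - x0) \<bullet> (y - x0)) has_derivative (\<lambda>v. 2 * ((x - x0) \<bullet> v))) (at x)" by (auto intro!: derivative_eq_intros simp: inner_commute)
    then have "((\<lambda>y. (norm (y - x0))\<^sup>2) has_derivative (\<lambda>v. 2 * ((x - x0) \<bullet> v))) (at x)" by (simp only: power2_norm_eq_inner)
    then have "((\<lambda>y. e + (norm (y - x0))\<^sup>2) has_derivative (\<lambda>v. 2 * ((x - x0) \<bullet> v))) (at x)"
      by (rule has_derivative_add_const[of _ _ _ e, unfolded add.commute[of _ e]])
    from Deriv.has_derivative_inverse[OF _ this] have "((\<lambda>y. inverse (e + (norm (y - x0))\<^sup>2)) has_derivative (\<lambda>v. - (P * (2 * ((x - x0) \<bullet> v)) * P))) (at x)"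
      using pos[of x] by (simp add: P_def)
    note hd' = this
    have hd: "(h has_derivative (\<lambda>v. - (P * (2 * ((x - x0) \<bullet> v)) * P))) (at x)"
      using has_derivative_diff[OF hd' has_derivative_const[of "inverse (e + \<rho>\<^sup>2)"]] by (simp add: h_def[abs_def])
    have "((\<lambda>t. t * exp (- 1 / (real n * t))) has_real_derivative c) (at (h x))"
      using hx n by (auto intro!: derivative_eq_intros simp: c_def field_simps)
    from DERIV_compose_FDERIV[OF this hd]
    have "((\<lambda>y. h y * exp (- 1 / (real n * h y))) has_derivative (\<lambda>v. - (P * (2 * ((x - x0) \<bullet> v)) * P) * c)) (at x)" .
    then have "(w has_derivative (\<lambda>v. - (P * (2 * ((x - x0) \<bullet> v)) * P) * c)) (at x)"
    proof (rule has_derivative_transform_within_open)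
      have hc: "continuous_on UNIV h" by (rule smooth_on_imp_continuous_on[OF hs])
      show "open {y. 0 < h y}" by (intro open_Collect_less continuous_on_const hc)
      show "h y * exp (- 1 / (real n * h y)) = w y" if "y \<in> {y. 0 < h y}" for y using that n by (simp add: w_def flat_def not_le mult_le_0_iff)
    qed (use hx in simp)
    then have "(w has_derivative (\<lambda>v. ((- 2 * P\<^sup>2 * c) *\<^sub>R (x - x0)) \<bullet> v)) (at x)" by (rule has_derivative_eq_rhs) (auto simp: power2_eq_square)
    then have "grad w x = (- 2 * P\<^sup>2 * c) *\<^sub>R (x - x0)" by (rule grad_unique)
    then have "(norm (grad w x))\<^sup>2 = 4 * (norm (x - x0))\<^sup>2 * P ^ 4 * c\<^sup>2" by (simp add: power_mult_distrib power2_eq_square power4_eq_xxxx)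
    also have "\<dots> \<le> 4 * (norm (x - x0))\<^sup>2 * P ^ 4 * 1" using c01 pos[of x] by (intro mult_left_mono) (auto simp: power_le_one P_def)
    finally show ?thesis by (simp add: P_def)
  qed
qed

text \<open>The factor \<open>flat\<close> lies in [0, 1] and tends to the indicator of positivity,
  so \<open>max (h x) 0\<close> is both the limit and the dominating function.\<close>

lemma truncated_bubble_limits:
  fixes x0 :: "'a::euclidean_space" and e \<rho> :: real
  assumes e: "e > 0" and \<rho>: "\<rho> > 0" and m: "m > 0"
  defines "h \<equiv> \<lambda>x. inverse (e + (norm (x - x0))\<^sup>2) - inverse (e + \<rho>\<^sup>2)"
  shows "integrable lborel (\<lambda>x. (max (h x) 0) ^ m)"
    "(\<lambda>n. LINT x|lebesgue. (h x * flat (real n * h x)) ^ m) \<longlonglongrightarrow> (LINT x|lborel. (max (h x) 0) ^ m)"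
proof -
  have pos: "e + (norm (x - x0))\<^sup>2 > 0" for x using e by (simp add: add_pos_nonneg)
  then have nz: "e + (norm (x - x0))\<^sup>2 \<noteq> 0" for x by (simp add: less_imp_neq[symmetric])
  have hc: "continuous_on UNIV h" unfolding h_def using nz by (intro continuous_intros) auto
  have h0: "max (h x) 0 ^ m = 0" if "x \<notin> cball x0 \<rho>" for x
  proof -
    have "\<rho> \<le> norm (x - x0)" using that by (simp add: dist_norm norm_minus_commute)
    then have "\<rho>\<^sup>2 \<le> (norm (x - x0))\<^sup>2" using \<rho> by (intro power_mono) auto
    then have "h x \<le> 0" unfolding h_def using e \<rho> by (simp add: le_imp_inverse_le add_pos_nonneg)
    then show ?thesis using m by (simp add: max_def)
  qed
  have c: "continuous_on UNIV (\<lambda>x. max (h x) 0 ^ m)" by (intro continuous_intros hc)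
  show i: "integrable lborel (\<lambda>x. max (h x) 0 ^ m)" by (rule integrable_continuous_compact_support(1)[OF c compact_cball[of x0 \<rho>] h0])
  have fc: "continuous_on UNIV (\<lambda>x. flat (real n * h x))" for n
    by (rule continuous_on_compose2[OF smooth_on_imp_continuous_on[OF smooth_flat]]) (auto intro!: continuous_intros hc)
  have hm: "(\<lambda>x. (h x * flat (real n * h x)) ^ m) \<in> borel_measurable borel" for n by (intro borel_measurable_continuous_onI continuous_intros hc fc)
  have "(\<lambda>n. LINT x|lborel. (h x * flat (real n * h x)) ^ m) \<longlonglongrightarrow> (LINT x|lborel. max (h x) 0 ^ m)"
  proof (rule integral_dominated_convergence[where w="\<lambda>x. max (h x) 0 ^ m"])
    show "AE x in lborel. (\<lambda>n. (h x * flat (real n * h x)) ^ m) \<longlonglongrightarrow> max (h x) 0 ^ m"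
    proof (rule AE_I2, rule tendsto_power)
      fix x
      have "(\<lambda>n. h x * flat (real n * h x)) \<longlonglongrightarrow> h x * indicator {0<..} (h x)" by (intro tendsto_mult tendsto_const flat_of_nat_tendsto)
      then show "(\<lambda>n. h x * flat (real n * h x)) \<longlonglongrightarrow> max (h x) 0" by (cases "h x > 0") (auto simp: max_def)
    qed
    show "AE x in lborel. norm ((h x * flat (real n * h x)) ^ m) \<le> max (h x) 0 ^ m" for n
    proof (rule AE_I2)
      fix x
      have "\<bar>h x * flat (real n * h x)\<bar> \<le> max (h x) 0"
      proof (cases "h x > 0")
        case True
        then show ?thesis using flat_nonneg[of "real n * h x"] flat_le_1[of "real n * h x"] by (simp add: abs_mult mult_left_le)
      qed (simp add: flat_eq_0 mult_nonneg_nonpos)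
      then show "norm ((h x * flat (real n * h x)) ^ m) \<le> max (h x) 0 ^ m" by (simp only: real_norm_def power_abs) (rule power_mono, auto)
    qed
  qed (use i hm in auto)
  then show "(\<lambda>n. LINT x|lebesgue. (h x * flat (real n * h x)) ^ m) \<longlonglongrightarrow> (LINT x|lborel. max (h x) 0 ^ m)" using hm by (simp add: integral_completion)
qed

text \<open>Up to the common factor \<open>sphere_area\<close>, the gradient costs at most
  \<open>2 / (3 * e)\<close>, the square root on the right side is in the limit at least
  \<open>2 / (3 * e) - 10 / T\<close>, and the square integral is at least half of
  \<open>ln (T / e)\<close> minus \<open>3 / 2\<close>. The leading terms cancel, and
  \<open>\<mu>\<close> times the logarithm overcomes the loss \<open>10 / T\<close>.\<close>

lemma bubble:
  fixes x0 :: "real^4" and \<rho> \<mu> :: real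
  assumes \<rho>: "\<rho> > 0" and \<mu>: "\<mu> > 0"
  obtains w where "w \<in> test_functions (cball x0 \<rho>)" "(LINT x|lebesgue. (w x) ^ 4) > 0"
    "(L2_sq (grad w)) - \<mu> * (LINT x|lebesgue. (w x)\<^sup>2) < sqrt (sobolev_sq * (LINT x|lebesgue. (w x) ^ 4))"
proof -
  define T where "T = \<rho>\<^sup>2"
  \<comment> \<open>\<open>X\<close> is \<open>ln (T / e)\<close>. The part
    \<open>20 / (T * \<mu>)\<close> pays exactly for the loss \<open>10 / T\<close>; the part 14
    leaves a surplus and gives \<open>15 * e <= T\<close>.\<close>
  define X where "X = 14 + 20 / (T * \<mu>)"
  define e where "e = T * exp (- X)"
  define q where "q = inverse (e + \<rho>\<^sup>2)"
  define p where "p r = inverse (e + r\<^sup>2)" for r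
  have T: "T > 0" using \<rho> by (simp add: T_def)
  have X: "X > 14" using T \<mu> by (simp add: X_def)
  have e: "e > 0" using T by (simp add: e_def)
  have eT: "15 * e \<le> T"
  proof -
    have "15 \<le> exp X" using X exp_ge_add_one_self[of X] by linarith
    then have "15 * e \<le> exp X * e" using e by (intro mult_right_mono) auto
    also have "\<dots> = T" by (simp add: e_def exp_minus)
    finally show ?thesis .
  qed
  have q: "q > 0" "q \<le> 1 / T" "e * q \<le> 1" "q * T \<le> 1" "p \<rho> = q" "p 0 = 1 / e" using e T by (simp_all add: q_def T_def[symmetric] p_def field_simps)
  have pos: "e + r\<^sup>2 > 0" for r using e by (simp add: add_pos_nonneg)
  have pp: "p r > 0" for r using pos by (simp add: p_def)
  have pr: "r\<^sup>2 * p r \<le> 1" for r using pos[of r] e by (simp add: p_def field_simps)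
  have pq: "q \<le> p r" if "0 \<le> r" "r \<le> \<rho>" for r
  proof -
    have "r\<^sup>2 \<le> \<rho>\<^sup>2" using that by (intro power_mono) auto
    then show ?thesis unfolding p_def q_def using pos[of r] by (intro le_imp_inverse_le) auto
  qed
  have pc: "continuous_on UNIV p" unfolding p_def using pos by (intro continuous_intros) (auto simp: less_imp_neq[symmetric])
  define h where "h x = inverse (e + (norm (x - x0))\<^sup>2) - inverse (e + \<rho>\<^sup>2)" for x
  have hp: "h x = p (norm (x - x0)) - q" for x by (simp add: h_def p_def q_def)
  define w where "w n x = h x * flat (real n * h x)" for n x
  define A where "A n = (L2_sq (grad (w n)))" for n
  define B where "B = (LINT x|lborel. max (h x) 0 ^ 4)"
  define C where "C = (LINT x|lborel. max (h x) 0 ^ 2)"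
  have i: "integrable lborel (\<lambda>x. max (h x) 0 ^ 4)" "integrable lborel (\<lambda>x. max (h x) 0 ^ 2)"
    using truncated_bubble_limits(1)[OF e \<rho>, where ?x0.0=x0 and m=4] truncated_bubble_limits(1)[OF e \<rho>, where ?x0.0=x0 and m=2] by (simp_all add: h_def)
  have Bn: "(\<lambda>n. LINT x|lebesgue. (w n x) ^ 4) \<longlonglongrightarrow> B" and Cn: "(\<lambda>n. LINT x|lebesgue. (w n x)\<^sup>2) \<longlonglongrightarrow> C"
    using truncated_bubble_limits(2)[OF e \<rho>, where ?x0.0=x0 and m=4] truncated_bubble_limits(2)[OF e \<rho>, where ?x0.0=x0 and m=2]
    by (simp_all add: h_def w_def[abs_def] B_def C_def)
  have wt: "w n \<in> test_functions (cball x0 \<rho>)" if "n > 0" for n using truncated_bubble(1)[OF e \<rho> that] by (simp add: w_def[abs_def] h_def)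
  \<comment> \<open>Truncation at height \<open>q\<close> costs, to first order,
    \<open>4 * q * p ^ 3\<close>; integrated against \<open>r ^ 3\<close> this is
    \<open>q / e\<close> to leading order.\<close>
  have B: "sphere_area * (1 / (12 * e\<^sup>2) - q / e) \<le> B"
  proof -
    let ?F = "\<lambda>r. (e / 6 * p r ^ 3 - (p r)\<^sup>2 / 4) - (4 * q) * (e / 4 * (p r)\<^sup>2 - p r / 2)"
    let ?f = "\<lambda>r. r ^ 3 * p r ^ 4 - (4 * q) * (r ^ 3 * p r ^ 3)"
    have "sphere_area * (?F \<rho> - ?F 0) \<le> (LINT x|lborel. max (p (norm (x - x0)) - q) 0 ^ 4)"
    proof (rule radial_integral_lower_bound[where f = ?f])
      show "(?F has_real_derivative ?f r) (at r)" for r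
        using bubble_derivatives(1,2)[OF e, of r] unfolding p_def[symmetric] by (intro DERIV_diff DERIV_cmult)
      fix r assume r: "0 \<le> r" "r \<le> \<rho>"
      have "?f r = (p r ^ 4 - 4 * q * p r ^ 3) * r ^ 3" by (simp add: algebra_simps)
      also have "\<dots> \<le> (p r - q) ^ 4 * r ^ 3" using r q(1) pq[OF r] by (intro mult_right_mono power4_diff_ge) auto
      also have "p r - q = max (p r - q) 0" using pq[OF r] by simp
      finally show "?f r \<le> max (p r - q) 0 ^ 4 * r ^ 3" .
    qed (use pc \<rho> i in \<open>auto intro!: continuous_intros simp: hp\<close>)
    moreover have "1 / (12 * e\<^sup>2) - q / e \<le> ?F \<rho> - ?F 0"
    proof -
      have "?F \<rho> - ?F 0 = 1 / (12 * e\<^sup>2) - q / e + q\<^sup>2 * (7 / 4 - 5 / 6 * (e * q))"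
        unfolding q(5,6) using e by (simp add: power2_eq_square power3_eq_cube field_simps)
      moreover have "0 \<le> q\<^sup>2 * (7 / 4 - 5 / 6 * (e * q))" using q(3) by (intro mult_nonneg_nonneg) auto
      ultimately show ?thesis by linarith
    qed
    ultimately show ?thesis unfolding B_def hp using mult_left_mono[of "1 / (12 * e\<^sup>2) - q / e" "?F \<rho> - ?F 0" sphere_area] sphere_area_pos by linarith
  qed
  \<comment> \<open>The cross term \<open>2 * q * p * r ^ 3\<close> is at most
    \<open>2 * q * r\<close>, since \<open>r\<^sup>2 * p <= 1\<close>; it costs a bounded amount
    against the logarithm.\<close>
  have C: "sphere_area * (X / 2 - 3 / 2) \<le> C"
  proof -
    let ?F = "\<lambda>r. (ln (e + r\<^sup>2) + e * p r) / 2 - q * r\<^sup>2"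
    let ?f = "\<lambda>r. r ^ 3 * (p r)\<^sup>2 - q * (2 * r)"
    have "sphere_area * (?F \<rho> - ?F 0) \<le> (LINT x|lborel. max (p (norm (x - x0)) - q) 0 ^ 2)"
    proof (rule radial_integral_lower_bound[where f = ?f])
      show "(?F has_real_derivative ?f r) (at r)" for r using bubble_derivatives(3)[OF e, of r] unfolding p_def[symmetric]
        by (intro DERIV_diff DERIV_cmult) (auto intro!: derivative_eq_intros)
      fix r assume r: "0 \<le> r" "r \<le> \<rho>"
      have "q * r * (r\<^sup>2 * p r) \<le> q * r * 1" using r q(1) pr by (intro mult_left_mono) auto
      moreover have "(p r - q)\<^sup>2 * r ^ 3 = r ^ 3 * (p r)\<^sup>2 - 2 * (q * r * (r\<^sup>2 * p r)) + q\<^sup>2 * r ^ 3"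
        by (simp add: power2_eq_square power3_eq_cube algebra_simps)
      moreover have "0 \<le> q\<^sup>2 * r ^ 3" using r by simp
      ultimately have "?f r \<le> (p r - q)\<^sup>2 * r ^ 3" by linarith
      also have "p r - q = max (p r - q) 0" using pq[OF r] by simp
      finally show "?f r \<le> (max (p r - q) 0)\<^sup>2 * r ^ 3" .
    qed (use pc \<rho> i in \<open>auto intro!: continuous_intros simp: hp\<close>)
    moreover have "X / 2 - 3 / 2 \<le> ?F \<rho> - ?F 0"
    proof -
      have "ln T \<le> ln (e + T)" using T e by simp
      moreover have "ln e = ln T - X" using T by (simp add: e_def ln_mult)
      moreover have "0 \<le> e * q" using e q by simp
      ultimately have "X / 2 - 3 / 2 \<le> (ln (e + T) + e * q) / 2 - q * T - (ln e + 1) / 2" using q(4) by argo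
      also have "\<dots> = ?F \<rho> - ?F 0" unfolding q(5,6) using e by (simp add: T_def)
      finally show ?thesis .
    qed
    ultimately show ?thesis unfolding C_def hp using mult_left_mono[of "X / 2 - 3 / 2" "?F \<rho> - ?F 0" sphere_area] sphere_area_pos by linarith
  qed
  \<comment> \<open>Bounded by the Dirichlet integral of the full bubble on the whole space, which
    the fourth antiderivative evaluates.\<close>
  have A: "A n \<le> sphere_area * (2 / (3 * e))" if n: "n > 0" for n
  proof -
    have [measurable]: "p \<in> borel_measurable borel" using pc by (rule borel_measurable_continuous_onI)
    have "ennreal (A n) = (\<integral>\<^sup>+x. ennreal ((norm (grad (w n) x))\<^sup>2) \<partial>lborel)"
      using test_function_integrals(3,4)[OF wt[OF n]] by (simp add: nn_integral_eq_integral A_def)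
    also have "\<dots> \<le> (\<integral>\<^sup>+x. ennreal (4 * (norm (x - x0))\<^sup>2 * p (norm (x - x0)) ^ 4) \<partial>lborel)"
    proof (intro nn_integral_mono ennreal_leI)
      fix x show "(norm (grad (w n) x))\<^sup>2 \<le> 4 * (norm (x - x0))\<^sup>2 * p (norm (x - x0)) ^ 4"
        using truncated_bubble(2)[OF e \<rho> n, of x0 x] by (simp add: w_def[abs_def] h_def p_def)
    qed
    also have "\<dots> = (\<integral>\<^sup>+x. ennreal (4 * (norm (x::real^4))\<^sup>2 * p (norm x) ^ 4) \<partial>lborel)"
      using nn_integral_lborel_translation[of "\<lambda>x::real^4. ennreal (4 * (norm x)\<^sup>2 * p (norm x) ^ 4)" "- x0"] by simp
    also have "\<dots> = ennreal sphere_area * (\<integral>\<^sup>+r. ennreal (4 * r\<^sup>2 * p r ^ 4) * ennreal (r ^ 3) * indicator {0..} r \<partial>lborel)"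
      by (rule radial_nn_integral) measurable
    also have "(\<integral>\<^sup>+r. ennreal (4 * r\<^sup>2 * p r ^ 4) * ennreal (r ^ 3) * indicator {0..} r \<partial>lborel)
        = (\<integral>\<^sup>+r. ennreal (4 * r ^ 5 * p r ^ 4) * indicator {0..} r \<partial>lborel)"
    proof (rule nn_integral_cong)
      fix r :: real
      have eq: "4 * r ^ 5 * p r ^ 4 = (4 * r\<^sup>2 * p r ^ 4) * r ^ 3" by (simp add: eval_nat_numeral)
      show "ennreal (4 * r\<^sup>2 * p r ^ 4) * ennreal (r ^ 3) * indicator {0..} r = ennreal (4 * r ^ 5 * p r ^ 4) * indicator {0..} r"
        unfolding eq by (cases "0 \<le> r") (auto simp: ennreal_mult pp less_imp_le)
    qed
    also have "\<dots> = ennreal (2 / (3 * e) - 2 / (3 * e) * (1 - e * p 0) ^ 3)"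
    proof (rule nn_integral_FTC_atLeast)
      show "((\<lambda>r. 2 / (3 * e) * (1 - e * p r) ^ 3) has_real_derivative 4 * r ^ 5 * p r ^ 4) (at r)" for r
        using bubble_derivatives(4)[OF e, of r] unfolding p_def[symmetric] .
      have "(p \<longlongrightarrow> 0) at_top" unfolding p_def[abs_def] using e by real_asymp
      then have "((\<lambda>r. 2 / (3 * e) * (1 - e * p r) ^ 3) \<longlongrightarrow> 2 / (3 * e) * (1 - e * 0) ^ 3) at_top" by (intro tendsto_intros)
      then show "((\<lambda>r. 2 / (3 * e) * (1 - e * p r) ^ 3) \<longlongrightarrow> 2 / (3 * e)) at_top" by simp
    qed (use pp in \<open>auto simp: less_imp_le\<close>)
    also have "2 / (3 * e) - 2 / (3 * e) * (1 - e * p 0) ^ 3 = 2 / (3 * e)" using e q(6) by simp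
    also have "ennreal sphere_area * ennreal (2 / (3 * e)) = ennreal (sphere_area * (2 / (3 * e)))"
      using sphere_area_pos e by (subst ennreal_mult[symmetric]) auto
    finally show ?thesis using sphere_area_pos e by (subst (asm) ennreal_le_iff) auto
  qed
  have strict: "sphere_area * (2 / (3 * e)) < \<mu> * C + sqrt (sobolev_sq * B)"
  proof -
    \<comment> \<open>Squaring \<open>?a\<close> subtracts \<open>40 / 3\<close> times
      \<open>1 / (e * T)\<close>: of this, \<open>16 / 3\<close> pays for the quartic loss and the
      remaining 8 for \<open>100 / T\<^sup>2\<close>. Hence the 10.\<close>
    let ?a = "2 / (3 * e) - 10 / T"
    have "100 / T\<^sup>2 \<le> 8 / (e * T)" using e T eT by (simp add: power2_eq_square divide_simps)
    moreover have "q / e \<le> 1 / (e * T)" using divide_right_mono[OF q(2), of e] e by (simp add: mult.commute)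
    moreover have "?a\<^sup>2 = 4 / (9 * e\<^sup>2) - 40 / 3 * (1 / (e * T)) + 100 / T\<^sup>2" using e T by (simp add: power2_eq_square field_simps)
    moreover have "8 / (e * T) = 8 * (1 / (e * T))" by simp
    moreover have "16 / 3 * (1 / (12 * e\<^sup>2) - q / e) = 4 / (9 * e\<^sup>2) - 16 / 3 * (q / e)" by (simp add: field_simps)
    ultimately have "?a\<^sup>2 \<le> 16 / 3 * (1 / (12 * e\<^sup>2) - q / e)" by linarith
    then have "sphere_area\<^sup>2 * ?a\<^sup>2 \<le> sphere_area\<^sup>2 * (16 / 3 * (1 / (12 * e\<^sup>2) - q / e))" by (intro mult_left_mono) auto
    also have "\<dots> = sobolev_sq * (sphere_area * (1 / (12 * e\<^sup>2) - q / e))" by (simp add: sobolev_sq_def power2_eq_square)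
    also have "\<dots> \<le> sobolev_sq * B" using B sobolev_sq_pos by (intro mult_left_mono) auto
    finally have "(sphere_area * ?a)\<^sup>2 \<le> sobolev_sq * B" by (simp add: power_mult_distrib)
    then have 1: "sphere_area * ?a \<le> sqrt (sobolev_sq * B)" by (rule real_le_rsqrt)
    have "10 / T < \<mu> * (X / 2 - 3 / 2)"
    proof -
      have "\<mu> * (X / 2 - 3 / 2) = \<mu> * (11 / 2) + 10 / T" using \<mu> T by (simp add: X_def field_simps)
      then show ?thesis using \<mu> by simp
    qed
    then have "sphere_area * (10 / T) < sphere_area * (\<mu> * (X / 2 - 3 / 2))" using sphere_area_pos by (rule mult_strict_left_mono)
    also have "\<dots> = \<mu> * (sphere_area * (X / 2 - 3 / 2))" by simp
    also have "\<dots> \<le> \<mu> * C" using C \<mu> by (intro mult_left_mono) auto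
    finally have "sphere_area * (10 / T) < \<mu> * C" .
    moreover have "sphere_area * ?a = sphere_area * (2 / (3 * e)) - sphere_area * (10 / T)" by (simp only: right_diff_distrib)
    ultimately show ?thesis using 1 by linarith
  qed
  have "0 < 1 / (12 * e\<^sup>2) - q / e"
  proof -
    have "q * (15 * e) \<le> q * T" using eT q(1) by (intro mult_left_mono) auto
    moreover have "q * (15 * e) = 15 * (q * e)" by simp
    moreover have "0 < q * e" using q(1) e by simp
    ultimately have "12 * (q * e) < 1" using q(4) by linarith
    then have "0 < (1 - 12 * (q * e)) / (12 * e\<^sup>2)" using e by (intro divide_pos_pos) auto
    also have "\<dots> = 1 / (12 * e\<^sup>2) - q / e" using e by (simp add: power2_eq_square field_simps)
    finally show ?thesis .
  qed
  from mult_pos_pos[OF sphere_area_pos this] have B0: "B > 0" using B by linarith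
  \<comment> \<open>Strictness for the limit profile passes to the smooth truncations with large
    \<open>n\<close>.\<close>
  have "(\<lambda>n. \<mu> * (LINT x|lebesgue. (w n x)\<^sup>2) + sqrt (sobolev_sq * (LINT x|lebesgue. (w n x) ^ 4))) \<longlonglongrightarrow> \<mu> * C + sqrt (sobolev_sq * B)"
    by (intro tendsto_intros Bn Cn)
  from order_tendstoD(1)[OF this strict] order_tendstoD(1)[OF Bn B0] eventually_gt_at_top[of 0]
  have "\<forall>\<^sub>F n in sequentially. sphere_area * (2 / (3 * e)) < \<mu> * (LINT x|lebesgue. (w n x)\<^sup>2) + sqrt (sobolev_sq * (LINT x|lebesgue. (w n x) ^ 4))
     \<and> 0 < (LINT x|lebesgue. (w n x) ^ 4) \<and> n > 0" by eventually_elim auto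
  then obtain n where n: "sphere_area * (2 / (3 * e)) < \<mu> * (LINT x|lebesgue. (w n x)\<^sup>2) + sqrt (sobolev_sq * (LINT x|lebesgue. (w n x) ^ 4))"
    "0 < (LINT x|lebesgue. (w n x) ^ 4)" "n > 0" by (auto simp: eventually_sequentially)
  show ?thesis by (rule that[of "w n"]) (use wt[OF n(3)] n A[OF n(3)] in \<open>auto simp: A_def\<close>)
qed

section \<open>The limiting energy and the lower bound for \<open>l_level\<close>\<close>

lemma test_function_D12:
  assumes "\<phi> \<in> test_functions UNIV"
  shows "\<phi> \<in> D12" "AE x in lebesgue. weak_grad UNIV \<phi> x = grad \<phi> x"
proof -
  have s: "smooth_on UNIV \<phi>" using assms by (simp add: test_functions_def)
  have wg: "is_weak_grad UNIV \<phi> (grad \<phi>)" by (rule smooth_is_weak_grad[OF s])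
  show "AE x in lebesgue. weak_grad UNIV \<phi> x = grad \<phi> x" using weak_grad_eqI(2)[OF open_UNIV wg] by simp
  have 0: "(LINT x|lebesgue. (norm (weak_grad UNIV (\<lambda>y. \<phi> y - \<phi> y) x))\<^sup>2) = (LINT x::real^4|lebesgue. 0)"
    by (rule integral_lebesgue_cong_AE(1)) (use weak_grad_eqI(2)[OF open_UNIV is_weak_grad_diff[OF wg wg]] in \<open>eventually_elim, simp\<close>)
  have "\<phi> \<in> Lp 4 UNIV" using sobolev_test(1)[OF assms] L2_measurable[OF L2_test_function(1)[OF assms]]
    by (simp add: Lp_def set_borel_measurable_def set_integrable_def)
  moreover have "grad \<phi> \<in> Lp 2 UNIV" using L2_test_function(2)[OF assms] by (simp add: Lp_2_iff)
  ultimately show "\<phi> \<in> D12" unfolding D12_def using wg 0 assms by (auto intro!: exI[of _ "\<lambda>n. \<phi>"])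
qed

text \<open>\<open>E_fun\<close> along a ray is an explicit polynomial in \<open>c\<close>: taking
  \<open>c = 1 + t\<close> gives the derivative in the constraint, and \<open>c = 1\<close> splits
  the energy into its two parts.\<close>

lemma E_fun_scale:
  fixes v :: family
  assumes v: "\<And>i. i \<in> block a h \<Longrightarrow> v i \<in> D12"
  shows "E_fun \<beta> a h (\<lambda>i x. c * v i x) =
    1/2 * c\<^sup>2 * (\<Sum>i\<in>block a h. L2_sq (weak_grad UNIV (v i)))
    - 1/4 * c ^ 4 * (\<Sum>(i, j)\<in>block a h \<times> block a h. \<beta> i j * (LINT x|lebesgue. (v j x)\<^sup>2 * (v i x)\<^sup>2))"
proof -
  have fin: "finite (block a h)" by (simp add: block_def)
  have "AE x in lebesgue. \<forall>i\<in>block a h. weak_grad UNIV (\<lambda>x. c * v i x) x = c *\<^sub>R weak_grad UNIV (v i) x"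
  proof (subst AE_finite_all[OF fin], intro ballI)
    fix i assume "i \<in> block a h"
    from is_weak_grad_scale[OF D12_sobolev(4)[OF v[OF this]], of c]
    show "AE x in lebesgue. weak_grad UNIV (\<lambda>x. c * v i x) x = c *\<^sub>R weak_grad UNIV (v i) x" using weak_grad_eqI(2)[OF open_UNIV] by force
  qed
  then have ae: "AE x in lebesgue. 1/2 * (\<Sum>i\<in>block a h. (norm (weak_grad UNIV (\<lambda>x. c * v i x) x))\<^sup>2)
     - 1/4 * (\<Sum>(i, j)\<in>block a h \<times> block a h. \<beta> i j * (c * v j x)\<^sup>2 * (c * v i x)\<^sup>2)
     = 1/2 * c\<^sup>2 * (\<Sum>i\<in>block a h. (norm (weak_grad UNIV (v i) x))\<^sup>2)
     - 1/4 * c ^ 4 * (\<Sum>(i, j)\<in>block a h \<times> block a h. \<beta> i j * ((v j x)\<^sup>2 * (v i x)\<^sup>2))"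
  proof eventually_elim
    case (elim x)
    have "(\<Sum>i\<in>block a h. (norm (weak_grad UNIV (\<lambda>x. c * v i x) x))\<^sup>2) = c\<^sup>2 * (\<Sum>i\<in>block a h. (norm (weak_grad UNIV (v i) x))\<^sup>2)"
      unfolding sum_distrib_left by (intro sum.cong refl) (use elim in \<open>simp add: power_mult_distrib\<close>)
    moreover have "(\<Sum>(i, j)\<in>block a h \<times> block a h. \<beta> i j * (c * v j x)\<^sup>2 * (c * v i x)\<^sup>2)
        = c ^ 4 * (\<Sum>(i, j)\<in>block a h \<times> block a h. \<beta> i j * ((v j x)\<^sup>2 * (v i x)\<^sup>2))"
      unfolding sum_distrib_left by (intro sum.cong refl) (auto simp: power2_eq_square power4_eq_xxxx)
    ultimately show ?case by simp
  qed
  have i1: "integrable lebesgue (\<lambda>x. (norm (weak_grad UNIV (v i) x))\<^sup>2)" if "i \<in> block a h" for i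
    by (rule L2_integrable[OF D12_sobolev(3)[OF v[OF that]]])
  have i2: "integrable lebesgue (\<lambda>x. (v j x)\<^sup>2 * (v i x)\<^sup>2)" if "i \<in> block a h" "j \<in> block a h" for i j
    using L2_inner_integrable[of "\<lambda>x. (v j x)\<^sup>2" "\<lambda>x. (v i x)\<^sup>2"] D12_sobolev(1,2)[OF v] that by (simp add: L2_def power_mult[symmetric])
  have "E_fun \<beta> a h (\<lambda>i x. c * v i x) = (LINT x|lebesgue. 1/2 * c\<^sup>2 * (\<Sum>i\<in>block a h. (norm (weak_grad UNIV (v i) x))\<^sup>2)
     - 1/4 * c ^ 4 * (\<Sum>z\<in>block a h \<times> block a h. \<beta> (fst z) (snd z) * ((v (snd z) x)\<^sup>2 * (v (fst z) x)\<^sup>2)))"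
    unfolding E_fun_def using integral_lebesgue_cong_AE(1)[OF ae] by (simp only: case_prod_unfold)
  also have "\<dots> = 1/2 * c\<^sup>2 * (LINT x|lebesgue. (\<Sum>i\<in>block a h. (norm (weak_grad UNIV (v i) x))\<^sup>2))
     - 1/4 * c ^ 4 * (LINT x|lebesgue. (\<Sum>z\<in>block a h \<times> block a h. \<beta> (fst z) (snd z) * ((v (snd z) x)\<^sup>2 * (v (fst z) x)\<^sup>2)))"
    by (subst Bochner_Integration.integral_diff)
      (auto intro!: integrable_mult_right Bochner_Integration.integrable_sum i1 i2 simp del: integral_mult_right_zero integral_mult_left_zero, auto)
  also have "(LINT x|lebesgue. (\<Sum>i\<in>block a h. (norm (weak_grad UNIV (v i) x))\<^sup>2)) = (\<Sum>i\<in>block a h. L2_sq (weak_grad UNIV (v i)))"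
    by (rule Bochner_Integration.integral_sum) (rule i1)
  also have "(LINT x|lebesgue. (\<Sum>z\<in>block a h \<times> block a h. \<beta> (fst z) (snd z) * ((v (snd z) x)\<^sup>2 * (v (fst z) x)\<^sup>2)))
      = (\<Sum>z\<in>block a h \<times> block a h. LINT x|lebesgue. \<beta> (fst z) (snd z) * ((v (snd z) x)\<^sup>2 * (v (fst z) x)\<^sup>2))"
    by (rule Bochner_Integration.integral_sum) (auto intro!: integrable_mult_right i2)
  finally show ?thesis by (simp add: case_prod_unfold)
qed

lemma E_fun_directional_deriv:
  fixes v :: family
  assumes v: "\<And>i. i \<in> block a h \<Longrightarrow> v i \<in> D12"
  shows "directional_deriv (E_fun \<beta> a h) v v =
    (\<Sum>i\<in>block a h. L2_sq (weak_grad UNIV (v i)))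
    - (\<Sum>(i, j)\<in>block a h \<times> block a h. \<beta> i j * (LINT x|lebesgue. (v j x)\<^sup>2 * (v i x)\<^sup>2))" (is "_ = ?N - ?P")
proof -
  have "E_fun \<beta> a h (\<lambda>i x. v i x + t * v i x) = 1/2 * (1 + t)\<^sup>2 * ?N - 1/4 * (1 + t) ^ 4 * ?P" for t
    using E_fun_scale[of a h v \<beta> "1 + t", OF v] by (simp only: distrib_right mult_1_left)
  moreover have "((\<lambda>t. 1/2 * (1 + t)\<^sup>2 * ?N - 1/4 * (1 + t) ^ 4 * ?P) has_real_derivative ?N - ?P) (at 0)" by (auto intro!: derivative_eq_intros)
  ultimately show ?thesis unfolding directional_deriv_def by (simp add: DERIV_imp_deriv)
qed

text \<open>On the constraint the energy is a quarter of the Dirichlet sum \<open>N\<close>. With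
  \<open>s i\<close> the squared \<open>L^4\<close> norm of a component, Sobolev bounds
  \<open>N\<close> below by a multiple of the sum of \<open>s\<close>, and Cauchy-Schwarz bounds the
  coupling, which equals \<open>N\<close>, by \<open>F\<close> times the square of that sum;
  dividing by \<open>N > 0\<close> gives the claim.\<close>

lemma l_level_ge:
  assumes I: "i0 \<in> block a h" "\<beta> i0 i0 > 0" and F: "F > 0"
    and nonneg: "\<And>i j. i \<in> block a h \<Longrightarrow> j \<in> block a h \<Longrightarrow> 0 \<le> \<beta> i j"
    and bound: "\<And>y. (\<And>i. i \<in> block a h \<Longrightarrow> 0 \<le> y i) \<Longrightarrow>
       (coupling \<beta> a h y) \<le> F * (sum y (block a h))\<^sup>2"
  shows "sobolev_sq / (4 * F) \<le> l_level \<beta> a h"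
  unfolding l_level_def
proof (rule cInf_greatest)
  have fin: "finite (block a h)" by (simp add: block_def)
  \<comment> \<open>The infimum of an empty set would be unspecified, so a point of the constraint
    is exhibited: a multiple of a bubble in the single component \<open>i0\<close>.\<close>
  show "{E_fun \<beta> a h v |v. (\<forall>i\<in>block a h. v i \<in> D12) \<and> \<not> (\<forall>i\<in>block a h. zero_on UNIV (v i)) \<and>
      directional_deriv (E_fun \<beta> a h) v v = 0} \<noteq> {}"
  proof -
    obtain w :: "real^4 \<Rightarrow> real" where w: "w \<in> test_functions (cball 0 1)" "(LINT x|lebesgue. (w x) ^ 4) > 0" by (rule bubble[of 1 1 0]) auto
    have wU: "w \<in> test_functions UNIV" using w(1) by (auto simp: test_functions_def)
    define A where "A = L2_sq (grad w)"
    define B where "B = (LINT x|lebesgue. (w x) ^ 4)"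
    \<comment> \<open>Solves \<open>t\<^sup>2 * A = t ^ 4 * \<beta> i0 i0 * B\<close>, the
      constraint for one component.\<close>
    define t where "t = sqrt (A / (\<beta> i0 i0 * B))"
    have A: "A > 0"
    proof -
      have "0 < sobolev_sq * B" using w(2) sobolev_sq_pos by (simp add: B_def)
      also have "\<dots> \<le> A\<^sup>2" using sobolev_test(2)[OF wU] by (simp add: A_def B_def)
      finally have "A \<noteq> 0" by auto
      moreover have "A \<ge> 0" by (simp add: A_def)
      ultimately show ?thesis by simp
    qed
    have t: "t\<^sup>2 * (\<beta> i0 i0 * B) = A" "t \<noteq> 0" using A I(2) w(2) by (simp_all add: t_def B_def)
    define v :: family where "v i x = (if i = i0 then t * w x else 0)" for i x
    have vt: "v i \<in> test_functions UNIV" for i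
      using test_functions_scale[OF wU, of t] test_functions_zero by (cases "i = i0") (simp_all add: v_def[abs_def])
    have N: "(L2_sq (weak_grad UNIV (v i))) = (if i = i0 then t\<^sup>2 * A else 0)" for i
    proof -
      have "(L2_sq (weak_grad UNIV (v i))) = (LINT x|lebesgue. (if i = i0 then t\<^sup>2 else 0) * (norm (grad w x))\<^sup>2)"
      proof (rule integral_lebesgue_cong_AE(1))
        have "smooth_on UNIV w" using wU by (simp add: test_functions_def)
        then have g: "grad (\<lambda>x. t * w x) = (\<lambda>x. t *\<^sub>R grad w x)" "grad (\<lambda>x::real^4. 0::real) = (\<lambda>x. 0)"
          by (rule smooth_grad_scale) (rule ext, rule grad_unique, simp)
        show "AE x in lebesgue. (norm (weak_grad UNIV (v i) x))\<^sup>2 = (if i = i0 then t\<^sup>2 else 0) * (norm (grad w x))\<^sup>2"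
          using test_function_D12(2)[OF vt[of i]] by eventually_elim (simp add: v_def[abs_def] g power_mult_distrib)
      qed
      then show ?thesis by (simp add: A_def)
    qed
    have P: "(LINT x|lebesgue. (v j x)\<^sup>2 * (v i x)\<^sup>2) = (if i = i0 \<and> j = i0 then t ^ 4 * B else 0)" for i j
    proof -
      have "(LINT x|lebesgue. (v j x)\<^sup>2 * (v i x)\<^sup>2) = (LINT x|lebesgue. (if i = i0 \<and> j = i0 then t ^ 4 else 0) * (w x) ^ 4)"
        by (intro Bochner_Integration.integral_cong refl) (auto simp: v_def power2_eq_square power4_eq_xxxx)
      then show ?thesis by (simp add: B_def)
    qed
    have "(\<Sum>(i, j)\<in>block a h \<times> block a h. \<beta> i j * (if i = i0 \<and> j = i0 then t ^ 4 * B else 0))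
        = (\<Sum>z\<in>block a h \<times> block a h. if z = (i0, i0) then \<beta> i0 i0 * (t ^ 4 * B) else 0)" by (intro sum.cong refl) (auto split: if_splits)
    then have "directional_deriv (E_fun \<beta> a h) v v = t\<^sup>2 * A - \<beta> i0 i0 * (t ^ 4 * B)"
      using E_fun_directional_deriv[of a h v \<beta>, OF test_function_D12(1)[OF vt]] I(1) fin by (simp add: N P)
    also have "\<dots> = t\<^sup>2 * (A - t\<^sup>2 * (\<beta> i0 i0 * B))" by (simp add: power2_eq_square power4_eq_xxxx algebra_simps)
    finally have "directional_deriv (E_fun \<beta> a h) v v = 0" using t(1) by simp
    moreover have "\<not> zero_on UNIV (v i0)"
    proof
      assume "zero_on UNIV (v i0)"
      then have "AE x in lebesgue. (w x) ^ 4 = 0" using t(2) by (simp add: zero_on_def v_def)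
      then have "(LINT x|lebesgue. (w x) ^ 4) = (LINT x::real^4|lebesgue. 0)" by (rule integral_lebesgue_cong_AE(1))
      then show False using w(2) by simp
    qed
    ultimately show ?thesis using test_function_D12(1)[OF vt] I(1) by blast
  qed
  fix E assume "E \<in> {E_fun \<beta> a h v |v. (\<forall>i\<in>block a h. v i \<in> D12) \<and> \<not> (\<forall>i\<in>block a h. zero_on UNIV (v i)) \<and>
      directional_deriv (E_fun \<beta> a h) v v = 0}"
  then obtain v where v: "\<And>i. i \<in> block a h \<Longrightarrow> v i \<in> D12" "\<not> (\<forall>i\<in>block a h. zero_on UNIV (v i))"
    "directional_deriv (E_fun \<beta> a h) v v = 0" and E: "E = E_fun \<beta> a h v" by blast
  define N where "N = (\<Sum>i\<in>block a h. L2_sq (weak_grad UNIV (v i)))"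
  define P where "P = (\<Sum>(i, j)\<in>block a h \<times> block a h. \<beta> i j * (LINT x|lebesgue. (v j x)\<^sup>2 * (v i x)\<^sup>2))"
  have NP: "N = P" using E_fun_directional_deriv[of a h v \<beta>, OF v(1)] v(3) by (simp add: N_def P_def)
  have EN: "E = N / 4" using E_fun_scale[of a h v \<beta> 1, OF v(1)] NP by (simp add: E N_def P_def)
  define s where "s i = sqrt (LINT x|lebesgue. (v i x) ^ 4)" for i
  have s0: "0 \<le> s i" for i by (simp add: s_def)
  have sN: "sqrt sobolev_sq * s i \<le> (L2_sq (weak_grad UNIV (v i)))" if "i \<in> block a h" for i
  proof -
    have "sqrt sobolev_sq * s i = sqrt (sobolev_sq * (LINT x|lebesgue. (v i x) ^ 4))" by (simp add: s_def real_sqrt_mult)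
    also have "\<dots> \<le> sqrt ((L2_sq (weak_grad UNIV (v i)))\<^sup>2)" by (rule real_sqrt_le_mono[OF D12_sobolev(5)[OF v(1)[OF that]]])
    also have "\<dots> = (L2_sq (weak_grad UNIV (v i)))" by simp
    finally show ?thesis .
  qed
  have 1: "sqrt sobolev_sq * sum s (block a h) \<le> N" unfolding N_def sum_distrib_left by (intro sum_mono sN)
  have pij: "(LINT x|lebesgue. (v j x)\<^sup>2 * (v i x)\<^sup>2) \<le> s i * s j" if "i \<in> block a h" "j \<in> block a h" for i j
  proof -
    have L: "L2 (\<lambda>x. (v k x)\<^sup>2)" if "k \<in> block a h" for k using D12_sobolev(1,2)[OF v(1)[OF that]] by (simp add: L2_def power_mult[symmetric])
    have "(LINT x|lebesgue. (v j x)\<^sup>2 \<bullet> (v i x)\<^sup>2)\<^sup>2 \<le> (LINT x|lebesgue. (norm ((v j x)\<^sup>2))\<^sup>2) * (LINT x|lebesgue. (norm ((v i x)\<^sup>2))\<^sup>2)"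
      by (intro L2_Cauchy_Schwarz L that)
    also have "\<dots> = (s i * s j)\<^sup>2" by (simp add: s_def power_mult_distrib power_mult[symmetric])
    finally have "(LINT x|lebesgue. (v j x)\<^sup>2 * (v i x)\<^sup>2)\<^sup>2 \<le> (s i * s j)\<^sup>2" by (simp only: inner_real_def)
    then show ?thesis by (rule power2_le_imp_le) (simp add: s0)
  qed
  have "P \<le> (coupling \<beta> a h s)" unfolding P_def by (intro sum_mono) (auto intro!: mult_left_mono pij nonneg)
  also have "\<dots> \<le> F * (sum s (block a h))\<^sup>2" by (rule bound) (rule s0)
  finally have 2: "N \<le> F * (sum s (block a h))\<^sup>2" by (simp add: NP)
  have "(sqrt sobolev_sq * sum s (block a h))\<^sup>2 \<le> N\<^sup>2"
    by (rule power_mono[OF 1]) (auto intro!: mult_nonneg_nonneg sum_nonneg s0 simp: sobolev_sq_pos less_imp_le)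
  then have "sobolev_sq * (sum s (block a h))\<^sup>2 \<le> N\<^sup>2" using sobolev_sq_pos by (simp add: power_mult_distrib)
  then have "F * (sobolev_sq * (sum s (block a h))\<^sup>2) \<le> F * N\<^sup>2" using F by (intro mult_left_mono) auto
  moreover have "sobolev_sq * N \<le> sobolev_sq * (F * (sum s (block a h))\<^sup>2)" using 2 sobolev_sq_pos by (intro mult_left_mono) auto
  ultimately have 3: "sobolev_sq * N \<le> F * N * N" by (simp add: power2_eq_square mult_ac)
  \<comment> \<open>If \<open>N\<close> were 0, Sobolev would make every \<open>L^4\<close> integral
    vanish, against the nontriviality of \<open>v\<close>.\<close>
  have N0: "N > 0"
  proof (rule ccontr)
    assume "\<not> N > 0"
    moreover have "N \<ge> 0" unfolding N_def by (intro sum_nonneg) simp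
    ultimately have "N = 0" by simp
    have "zero_on UNIV (v i)" if i: "i \<in> block a h" for i
    proof -
      have "(L2_sq (weak_grad UNIV (v i))) = 0" using \<open>N = 0\<close> i fin by (simp add: N_def sum_nonneg_eq_0_iff)
      then have "(LINT x|lebesgue. (v i x) ^ 4) \<le> 0" using D12_sobolev(5)[OF v(1)[OF i]] sobolev_sq_pos by (simp add: mult_le_0_iff)
      moreover have "0 \<le> (LINT x|lebesgue. (v i x) ^ 4)" by simp
      ultimately have "(LINT x|lebesgue. (v i x) ^ 4) = 0" by simp
      then have "AE x in lebesgue. (v i x) ^ 4 = 0" using integral_nonneg_eq_0_iff_AE[OF D12_sobolev(2)[OF v(1)[OF i]]] by simp
      then show ?thesis by (simp add: zero_on_def)
    qed
    with v(2) show False by blast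
  qed
  from 3 N0 have "sobolev_sq \<le> F * N" by simp
  then show "sobolev_sq / (4 * F) \<le> E" using F by (simp add: EN field_simps)
qed

section \<open>Competitors for the energy levels\<close>

definition quad_energy :: "'a::euclidean_space set \<Rightarrow> real \<Rightarrow> ('a \<Rightarrow> real) \<Rightarrow> real" where
  "quad_energy \<Omega> l w = (LINT x:\<Omega>|lebesgue. (norm (weak_grad \<Omega> w x))\<^sup>2 + l * (w x)\<^sup>2)"

definition quartic_pairing :: "'a::euclidean_space set \<Rightarrow> ('a \<Rightarrow> real) \<Rightarrow> ('a \<Rightarrow> real) \<Rightarrow> real" where
  "quartic_pairing \<Omega> w z = (LINT x:\<Omega>|lebesgue. (w x)\<^sup>2 * (z x)\<^sup>2)"

lemma quartic_pairing_commute: "quartic_pairing \<Omega> w z = quartic_pairing \<Omega> z w"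
  by (simp add: quartic_pairing_def mult.commute)

text \<open>Homogeneity holds for the Lebesgue integral in every case, a non-integrable product
  counting as 0 on both sides. Thus \<open>J\<close> can be expanded along rays without an embedding
  into \<open>L^4\<close>.\<close>

lemma quartic_pairing_scale: "quartic_pairing \<Omega> (\<lambda>x. c * w x) (\<lambda>x. e * z x) = c\<^sup>2 * e\<^sup>2 * quartic_pairing \<Omega> w z"
proof -
  have "quartic_pairing \<Omega> (\<lambda>x. c * w x) (\<lambda>x. e * z x) = (LINT x:\<Omega>|lebesgue. (c\<^sup>2 * e\<^sup>2) * ((w x)\<^sup>2 * (z x)\<^sup>2))"
    by (simp add: quartic_pairing_def power_mult_distrib mult_ac)
  then show ?thesis by (simp only: quartic_pairing_def set_integral_mult_right)
qed

lemma quad_energy_scale: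
  assumes "open \<Omega>" "w \<in> H1_0 \<Omega>"
  shows "quad_energy \<Omega> l (\<lambda>x. c * w x) = c\<^sup>2 * quad_energy \<Omega> l w"
proof -
  have wg: "is_weak_grad \<Omega> w (weak_grad \<Omega> w)" by (rule H1_0_E[OF assms])
  have "quad_energy \<Omega> l (\<lambda>x. c * w x) = (LINT x:\<Omega>|lebesgue. c\<^sup>2 * ((norm (weak_grad \<Omega> w x))\<^sup>2 + l * (w x)\<^sup>2))"
    unfolding quad_energy_def set_lebesgue_integral_def
  proof (rule integral_lebesgue_cong_AE(1))
    show "AE x in lebesgue. indicator \<Omega> x *\<^sub>R ((norm (weak_grad \<Omega> (\<lambda>x. c * w x) x))\<^sup>2 + l * (c * w x)\<^sup>2)
        = indicator \<Omega> x *\<^sub>R (c\<^sup>2 * ((norm (weak_grad \<Omega> w x))\<^sup>2 + l * (w x)\<^sup>2))" using weak_grad_eqI(2)[OF assms(1) is_weak_grad_scale[OF wg, of c]]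
      by eventually_elim (auto simp: indicator_def power_mult_distrib algebra_simps)
  qed
  then show ?thesis by (simp only: quad_energy_def set_integral_mult_right)
qed

lemma quad_energy_eq:
  assumes "open \<Omega>" "w \<in> H1_0 \<Omega>"
  shows "quad_energy \<Omega> l w = (LINT x|lebesgue. (norm (indicator \<Omega> x *\<^sub>R weak_grad \<Omega> w x))\<^sup>2)
    + l * (LINT x|lebesgue. (norm (indicator \<Omega> x *\<^sub>R w x))\<^sup>2)"
proof -
  have L: "L2 (zero_ext \<Omega> w)" "L2 (zero_ext \<Omega> (weak_grad \<Omega> w))" by (rule H1_0_E[OF assms], assumption)+
  have "quad_energy \<Omega> l w = (LINT x|lebesgue. (norm (indicator \<Omega> x *\<^sub>R weak_grad \<Omega> w x))\<^sup>2 + l * (norm (indicator \<Omega> x *\<^sub>R w x))\<^sup>2)"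
    unfolding quad_energy_def set_lebesgue_integral_def by (intro Bochner_Integration.integral_cong refl) (auto simp: indicator_def)
  then show ?thesis using L2_integrable[OF L(1)] L2_integrable[OF L(2)] by simp
qed

text \<open>The form of the Rayleigh bound in which a coefficient \<open>l\<close> above minus the
  first eigenvalue makes the quadratic energy positive on nonzero functions.\<close>

lemma quad_energy_ge:
  assumes "open \<Omega>" "bounded \<Omega>" "\<Omega> \<noteq> {}" "w \<in> H1_0 \<Omega>"
  shows "(first_dirichlet_eigenvalue \<Omega> + l) * (LINT x|lebesgue. (norm (indicator \<Omega> x *\<^sub>R w x))\<^sup>2) \<le> quad_energy \<Omega> l w"
  using first_dirichlet_eigenvalue_rayleigh[OF assms] quad_energy_eq[OF assms(1,4), of l] by (simp add: distrib_right)

lemma quad_energy_nonneg: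
  assumes "open \<Omega>" "bounded \<Omega>" "\<Omega> \<noteq> {}" "w \<in> H1_0 \<Omega>" "- first_dirichlet_eigenvalue \<Omega> < l"
  shows "0 \<le> quad_energy \<Omega> l w"
proof -
  have "0 \<le> (first_dirichlet_eigenvalue \<Omega> + l) * (LINT x|lebesgue. (norm (indicator \<Omega> x *\<^sub>R w x))\<^sup>2)" using assms(5) by (intro mult_nonneg_nonneg) auto
  then show ?thesis using quad_energy_ge[OF assms(1-4), of l] by linarith
qed

lemma quad_energy_test_function:
  assumes "open \<Omega>" "w \<in> test_functions \<Omega>"
  shows "quad_energy \<Omega> l w = (L2_sq (grad w)) + l * (LINT x|lebesgue. (w x)\<^sup>2)"
proof -
  have "(LINT x|lebesgue. (norm (indicator \<Omega> x *\<^sub>R weak_grad \<Omega> w x))\<^sup>2) = L2_sq (grad w)"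
    by (rule integral_lebesgue_cong_AE(1)) (use test_function_H1_0(2)[OF assms] in \<open>eventually_elim, simp\<close>)
  moreover have "(LINT x|lebesgue. (norm (indicator \<Omega> x *\<^sub>R w x))\<^sup>2) = (LINT x|lebesgue. (w x)\<^sup>2)"
    using test_function_indicator(1)[OF assms(2)] by (simp del: real_scaleR_def)
  ultimately show ?thesis using quad_energy_eq[OF assms(1) test_function_H1_0(1)[OF assms], of l] by simp
qed

section \<open>Derivatives of \<open>J\<close>, the Nehari constraint and competitors\<close>

lemma J_eq:
  assumes fin: "finite \<Gamma>" and disj: "disjoint_family_on (block a) \<Gamma>"
  shows "J \<Omega> lam \<beta> a \<Gamma> u = 1/2 * (\<Sum>i\<in>(blocks a \<Gamma>). quad_energy \<Omega> (lam i) (u i))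
    - 1/4 * (\<Sum>i\<in>(blocks a \<Gamma>). \<Sum>j\<in>(blocks a \<Gamma>). \<beta> i j * quartic_pairing \<Omega> (u i) (u j))"
proof -
  have b: "\<forall>k\<in>\<Gamma>. finite (block a k)" by (simp add: block_def)
  have U: "(\<Sum>i\<in>(blocks a \<Gamma>). f i) = (\<Sum>k\<in>\<Gamma>. \<Sum>i\<in>block a k. f i)" for f :: "nat \<Rightarrow> real"
    by (rule sum.UNION_disjoint[OF fin b]) (use disj in \<open>auto simp: disjoint_family_on_def\<close>)
  have "(LINT x:\<Omega>|lebesgue. \<beta> i j * (u i x)\<^sup>2 * (u j x)\<^sup>2) = \<beta> i j * quartic_pairing \<Omega> (u i) (u j)" for i j
    by (simp only: quartic_pairing_def mult.assoc set_integral_mult_right)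
  then have "(\<Sum>k\<in>\<Gamma>. \<Sum>l\<in>\<Gamma>. \<Sum>(i, j)\<in>block a k \<times> block a l. LINT x:\<Omega>|lebesgue. \<beta> i j * (u i x)\<^sup>2 * (u j x)\<^sup>2)
     = (\<Sum>k\<in>\<Gamma>. \<Sum>l\<in>\<Gamma>. \<Sum>i\<in>block a k. \<Sum>j\<in>block a l. \<beta> i j * quartic_pairing \<Omega> (u i) (u j))" by (simp only: sum.cartesian_product)
  also have "\<dots> = (\<Sum>k\<in>\<Gamma>. \<Sum>i\<in>block a k. \<Sum>l\<in>\<Gamma>. \<Sum>j\<in>block a l. \<beta> i j * quartic_pairing \<Omega> (u i) (u j))" by (intro sum.cong refl sum.swap)
  finally show ?thesis unfolding J_def block_norm_sq_def quad_energy_def[symmetric] by (simp only: U)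
qed

text \<open>In the direction \<open>u i\<close> the family is only rescaled in its i-th component,
  so \<open>J\<close> becomes a polynomial in \<open>t\<close> by homogeneity. Symmetry of
  \<open>\<beta>\<close> merges the two halves of the quartic derivative, which turns the factor 1/4
  into 1.\<close>

lemma J_partial_deriv:
  fixes u :: family
  assumes fin: "finite \<Gamma>" and disj: "disjoint_family_on (block a) \<Gamma>"
    and \<Omega>: "open \<Omega>" and u: "\<And>i. i \<in> blocks a \<Gamma> \<Longrightarrow> u i \<in> H1_0 \<Omega>"
    and sym: "\<And>i j. i \<in> blocks a \<Gamma> \<Longrightarrow> j \<in> blocks a \<Gamma> \<Longrightarrow> \<beta> i j = \<beta> j i"
    and i: "i \<in> blocks a \<Gamma>"
  shows "partial_deriv i (J \<Omega> lam \<beta> a \<Gamma>) u (u i) = quad_energy \<Omega> (lam i) (u i)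
    - (\<Sum>j\<in>(blocks a \<Gamma>). \<beta> i j * quartic_pairing \<Omega> (u i) (u j))"
proof -
  define U where "U = (blocks a \<Gamma>)"
  have finU: "finite U" using fin by (simp add: U_def block_def)
  have iU: "i \<in> U" using i by (simp add: U_def)
  define q where "q j = quad_energy \<Omega> (lam j) (u j)" for j
  define p where "p j k = \<beta> j k * quartic_pairing \<Omega> (u j) (u k)" for j k
  define \<delta> :: "nat \<Rightarrow> real" where "\<delta> j = (if j = i then 1 else 0)" for j
  have p: "p k j = p j k" if "j \<in> U" "k \<in> U" for j k using sym[of j k] that quartic_pairing_commute[of \<Omega> "u j" "u k"] by (simp add: p_def U_def)
  have "J \<Omega> lam \<beta> a \<Gamma> (\<lambda>j x. u j x + t * (if j = i then u i else (\<lambda>x. 0)) x)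
      = 1/2 * (\<Sum>j\<in>U. (1 + t * \<delta> j)\<^sup>2 * q j) - 1/4 * (\<Sum>j\<in>U. \<Sum>k\<in>U. (1 + t * \<delta> j)\<^sup>2 * (1 + t * \<delta> k)\<^sup>2 * p j k)" for t
  proof -
    have eq: "(\<lambda>j x. u j x + t * (if j = i then u i else (\<lambda>x. 0)) x) = (\<lambda>j x. (1 + t * \<delta> j) * u j x)" by (auto simp: fun_eq_iff \<delta>_def distrib_right)
    have "quad_energy \<Omega> (lam j) (\<lambda>x. (1 + t * \<delta> j) * u j x) = (1 + t * \<delta> j)\<^sup>2 * q j" if "j \<in> U" for j
      unfolding q_def by (rule quad_energy_scale[OF \<Omega> u]) (use that in \<open>simp add: U_def\<close>)
    then have "(\<Sum>j\<in>U. quad_energy \<Omega> (lam j) (\<lambda>x. (1 + t * \<delta> j) * u j x)) = (\<Sum>j\<in>U. (1 + t * \<delta> j)\<^sup>2 * q j)" by simp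
    moreover have "(\<Sum>j\<in>U. \<Sum>k\<in>U. \<beta> j k * ((1 + t * \<delta> j)\<^sup>2 * (1 + t * \<delta> k)\<^sup>2 * quartic_pairing \<Omega> (u j) (u k)))
        = (\<Sum>j\<in>U. \<Sum>k\<in>U. (1 + t * \<delta> j)\<^sup>2 * (1 + t * \<delta> k)\<^sup>2 * p j k)" by (intro sum.cong refl) (simp add: p_def)
    ultimately show ?thesis unfolding eq J_eq[OF fin disj] U_def[symmetric] quartic_pairing_scale by simp
  qed
  moreover have "((\<lambda>t. 1/2 * (\<Sum>j\<in>U. (1 + t * \<delta> j)\<^sup>2 * q j) - 1/4 * (\<Sum>j\<in>U. \<Sum>k\<in>U. (1 + t * \<delta> j)\<^sup>2 * (1 + t * \<delta> k)\<^sup>2 * p j k))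
     has_real_derivative 1/2 * (\<Sum>j\<in>U. 2 * \<delta> j * q j) - 1/4 * (\<Sum>j\<in>U. \<Sum>k\<in>U. (2 * \<delta> j + 2 * \<delta> k) * p j k)) (at 0)"
    by (intro DERIV_diff DERIV_cmult DERIV_sum) (auto intro!: derivative_eq_intros simp: algebra_simps)
  moreover have "1/2 * (\<Sum>j\<in>U. 2 * \<delta> j * q j) - 1/4 * (\<Sum>j\<in>U. \<Sum>k\<in>U. (2 * \<delta> j + 2 * \<delta> k) * p j k) = q i - (\<Sum>j\<in>U. p i j)"
  proof -
    have 1: "(\<Sum>j\<in>U. 2 * \<delta> j * q j) = 2 * q i"
    proof -
      have "(\<Sum>j\<in>U. 2 * \<delta> j * q j) = (\<Sum>j\<in>U. if j = i then 2 * q i else 0)" by (intro sum.cong) (auto simp: \<delta>_def)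
      then show ?thesis using finU iU by simp
    qed
    have 2: "(\<Sum>j\<in>U. \<Sum>k\<in>U. \<delta> j * p j k) = (\<Sum>k\<in>U. p i k)"
    proof -
      have "(\<Sum>j\<in>U. \<Sum>k\<in>U. \<delta> j * p j k) = (\<Sum>j\<in>U. if j = i then (\<Sum>k\<in>U. p i k) else 0)" by (intro sum.cong) (auto simp: \<delta>_def)
      then show ?thesis using finU iU by simp
    qed
    have "(\<Sum>j\<in>U. \<Sum>k\<in>U. \<delta> k * p j k) = (\<Sum>k\<in>U. \<Sum>j\<in>U. \<delta> k * p j k)" by (rule sum.swap)
    also have "\<dots> = (\<Sum>k\<in>U. \<Sum>j\<in>U. \<delta> k * p k j)" by (intro sum.cong refl) (simp add: p)
    finally have 3: "(\<Sum>j\<in>U. \<Sum>k\<in>U. \<delta> k * p j k) = (\<Sum>k\<in>U. p i k)" using 2 by simp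
    have "(\<Sum>j\<in>U. \<Sum>k\<in>U. (2 * \<delta> j + 2 * \<delta> k) * p j k) = 2 * (\<Sum>j\<in>U. \<Sum>k\<in>U. \<delta> j * p j k) + 2 * (\<Sum>j\<in>U. \<Sum>k\<in>U. \<delta> k * p j k)"
      by (simp add: sum_distrib_left sum.distrib[symmetric] algebra_simps)
    then show ?thesis by (simp add: 1 2 3)
  qed
  ultimately show ?thesis unfolding partial_deriv_def directional_deriv_def by (simp add: DERIV_imp_deriv q_def p_def U_def)
qed

text \<open>Summing the constraints over the blocks identifies the total quadratic with the total
  quartic part, and 1/2 - 1/4 = 1/4 remains.\<close>

lemma J_on_Nehari:
  assumes fin: "finite \<Gamma>" and disj: "disjoint_family_on (block a) \<Gamma>"
    and \<Omega>: "open \<Omega>"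
    and sym: "\<And>i j. i \<in> blocks a \<Gamma> \<Longrightarrow> j \<in> blocks a \<Gamma> \<Longrightarrow> \<beta> i j = \<beta> j i"
    and u: "u \<in> Nehari \<Omega> lam \<beta> a \<Gamma>"
  shows "J \<Omega> lam \<beta> a \<Gamma> u = 1/4 * (\<Sum>k\<in>\<Gamma>. \<Sum>i\<in>block a k. quad_energy \<Omega> (lam i) (u i))"
proof -
  have b: "\<forall>k\<in>\<Gamma>. finite (block a k)" by (simp add: block_def)
  have U: "(\<Sum>i\<in>(blocks a \<Gamma>). f i) = (\<Sum>k\<in>\<Gamma>. \<Sum>i\<in>block a k. f i)" for f :: "nat \<Rightarrow> real"
    by (rule sum.UNION_disjoint[OF fin b]) (use disj in \<open>auto simp: disjoint_family_on_def\<close>)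
  have uH: "u i \<in> H1_0 \<Omega>" if "i \<in> blocks a \<Gamma>" for i using u that by (auto simp: Nehari_def)
  have "(\<Sum>i\<in>block a k. quad_energy \<Omega> (lam i) (u i) - (\<Sum>j\<in>(blocks a \<Gamma>). \<beta> i j * quartic_pairing \<Omega> (u i) (u j))) = 0" if k: "k \<in> \<Gamma>" for k
  proof -
    have "(\<Sum>i\<in>block a k. partial_deriv i (J \<Omega> lam \<beta> a \<Gamma>) u (u i)) = 0" using u k by (simp add: Nehari_def)
    moreover have "partial_deriv i (J \<Omega> lam \<beta> a \<Gamma>) u (u i) = quad_energy \<Omega> (lam i) (u i)
       - (\<Sum>j\<in>(blocks a \<Gamma>). \<beta> i j * quartic_pairing \<Omega> (u i) (u j))" if "i \<in> block a k" for i
      by (rule J_partial_deriv[OF fin disj \<Omega> uH sym]) (use that k in auto)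
    ultimately show ?thesis by simp
  qed
  then have "(\<Sum>i\<in>(blocks a \<Gamma>). quad_energy \<Omega> (lam i) (u i) - (\<Sum>j\<in>(blocks a \<Gamma>). \<beta> i j * quartic_pairing \<Omega> (u i) (u j))) = 0"
    by (simp only: U[of "\<lambda>i. quad_energy \<Omega> (lam i) (u i) - (\<Sum>j\<in>(blocks a \<Gamma>). \<beta> i j * quartic_pairing \<Omega> (u i) (u j))"] sum.neutral_const cong: sum.cong)
  then show ?thesis unfolding J_eq[OF fin disj] U[symmetric] by (simp add: sum_subtractf)
qed

text \<open>The competitor has components \<open>sqrt (\<tau> h * y h i) * W h\<close>. Disjoint
  supports remove the coupling between blocks, so each constraint is a scalar equation for
  \<open>\<tau> h\<close>, solved by \<open>Q h / (B h * f h)\<close>; the energy is then a quarter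
  of the sum of the products \<open>\<tau> h * Q h\<close>.\<close>

lemma c_level_le:
  fixes W :: "nat \<Rightarrow> real^4 \<Rightarrow> real"
  assumes fin: "finite \<Gamma>" and disj: "disjoint_family_on (block a) \<Gamma>"
    and \<Omega>: "open \<Omega>" "bounded \<Omega>" "\<Omega> \<noteq> {}"
    and lam: "\<And>h i. h \<in> \<Gamma> \<Longrightarrow> i \<in> block a h \<Longrightarrow> - first_dirichlet_eigenvalue \<Omega> < lam i"
    and sym: "\<And>i j. i \<in> blocks a \<Gamma> \<Longrightarrow> j \<in> blocks a \<Gamma> \<Longrightarrow> \<beta> i j = \<beta> j i"
    and W: "\<And>h. h \<in> \<Gamma> \<Longrightarrow> W h \<in> test_functions \<Omega>"
    and Wdisj: "\<And>h k x. h \<in> \<Gamma> \<Longrightarrow> k \<in> \<Gamma> \<Longrightarrow> h \<noteq> k \<Longrightarrow> W h x * W k x = 0"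
    and y: "\<And>h i. h \<in> \<Gamma> \<Longrightarrow> i \<in> block a h \<Longrightarrow> 0 \<le> y h i"
  defines "Q \<equiv> \<lambda>h. weighted_energy lam a h (W h) (y h)"
    and "B \<equiv> \<lambda>h. LINT x|lebesgue. (W h x) ^ 4"
    and "f \<equiv> \<lambda>h. \<Sum>(i, j)\<in>block a h \<times> block a h. \<beta> i j * (y h i * y h j)"
  assumes pos: "\<And>h. h \<in> \<Gamma> \<Longrightarrow> 0 < Q h" "\<And>h. h \<in> \<Gamma> \<Longrightarrow> 0 < B h" "\<And>h. h \<in> \<Gamma> \<Longrightarrow> 0 < f h"
  shows "c_level \<Omega> lam \<beta> a \<Gamma> \<le> (\<Sum>h\<in>\<Gamma>. (Q h)\<^sup>2 / (4 * B h * f h))"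
proof -
  define U where "U = (blocks a \<Gamma>)"
  have finU: "finite U" using fin by (simp add: U_def block_def)
  \<comment> \<open>The block of an index, well defined because the blocks in
    \<open>\<Gamma>\<close> are disjoint.\<close>
  define hb where "hb i = (THE h. h \<in> \<Gamma> \<and> i \<in> block a h)" for i
  have hb: "hb i = h" if "h \<in> \<Gamma>" "i \<in> block a h" for h i unfolding hb_def by (rule the_equality) (use that disj in \<open>auto simp: disjoint_family_on_def\<close>)
  define \<tau> where "\<tau> h = Q h / (B h * f h)" for h
  have \<tau>: "\<tau> h > 0" "\<tau> h * (B h * f h) = Q h" if "h \<in> \<Gamma>" for h using pos(1-3)[OF that] by (simp_all add: \<tau>_def)
  define c where "c i = sqrt (\<tau> (hb i) * y (hb i) i)" for i
  have c2: "(c i)\<^sup>2 = \<tau> h * y h i" if "h \<in> \<Gamma>" "i \<in> block a h" for h i using \<tau>(1)[OF that(1)] y[OF that] by (simp add: c_def hb[OF that])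
  define u :: family where "u i x = c i * W (hb i) x" for i x
  have uH: "u i \<in> H1_0 \<Omega>" if "i \<in> U" for i
  proof -
    obtain h where h: "h \<in> \<Gamma>" "i \<in> block a h" using \<open>i \<in> U\<close> unfolding U_def by blast
    then have "u i \<in> test_functions \<Omega>" unfolding u_def[abs_def] using W[of h] by (intro test_functions_scale) (simp add: hb)
    then show ?thesis by (rule test_function_H1_0(1)[OF \<Omega>(1)])
  qed
  have q: "quad_energy \<Omega> (lam i) (u i) = \<tau> h * (y h i * (L2_sq (grad (W h)) + lam i * (LINT x|lebesgue. (W h x)\<^sup>2)))"
    if "h \<in> \<Gamma>" "i \<in> block a h" for h i unfolding u_def[abs_def] hb[OF that]
    using quad_energy_scale[OF \<Omega>(1) test_function_H1_0(1)[OF \<Omega>(1) W[OF that(1)]], of "lam i" "c i"]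
      quad_energy_test_function[OF \<Omega>(1) W[OF that(1)], of "lam i"] c2[OF that] by simp
  have p0: "quartic_pairing \<Omega> (u i) (u j) = 0" if "h \<in> \<Gamma>" "i \<in> block a h" "k \<in> \<Gamma>" "j \<in> block a k" "h \<noteq> k" for h i k j
  proof -
    have "(u i x)\<^sup>2 * (u j x)\<^sup>2 = (c i)\<^sup>2 * (c j)\<^sup>2 * (W h x * W k x)\<^sup>2" for x using that by (simp add: u_def hb power_mult_distrib)
    then have "(u i x)\<^sup>2 * (u j x)\<^sup>2 = 0" for x by (simp only: Wdisj[OF that(1,3,5)]) simp
    then show ?thesis by (simp only: quartic_pairing_def set_lebesgue_integral_def) simp
  qed
  have WB: "quartic_pairing \<Omega> (W h) (W h) = B h" if "h \<in> \<Gamma>" for h unfolding quartic_pairing_def B_def set_lebesgue_integral_def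
  proof (intro Bochner_Integration.integral_cong refl)
    fix x
    have "indicator \<Omega> x *\<^sub>R W h x = W h x" by (rule test_function_indicator(1)[OF W[OF that]])
    then show "indicator \<Omega> x *\<^sub>R ((W h x)\<^sup>2 * (W h x)\<^sup>2) = (W h x) ^ 4" by (cases "x \<in> \<Omega>") (auto simp: power2_eq_square power4_eq_xxxx)
  qed
  have p1: "quartic_pairing \<Omega> (u i) (u j) = (\<tau> h)\<^sup>2 * B h * (y h i * y h j)" if "h \<in> \<Gamma>" "i \<in> block a h" "j \<in> block a h" for h i j
    unfolding u_def[abs_def] hb[OF that(1,2)] hb[OF that(1,3)] quartic_pairing_scale
    using c2[OF that(1,2)] c2[OF that(1,3)] WB[OF that(1)] by (simp add: power2_eq_square)
  have sum_p: "(\<Sum>i\<in>block a h. \<Sum>j\<in>U. \<beta> i j * quartic_pairing \<Omega> (u i) (u j)) = (\<tau> h)\<^sup>2 * B h * f h" if h: "h \<in> \<Gamma>" for h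
  proof -
    have "(\<Sum>j\<in>U. \<beta> i j * quartic_pairing \<Omega> (u i) (u j)) = (\<Sum>j\<in>block a h. (\<tau> h)\<^sup>2 * B h * (\<beta> i j * (y h i * y h j)))"
      if i: "i \<in> block a h" for i
    proof -
      have "(\<Sum>j\<in>U. \<beta> i j * quartic_pairing \<Omega> (u i) (u j)) = (\<Sum>j\<in>block a h. \<beta> i j * quartic_pairing \<Omega> (u i) (u j))"
      proof (rule sum.mono_neutral_right[OF finU])
        show "block a h \<subseteq> U" using h by (auto simp: U_def)
        show "\<forall>j\<in>U - block a h. \<beta> i j * quartic_pairing \<Omega> (u i) (u j) = 0"
        proof
          fix j assume "j \<in> U - block a h"
          then obtain k where "k \<in> \<Gamma>" "j \<in> block a k" "h \<noteq> k" by (auto simp: U_def)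
          from p0[OF h i this] show "\<beta> i j * quartic_pairing \<Omega> (u i) (u j) = 0" by simp
        qed
      qed
      also have "\<dots> = (\<Sum>j\<in>block a h. (\<tau> h)\<^sup>2 * B h * (\<beta> i j * (y h i * y h j)))" by (intro sum.cong refl) (simp add: p1[OF h i])
      finally show ?thesis .
    qed
    then show ?thesis by (simp add: f_def sum.cartesian_product[symmetric] sum_distrib_left)
  qed
  have sum_q: "(\<Sum>i\<in>block a h. quad_energy \<Omega> (lam i) (u i)) = \<tau> h * Q h" if "h \<in> \<Gamma>" for h by (simp add: q[OF that] Q_def sum_distrib_left)
  have uN: "u \<in> Nehari \<Omega> lam \<beta> a \<Gamma>" unfolding Nehari_def
  proof (intro CollectI ballI conjI)
    fix h assume h: "h \<in> \<Gamma>"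
    show "u i \<in> H1_0 \<Omega>" if "i \<in> block a h" for i by (rule uH) (use that h in \<open>auto simp: U_def\<close>)
    \<comment> \<open>A vanishing block would have quartic sum 0, but that sum is
      \<open>(\<tau> h)\<^sup>2 * B h * f h > 0\<close>.\<close>
    show "\<not> (\<forall>i\<in>block a h. zero_on \<Omega> (u i))"
    proof
      assume z: "\<forall>i\<in>block a h. zero_on \<Omega> (u i)"
      have "quartic_pairing \<Omega> (u i) (u j) = 0" if "i \<in> block a h" for i j
      proof -
        have "AE x in lebesgue. x \<in> \<Omega> \<longrightarrow> u i x = 0" using z that by (simp add: zero_on_def)
        then have "AE x in lebesgue. indicator \<Omega> x *\<^sub>R ((u i x)\<^sup>2 * (u j x)\<^sup>2) = 0" by eventually_elim (auto simp: indicator_def)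
        from integral_lebesgue_cong_AE(1)[OF this] show ?thesis by (simp add: quartic_pairing_def set_lebesgue_integral_def)
      qed
      then have "(\<tau> h)\<^sup>2 * B h * f h = 0" using sum_p[OF h] by simp
      then show False using \<tau>(1)[OF h] pos(2,3)[OF h] by simp
    qed
    have "partial_deriv i (J \<Omega> lam \<beta> a \<Gamma>) u (u i) = quad_energy \<Omega> (lam i) (u i)
       - (\<Sum>j\<in>U. \<beta> i j * quartic_pairing \<Omega> (u i) (u j))" if "i \<in> block a h" for i
      unfolding U_def by (rule J_partial_deriv[OF fin disj \<Omega>(1) _ sym]) (use that h in \<open>auto intro!: uH simp: U_def\<close>)
    then have "(\<Sum>i\<in>block a h. partial_deriv i (J \<Omega> lam \<beta> a \<Gamma>) u (u i)) = \<tau> h * Q h - (\<tau> h)\<^sup>2 * B h * f h"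
      by (simp add: sum_subtractf sum_q[OF h] sum_p[OF h])
    also have "\<dots> = \<tau> h * (Q h - \<tau> h * (B h * f h))" by (simp add: power2_eq_square algebra_simps)
    finally show "(\<Sum>i\<in>block a h. partial_deriv i (J \<Omega> lam \<beta> a \<Gamma>) u (u i)) = 0" using \<tau>(2)[OF h] by simp
  qed
  have JN: "J \<Omega> lam \<beta> a \<Gamma> v = 1/4 * (\<Sum>k\<in>\<Gamma>. \<Sum>i\<in>block a k. quad_energy \<Omega> (lam i) (v i))" if "v \<in> Nehari \<Omega> lam \<beta> a \<Gamma>" for v
    by (rule J_on_Nehari[OF fin disj \<Omega>(1) sym that])
  have "c_level \<Omega> lam \<beta> a \<Gamma> \<le> J \<Omega> lam \<beta> a \<Gamma> u" unfolding c_level_def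
  proof (rule cINF_lower[OF _ uN])
    \<comment> \<open>An infimum over the reals bounds its members only if the set is bounded below.
      On the constraint \<open>J\<close> is a sum of energies that are nonnegative because
      \<open>lam i\<close> exceeds minus the first eigenvalue.\<close>
    show "bdd_below (J \<Omega> lam \<beta> a \<Gamma> ` Nehari \<Omega> lam \<beta> a \<Gamma>)"
    proof (rule bdd_belowI2)
      fix v assume v: "v \<in> Nehari \<Omega> lam \<beta> a \<Gamma>"
      have "0 \<le> quad_energy \<Omega> (lam i) (v i)" if "k \<in> \<Gamma>" "i \<in> block a k" for k i
        by (rule quad_energy_nonneg[OF \<Omega> _ lam[OF that]]) (use v that in \<open>auto simp: Nehari_def\<close>)
      then show "0 \<le> J \<Omega> lam \<beta> a \<Gamma> v" unfolding JN[OF v] by (intro mult_nonneg_nonneg sum_nonneg) auto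
    qed
  qed
  also have "\<dots> = (\<Sum>h\<in>\<Gamma>. (Q h)\<^sup>2 / (4 * B h * f h))" unfolding JN[OF uN] sum_distrib_left
  proof (intro sum.cong refl)
    fix h assume h: "h \<in> \<Gamma>"
    have "(\<Sum>i\<in>block a h. 1/4 * quad_energy \<Omega> (lam i) (u i)) = 1/4 * (\<tau> h * Q h)" by (simp only: sum_distrib_left[symmetric] sum_q[OF h])
    then show "(\<Sum>i\<in>block a h. 1/4 * quad_energy \<Omega> (lam i) (u i)) = (Q h)\<^sup>2 / (4 * B h * f h)" by (simp add: \<tau>_def power2_eq_square)
  qed
  finally show ?thesis .
qed

text \<open>The strict inequality \<open>R\<^sup>2 < sobolev_sq * B\<close> for the bubble leaves
  room for weights whose coupling is merely close to its supremum \<open>F\<close>; the energy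
  quotient then falls below \<open>sobolev_sq / (4 * F)\<close>, hence below
  \<open>l_level\<close>.\<close>

lemma block_competitor:
  fixes \<Omega> :: "(real^4) set"
  assumes \<Omega>: "open \<Omega>" "bounded \<Omega>" "cball x0 \<rho> \<subseteq> \<Omega>" "\<rho> > 0"
    and i0: "i0 \<in> block a h"
    and lam: "\<And>i. i \<in> block a h \<Longrightarrow> - first_dirichlet_eigenvalue \<Omega> < lam i" "\<And>i. i \<in> block a h \<Longrightarrow> lam i < 0"
    and \<beta>: "\<beta> i0 i0 > 0" "\<And>i j. i \<in> block a h \<Longrightarrow> j \<in> block a h \<Longrightarrow> 0 \<le> \<beta> i j"
  obtains W y where "W \<in> test_functions (cball x0 \<rho>)" "0 < (LINT x|lebesgue. (W x) ^ 4)"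
    "\<And>i. i \<in> block a h \<Longrightarrow> 0 \<le> y i"
    "0 < (weighted_energy lam a h W y)"
    "0 < (coupling \<beta> a h y)"
    "(weighted_energy lam a h W y)\<^sup>2
      / (4 * (LINT x|lebesgue. (W x) ^ 4) * (coupling \<beta> a h y)) < l_level \<beta> a h"
proof -
  have fin: "finite (block a h)" by (simp add: block_def)
  have \<Omega>0: "\<Omega> \<noteq> {}" using \<Omega>(3,4) by auto
  \<comment> \<open>The smallest absolute value of the negative coefficients \<open>lam i\<close> in
    the block; a bubble built for it serves all components at once.\<close>
  define \<mu> where "\<mu> = Min ((\<lambda>i. - lam i) ` block a h)"
  have \<mu>: "\<mu> > 0" unfolding \<mu>_def using fin i0 lam(2) by (subst Min_gr_iff) auto
  have \<mu>le: "lam i \<le> - \<mu>" if "i \<in> block a h" for i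
  proof -
    have "\<mu> \<le> - lam i" unfolding \<mu>_def using fin that by (intro Min_le) auto
    then show ?thesis by simp
  qed
  obtain W where W: "W \<in> test_functions (cball x0 \<rho>)" "(LINT x|lebesgue. (W x) ^ 4) > 0"
    "(L2_sq (grad W)) - \<mu> * (LINT x|lebesgue. (W x)\<^sup>2) < sqrt (sobolev_sq * (LINT x|lebesgue. (W x) ^ 4))"
    by (rule bubble[OF \<Omega>(4) \<mu>, of x0]) (rule that)
  have W\<Omega>: "W \<in> test_functions \<Omega>" using W(1) \<Omega>(3) by (auto simp: test_functions_def)
  define A where "A = L2_sq (grad W)"
  define B where "B = (LINT x|lebesgue. (W x) ^ 4)"
  define C where "C = (LINT x|lebesgue. (W x)\<^sup>2)"
  have B: "B > 0" using W(2) by (simp add: B_def)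
  have C: "C > 0"
  proof (rule ccontr)
    assume "\<not> C > 0"
    moreover have "C \<ge> 0" by (simp add: C_def)
    ultimately have "C = 0" by simp
    moreover have "integrable lebesgue (\<lambda>x. (W x)\<^sup>2)" using L2_integrable[OF L2_test_function(1)[OF W\<Omega>]] by simp
    ultimately have "AE x in lebesgue. (W x)\<^sup>2 = 0" using integral_nonneg_eq_0_iff_AE[of lebesgue "\<lambda>x. (W x)\<^sup>2"] by (simp add: C_def)
    then have "AE x in lebesgue. (W x) ^ 4 = 0" by eventually_elim simp
    from integral_lebesgue_cong_AE(1)[OF this] show False using B by (simp add: B_def)
  qed
  define R where "R = A - \<mu> * C"
  define Q where "Q y = (\<Sum>i\<in>block a h. y i * (A + lam i * C))" for y
  define f where "f y = (coupling \<beta> a h y)" for y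
  \<comment> \<open>A simplex in the coordinates of the block; the values of a weight elsewhere
    enter neither \<open>f\<close> nor \<open>Q\<close>.\<close>
  define Y where "Y = {y :: nat \<Rightarrow> real. (\<forall>i\<in>block a h. 0 \<le> y i) \<and> sum y (block a h) = 1}"
  define F where "F = (SUP y\<in>Y. f y)"
  have bdd: "bdd_above (f ` Y)"
  proof (rule bdd_aboveI2)
    fix y assume y: "y \<in> Y"
    have y1: "y i \<le> 1" if "i \<in> block a h" for i using member_le_sum[of i "block a h" y] y that fin by (simp add: Y_def)
    show "f y \<le> (\<Sum>(i, j)\<in>block a h \<times> block a h. \<beta> i j)" unfolding f_def
    proof (intro sum_mono, clarify)
      fix i j assume ij: "i \<in> block a h" "j \<in> block a h"
      then have "y i * y j \<le> 1 * 1" using y by (intro mult_mono y1) (auto simp: Y_def)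
      then show "\<beta> i j * (y i * y j) \<le> \<beta> i j" using mult_left_mono[of "y i * y j" 1 "\<beta> i j"] \<beta>(2)[OF ij] by simp
    qed
  qed
  define y0 :: "nat \<Rightarrow> real" where "y0 i = (if i = i0 then 1 else 0)" for i
  have y0: "y0 \<in> Y" using i0 fin by (simp add: Y_def y0_def)
  have "f y0 = (\<Sum>z\<in>block a h \<times> block a h. if z = (i0, i0) then \<beta> i0 i0 else 0)"
    unfolding f_def by (intro sum.cong refl) (auto simp: y0_def split: if_splits)
  then have fy0: "f y0 = \<beta> i0 i0" using i0 fin by simp
  have F: "F > 0" using cSUP_upper[OF y0 bdd] \<beta>(1) by (simp add: F_def fy0)
  have l: "sobolev_sq / (4 * F) \<le> l_level \<beta> a h"
  proof (rule l_level_ge[where \<beta>=\<beta>, OF i0 \<beta>(1) F])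
    show "0 \<le> \<beta> i j" if "i \<in> block a h" "j \<in> block a h" for i j by (rule \<beta>(2)[OF that])
    fix y :: "nat \<Rightarrow> real" assume y: "\<And>i. i \<in> block a h \<Longrightarrow> 0 \<le> y i"
    define s where "s = sum y (block a h)"
    have s0: "s \<ge> 0" unfolding s_def by (intro sum_nonneg y)
    show "(coupling \<beta> a h y) \<le> F * (sum y (block a h))\<^sup>2"
    proof (cases "s = 0")
      case True
      then have "y i = 0" if "i \<in> block a h" for i using y that fin by (simp add: s_def sum_nonneg_eq_0_iff)
      then have "(coupling \<beta> a h y) = 0" by (intro sum.neutral) auto
      then show ?thesis using F by simp
    next
      case False
      then have s: "s > 0" using s0 by simp
      have "(\<lambda>i. y i / s) \<in> Y" using y s by (simp add: Y_def sum_divide_distrib[symmetric] s_def[symmetric])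
      from cSUP_upper[OF this bdd] have "f (\<lambda>i. y i / s) \<le> F" by (simp add: F_def)
      moreover have "f (\<lambda>i. y i / s) = f y / s\<^sup>2" unfolding f_def sum_divide_distrib by (intro sum.cong refl) (auto simp: power2_eq_square)
      ultimately have "f y \<le> F * s\<^sup>2" using s by (simp add: field_simps)
      then show ?thesis by (simp add: f_def s_def)
    qed
  qed
  have Q: "0 < Q y" "Q y \<le> R" if y: "y \<in> Y" for y
  proof -
    \<comment> \<open>The Rayleigh bound for \<open>W\<close> keeps \<open>Q\<close> positive
      although \<open>lam i\<close> is negative.\<close>
    have ray: "0 < A + lam i * C" if "i \<in> block a h" for i
    proof -
      have "(LINT x|lebesgue. (norm (indicator \<Omega> x *\<^sub>R W x))\<^sup>2) = C" using test_function_indicator(1)[OF W\<Omega>] by (simp add: C_def del: real_scaleR_def)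
      then have "(first_dirichlet_eigenvalue \<Omega> + lam i) * C \<le> A + lam i * C"
        using quad_energy_ge[OF \<Omega>(1,2) \<Omega>0 test_function_H1_0(1)[OF \<Omega>(1) W\<Omega>], of "lam i"]
        by (simp add: quad_energy_test_function[OF \<Omega>(1) W\<Omega>] A_def C_def)
      moreover have "0 < (first_dirichlet_eigenvalue \<Omega> + lam i) * C" using lam(1)[OF that] C by (intro mult_pos_pos) auto
      ultimately show ?thesis by linarith
    qed
    obtain i1 where i1: "i1 \<in> block a h" "y i1 \<noteq> 0" using y by (force simp: Y_def intro: ccontr)
    have yn: "0 \<le> y i" if "i \<in> block a h" for i using y that by (simp add: Y_def)
    show "0 < Q y" unfolding Q_def
    proof (rule sum_pos2[OF fin i1(1)])
      show "0 < y i1 * (A + lam i1 * C)" using i1 yn[OF i1(1)] ray[OF i1(1)] by simp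
      show "0 \<le> y i * (A + lam i * C)" if "i \<in> block a h" for i using yn[OF that] ray[OF that] by simp
    qed
    have "Q y \<le> (\<Sum>i\<in>block a h. y i * R)" unfolding Q_def
    proof (intro sum_mono mult_left_mono yn)
      fix i assume "i \<in> block a h"
      from mult_right_mono[OF \<mu>le[OF this], of C] show "A + lam i * C \<le> R" using C by (simp add: R_def)
    qed
    also have "\<dots> = R" using y by (simp add: Y_def sum_distrib_right[symmetric])
    finally show "Q y \<le> R" .
  qed
  have R: "0 < R" using Q[OF y0] by linarith
  have "R\<^sup>2 < (sqrt (sobolev_sq * B))\<^sup>2" using W(3) R by (intro power_strict_mono) (auto simp: R_def A_def B_def C_def)
  then have RB: "R\<^sup>2 < sobolev_sq * B" using sobolev_sq_pos B by simp
  have SB: "sobolev_sq * B > 0" using sobolev_sq_pos B by simp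
  have "R\<^sup>2 * F < sobolev_sq * B * F" using RB F by (rule mult_strict_right_mono)
  then have "R\<^sup>2 * F / (sobolev_sq * B) < F" using SB by (simp add: field_simps)
  \<comment> \<open>The threshold lies strictly below the supremum \<open>F\<close>, so some weight
    exceeds it; this is exactly what makes the quotient smaller than
    \<open>sobolev_sq / (4 * F)\<close>.\<close>
  then have "\<exists>y\<in>Y. R\<^sup>2 * F / (sobolev_sq * B) < f y" using less_cSUP_iff[OF _ bdd] y0 by (auto simp: F_def)
  then obtain y where y: "y \<in> Y" "R\<^sup>2 * F / (sobolev_sq * B) < f y" by blast
  have "0 \<le> R\<^sup>2 * F / (sobolev_sq * B)" using F SB by simp
  then have fy: "f y > 0" using y(2) by linarith
  have "(Q y)\<^sup>2 / (4 * B * f y) \<le> R\<^sup>2 / (4 * B * f y)" using Q[OF y(1)] B fy by (intro divide_right_mono power_mono) auto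
  also have "\<dots> < sobolev_sq / (4 * F)" using y(2) SB B F fy by (simp add: field_simps)
  also have "\<dots> \<le> l_level \<beta> a h" by (rule l)
  finally show ?thesis by (intro that[OF W(1,2), of y]) (use y(1) Q(1)[OF y(1)] fy in \<open>auto simp: Q_def f_def A_def B_def C_def Y_def\<close>)
qed

text \<open>Only coefficients with both indices in the block are read; hence one gap serves all
  matrices that agree inside the blocks.\<close>

lemma l_level_cong:
  assumes "\<And>i j. i \<in> block a h \<Longrightarrow> j \<in> block a h \<Longrightarrow> \<beta> i j = \<beta>' i j"
  shows "l_level \<beta> a h = l_level \<beta>' a h"
proof -
  have "(\<Sum>(i, j)\<in>block a h \<times> block a h. \<beta> i j * (v j x)\<^sup>2 * (v i x)\<^sup>2)
      = (\<Sum>(i, j)\<in>block a h \<times> block a h. \<beta>' i j * (v j x)\<^sup>2 * (v i x)\<^sup>2)" for v :: family and x by (intro sum.cong refl) (auto simp: assms)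
  then have "E_fun \<beta> a h = E_fun \<beta>' a h" by (intro ext) (simp only: E_fun_def)
  then show ?thesis by (simp only: l_level_def)
qed

section \<open>Blocks, disjoint balls and the final assembly\<close>

lemma decomposition_mono:
  assumes "decomposition m d a" "l \<le> m" "k \<le> l"
  shows "a k \<le> a l"
  using assms(3,2)
proof (induction l rule: dec_induct)
  case (step n)
  then have "a n < a (Suc n)" using assms(1) by (simp add: decomposition_def)
  then show ?case using step by simp
qed simp

lemma decomposition_block:
  assumes "decomposition m d a" "h \<in> {1..m}"
  shows "a h \<in> block a h" "block a h \<subseteq> {1..d}"
proof -
  have "Suc (h - 1) = h" "h - 1 < m" using assms(2) by auto
  then have "a (h - 1) < a h" using assms(1) by (metis decomposition_def)
  then show "a h \<in> block a h" by (simp add: block_def)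
  have "a h \<le> a m" by (rule decomposition_mono[OF assms(1)]) (use assms(2) in auto)
  then show "block a h \<subseteq> {1..d}" using assms(1) by (auto simp: block_def decomposition_def)
qed

lemma decomposition_disjoint:
  assumes "decomposition m d a"
  shows "disjoint_family_on (block a) {1..m}"
proof -
  have "block a k \<inter> block a l = {}" if "k < l" "l \<le> m" for k l
  proof -
    have "a k \<le> a (l - 1)" by (rule decomposition_mono[OF assms]) (use that in auto)
    then show ?thesis by (auto simp: block_def)
  qed
  then show ?thesis unfolding disjoint_family_on_def by (metis Int_commute atLeastAtMost_iff linorder_neqE_nat)
qed

lemma disjoint_balls:
  fixes \<Omega> :: "'a::euclidean_space set"
  assumes "open \<Omega>" "\<Omega> \<noteq> {}"
  obtains z :: "nat \<Rightarrow> 'a" and \<rho> :: real where "\<rho> > 0" "\<And>h. h \<in> {1..m} \<Longrightarrow> cball (z h) \<rho> \<subseteq> \<Omega>"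
    "\<And>h k. h \<noteq> k \<Longrightarrow> cball (z h) \<rho> \<inter> cball (z k) \<rho> = {}"
proof -
  obtain c R where R: "R > 0" "cball c R \<subseteq> \<Omega>" using assms open_contains_cball by blast
  obtain e :: 'a where e: "e \<in> Basis" using nonempty_Basis by blast
  \<comment> \<open>Centres will be \<open>3 * \<rho>\<close> apart along one axis, more than two
    radii; dividing \<open>R\<close> by \<open>4 * Suc m\<close> leaves room for the last
    ball.\<close>
  define \<rho> where "\<rho> = R / (4 * real (Suc m))"
  define z where "z h = c + (3 * \<rho> * real h) *\<^sub>R e" for h
  have \<rho>: "\<rho> > 0" using R by (simp add: \<rho>_def)
  have R\<rho>: "R = 4 * real (Suc m) * \<rho>" by (simp add: \<rho>_def)
  show ?thesis
  proof
    show "\<rho> > 0" by (rule \<rho>)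
    show "cball (z h) \<rho> \<subseteq> \<Omega>" if h: "h \<in> {1..m}" for h
    proof -
      have "3 * \<rho> * real h \<le> 3 * \<rho> * real m" using h \<rho> by (intro mult_left_mono) auto
      moreover have "dist c (z h) = 3 * \<rho> * real h" using e \<rho> by (simp add: z_def dist_norm abs_mult)
      moreover have "R = 3 * \<rho> * real m + 4 * \<rho> + \<rho> * real m" by (simp add: R\<rho> algebra_simps)
      moreover have "0 \<le> \<rho> * real m" using \<rho> by simp
      ultimately have "dist c (z h) + \<rho> \<le> R" using \<rho> by linarith
      then have "cball (z h) \<rho> \<subseteq> cball c R" using \<rho> by (simp add: cball_subset_cball_iff dist_commute)
      then show ?thesis using R(2) by blast
    qed
    show "cball (z h) \<rho> \<inter> cball (z k) \<rho> = {}" if hk: "h \<noteq> k" for h k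
    proof -
      have "z h - z k = (3 * \<rho> * (real h - real k)) *\<^sub>R e" by (simp add: z_def algebra_simps)
      then have "dist (z h) (z k) = 3 * \<rho> * \<bar>real h - real k\<bar>" using e \<rho> by (simp add: dist_norm abs_mult)
      moreover have "1 \<le> \<bar>real h - real k\<bar>" using hk by linarith
      then have "3 * \<rho> * 1 \<le> 3 * \<rho> * \<bar>real h - real k\<bar>" using \<rho> by (intro mult_left_mono) auto
      ultimately have "dist (z h) (z k) > \<rho> + \<rho>" using \<rho> by linarith
      then show ?thesis by (rule disjoint_cballI)
    qed
  qed
qed

text \<open>What \<open>\<delta>\<close> may depend on is expressed by the order of quantifiers: it
  is fixed first and then serves every symmetric \<open>\<beta>'\<close> that agrees with
  \<open>\<beta>\<close> on the diagonal and on \<open>K1\<close>, whatever the entries between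
  different blocks are.\<close>

theorem theorem3p6:
  fixes \<Omega> :: "(real^4) set" and d m :: nat and a :: "nat \<Rightarrow> nat"
    and lam :: "nat \<Rightarrow> real" and \<beta> :: "nat \<Rightarrow> nat \<Rightarrow> real"
  assumes "d \<ge> 2"
    and "bounded_smooth_domain \<Omega>"
    and "\<forall>i\<in>{1..d}. - first_dirichlet_eigenvalue \<Omega> < lam i \<and> lam i < 0"
    and "\<forall>i\<in>{1..d}. \<beta> i i > 0"
    and "\<forall>i\<in>{1..d}. \<forall>j\<in>{1..d}. \<beta> i j = \<beta> j i"
    and "1 \<le> m" "m \<le> d"
    and "decomposition m d a"
    and "\<forall>(i, j)\<in>K1 m a. \<beta> i j \<ge> 0"
  shows "\<exists>\<delta>>0. \<forall>\<beta>' :: nat \<Rightarrow> nat \<Rightarrow> real.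
    (\<forall>i\<in>{1..d}. \<beta>' i i = \<beta> i i) \<and> (\<forall>(i, j)\<in>K1 m a. \<beta>' i j = \<beta> i j) \<and>
    (\<forall>i\<in>{1..d}. \<forall>j\<in>{1..d}. \<beta>' i j = \<beta>' j i) \<longrightarrow>
      (\<forall>\<Gamma>. \<Gamma> \<noteq> {} \<and> \<Gamma> \<subseteq> {1..m} \<longrightarrow>
         c_level \<Omega> lam \<beta>' a \<Gamma> < (\<Sum>h\<in>\<Gamma>. l_level \<beta>' a h) - \<delta>) \<and>
      c_level \<Omega> lam \<beta>' a {1..m} < (\<Sum>h=1..m. l_level \<beta>' a h) - \<delta>"
proof -
  have \<Omega>: "open \<Omega>" "bounded \<Omega>" "\<Omega> \<noteq> {}" using assms(2) by (auto simp: bounded_smooth_domain_def)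
  have blk: "i \<in> {1..d}" if "h \<in> {1..m}" "i \<in> block a h" for h i using decomposition_block(2)[OF assms(8) that(1)] that(2) by blast
  have lam: "- first_dirichlet_eigenvalue \<Omega> < lam i" "lam i < 0" if "h \<in> {1..m}" "i \<in> block a h" for h i using assms(3) blk[OF that] by auto
  have \<beta>: "0 \<le> \<beta> i j" if "h \<in> {1..m}" "i \<in> block a h" "j \<in> block a h" for h i j
  proof (cases "i = j")
    case True
    then show ?thesis using assms(4) blk[OF that(1,2)] by (auto intro: less_imp_le)
  next
    case False
    then have "(i, j) \<in> K1 m a" using that by (auto simp: K1_def)
    then show ?thesis using assms(9) by auto
  qed
  obtain z :: "nat \<Rightarrow> real^4" and \<rho> :: real where z: "\<rho> > 0" "\<And>h. h \<in> {1..m} \<Longrightarrow> cball (z h) \<rho> \<subseteq> \<Omega>"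
    "\<And>h k. h \<noteq> k \<Longrightarrow> cball (z h) \<rho> \<inter> cball (z k) \<rho> = {}" by (rule disjoint_balls[OF \<Omega>(1,3), of m]) (rule that)
  define B where "B W = (LINT x|lebesgue. (W x) ^ 4)" for W :: "real^4 \<Rightarrow> real"
  define Q where "Q h W y = (weighted_energy lam a h W y)"
    for h and W :: "real^4 \<Rightarrow> real" and y
  define f where "f h y = (coupling \<beta> a h y)" for h y
  define P where "P h W y \<longleftrightarrow> W \<in> test_functions (cball (z h) \<rho>) \<and> 0 < B W \<and> (\<forall>i\<in>block a h. 0 \<le> y i) \<and> 0 < Q h W y \<and> 0 < f h y
      \<and> (Q h W y)\<^sup>2 / (4 * B W * f h y) < l_level \<beta> a h" for h W y
  have "\<exists>W y. P h W y" if h: "h \<in> {1..m}" for h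
  proof -
    have i0: "a h \<in> block a h" by (rule decomposition_block(1)[OF assms(8) h])
    have "0 < \<beta> (a h) (a h)" using assms(4) blk[OF h i0] by blast
    show ?thesis unfolding P_def B_def Q_def f_def by (rule block_competitor[OF \<Omega>(1,2) z(2)[OF h] z(1) i0, of lam \<beta>];
          use lam[OF h] \<open>0 < \<beta> (a h) (a h)\<close> \<beta>[OF h] in blast)
  qed
  \<comment> \<open>Bubbles and weights are chosen from \<open>\<beta>\<close> before any
    \<open>\<beta>'\<close> or \<open>\<Gamma>\<close> is considered, one pair for each
    block.\<close>
  then obtain W y where P: "\<And>h. h \<in> {1..m} \<Longrightarrow> P h (W h) (y h)" by metis
  have Wy: "\<And>h. h \<in> {1..m} \<Longrightarrow> W h \<in> test_functions (cball (z h) \<rho>)"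
    "\<And>h. h \<in> {1..m} \<Longrightarrow> 0 < B (W h)" "\<And>h i. h \<in> {1..m} \<Longrightarrow> i \<in> block a h \<Longrightarrow> 0 \<le> y h i"
    "\<And>h. h \<in> {1..m} \<Longrightarrow> 0 < Q h (W h) (y h)" "\<And>h. h \<in> {1..m} \<Longrightarrow> 0 < f h (y h)"
    "\<And>h. h \<in> {1..m} \<Longrightarrow> (Q h (W h) (y h))\<^sup>2 / (4 * B (W h) * f h (y h)) < l_level \<beta> a h" using P by (auto simp: P_def)
  define e where "e h = (Q h (W h) (y h))\<^sup>2 / (4 * B (W h) * f h (y h))" for h
  \<comment> \<open>Halving makes each block gain \<open>2 * \<delta>\<close>, so that the final
    inequality with \<open>\<delta>\<close> is strict.\<close>
  define \<delta> where "\<delta> = Min ((\<lambda>h. l_level \<beta> a h - e h) ` {1..m}) / 2"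
  have \<delta>: "\<delta> > 0" using Wy(6) assms(6) by (simp add: \<delta>_def e_def)
  have \<delta>le: "e h + 2 * \<delta> \<le> l_level \<beta> a h" if "h \<in> {1..m}" for h
  proof -
    have "Min ((\<lambda>h. l_level \<beta> a h - e h) ` {1..m}) \<le> l_level \<beta> a h - e h" using that by (intro Min_le) auto
    then show ?thesis by (simp add: \<delta>_def)
  qed
  have main: "c_level \<Omega> lam \<beta>' a \<Gamma> < (\<Sum>h\<in>\<Gamma>. l_level \<beta>' a h) - \<delta>"
    if \<beta>': "\<forall>i\<in>{1..d}. \<beta>' i i = \<beta> i i" "\<forall>(i, j)\<in>K1 m a. \<beta>' i j = \<beta> i j" "\<forall>i\<in>{1..d}. \<forall>j\<in>{1..d}. \<beta>' i j = \<beta>' j i"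
      and \<Gamma>: "\<Gamma> \<noteq> {}" "\<Gamma> \<subseteq> {1..m}" for \<beta>' :: "nat \<Rightarrow> nat \<Rightarrow> real" and \<Gamma>
  proof -
    have fin: "finite \<Gamma>" using \<Gamma>(2) by (rule finite_subset) simp
    have eq: "\<beta>' i j = \<beta> i j" if "h \<in> {1..m}" "i \<in> block a h" "j \<in> block a h" for h i j
    proof (cases "i = j")
      case True
      then show ?thesis using \<beta>'(1) blk[OF that(1,2)] by blast
    next
      case False
      then have "(i, j) \<in> K1 m a" using that by (auto simp: K1_def)
      then show ?thesis using \<beta>'(2) by auto
    qed
    have feq: "(coupling \<beta>' a h (y h)) = f h (y h)" if "h \<in> {1..m}" for h unfolding f_def by (intro sum.cong refl) (auto simp: eq[OF that])
    have leq: "l_level \<beta>' a h = l_level \<beta> a h" if "h \<in> {1..m}" for h by (rule l_level_cong) (rule eq[OF that])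
    have in\<Gamma>: "h \<in> {1..m}" if "h \<in> \<Gamma>" for h using \<Gamma>(2) that by blast
    have "c_level \<Omega> lam \<beta>' a \<Gamma> \<le> (\<Sum>h\<in>\<Gamma>. (Q h (W h) (y h))\<^sup>2 / (4 * B (W h) * (coupling \<beta>' a h (y h))))" unfolding Q_def B_def
    proof (rule c_level_le[OF fin _ \<Omega>])
      show "disjoint_family_on (block a) \<Gamma>" by (rule disjoint_family_on_mono[OF \<Gamma>(2) decomposition_disjoint[OF assms(8)]])
      show "- first_dirichlet_eigenvalue \<Omega> < lam i" if "h \<in> \<Gamma>" "i \<in> block a h" for h i by (rule lam(1)[OF in\<Gamma>[OF that(1)] that(2)])
      show "\<beta>' i j = \<beta>' j i" if "i \<in> blocks a \<Gamma>" "j \<in> blocks a \<Gamma>" for i j using that \<beta>'(3) blk in\<Gamma> by blast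
      show "W h \<in> test_functions \<Omega>" if "h \<in> \<Gamma>" for h using Wy(1)[OF in\<Gamma>[OF that]] test_functions_mono[OF z(2)[OF in\<Gamma>[OF that]]] by blast
      show "W h x * W k x = 0" if "h \<in> \<Gamma>" "k \<in> \<Gamma>" "h \<noteq> k" for h k x
      proof -
        have off: "W j x = 0" if "j \<in> \<Gamma>" "x \<notin> cball (z j) \<rho>" for j using test_function_indicator(1)[OF Wy(1)[OF in\<Gamma>[OF that(1)]], of x] that(2) by simp
        show ?thesis using off[OF that(1)] off[OF that(2)] z(3)[OF that(3)] by (auto simp: disjoint_iff)
      qed
      show "0 \<le> y h i" if "h \<in> \<Gamma>" "i \<in> block a h" for h i by (rule Wy(3)[OF in\<Gamma>[OF that(1)] that(2)])
      show "0 < (weighted_energy lam a h (W h) (y h))"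
        if "h \<in> \<Gamma>" for h using Wy(4)[OF in\<Gamma>[OF that]] by (simp only: Q_def)
      show "0 < (LINT x|lebesgue. (W h x) ^ 4)" if "h \<in> \<Gamma>" for h using Wy(2)[OF in\<Gamma>[OF that]] by (simp only: B_def)
      show "0 < (coupling \<beta>' a h (y h))" if "h \<in> \<Gamma>" for h using Wy(5)[OF in\<Gamma>[OF that]] by (simp only: feq[OF in\<Gamma>[OF that]])
    qed
    also have "\<dots> = (\<Sum>h\<in>\<Gamma>. e h)" by (intro sum.cong refl) (simp add: e_def feq[OF in\<Gamma>])
    also have "\<dots> \<le> (\<Sum>h\<in>\<Gamma>. l_level \<beta>' a h - 2 * \<delta>)" using \<delta>le[OF in\<Gamma>] leq[OF in\<Gamma>] by (intro sum_mono) (simp add: le_diff_eq)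
    also have "\<dots> = (\<Sum>h\<in>\<Gamma>. l_level \<beta>' a h) - real (card \<Gamma>) * (2 * \<delta>)" by (simp add: sum_subtractf)
    also have "\<dots> < (\<Sum>h\<in>\<Gamma>. l_level \<beta>' a h) - \<delta>"
    proof -
      \<comment> \<open>Nonemptiness of \<open>\<Gamma>\<close> enters here: at least one block
        contributes its gap.\<close>
      have "1 \<le> real (card \<Gamma>)" using \<Gamma>(1) fin by (simp add: Suc_le_eq card_gt_0_iff)
      then have "1 * (2 * \<delta>) \<le> real (card \<Gamma>) * (2 * \<delta>)" using \<delta> by (intro mult_right_mono) auto
      then show ?thesis using \<delta> by linarith
    qed
    finally show ?thesis .
  qed
  have ne: "{1..m} \<noteq> {}" using assms(6) by simp
  show ?thesis by (rule exI[of _ \<delta>], intro conjI \<delta> allI impI; elim conjE)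
      (blast intro: main, rule main[OF _ _ _ ne subset_refl], assumption+)
qed

end
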